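(* Let $\Lambda$ be a finite abelian group, $A$ a unital Fréchet algebra with trivial center, $(\mathbb{A},M,A,q)$ an algebra bundle (total space $\mathbb{A}$, base manifold $M$, fibre $A$, projection $q$) and $(P,M,\Lambda,\pi,\sigma)$ a principal $\Lambda$-bundle (total space $P$, base $M$, projection $\pi$, right action $\sigma$, written $p.\lambda:=\sigma(p,\lambda)$). If $\pi^{*}(\mathbb{A}):=\{(p,a)\in P\times\mathbb{A}:\pi(p)=q(a)\}$ is the pull-back bundle over $P$ and $\mathcal{A}:=\Gamma\pi^{*}(\mathbb{A})$ the corresponding space of (smooth) sections, then the following assertions hold: (a) The map \[\sigma^*:\pi^{*}(\mathbb{A})\times\Lambda\rightarrow\pi^{*}(\mathbb{A}),\quad((p,a),\lambda)\mapsto(p.\lambda,a)\] defines an action of $\Lambda$ on $\pi^{*}(\mathbb{A})$. Moreover, the map \[\alpha:\Lambda\times\mathcal{A}\rightarrow\mathcal{A},\quad\alpha(\lambda,s)(p):=\sigma^*(s(p.\lambda),\lambda^{-1})\] defines an action of $\Lambda$ on $\mathcal{A}$ by algebra automorphisms. (b) The dynamical system $(\mathcal{A},\Lambda,\alpha)$ is a noncommutative principal $\Lambda$-bundle.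
   Context: Manifolds are finite-dimensional, paracompact, second countable and smooth; algebras are associative and complex. "Trivial center" means the center equals $\mathbb{C}\cdot 1_A$. For an algebra $A$, $\Gamma_A$ denotes the set of nonzero algebra homomorphisms $A\to\mathbb{C}$; $C_A$ is the center of $A$. A dynamical system $(A,\Lambda,\alpha)$ consists of a unital locally convex algebra $A$ and a group homomorphism $\alpha:\Lambda\to\mathrm{Aut}(A)$ inducing a continuous action. $C_A^\Lambda$ is the fixed point algebra of the induced $\Lambda$-action on $C_A$. For $\chi\in\widehat{\Lambda}=\mathrm{Hom}(\Lambda,\mathbb{T})$, $A_\chi=\{a\in A:\alpha(\lambda)a=\chi(\lambda)a\ \forall\lambda\in\Lambda\}$. Spaces of smooth sections of algebra bundles are unital algebras under pointwise operations with their usual locally convex topology (of uniform convergence of local representatives and all derivatives on compact sets). Trivial bundles: let $\{\lambda_1,\ldots,\lambda_k\}$ be a set of generators of $\Lambda$ of minimal cardinality, of orders $n_1,\ldots,n_k$, such that $\Lambda$ is the internal direct product of the cyclic subgroups $\langle\lambda_i\rangle$. Define $\widehat{\lambda}_i\in\widehat{\Lambda}$ by $\widehat{\lambda}_i(\lambda_i)=\exp(2\pi i/n_i)$ (imaginary unit in the exponent) and $\widehat{\lambda}_i(\lambda_j)=1$ for $j\neq i$. $(A,\Lambda,\alpha)$ is a trivial noncommutative principal $\Lambda$-bundle if there exists such a set of generators for which each $A_{\widehat{\lambda}_i}$ contains an invertible element $a_i$ with $a_i^{n_i}=1_A$. Smooth localization: for a unital locally convex algebra $A$ and $a\in A$,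 let $f_a\in C^\infty(\mathbb{R},A)$, $f_a(t)=1_A-ta$, where $C^\infty(\mathbb{R},A)$ carries the smooth compact-open topology, let $I_a$ be the closure of the two-sided ideal generated by $f_a$, and set $A_{\{a\}}:=C^\infty(\mathbb{R},A)/I_a$. For $z\in C_A^\Lambda$, $\alpha_{\{z\}}(\lambda,[f]):=[\alpha(\lambda)\circ f]$ defines an action of $\Lambda$ on $A_{\{z\}}$, giving a dynamical system $(A_{\{z\}},\Lambda,\alpha_{\{z\}})$. A dynamical system $(A,\Lambda,\alpha)$ is a noncommutative principal $\Lambda$-bundle if for each $\chi\in\Gamma_{C_A^\Lambda}$ there exists $z\in C_A^\Lambda$ with $\chi(z)\neq0$ such that $(A_{\{z\}},\Lambda,\alpha_{\{z\}})$ is a trivial noncommutative principal $\Lambda$-bundle. *)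

theory Defs
  imports
    "HOL-Analysis.Analysis"
    "HOL-Algebra.Module"
    "HOL-Algebra.QuotRing"
    "HOL-Algebra.Generated_Groups"
    "HOL-Algebra.Multiplicative_Group"
begin

section \<open>Locally convex spaces and algebras\<close>

text \<open>
  Vector spaces and algebras are carrier-based, since section spaces and quotients have to be
  objects of the same kind as the fibre. For plain vector spaces the fields \<open>mult\<close> and \<open>one\<close> of
  the underlying ring record carry no information.
\<close>

record ('k, 'a) tvs = "('k, 'a) module" +
  vtop :: "'a topology"

definition scalars :: "('k::field) ring"
  where "scalars = \<lparr>carrier = UNIV, mult = (*), one = 1, zero = 0, add = (+)\<rparr>"

definition locally_convex_space :: "('k::real_normed_field, 'a, 'r) tvs_scheme \<Rightarrow> bool"
  where "locally_convex_space E \<longleftrightarrow>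
    Module.module (scalars :: 'k ring) E \<and>
    topspace (vtop E) = carrier E \<and>
    Hausdorff_space (vtop E) \<and>
    continuous_map (prod_topology (vtop E) (vtop E)) (vtop E) (\<lambda>(x, y). x \<oplus>\<^bsub>E\<^esub> y) \<and>
    continuous_map (prod_topology euclidean (vtop E)) (vtop E) (\<lambda>(c, x). c \<odot>\<^bsub>E\<^esub> x) \<and>
    (\<forall>W. openin (vtop E) W \<and> \<zero>\<^bsub>E\<^esub> \<in> W \<longrightarrow>
      (\<exists>V. openin (vtop E) V \<and> \<zero>\<^bsub>E\<^esub> \<in> V \<and> V \<subseteq> W \<and>
        (\<forall>x\<in>V. \<forall>y\<in>V. \<forall>t\<in>{0..1::real}.
          (of_real t \<odot>\<^bsub>E\<^esub> x) \<oplus>\<^bsub>E\<^esub> (of_real (1 - t) \<odot>\<^bsub>E\<^esub> y) \<in> V)))"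

text \<open>The library locale for algebras over a ring is restricted to commutative ones.\<close>

definition complex_algebra :: "(complex, 'a, 'r) module_scheme \<Rightarrow> bool"
  where "complex_algebra A \<longleftrightarrow>
    Module.module (scalars :: complex ring) A \<and> ring A \<and>
    (\<forall>c. \<forall>a\<in>carrier A. \<forall>b\<in>carrier A.
      (c \<odot>\<^bsub>A\<^esub> a) \<otimes>\<^bsub>A\<^esub> b = c \<odot>\<^bsub>A\<^esub> (a \<otimes>\<^bsub>A\<^esub> b) \<and>
      a \<otimes>\<^bsub>A\<^esub> (c \<odot>\<^bsub>A\<^esub> b) = c \<odot>\<^bsub>A\<^esub> (a \<otimes>\<^bsub>A\<^esub> b))"

definition locally_convex_algebra :: "(complex, 'a, 'r) tvs_scheme \<Rightarrow> bool"
  where "locally_convex_algebra A \<longleftrightarrow>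
    locally_convex_space A \<and> complex_algebra A \<and>
    continuous_map (prod_topology (vtop A) (vtop A)) (vtop A) (\<lambda>(a, b). a \<otimes>\<^bsub>A\<^esub> b)"

definition frechet_algebra :: "(complex, 'a, 'r) tvs_scheme \<Rightarrow> bool"
  where "frechet_algebra A \<longleftrightarrow>
    locally_convex_algebra A \<and>
    (\<exists>d. Metric_space (carrier A) d \<and>
      Metric_space.mtopology (carrier A) d = vtop A \<and>
      Metric_space.mcomplete (carrier A) d \<and>
      (\<forall>x\<in>carrier A. \<forall>y\<in>carrier A. \<forall>z\<in>carrier A. d (x \<oplus>\<^bsub>A\<^esub> z) (y \<oplus>\<^bsub>A\<^esub> z) = d x y))"

definition alg_center :: "(complex, 'a, 'r) module_scheme \<Rightarrow> 'a set"
  where "alg_center A = {z \<in> carrier A. \<forall>a\<in>carrier A. z \<otimes>\<^bsub>A\<^esub> a = a \<otimes>\<^bsub>A\<^esub> z}"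

definition trivial_center :: "(complex, 'a, 'r) module_scheme \<Rightarrow> bool"
  where "trivial_center A \<longleftrightarrow> alg_center A = range (\<lambda>c. c \<odot>\<^bsub>A\<^esub> \<one>\<^bsub>A\<^esub>)"

definition alg_iso ::
    "(complex, 'a, 'r) module_scheme \<Rightarrow> (complex, 'b, 's) module_scheme \<Rightarrow> ('a \<Rightarrow> 'b) set"
  where "alg_iso A B = {h \<in> ring_hom A B. bij_betw h (carrier A) (carrier B) \<and>
    (\<forall>c. \<forall>a\<in>carrier A. h (c \<odot>\<^bsub>A\<^esub> a) = c \<odot>\<^bsub>B\<^esub> h a)}"

text \<open>The nonzero, not necessarily continuous, algebra homomorphisms into the complex numbers.\<close>

definition characters :: "(complex, 'a, 'r) module_scheme \<Rightarrow> ('a \<Rightarrow> complex) set"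
  where "characters A = {\<omega>.
    (\<forall>a\<in>carrier A. \<forall>b\<in>carrier A.
      \<omega> (a \<oplus>\<^bsub>A\<^esub> b) = \<omega> a + \<omega> b \<and> \<omega> (a \<otimes>\<^bsub>A\<^esub> b) = \<omega> a * \<omega> b) \<and>
    (\<forall>c. \<forall>a\<in>carrier A. \<omega> (c \<odot>\<^bsub>A\<^esub> a) = c * \<omega> a) \<and>
    (\<exists>a\<in>carrier A. \<omega> a \<noteq> 0)}"

definition real_space :: "(complex, 'a, 'r) tvs_scheme \<Rightarrow> (real, 'a) tvs"
  where "real_space A = \<lparr>carrier = carrier A, mult = mult A, one = one A, zero = zero A,
    add = add A, smult = (\<lambda>r x. complex_of_real r \<odot>\<^bsub>A\<^esub> x), vtop = vtop A\<rparr>"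

definition euclid_space :: "nat \<Rightarrow> (real, nat \<Rightarrow> real) tvs"
  where "euclid_space n = \<lparr>carrier = topspace (Euclidean_space n), mult = undefined, one = undefined,
    zero = (\<lambda>_. 0), add = (\<lambda>x y i. x i + y i), smult = (\<lambda>r x i. r * x i),
    vtop = Euclidean_space n\<rparr>"

definition real_line :: "(real, real) tvs"
  where "real_line = \<lparr>carrier = UNIV, mult = (*), one = 1, zero = 0, add = (+), smult = (*),
    vtop = euclidean\<rparr>"

definition prod_space :: "(real, 'e) tvs \<Rightarrow> (real, 'f) tvs \<Rightarrow> (real, 'e \<times> 'f) tvs"
  where "prod_space E F = \<lparr>carrier = carrier E \<times> carrier F, mult = undefined, one = undefined,
    zero = (\<zero>\<^bsub>E\<^esub>, \<zero>\<^bsub>F\<^esub>),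
    add = (\<lambda>(x, y) (x', y'). (x \<oplus>\<^bsub>E\<^esub> x', y \<oplus>\<^bsub>F\<^esub> y')),
    smult = (\<lambda>r (x, y). (r \<odot>\<^bsub>E\<^esub> x, r \<odot>\<^bsub>F\<^esub> y)),
    vtop = prod_topology (vtop E) (vtop F)\<rparr>"


section \<open>Calculus in locally convex spaces\<close>

text \<open>
  \<open>dir_deriv E F f k x v\<close> is the iterated directional derivative of \<open>f\<close> at \<open>x\<close> in the directions
  \<open>v 0, \<dots>, v (k - 1)\<close>. A map is smooth (in the sense of Michal and Bastiani) if all these
  derivatives exist and are jointly continuous in the point and the directions.
\<close>

primrec dir_deriv ::
    "(real, 'e) tvs \<Rightarrow> (real, 'f) tvs \<Rightarrow> ('e \<Rightarrow> 'f) \<Rightarrow> nat \<Rightarrow> 'e \<Rightarrow> (nat \<Rightarrow> 'e) \<Rightarrow> 'f"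
  where
    "dir_deriv E F f 0 x v = f x"
  | "dir_deriv E F f (Suc k) x v =
      (THE l. limitin (vtop F)
        (\<lambda>t. inverse t \<odot>\<^bsub>F\<^esub>
          (dir_deriv E F f k (x \<oplus>\<^bsub>E\<^esub> (t \<odot>\<^bsub>E\<^esub> v k)) v \<ominus>\<^bsub>F\<^esub> dir_deriv E F f k x v))
        l (at 0))"

definition jet_domain :: "(real, 'e) tvs \<Rightarrow> 'e set \<Rightarrow> nat \<Rightarrow> ('e \<times> (nat \<Rightarrow> 'e)) topology"
  where "jet_domain E U k =
    prod_topology (subtopology (vtop E) U) (product_topology (\<lambda>_. vtop E) {..<k})"

definition smooth_on :: "(real, 'e) tvs \<Rightarrow> (real, 'f) tvs \<Rightarrow> 'e set \<Rightarrow> ('e \<Rightarrow> 'f) \<Rightarrow> bool"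
  where "smooth_on E F U f \<longleftrightarrow>
    openin (vtop E) U \<and>
    (\<forall>k. \<forall>x\<in>U. \<forall>v \<in> {..<Suc k} \<rightarrow>\<^sub>E carrier E.
      \<exists>l. limitin (vtop F)
        (\<lambda>t. inverse t \<odot>\<^bsub>F\<^esub>
          (dir_deriv E F f k (x \<oplus>\<^bsub>E\<^esub> (t \<odot>\<^bsub>E\<^esub> v k)) v \<ominus>\<^bsub>F\<^esub> dir_deriv E F f k x v))
        l (at 0)) \<and>
    (\<forall>k. continuous_map (jet_domain E U k) (vtop F) (\<lambda>(x, v). dir_deriv E F f k x v))"

text \<open>
  Subbasic sets of the smooth compact-open topology: the topology induced by the compact-open
  topologies via all the derivatives, i.e. that of uniform convergence of all derivatives on
  compact sets.
\<close>

definition smooth_co_subbasis ::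
    "(real, 'e) tvs \<Rightarrow> (real, 'f) tvs \<Rightarrow> 'e set \<Rightarrow> ('e \<Rightarrow> 'f) set set"
  where "smooth_co_subbasis E F U =
    {{f. \<forall>(x, v)\<in>K. dir_deriv E F f k x v \<in> W} | k K W.
      compactin (jet_domain E U k) K \<and> openin (vtop F) W}"


section \<open>Manifolds\<close>

record ('m, 'e) mfd =
  mtop :: "'m topology"
  model :: "(real, 'e) tvs"
  atlas :: "('m set \<times> ('m \<Rightarrow> 'e)) set"

abbreviation points :: "('m, 'e) mfd \<Rightarrow> 'm set"
  where "points X \<equiv> topspace (mtop X)"

definition smooth_manifold :: "('m, 'e) mfd \<Rightarrow> bool"
  where "smooth_manifold X \<longleftrightarrow>
    locally_convex_space (model X) \<and> Hausdorff_space (mtop X) \<and>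
    (\<Union>(U, \<phi>)\<in>atlas X. U) = points X \<and>
    (\<forall>(U, \<phi>)\<in>atlas X.
      openin (mtop X) U \<and> openin (vtop (model X)) (\<phi> ` U) \<and>
      homeomorphic_map (subtopology (mtop X) U) (subtopology (vtop (model X)) (\<phi> ` U)) \<phi>) \<and>
    (\<forall>(U, \<phi>)\<in>atlas X. \<forall>(V, \<psi>)\<in>atlas X.
      smooth_on (model X) (model X) (\<phi> ` (U \<inter> V)) (\<psi> \<circ> inv_into U \<phi>))"

definition paracompact_space :: "'m topology \<Rightarrow> bool"
  where "paracompact_space X \<longleftrightarrow>
    (\<forall>\<U>. (\<forall>U\<in>\<U>. openin X U) \<and> \<Union>\<U> = topspace X \<longrightarrow>
      (\<exists>\<V>. (\<forall>V\<in>\<V>. openin X V \<and> (\<exists>U\<in>\<U>. V \<subseteq> U)) \<and> \<Union>\<V> = topspace X \<and> locally_finite_in X \<V>))"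

definition fin_dim_manifold :: "('m, nat \<Rightarrow> real) mfd \<Rightarrow> bool"
  where "fin_dim_manifold X \<longleftrightarrow>
    smooth_manifold X \<and> (\<exists>n. model X = euclid_space n) \<and>
    second_countable (mtop X) \<and> paracompact_space (mtop X)"

definition smooth_map :: "('m, 'e) mfd \<Rightarrow> ('n, 'f) mfd \<Rightarrow> ('m \<Rightarrow> 'n) \<Rightarrow> bool"
  where "smooth_map X Y f \<longleftrightarrow>
    continuous_map (mtop X) (mtop Y) f \<and>
    (\<forall>(U, \<phi>)\<in>atlas X. \<forall>(V, \<psi>)\<in>atlas Y.
      smooth_on (model X) (model Y) (\<phi> ` (U \<inter> f -` V)) (\<psi> \<circ> f \<circ> inv_into U \<phi>))"

definition diffeomorphism :: "('m, 'e) mfd \<Rightarrow> ('n, 'f) mfd \<Rightarrow> ('m \<Rightarrow> 'n) \<Rightarrow> bool"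
  where "diffeomorphism X Y f \<longleftrightarrow>
    bij_betw f (points X) (points Y) \<and> smooth_map X Y f \<and> smooth_map Y X (inv_into (points X) f)"

definition open_submfd :: "('m, 'e) mfd \<Rightarrow> 'm set \<Rightarrow> ('m, 'e) mfd"
  where "open_submfd X U = \<lparr>mtop = subtopology (mtop X) U, model = model X,
    atlas = {(V \<inter> U, \<phi>) | V \<phi>. (V, \<phi>) \<in> atlas X}\<rparr>"

definition prod_mfd :: "('m, 'e) mfd \<Rightarrow> ('n, 'f) mfd \<Rightarrow> ('m \<times> 'n, 'e \<times> 'f) mfd"
  where "prod_mfd X Y = \<lparr>mtop = prod_topology (mtop X) (mtop Y),
    model = prod_space (model X) (model Y),
    atlas = {(U \<times> V, map_prod \<phi> \<psi>) | U \<phi> V \<psi>. (U, \<phi>) \<in> atlas X \<and> (V, \<psi>) \<in> atlas Y}\<rparr>"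

definition alg_mfd :: "(complex, 'a) tvs \<Rightarrow> ('a, 'a) mfd"
  where "alg_mfd A = \<lparr>mtop = vtop A, model = real_space A, atlas = {(carrier A, \<lambda>a. a)}\<rparr>"

definition discrete_mfd :: "'l set \<Rightarrow> ('l, nat \<Rightarrow> real) mfd"
  where "discrete_mfd S = \<lparr>mtop = discrete_topology S, model = euclid_space 0,
    atlas = {({g}, \<lambda>_ _. 0) | g. g \<in> S}\<rparr>"


section \<open>Principal bundles\<close>

definition right_action :: "('l, 'r) monoid_scheme \<Rightarrow> 'x set \<Rightarrow> ('x \<times> 'l \<Rightarrow> 'x) \<Rightarrow> bool"
  where "right_action L X \<sigma> \<longleftrightarrow>
    (\<forall>x\<in>X. \<forall>g\<in>carrier L. \<sigma> (x, g) \<in> X) \<and>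
    (\<forall>x\<in>X. \<sigma> (x, \<one>\<^bsub>L\<^esub>) = x) \<and>
    (\<forall>x\<in>X. \<forall>g\<in>carrier L. \<forall>h\<in>carrier L. \<sigma> (\<sigma> (x, g), h) = \<sigma> (x, g \<otimes>\<^bsub>L\<^esub> h))"

definition smooth_right_action ::
    "('l, 'r) monoid_scheme \<Rightarrow> ('x, 'e) mfd \<Rightarrow> ('x \<times> 'l \<Rightarrow> 'x) \<Rightarrow> bool"
  where "smooth_right_action L X \<sigma> \<longleftrightarrow>
    right_action L (points X) \<sigma> \<and> smooth_map (prod_mfd X (discrete_mfd (carrier L))) X \<sigma>"

text \<open>The structure group is a discrete (zero-dimensional) Lie group.\<close>

definition principal_bundle ::
    "('p, nat \<Rightarrow> real) mfd \<Rightarrow> ('m, nat \<Rightarrow> real) mfd \<Rightarrow> ('l, 'r) monoid_scheme \<Rightarrow>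
      ('p \<Rightarrow> 'm) \<Rightarrow> ('p \<times> 'l \<Rightarrow> 'p) \<Rightarrow> bool"
  where "principal_bundle P M L \<pi> \<sigma> \<longleftrightarrow>
    fin_dim_manifold P \<and> fin_dim_manifold M \<and> group L \<and>
    smooth_map P M \<pi> \<and> smooth_right_action L P \<sigma> \<and>
    (\<forall>x\<in>points M. \<exists>U \<phi>. openin (mtop M) U \<and> x \<in> U \<and>
      diffeomorphism (prod_mfd (open_submfd M U) (discrete_mfd (carrier L)))
        (open_submfd P {p \<in> points P. \<pi> p \<in> U}) \<phi> \<and>
      (\<forall>y\<in>U. \<forall>g\<in>carrier L. \<pi> (\<phi> (y, g)) = y) \<and>
      (\<forall>y\<in>U. \<forall>g\<in>carrier L. \<forall>h\<in>carrier L. \<phi> (y, g \<otimes>\<^bsub>L\<^esub> h) = \<sigma> (\<phi> (y, g), h)))"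


section \<open>Algebra bundles and their sections\<close>

record ('b, 'f, 'm, 'a) alg_bundle =
  total_space :: "('b, 'f) mfd"
  base_space :: "('m, nat \<Rightarrow> real) mfd"
  fibre :: "(complex, 'a) tvs"
  proj :: "'b \<Rightarrow> 'm"
  fibre_alg :: "'m \<Rightarrow> (complex, 'b) module"

definition local_trivialization ::
    "('b, 'f, 'm, 'a) alg_bundle \<Rightarrow> 'm set \<Rightarrow> ('m \<times> 'a \<Rightarrow> 'b) \<Rightarrow> bool"
  where "local_trivialization B U \<phi> \<longleftrightarrow>
    openin (mtop (base_space B)) U \<and>
    diffeomorphism (prod_mfd (open_submfd (base_space B) U) (alg_mfd (fibre B)))
      (open_submfd (total_space B) {b \<in> points (total_space B). proj B b \<in> U}) \<phi> \<and>
    (\<forall>x\<in>U. \<forall>a\<in>carrier (fibre B). proj B (\<phi> (x, a)) = x) \<and>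
    (\<forall>x\<in>U. (\<lambda>a. \<phi> (x, a)) \<in> alg_iso (fibre B) (fibre_alg B x))"

definition algebra_bundle :: "('b, 'f, 'm, 'a) alg_bundle \<Rightarrow> bool"
  where "algebra_bundle B \<longleftrightarrow>
    smooth_manifold (total_space B) \<and> fin_dim_manifold (base_space B) \<and>
    locally_convex_algebra (fibre B) \<and>
    smooth_map (total_space B) (base_space B) (proj B) \<and>
    (\<forall>x\<in>points (base_space B). complex_algebra (fibre_alg B x) \<and>
      carrier (fibre_alg B x) = {b \<in> points (total_space B). proj B b = x}) \<and>
    (\<forall>x\<in>points (base_space B). \<exists>U \<phi>. x \<in> U \<and> local_trivialization B U \<phi>)"

definition fibre_coord :: "('b, 'f, 'm, 'a) alg_bundle \<Rightarrow> 'm set \<Rightarrow> ('m \<times> 'a \<Rightarrow> 'b) \<Rightarrow> 'b \<Rightarrow> 'a"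
  where "fibre_coord B U \<phi> b = snd (inv_into (U \<times> carrier (fibre B)) \<phi> b)"

text \<open>
  The charts of the pull-back combine a chart of the new base with the fibre coordinate of a local
  trivialization of the given bundle.
\<close>

definition pullback_bundle ::
    "('p, nat \<Rightarrow> real) mfd \<Rightarrow> ('p \<Rightarrow> 'm) \<Rightarrow> ('b, 'f, 'm, 'a) alg_bundle \<Rightarrow>
      ('p \<times> 'b, (nat \<Rightarrow> real) \<times> 'a, 'p, 'a) alg_bundle"
  where "pullback_bundle P \<pi> B = \<lparr>
    total_space = \<lparr>
      mtop = subtopology (prod_topology (mtop P) (mtop (total_space B))) {(p, b). \<pi> p = proj B b},
      model = prod_space (model P) (real_space (fibre B)),
      atlas = {({(p, b). p \<in> W \<and> \<pi> p \<in> U \<and> b \<in> points (total_space B) \<and> \<pi> p = proj B b},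
                \<lambda>(p, b). (\<psi> p, fibre_coord B U \<phi> b)) | W \<psi> U \<phi>.
              (W, \<psi>) \<in> atlas P \<and> local_trivialization B U \<phi>}\<rparr>,
    base_space = P,
    fibre = fibre B,
    proj = fst,
    fibre_alg = (\<lambda>p. let F = fibre_alg B (\<pi> p) in \<lparr>
      carrier = {p} \<times> carrier F,
      mult = (\<lambda>x y. (p, snd x \<otimes>\<^bsub>F\<^esub> snd y)),
      one = (p, \<one>\<^bsub>F\<^esub>),
      zero = (p, \<zero>\<^bsub>F\<^esub>),
      add = (\<lambda>x y. (p, snd x \<oplus>\<^bsub>F\<^esub> snd y)),
      smult = (\<lambda>c x. (p, c \<odot>\<^bsub>F\<^esub> snd x))\<rparr>)\<rparr>"

definition smooth_sections :: "('b, 'f, 'm, 'a) alg_bundle \<Rightarrow> ('m \<Rightarrow> 'b) set"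
  where "smooth_sections B = {s \<in> extensional (points (base_space B)).
    smooth_map (base_space B) (total_space B) s \<and> (\<forall>x\<in>points (base_space B). proj B (s x) = x)}"

text \<open>
  The topology is the initial one for the local representatives of sections, with respect to all
  charts and all local trivializations, each carrying the smooth compact-open topology.
\<close>

definition section_algebra :: "('b, 'f, 'm, 'a) alg_bundle \<Rightarrow> (complex, 'm \<Rightarrow> 'b) tvs"
  where "section_algebra B = \<lparr>
    carrier = smooth_sections B,
    mult = (\<lambda>s t. \<lambda>x\<in>points (base_space B). s x \<otimes>\<^bsub>fibre_alg B x\<^esub> t x),
    one = (\<lambda>x\<in>points (base_space B). \<one>\<^bsub>fibre_alg B x\<^esub>),
    zero = (\<lambda>x\<in>points (base_space B). \<zero>\<^bsub>fibre_alg B x\<^esub>),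
    add = (\<lambda>s t. \<lambda>x\<in>points (base_space B). s x \<oplus>\<^bsub>fibre_alg B x\<^esub> t x),
    smult = (\<lambda>c s. \<lambda>x\<in>points (base_space B). c \<odot>\<^bsub>fibre_alg B x\<^esub> s x),
    vtop = topology_generated_by (insert (smooth_sections B)
      {{s \<in> smooth_sections B. fibre_coord B U \<phi> \<circ> s \<circ> inv_into V \<psi> \<in> N} | U \<phi> V \<psi> N.
        local_trivialization B U \<phi> \<and> (V, \<psi>) \<in> atlas (base_space B) \<and>
        N \<in> smooth_co_subbasis (model (base_space B)) (real_space (fibre B)) (\<psi> ` (U \<inter> V))})\<rparr>"

definition pullback_action :: "('p \<times> 'l \<Rightarrow> 'p) \<Rightarrow> ('p \<times> 'b) \<times> 'l \<Rightarrow> 'p \<times> 'b"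
  where "pullback_action \<sigma> = (\<lambda>((p, a), g). (\<sigma> (p, g), a))"

definition section_action ::
    "('p, 'e) mfd \<Rightarrow> ('l, 'r) monoid_scheme \<Rightarrow> ('p \<times> 'l \<Rightarrow> 'p) \<Rightarrow>
      'l \<Rightarrow> ('p \<Rightarrow> 'p \<times> 'b) \<Rightarrow> 'p \<Rightarrow> 'p \<times> 'b"
  where "section_action P L \<sigma> g s =
    (\<lambda>p\<in>points P. pullback_action \<sigma> (s (\<sigma> (p, g)), inv\<^bsub>L\<^esub> g))"


section \<open>Dynamical systems and smooth localization\<close>

definition automorphism_action ::
    "(complex, 'a, 's) module_scheme \<Rightarrow> ('l, 'r) monoid_scheme \<Rightarrow> ('l \<Rightarrow> 'a \<Rightarrow> 'a) \<Rightarrow> bool"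
  where "automorphism_action A L \<alpha> \<longleftrightarrow>
    (\<forall>g\<in>carrier L. \<alpha> g \<in> alg_iso A A) \<and>
    (\<forall>a\<in>carrier A. \<alpha> \<one>\<^bsub>L\<^esub> a = a) \<and>
    (\<forall>g\<in>carrier L. \<forall>h\<in>carrier L. \<forall>a\<in>carrier A. \<alpha> (g \<otimes>\<^bsub>L\<^esub> h) a = \<alpha> g (\<alpha> h a))"

definition dynamical_system ::
    "(complex, 'a) tvs \<Rightarrow> ('l, 'r) monoid_scheme \<Rightarrow> ('l \<Rightarrow> 'a \<Rightarrow> 'a) \<Rightarrow> bool"
  where "dynamical_system A L \<alpha> \<longleftrightarrow>
    locally_convex_algebra A \<and> group L \<and> automorphism_action A L \<alpha> \<and>
    continuous_map (prod_topology (discrete_topology (carrier L)) (vtop A)) (vtop A)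
      (\<lambda>(g, a). \<alpha> g a)"

definition circle_group :: "complex monoid"
  where "circle_group = \<lparr>carrier = sphere 0 1, mult = (*), one = 1\<rparr>"

definition dual_group :: "('l, 'r) monoid_scheme \<Rightarrow> ('l \<Rightarrow> complex) set"
  where "dual_group L = hom L circle_group \<inter> extensional (carrier L)"

definition isotypic ::
    "(complex, 'a) tvs \<Rightarrow> ('l, 'r) monoid_scheme \<Rightarrow> ('l \<Rightarrow> 'a \<Rightarrow> 'a) \<Rightarrow> ('l \<Rightarrow> complex) \<Rightarrow> 'a set"
  where "isotypic A L \<alpha> \<omega> = {a \<in> carrier A. \<forall>g\<in>carrier L. \<alpha> g a = \<omega> g \<odot>\<^bsub>A\<^esub> a}"

text \<open>
  Sets of generators of minimal cardinality whose cyclic subgroups form an internal direct product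
  decomposition: multiplication is a bijection from their direct product onto the group.
\<close>

definition generator_system :: "('l, 'r) monoid_scheme \<Rightarrow> 'l set \<Rightarrow> bool"
  where "generator_system L S \<longleftrightarrow>
    S \<subseteq> carrier L \<and> generate L S = carrier L \<and>
    (\<forall>T. T \<subseteq> carrier L \<and> generate L T = carrier L \<longrightarrow> card S \<le> card T) \<and>
    bij_betw (\<lambda>h. finprod L h S) (\<Pi>\<^sub>E s\<in>S. generate L {s}) (carrier L)"

definition dual_generator :: "('l, 'r) monoid_scheme \<Rightarrow> 'l set \<Rightarrow> 'l \<Rightarrow> 'l \<Rightarrow> complex"
  where "dual_generator L S s = (THE \<omega>. \<omega> \<in> dual_group L \<and>
    \<omega> s = exp (2 * of_real pi * \<i> / of_nat (group.ord L s)) \<and> (\<forall>t\<in>S - {s}. \<omega> t = 1))"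

definition trivial_nc_principal_bundle ::
    "(complex, 'a) tvs \<Rightarrow> ('l, 'r) monoid_scheme \<Rightarrow> ('l \<Rightarrow> 'a \<Rightarrow> 'a) \<Rightarrow> bool"
  where "trivial_nc_principal_bundle A L \<alpha> \<longleftrightarrow>
    dynamical_system A L \<alpha> \<and>
    (\<exists>S. generator_system L S \<and>
      (\<forall>s\<in>S. \<exists>a \<in> isotypic A L \<alpha> (dual_generator L S s).
        a \<in> Units A \<and> a [^]\<^bsub>A\<^esub> group.ord L s = \<one>\<^bsub>A\<^esub>))"

definition smooth_curves :: "(complex, 'a) tvs \<Rightarrow> (complex, real \<Rightarrow> 'a) tvs"
  where "smooth_curves A = \<lparr>
    carrier = {f. smooth_on real_line (real_space A) UNIV f},
    mult = (\<lambda>f g t. f t \<otimes>\<^bsub>A\<^esub> g t),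
    one = (\<lambda>_. \<one>\<^bsub>A\<^esub>),
    zero = (\<lambda>_. \<zero>\<^bsub>A\<^esub>),
    add = (\<lambda>f g t. f t \<oplus>\<^bsub>A\<^esub> g t),
    smult = (\<lambda>c f t. c \<odot>\<^bsub>A\<^esub> f t),
    vtop = topology_generated_by
      {{f \<in> N. smooth_on real_line (real_space A) UNIV f} | N.
        N \<in> smooth_co_subbasis real_line (real_space A) UNIV}\<rparr>"

definition quotient_algebra :: "(complex, 'a) tvs \<Rightarrow> 'a set \<Rightarrow> (complex, 'a set) tvs"
  where "quotient_algebra R I = \<lparr>
    carrier = carrier (R Quot I),
    mult = mult (R Quot I),
    one = one (R Quot I),
    zero = zero (R Quot I),
    add = add (R Quot I),
    smult = (\<lambda>c X. \<Union>x\<in>X. I +>\<^bsub>R\<^esub> (c \<odot>\<^bsub>R\<^esub> x)),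
    vtop = topology (\<lambda>V. V \<subseteq> carrier (R Quot I) \<and>
      openin (vtop R) {x \<in> topspace (vtop R). I +>\<^bsub>R\<^esub> x \<in> V})\<rparr>"

lemma istopology_quotient:
  "istopology (\<lambda>V. V \<subseteq> C \<and> openin T {x \<in> topspace T. q x \<in> V})"
proof -
  have int: "{x \<in> topspace T. q x \<in> V \<inter> W} =
      {x \<in> topspace T. q x \<in> V} \<inter> {x \<in> topspace T. q x \<in> W}" for V W
    by auto
  have un: "{x \<in> topspace T. q x \<in> \<Union>\<K>} = (\<Union>K\<in>\<K>. {x \<in> topspace T. q x \<in> K})" for \<K>
    by auto
  show ?thesis
    unfolding istopology_def int un by auto
qed

definition localization_ideal :: "(complex, 'a) tvs \<Rightarrow> 'a \<Rightarrow> (real \<Rightarrow> 'a) set"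
  where "localization_ideal A a =
    vtop (smooth_curves A) closure_of
      (Idl\<^bsub>smooth_curves A\<^esub> {\<lambda>t. \<one>\<^bsub>A\<^esub> \<ominus>\<^bsub>A\<^esub> (complex_of_real t \<odot>\<^bsub>A\<^esub> a)})"

definition localization :: "(complex, 'a) tvs \<Rightarrow> 'a \<Rightarrow> (complex, (real \<Rightarrow> 'a) set) tvs"
  where "localization A a = quotient_algebra (smooth_curves A) (localization_ideal A a)"

definition localized_action ::
    "(complex, 'a) tvs \<Rightarrow> 'a \<Rightarrow> ('l \<Rightarrow> 'a \<Rightarrow> 'a) \<Rightarrow> 'l \<Rightarrow> (real \<Rightarrow> 'a) set \<Rightarrow> (real \<Rightarrow> 'a) set"
  where "localized_action A a \<alpha> g X =
    (\<Union>f\<in>X. localization_ideal A a +>\<^bsub>smooth_curves A\<^esub> (\<alpha> g \<circ> f))"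

definition fixed_center ::
    "(complex, 'a) tvs \<Rightarrow> ('l, 'r) monoid_scheme \<Rightarrow> ('l \<Rightarrow> 'a \<Rightarrow> 'a) \<Rightarrow> (complex, 'a) tvs"
  where "fixed_center A L \<alpha> =
    A\<lparr>carrier := {z \<in> alg_center A. \<forall>g\<in>carrier L. \<alpha> g z = z}\<rparr>"

definition nc_principal_bundle ::
    "(complex, 'a) tvs \<Rightarrow> ('l, 'r) monoid_scheme \<Rightarrow> ('l \<Rightarrow> 'a \<Rightarrow> 'a) \<Rightarrow> bool"
  where "nc_principal_bundle A L \<alpha> \<longleftrightarrow>
    dynamical_system A L \<alpha> \<and>
    (\<forall>\<omega> \<in> characters (fixed_center A L \<alpha>).
      \<exists>z \<in> carrier (fixed_center A L \<alpha>). \<omega> z \<noteq> 0 \<and>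
        trivial_nc_principal_bundle (localization A z) L (localized_action A z \<alpha>))"

end

theory Submission
  imports Defs
begin

text \<open>
 Smoothness of maps between locally convex spaces is controlled by the explicit family of all iterated
 directional derivatives. A chain rule of Faa di Bruno type, with parameters, makes the algebra \<open>\<A>\<close> of
 sections of the pull-back a locally convex algebra on which \<open>\<Lambda>\<close> acts continuously.

 Let \<open>\<omega>\<close> be a character of the fixed point algebra of the center of \<open>\<A>\<close>. Real smooth functions on \<open>M\<close>,
 pulled back to \<open>P\<close>, act on \<open>\<A>\<close> as scalars and lie in that algebra. Take countably many bump functions,
 each supported in an open set over which \<open>P\<close> is trivial, such that the sets where they are \<open>1\<close> cover \<open>M\<close>.
 Then \<open>\<omega>\<close> is nonzero on one of them, \<open>b\<close>: otherwise it would annihilate a positive, hence invertible, function.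

 Over the trivializing set the characters of \<open>\<Lambda>\<close> are locally constant functions on \<open>P\<close>. Multiplied by \<open>b\<close>
 they extend by zero to sections \<open>w\<close> in the isotypic components which satisfy \<open>w\<^sup>n = b\<^sup>n\<close>, \<open>n\<close> being the order
 of the generator. In the localization at \<open>b\<close> the class of \<open>t \<mapsto> t w\<close> is then an invertible \<open>n\<close>-th root of \<open>1\<close>.
\<close>

section \<open>Locally convex spaces\<close>

text \<open>Curves and sections carry the topology of uniform convergence of all derivatives on
  compact sets. Their jets live on locally compact domains, because the real line and the base
  manifolds are finite-dimensional. Hence a map into such a space is continuous once all jets depend
  jointly continuously on the parameter and the point, and evaluation of jets is jointly continuous
  in turn. This is why the calculus carries a parameter, and why formulas for all derivatives are
  kept rather than their mere existence.

  The fibre is only locally convex. Estimates are expressed by convex neighbourhoods, and the mean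
  value theorem is proved for open convex sets.

  The characters are algebraic homomorphisms without continuity, so a locally finite sum cannot be
  evaluated term by term under \<open>\<omega>\<close>. The positive function that
  \<open>\<omega>\<close> annihilates is therefore built from finitely many bumps and one unbounded
  function.

  Asking for the n-th power of \<open>w\<close> to be that of \<open>b\<close>, instead of
  \<open>b\<close> itself, avoids n-th roots of \<open>b\<close>, which may fail to be smooth at its
  zeros.\<close>

lemma scalars_simps [simp]:
 "carrier scalars = UNIV" "a \<otimes>\<^bsub>scalars\<^esub> b = a * b" "\<one>\<^bsub>scalars\<^esub> = 1"
 "\<zero>\<^bsub>scalars\<^esub> = 0" "a \<oplus>\<^bsub>scalars\<^esub> b = a + b" by (simp_all add: scalars_def)

lemma cring_scalars: "cring (scalars :: 'k::field ring)"
proof (rule cringI)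
 show "abelian_group (scalars :: 'k ring)"
 proof (rule abelian_groupI)
  show "\<exists>y\<in>carrier scalars. y \<oplus>\<^bsub>scalars\<^esub> x = \<zero>\<^bsub>scalars\<^esub>" for x :: 'k by (rule bexI[of _ "- x"]) auto
 qed (auto simp: ac_simps)
 show "comm_monoid (scalars :: 'k ring)" by (rule comm_monoidI) (auto simp: ac_simps)
qed (auto simp: algebra_simps)

lemma module_scalarsI:
 assumes "abelian_group E"
  and "!!c x. x \<in> carrier E ==> c \<odot>\<^bsub>E\<^esub> x \<in> carrier E"
  and "!!a b x. x \<in> carrier E ==> (a + b) \<odot>\<^bsub>E\<^esub> x = a \<odot>\<^bsub>E\<^esub> x \<oplus>\<^bsub>E\<^esub> b \<odot>\<^bsub>E\<^esub> x"
  and "!!a x y. x \<in> carrier E ==> y \<in> carrier E ==>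
   a \<odot>\<^bsub>E\<^esub> (x \<oplus>\<^bsub>E\<^esub> y) = a \<odot>\<^bsub>E\<^esub> x \<oplus>\<^bsub>E\<^esub> a \<odot>\<^bsub>E\<^esub> y"
  and "!!a b x. x \<in> carrier E ==> (a * b) \<odot>\<^bsub>E\<^esub> x = a \<odot>\<^bsub>E\<^esub> (b \<odot>\<^bsub>E\<^esub> x)"
  and "!!x. x \<in> carrier E ==> 1 \<odot>\<^bsub>E\<^esub> x = x"
 shows "Module.module (scalars :: 'k::field ring) E"
 using assms by (intro Module.moduleI cring_scalars) simp_all

text \<open>The field and the record scheme are left open, so that complex algebras, their
  underlying real spaces, fibres and quotients share one linear calculus.\<close>

locale vec =
 fixes E :: "('k::field, 'e, 'r) module_scheme" (structure)
 assumes module: "Module.module (scalars :: 'k ring) E"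
begin

sublocale ag: abelian_group E using module by (simp add: module_def)

lemma smult_closed [simp, intro]: "x \<in> carrier E ==> c \<odot> x \<in> carrier E"
 using module.smult_closed[OF module] by simp

lemma smult_add_left: "x \<in> carrier E ==> (a + b) \<odot> x = a \<odot> x \<oplus> b \<odot> x"
 using module.smult_l_distr[OF module, of a b x] by simp

lemma smult_add_right:
 "x \<in> carrier E ==> y \<in> carrier E ==> a \<odot> (x \<oplus> y) = a \<odot> x \<oplus> a \<odot> y"
 using module.smult_r_distr[OF module, of a x y] by simp

lemma smult_smult: "x \<in> carrier E ==> a \<odot> (b \<odot> x) = (a * b) \<odot> x"
 using module.smult_assoc1[OF module, of a b x] by simp

lemma smult_1 [simp]: "x \<in> carrier E ==> 1 \<odot> x = x" using module.smult_one[OF module] by simp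

lemma smult_0_left [simp]: "x \<in> carrier E ==> 0 \<odot> x = \<zero>" using module.smult_l_null[OF module] by simp

lemma smult_0_right [simp]: "a \<odot> \<zero> = \<zero>" using module.smult_r_null[OF module] by simp

lemma neg_eq: "x \<in> carrier E ==> \<ominus> x = (- 1) \<odot> x"
proof -
 assume x: "x \<in> carrier E"
 have "(- 1) \<odot> x \<oplus> x = (- 1) \<odot> x \<oplus> 1 \<odot> x" using x by simp
 also have "\<dots> = \<zero>" by (subst smult_add_left[symmetric]) (use x in simp_all)
 finally show ?thesis using x by (metis ag.minus_equality smult_closed)
qed

lemma diff_eq: "x \<in> carrier E ==> y \<in> carrier E ==> x \<ominus> y = x \<oplus> (- 1) \<odot> y" by (simp add: a_minus_def neg_eq)

lemma diff_closed [simp, intro]: "x \<in> carrier E ==> y \<in> carrier E ==> x \<ominus> y \<in> carrier E" by (simp add: diff_eq)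

lemma diff_add_cancel [simp]: "x \<in> carrier E ==> y \<in> carrier E ==> x \<ominus> y \<oplus> y = x"
 by (simp add: a_minus_def ag.a_assoc ag.l_neg)

lemma add_diff_cancel [simp]: "x \<in> carrier E ==> y \<in> carrier E ==> x \<oplus> y \<ominus> y = x"
 by (simp add: a_minus_def ag.a_assoc ag.r_neg)

lemma diff_self [simp]: "x \<in> carrier E ==> x \<ominus> x = \<zero>" by (simp add: a_minus_def ag.r_neg)

lemma diff_eqI: "x = z \<oplus> y ==> y \<in> carrier E ==> z \<in> carrier E ==> x \<ominus> y = z" by simp

lemma smult_diff_right:
 "x \<in> carrier E ==> y \<in> carrier E ==> a \<odot> (x \<ominus> y) = a \<odot> x \<ominus> a \<odot> y"
 by (simp add: diff_eq smult_add_right smult_smult)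

lemma diff_telescope:
 "x \<in> carrier E ==> y \<in> carrier E ==> z \<in> carrier E ==> (x \<ominus> y) \<oplus> (y \<ominus> z) = x \<ominus> z"
 by (simp add: a_minus_def ag.a_assoc ag.r_neg1)

lemma diff_add_add:
 assumes "x \<in> carrier E" "y \<in> carrier E" "x' \<in> carrier E" "y' \<in> carrier E"
 shows "(x \<oplus> y) \<ominus> (x' \<oplus> y') = (x \<ominus> x') \<oplus> (y \<ominus> y')" using assms by (simp add: diff_eq smult_add_right ag.a_ac)

end

locale lcs =
 fixes E :: "('k::real_normed_field, 'e, 'r) tvs_scheme" (structure)
 assumes lcs: "locally_convex_space E"
begin

sublocale vec E using lcs by (intro vec.intro) (simp add: locally_convex_space_def)

lemma topspace_eq [simp]: "topspace (vtop E) = carrier E" using lcs by (simp add: locally_convex_space_def)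

lemma hausdorff: "Hausdorff_space (vtop E)" using lcs by (simp add: locally_convex_space_def)

lemma continuous_add: "continuous_map (prod_topology (vtop E) (vtop E)) (vtop E) (%(x, y). x \<oplus> y)"
 using lcs by (simp add: locally_convex_space_def)

lemma continuous_smult: "continuous_map (prod_topology euclidean (vtop E)) (vtop E) (%(c, x). c \<odot> x)"
 using lcs by (simp add: locally_convex_space_def)

lemma convex_nhd_zero:
 assumes "openin (vtop E) W" "\<zero> \<in> W"
 obtains V where "openin (vtop E) V" "\<zero> \<in> V" "V \<subseteq> W"
  "!!x y t. x \<in> V ==> y \<in> V ==> 0 \<le> t ==> t \<le> 1 ==>
    of_real t \<odot> x \<oplus> of_real (1 - t) \<odot> y \<in> V"
proof -
 obtain V where "openin (vtop E) V \<and> \<zero> \<in> V \<and> V \<subseteq> W \<and>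
    (\<forall>x\<in>V. \<forall>y\<in>V. \<forall>t\<in>{0..1::real}. (of_real t \<odot> x) \<oplus> (of_real (1 - t) \<odot> y) \<in> V)"
  using lcs assms unfolding locally_convex_space_def by meson
 then show ?thesis by (intro that[of V]) auto
qed

lemma continuous_map_vadd:
 assumes "continuous_map Z (vtop E) f" "continuous_map Z (vtop E) g"
 shows "continuous_map Z (vtop E) (%z. f z \<oplus> g z)"
 using continuous_map_compose[OF continuous_map_pairedI[OF assms] continuous_add] by (simp add: o_def)

lemma continuous_map_vsmult:
 assumes "continuous_map Z euclidean c" "continuous_map Z (vtop E) g"
 shows "continuous_map Z (vtop E) (%z. c z \<odot> g z)"
 using continuous_map_compose[OF continuous_map_pairedI[OF assms] continuous_smult] by (simp add: o_def)

lemma continuous_map_vdiff: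
 assumes "continuous_map Z (vtop E) f" "continuous_map Z (vtop E) g"
 shows "continuous_map Z (vtop E) (%z. f z \<ominus> g z)"
proof -
 have "continuous_map Z (vtop E) (%z. f z \<oplus> (- 1) \<odot> g z)"
  by (intro continuous_map_vadd assms continuous_map_vsmult) auto
 then show ?thesis by (rule continuous_map_eq) (use assms in \<open>auto simp: continuous_map_def Pi_iff diff_eq\<close>)
qed

lemma lim_closed: "limitin (vtop E) f l G ==> l \<in> carrier E" by (metis limitin_topspace topspace_eq)

lemma lim_eventually_closed: "limitin (vtop E) f l G ==> eventually (%t. f t \<in> carrier E) G"
 unfolding limitin_def by (metis openin_topspace topspace_eq)

lemma lim_add:
 assumes "limitin (vtop E) f l G" "limitin (vtop E) g m G"
 shows "limitin (vtop E) (%t. f t \<oplus> g t) (l \<oplus> m) G"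
proof -
 have "limitin (prod_topology (vtop E) (vtop E)) (%t. (f t, g t)) (l, m) G"
  using assms by (simp add: limitin_pairwise o_def)
 from continuous_map_limit[OF continuous_add this] show ?thesis by (simp add: o_def)
qed

lemma lim_smult:
 assumes "(c \<longlongrightarrow> c0) G" "limitin (vtop E) f l G"
 shows "limitin (vtop E) (%t. c t \<odot> f t) (c0 \<odot> l) G"
proof -
 have "limitin (prod_topology euclidean (vtop E)) (%t. (c t, f t)) (c0, l) G"
  using assms by (simp add: limitin_pairwise o_def)
 from continuous_map_limit[OF continuous_smult this] show ?thesis by (simp add: o_def)
qed

lemma lim_eq:
 "limitin (vtop E) f l G ==> eventually (%t. f t = g t) G ==> limitin (vtop E) g l G"
 by (metis (mono_tags, lifting) limitin_transform_eventually)

lemma lim_const: "c \<in> carrier E ==> limitin (vtop E) (%_. c) c G" by simp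

lemma lim_unique:
 "limitin (vtop E) f l G ==> limitin (vtop E) f m G ==> G \<noteq> bot ==> l = m"
 using limitin_Hausdorff_unique[OF _ _ _ hausdorff] by blast

text \<open>A translate of a convex neighbourhood of zero. The mean value argument needs convex
  neighbourhoods around the value of a derivative.\<close>

lemma convex_nhd:
 assumes "openin (vtop E) W" "l \<in> W"
 obtains V where "openin (vtop E) V" "l \<in> V" "V \<subseteq> W"
  "!!x y t. x \<in> V ==> y \<in> V ==> 0 \<le> t ==> t \<le> 1 ==>
    of_real t \<odot> x \<oplus> of_real (1 - t) \<odot> y \<in> V"
proof -
 have l: "l \<in> carrier E" using assms openin_subset by force
 have c1: "continuous_map (vtop E) (vtop E) (%x. x \<oplus> l)" by (intro continuous_map_vadd) (use l in auto)
 have c2: "continuous_map (vtop E) (vtop E) (%x. x \<ominus> l)" by (intro continuous_map_vdiff) (use l in auto)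
 have "openin (vtop E) {x \<in> topspace (vtop E). x \<oplus> l \<in> W}"
  using openin_continuous_map_preimage[OF c1 assms(1)] .
 moreover have "\<zero> \<in> {x \<in> topspace (vtop E). x \<oplus> l \<in> W}" using assms(2) l by simp
 ultimately obtain V where V: "openin (vtop E) V" "\<zero> \<in> V" "V \<subseteq> {x \<in> topspace (vtop E). x \<oplus> l \<in> W}"
  "!!x y t. x \<in> V ==> y \<in> V ==> 0 \<le> t ==> t \<le> 1 ==>
    of_real t \<odot> x \<oplus> of_real (1 - t) \<odot> y \<in> V" by (rule convex_nhd_zero) blast
 let ?V = "{x \<in> topspace (vtop E). x \<ominus> l \<in> V}"
 \<comment> \<open>Translation by \<open>l\<close> commutes with convex combinations because the
   weights \<open>t\<close> and \<open>1 - t\<close> add up to 1.\<close>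
 have "of_real t \<odot> x \<oplus> of_real (1 - t) \<odot> y \<ominus> l =
   of_real t \<odot> (x \<ominus> l) \<oplus> of_real (1 - t) \<odot> (y \<ominus> l)"
  if "x \<in> carrier E" "y \<in> carrier E" for x y and t :: real
 proof (rule diff_eqI)
  have "of_real t \<odot> (x \<ominus> l) \<oplus> of_real (1 - t) \<odot> (y \<ominus> l) \<oplus> l =
   of_real t \<odot> (x \<ominus> l) \<oplus> of_real (1 - t) \<odot> (y \<ominus> l) \<oplus> (of_real t + of_real (1 - t)) \<odot> l" using l that by simp
  also have "\<dots> = of_real t \<odot> ((x \<ominus> l) \<oplus> l) \<oplus> of_real (1 - t) \<odot> ((y \<ominus> l) \<oplus> l)"
   using l that by (simp only: smult_add_left smult_add_right diff_closed) (simp add: ag.a_ac)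
  finally show "of_real t \<odot> x \<oplus> of_real (1 - t) \<odot> y =
    of_real t \<odot> (x \<ominus> l) \<oplus> of_real (1 - t) \<odot> (y \<ominus> l) \<oplus> l" using l that by simp
 qed (use l that in auto)
 then show ?thesis using V l openin_continuous_map_preimage[OF c2 V(1)]
  by (intro that[of ?V]) (auto simp: subset_iff)
qed

end

section \<open>The mean value theorem and iterated directional derivatives\<close>

text \<open>The difference quotient over an interval is a convex combination of those over two
  adjacent subintervals, and near each point the quotients based at that point lie in the open set
  \<open>W\<close>. Bisection of the interval, in the form of the rule \<open>Bolzano\<close>,
  combines the two facts.\<close>

lemma (in lcs) mean_value_convex:
 fixes \<phi> :: "real => 'e"
 assumes "a < b"
  and W: "openin (vtop E) W"
  and convex: "!!x y t. x \<in> W ==> y \<in> W ==> 0 \<le> t ==> t \<le> 1 ==>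
    of_real t \<odot> x \<oplus> of_real (1 - t) \<odot> y \<in> W"
  and closed: "!!r. a \<le> r ==> r \<le> b ==> \<phi> r \<in> carrier E"
  and deriv: "!!r. a \<le> r ==> r \<le> b ==>
    \<exists>l\<in>W. limitin (vtop E) (%h. of_real (inverse h) \<odot> (\<phi> (r + h) \<ominus> \<phi> r)) l (at 0)"
 shows "of_real (inverse (b - a)) \<odot> (\<phi> b \<ominus> \<phi> a) \<in> W"
proof -
 let ?q = "%x y. of_real (inverse (y - x)) \<odot> (\<phi> y \<ominus> \<phi> x)"
 let ?P = "%x y. a \<le> x \<longrightarrow> y \<le> b \<longrightarrow> x < y \<longrightarrow> ?q x y \<in> W"
 have swap: "?q x y = ?q y x" if "\<phi> x \<in> carrier E" "\<phi> y \<in> carrier E" for x y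
 proof -
  have "inverse (y - x) = inverse (x - y) * (- 1)" by (metis inverse_minus_eq minus_diff_eq mult_minus1_right)
  then have e: "(of_real (inverse (y - x)) ::  'k) = of_real (inverse (x - y)) * (- 1)"
   by (metis of_real_1 of_real_minus of_real_mult)
  have "?q x y = of_real (inverse (x - y)) \<odot> ((- 1) \<odot> (\<phi> y \<ominus> \<phi> x))"
   unfolding e using that by (simp only: smult_smult diff_closed)
  also have "(- 1) \<odot> (\<phi> y \<ominus> \<phi> x) = \<phi> x \<ominus> \<phi> y"
   using that by (simp add: diff_eq smult_add_right smult_smult ag.a_comm)
  finally show ?thesis .
 qed
 have add: "?q x z \<in> W" if "?q x y \<in> W" "?q y z \<in> W" "x < y" "y < z"
  "\<phi> x \<in> carrier E" "\<phi> y \<in> carrier E" "\<phi> z \<in> carrier E" for x y z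
 proof -
  \<comment> \<open>The weight of \<open>[x, y]\<close> is its share of the length of
    \<open>[x, z]\<close>.\<close>
  define t where "t = (y - x) / (z - x)"
  have t: "0 \<le> t" "t \<le> 1" "t * inverse (y - x) = inverse (z - x)" using that by (auto simp: t_def field_simps)
  have "1 - t = (z - y) / (z - x)" using that by (simp add: t_def field_simps)
  then have t': "(1 - t) * inverse (z - y) = inverse (z - x)" using that by (simp add: field_simps)
  have e1: "of_real t * of_real (inverse (y - x)) = (of_real (inverse (z - x)) :: 'k)"
   and e2: "of_real (1 - t) * of_real (inverse (z - y)) = (of_real (inverse (z - x)) :: 'k)"
   by (simp_all only: of_real_mult[symmetric] t t')
  have "of_real t \<odot> ?q x y \<oplus> of_real (1 - t) \<odot> ?q y z =
    of_real (inverse (z - x)) \<odot> (\<phi> y \<ominus> \<phi> x) \<oplus> of_real (inverse (z - x)) \<odot> (\<phi> z \<ominus> \<phi> y)"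
   using that by (simp only: smult_smult diff_closed e1 e2)
  also have "\<dots> = of_real (inverse (z - x)) \<odot> ((\<phi> z \<ominus> \<phi> y) \<oplus> (\<phi> y \<ominus> \<phi> x))"
   using that by (simp add: smult_add_right ag.a_comm)
  also have "\<dots> = ?q x z" using that by (simp only: diff_telescope)
  finally show ?thesis using convex[OF that(1,2) t(1,2)] by simp
 qed
 have "?P a b"
 proof (rule Bolzano[where P = ?P])
  show "a \<le> b" using assms by simp
 next
  fix x y z assume xy: "?P x y" and yz: "?P y z" and le: "x \<le> y" "y \<le> z"
  show "?P x z"
  proof (intro impI)
   assume b: "a \<le> x" "z \<le> b" "x < z"
   show "?q x z \<in> W"
   proof (cases "x < y \<and> y < z")
    case True
    have "?q x y \<in> W" "?q y z \<in> W" using True xy yz b by (auto simp del: of_real_inverse)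
    then show ?thesis by (rule add) (use True b in \<open>auto intro!: closed\<close>)
   next
    case False
    then have "x = y \<or> y = z" using le by linarith
    then show ?thesis using xy yz b by auto
   qed
  qed
 next
  fix x assume x: "a \<le> x" "x \<le> b"
  obtain l where l: "l \<in> W" "limitin (vtop E) (%h. of_real (inverse h) \<odot> (\<phi> (x + h) \<ominus> \<phi> x)) l (at 0)"
   using deriv[OF x] by blast
  then have "eventually (%h. of_real (inverse h) \<odot> (\<phi> (x + h) \<ominus> \<phi> x) \<in> W) (at 0)"
   using W unfolding limitin_def by blast
  then obtain d where d: "d > 0" "!!h. h \<noteq> 0 ==> \<bar>h\<bar> < d ==> of_real (inverse h) \<odot> (\<phi> (x + h) \<ominus> \<phi> x) \<in> W"
   unfolding eventually_at by (auto simp: dist_real_def)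
  have d': "?q x y \<in> W" if "y \<noteq> x" "\<bar>y - x\<bar> < d" for y using d(2)[of "y - x"] that by simp
  \<comment> \<open>Differentiability at \<open>x\<close> controls only quotients with endpoint
    \<open>x\<close>. An interval with \<open>x\<close> in its interior is cut there and treated by
    \<open>add\<close>.\<close>
  show "\<exists>d>0. \<forall>y z. y \<le> x \<and> x \<le> z \<and> z - y < d \<longrightarrow> ?P y z"
  proof (intro exI[of _ d] conjI allI impI d(1))
   fix y z assume yz: "y \<le> x \<and> x \<le> z \<and> z - y < d" "a \<le> y" "z \<le> b" "y < z"
   have c: "\<phi> x \<in> carrier E" "\<phi> y \<in> carrier E" "\<phi> z \<in> carrier E" using yz x by (auto intro!: closed)
   consider "y = x" | "z = x" | "y < x" "x < z" using yz by linarith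
   then show "?q y z \<in> W"
   proof cases
    case 1
    then show ?thesis using d'[of z] yz by simp
   next
    case 2
    then show ?thesis using d'[of y] yz swap[OF c(2,1)] by simp
   next
    case 3
    have "?q y x \<in> W" using d'[of y] yz 3 swap[OF c(2,1)] by simp
    moreover have "?q x z \<in> W" using d'[of z] yz 3 by simp
    ultimately show ?thesis by (rule add) (use 3 c in auto)
   qed
  qed
 qed
 then show ?thesis using \<open>a < b\<close> by simp
qed

section \<open>Iterated directional derivatives\<close>

lemma dir_deriv_cong_dirs:
 "(!!i. i < k ==> v i = w i) ==> dir_deriv E F f k x v = dir_deriv E F f k x w" by (induction k arbitrary: x) auto

lemma dir_deriv_restrict: "dir_deriv E F f k x (restrict v {..<k}) = dir_deriv E F f k x v"
 by (rule dir_deriv_cong_dirs) simp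

locale lcs2 = dom: lcs E + cod: lcs F
 for E :: "(real, 'e) tvs" (structure) and F :: "(real, 'f) tvs"
begin

lemma line_limit:
 assumes "x \<in> carrier E" "w \<in> carrier E"
 shows "limitin (vtop E) (%t. x \<oplus> t \<odot> w) x (at 0)"
proof -
 have "limitin (vtop E) (%t. x \<oplus> t \<odot> w) (x \<oplus> 0 \<odot> w) (at 0)"
  using assms by (intro dom.lim_add dom.lim_smult dom.lim_const tendsto_ident_at)
 then show ?thesis using assms by simp
qed

lemma line_eventually:
 assumes "openin (vtop E) U" "x \<in> U" "w \<in> carrier E"
 shows "eventually (%t. x \<oplus> t \<odot> w \<in> U) (at 0)"
 using line_limit[of x w] assms openin_subset[OF assms(1)] unfolding limitin_def by auto

lemma smooth_on_open: "smooth_on E F U f ==> openin (vtop E) U" by (simp add: smooth_on_def)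

lemma smooth_on_subset: "smooth_on E F U f ==> U \<subseteq> carrier E" using smooth_on_open openin_subset by fastforce

text \<open>The definition of smoothness supplies limits only for extensional tuples of directions.
  Entries of \<open>v\<close> beyond index \<open>k\<close> do not influence the derivative, and the
  Hausdorff property identifies the limit with the \<open>THE\<close> in
  \<open>dir_deriv\<close>.\<close>

lemma smooth_on_deriv_limit:
 assumes f: "smooth_on E F U f" and x: "x \<in> U" and v: "!!i. i < Suc k ==> v i \<in> carrier E"
 shows "limitin (vtop F) (%t. inverse t \<odot>\<^bsub>F\<^esub> (dir_deriv E F f k (x \<oplus> (t \<odot> v k)) v \<ominus>\<^bsub>F\<^esub> dir_deriv E F f k x v))
    (dir_deriv E F f (Suc k) x v) (at 0)"
proof -
 let ?v = "restrict v {..<Suc k}"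
 have eq: "dir_deriv E F f k y ?v = dir_deriv E F f k y v" for y by (rule dir_deriv_cong_dirs) simp
 have "?v \<in> {..<Suc k} \<rightarrow>\<^sub>E carrier E" using v by auto
 then obtain l where l: "limitin (vtop F) (%t. inverse t \<odot>\<^bsub>F\<^esub>
     (dir_deriv E F f k (x \<oplus> (t \<odot> ?v k)) ?v \<ominus>\<^bsub>F\<^esub> dir_deriv E F f k x ?v)) l (at 0)"
  using f x unfolding smooth_on_def by blast
 then have l: "limitin (vtop F) (%t. inverse t \<odot>\<^bsub>F\<^esub>
     (dir_deriv E F f k (x \<oplus> (t \<odot> v k)) v \<ominus>\<^bsub>F\<^esub> dir_deriv E F f k x v)) l (at 0)" by (simp add: eq)
 have "dir_deriv E F f (Suc k) x v = l" unfolding dir_deriv.simps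
  by (rule the_equality, rule l) (rule cod.lim_unique[OF _ l], auto)
 with l show ?thesis by simp
qed

lemma in_topspace_jet_domain:
 "(x, v) \<in> topspace (jet_domain E U k) \<longleftrightarrow> x \<in> U \<and> x \<in> carrier E \<and> v \<in> {..<k} \<rightarrow>\<^sub>E carrier E"
 by (auto simp: jet_domain_def PiE_def)

lemma smooth_on_deriv_closed:
 assumes f: "smooth_on E F U f" and x: "x \<in> U" and v: "!!i. i < k ==> v i \<in> carrier E"
 shows "dir_deriv E F f k x v \<in> carrier F"
proof -
 have "(x, restrict v {..<k}) \<in> topspace (jet_domain E U k)"
  using x v smooth_on_subset[OF f] by (auto simp: in_topspace_jet_domain)
 moreover have "continuous_map (jet_domain E U k) (vtop F) (%(x, v). dir_deriv E F f k x v)"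
  using f by (simp add: smooth_on_def)
 ultimately have "(%(x, v). dir_deriv E F f k x v) (x, restrict v {..<k}) \<in> topspace (vtop F)"
  unfolding continuous_map_def by blast
 then show ?thesis by (simp add: dir_deriv_restrict)
qed

lemma smooth_on_closed: "smooth_on E F U f ==> x \<in> U ==> f x \<in> carrier F"
 using smooth_on_deriv_closed[of U f x 0] by simp

lemma limitin_jet:
 assumes "limitin (vtop E) y y0 G" "openin (vtop E) U" "y0 \<in> U"
  and w: "!!i. i < k ==> limitin (vtop E) (%t. w t i) (w0 i) G"
 shows "limitin (jet_domain E U k) (%t. (y t, restrict (w t) {..<k})) (y0, restrict w0 {..<k}) G"
proof -
 have "limitin (subtopology (vtop E) U) y y0 G"
  using assms(1-3) by (auto simp: limitin_subtopology intro: limitinD)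
 moreover have "limitin (product_topology (%_. vtop E) {..<k}) (%t. restrict (w t) {..<k}) (restrict w0 {..<k}) G"
 proof -
  have "eventually (%t. \<forall>i<k. w t i \<in> carrier E) G"
  proof -
   have "eventually (%t. \<forall>i\<in>{..<k}. w t i \<in> carrier E) G"
    by (intro eventually_ball_finite ballI) (auto intro: dom.lim_eventually_closed[OF w])
   then show ?thesis by (rule eventually_mono) simp
  qed
  then have "eventually (%t. restrict (w t) {..<k} \<in> {..<k} \<rightarrow>\<^sub>E carrier E) G" by eventually_elim auto
  then show ?thesis using w by (simp add: limitin_componentwise)
 qed
 ultimately show ?thesis by (simp add: jet_domain_def limitin_pairwise o_def)
qed

lemma smooth_on_jet_limit:
 assumes f: "smooth_on E F U f" and y: "limitin (vtop E) y y0 G" and "y0 \<in> U"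
  and w: "!!i. i < k ==> limitin (vtop E) (%t. w t i) (w0 i) G"
 shows "limitin (vtop F) (%t. dir_deriv E F f k (y t) (w t)) (dir_deriv E F f k y0 w0) G"
proof -
 have "continuous_map (jet_domain E U k) (vtop F) (%(x, v). dir_deriv E F f k x v)"
  using f by (simp add: smooth_on_def)
 from continuous_map_limit[OF this limitin_jet[OF y smooth_on_open[OF f] \<open>y0 \<in> U\<close> w]]
 show ?thesis by (simp add: o_def dir_deriv_restrict)
qed

text \<open>All derivatives are guessed at once, \<open>g k\<close> being the candidate of order
  \<open>k\<close>. Uniqueness of limits identifies it with \<open>dir_deriv\<close> by induction;
  openness of \<open>U\<close> keeps nearby points of a line in the region where the induction
  hypothesis applies. The closed formulas for derivatives below are obtained in this way.\<close>

lemma smooth_onI_jet: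
 assumes U: "openin (vtop E) U"
  and g0: "!!x v. x \<in> U ==> g 0 x v = f x"
  and lim: "!!k x v. x \<in> U ==> (!!i. i < Suc k ==> v i \<in> carrier E) ==>
   limitin (vtop F) (%t. inverse t \<odot>\<^bsub>F\<^esub> (g k (x \<oplus> (t \<odot> v k)) v \<ominus>\<^bsub>F\<^esub> g k x v)) (g (Suc k) x v) (at 0)"
  and cont: "!!k. continuous_map (jet_domain E U k) (vtop F) (%(x, v). g k x v)"
 shows "smooth_on E F U f"
  and "!!k x v. x \<in> U ==> (!!i. i < k ==> v i \<in> carrier E) ==> dir_deriv E F f k x v = g k x v"
proof -
 have sub: "U \<subseteq> carrier E" using openin_subset[OF U] by simp
 have step: "limitin (vtop F) (%t. inverse t \<odot>\<^bsub>F\<^esub>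
     (dir_deriv E F f k (x \<oplus> (t \<odot> v k)) v \<ominus>\<^bsub>F\<^esub> dir_deriv E F f k x v)) (g (Suc k) x v) (at 0)"
  if eq: "!!x v. x \<in> U ==> (!!i. i < k ==> v i \<in> carrier E) ==> dir_deriv E F f k x v = g k x v"
   and x: "x \<in> U" and v: "!!i. i < Suc k ==> v i \<in> carrier E" for k x v
 proof (rule cod.lim_eq[OF lim[OF x v]])
  have "eventually (%t. x \<oplus> t \<odot> v k \<in> U) (at 0)" using line_eventually[OF U x] v by simp
  then show "\<forall>\<^sub>F t in at 0. inverse t \<odot>\<^bsub>F\<^esub> (g k (x \<oplus> (t \<odot> v k)) v \<ominus>\<^bsub>F\<^esub> g k x v) =
    inverse t \<odot>\<^bsub>F\<^esub> (dir_deriv E F f k (x \<oplus> (t \<odot> v k)) v \<ominus>\<^bsub>F\<^esub> dir_deriv E F f k x v)"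
   by eventually_elim (use eq x v in simp)
 qed auto
 show eq: "dir_deriv E F f k x v = g k x v" if "x \<in> U" "!!i. i < k ==> v i \<in> carrier E" for k x v using that
 proof (induction k arbitrary: x v)
  case 0
  then show ?case by (simp add: g0)
 next
  case (Suc k)
  have l: "limitin (vtop F) (%t. inverse t \<odot>\<^bsub>F\<^esub>
     (dir_deriv E F f k (x \<oplus> (t \<odot> v k)) v \<ominus>\<^bsub>F\<^esub> dir_deriv E F f k x v)) (g (Suc k) x v) (at 0)"
   by (rule step) (use Suc in auto)
  show ?case unfolding dir_deriv.simps by (rule the_equality, rule l) (rule cod.lim_unique[OF _ l], auto)
 qed
 show "smooth_on E F U f" unfolding smooth_on_def
 proof (intro conjI allI ballI U)
  fix k x v assume "x \<in> U" "v \<in> {..<Suc k} \<rightarrow>\<^sub>E carrier E"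
  then show "\<exists>l. limitin (vtop F) (%t. inverse t \<odot>\<^bsub>F\<^esub>
     (dir_deriv E F f k (x \<oplus> (t \<odot> v k)) v \<ominus>\<^bsub>F\<^esub> dir_deriv E F f k x v)) l (at 0)"
   by (intro exI[of _ "g (Suc k) x v"] step eq) (auto simp: PiE_def Pi_def)
 next
  fix k
  show "continuous_map (jet_domain E U k) (vtop F) (%(x, v). dir_deriv E F f k x v)"
   by (rule continuous_map_eq[OF cont]) (auto simp: in_topspace_jet_domain PiE_def Pi_def eq)
 qed
qed

text \<open>Base point, directions and increment may all move with \<open>t\<close>. Continuity of
  the next derivative keeps it close to its limit along the whole short segment from
  \<open>a t\<close> in direction \<open>u t\<close>, and the mean value theorem transfers this to
  the difference quotient.\<close>

lemma smooth_on_increment: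
 assumes f: "smooth_on E F U f" and a: "limitin (vtop E) a y0 (at 0)" and y0: "y0 \<in> U"
  and w: "!!i. i < k ==> limitin (vtop E) (%t. w t i) (w0 i) (at 0)"
  and u: "limitin (vtop E) u u0 (at (0::real))"
 shows "limitin (vtop F) (%t. inverse t \<odot>\<^bsub>F\<^esub>
   (dir_deriv E F f k (a t \<oplus> t \<odot> u t) (w t) \<ominus>\<^bsub>F\<^esub> dir_deriv E F f k (a t) (w t)))
  (dir_deriv E F f (Suc k) y0 (w0(k := u0))) (at 0)" (is "limitin _ ?q ?l _")
proof -
 have y0c: "y0 \<in> carrier E" using a by (rule dom.lim_closed)
 have u0c: "u0 \<in> carrier E" using u by (rule dom.lim_closed)
 have w0c: "w0 i \<in> carrier E" if "i < k" for i using w[OF that] by (rule dom.lim_closed)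
 have lc: "?l \<in> carrier F" by (rule smooth_on_deriv_closed[OF f y0]) (use u0c w0c in auto)
 \<comment> \<open>The first coordinate is the position on the segment, which may be 0; the second
   is the parameter of the curves, which may not. Convergence along this product filter is uniform
   on short segments.\<close>
 let ?G = "nhds (0::real) \<times>\<^sub>F at (0::real)"
 have fst: "filterlim fst (nhds 0) ?G" and snd: "filterlim snd (at 0) ?G"
  by (simp_all add: filterlim_fst filterlim_snd)
 have pull: "limitin (vtop E) (%z. h (snd z)) l ?G" if "limitin (vtop E) h l (at 0)" for h l
 proof -
  have "eventually (%z. h (snd z) \<in> V) ?G" if "openin (vtop E) V" "l \<in> V" for V
   using \<open>limitin (vtop E) h l (at 0)\<close> that snd unfolding limitin_def filterlim_iff by blast
  then show ?thesis using that by (auto simp: limitin_def)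
 qed
 have base: "limitin (vtop E) (%z. a (snd z) \<oplus> fst z \<odot> u (snd z)) y0 ?G"
 proof -
  have "limitin (vtop E) (%z. a (snd z) \<oplus> fst z \<odot> u (snd z)) (y0 \<oplus> 0 \<odot> u0) ?G"
   by (intro dom.lim_add dom.lim_smult pull a u fst)
  then show ?thesis using y0c u0c by simp
 qed
 have "limitin (vtop F) (%z. dir_deriv E F f (Suc k) (a (snd z) \<oplus> fst z \<odot> u (snd z))
   ((w (snd z))(k := u (snd z)))) ?l ?G" by (rule smooth_on_jet_limit[OF f base y0]) (auto intro!: pull u w)
 note main = this
 show ?thesis unfolding limitin_def
 proof (intro conjI allI impI)
  show "?l \<in> topspace (vtop F)" using lc by simp
  fix W assume W: "openin (vtop F) W \<and> ?l \<in> W"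
  obtain V where V: "openin (vtop F) V" "?l \<in> V" "V \<subseteq> W"
   "!!x y t. x \<in> V ==> y \<in> V ==> 0 \<le> t ==> t \<le> 1 ==>
     of_real t \<odot>\<^bsub>F\<^esub> x \<oplus>\<^bsub>F\<^esub> of_real (1 - t) \<odot>\<^bsub>F\<^esub> y \<in> V"
   by (rule cod.convex_nhd[OF conjunct1[OF W] conjunct2[OF W]]) blast
  have "eventually (%z. dir_deriv E F f (Suc k) (a (snd z) \<oplus> fst z \<odot> u (snd z))
   ((w (snd z))(k := u (snd z))) \<in> V \<and> a (snd z) \<oplus> fst z \<odot> u (snd z) \<in> U) ?G"
   by (intro eventually_conj limitinD[OF main V(1,2)] limitinD[OF base smooth_on_open[OF f] y0])
  then obtain R Q where RQ: "eventually R (nhds 0)" "eventually Q (at 0)"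
   "!!r t. R r ==> Q t ==> dir_deriv E F f (Suc k) (a t \<oplus> r \<odot> u t) ((w t)(k := u t)) \<in> V \<and>
     a t \<oplus> r \<odot> u t \<in> U" unfolding eventually_prod_filter by auto
  obtain d where d: "d > 0" "!!r. \<bar>r\<bar> < d ==> R r"
   using RQ(1) unfolding eventually_nhds_metric by (auto simp: dist_real_def)
  have "eventually (%t. \<forall>i\<in>{..<k}. w t i \<in> carrier E) (at 0)"
   by (intro eventually_ball_finite ballI) (auto intro: dom.lim_eventually_closed[OF w])
  moreover have "eventually (%t. u t \<in> carrier E) (at 0)" "eventually (%t. a t \<in> carrier E) (at 0)"
   using u a by (auto intro: dom.lim_eventually_closed)
  moreover have "eventually (%t::real. \<bar>t\<bar> < d \<and> t \<noteq> 0) (at 0)"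
   unfolding eventually_at using d(1) by (auto simp: dist_real_def)
  ultimately show "eventually (%t. ?q t \<in> W) (at 0)" using RQ(2)
  proof eventually_elim
   case (elim t)
   let ?\<phi> = "%r. dir_deriv E F f k (a t \<oplus> r \<odot> u t) (w t)"
   have inU: "a t \<oplus> r \<odot> u t \<in> U" if "\<bar>r\<bar> < d" for r using RQ(3) d(2) elim that by blast
   have cl: "?\<phi> r \<in> carrier F" if "\<bar>r\<bar> < d" for r
    by (rule smooth_on_deriv_closed[OF f inU]) (use that elim in auto)
   have der: "\<exists>l\<in>V. limitin (vtop F) (%h. of_real (inverse h) \<odot>\<^bsub>F\<^esub> (?\<phi> (r + h) \<ominus>\<^bsub>F\<^esub> ?\<phi> r)) l (at 0)"
    if r: "\<bar>r\<bar> < d" for r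
   proof
    have eq: "a t \<oplus> r \<odot> u t \<oplus> h \<odot> u t = a t \<oplus> (r + h) \<odot> u t" for h
     using elim by (simp add: dom.smult_add_left dom.ag.a_assoc)
    have cong: "dir_deriv E F f k y ((w t)(k := u t)) = dir_deriv E F f k y (w t)" for y
     by (rule dir_deriv_cong_dirs) simp
    have "limitin (vtop F) (%h. inverse h \<odot>\<^bsub>F\<^esub>
     (dir_deriv E F f k ((a t \<oplus> r \<odot> u t) \<oplus> (h \<odot> ((w t)(k := u t)) k)) ((w t)(k := u t)) \<ominus>\<^bsub>F\<^esub>
       dir_deriv E F f k (a t \<oplus> r \<odot> u t) ((w t)(k := u t))))
     (dir_deriv E F f (Suc k) (a t \<oplus> r \<odot> u t) ((w t)(k := u t))) (at 0)"
     by (rule smooth_on_deriv_limit[OF f inU[OF r]]) (use elim in auto)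
    then show "limitin (vtop F) (%h. of_real (inverse h) \<odot>\<^bsub>F\<^esub> (?\<phi> (r + h) \<ominus>\<^bsub>F\<^esub> ?\<phi> r))
      (dir_deriv E F f (Suc k) (a t \<oplus> r \<odot> u t) ((w t)(k := u t))) (at 0)"
     by (simp only: eq cong fun_upd_same of_real_eq_id id_apply)
    show "dir_deriv E F f (Suc k) (a t \<oplus> r \<odot> u t) ((w t)(k := u t)) \<in> V" using RQ(3) d(2) elim r by blast
   qed
   have \<phi>0: "?\<phi> 0 = dir_deriv E F f k (a t) (w t)" using elim by simp
   show ?case
   proof (cases "t > 0")
    case True
    have "of_real (inverse (t - 0)) \<odot>\<^bsub>F\<^esub> (?\<phi> t \<ominus>\<^bsub>F\<^esub> ?\<phi> 0) \<in> V"
     by (rule cod.mean_value_convex[OF True V(1)]) (use V(4) cl der elim in auto)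
    then show ?thesis unfolding \<phi>0 using V(3) by auto
   next
    \<comment> \<open>For negative \<open>t\<close> the interval is \<open>[t, 0]\<close>. Reversing
      the increment and the sign of its length leaves the quotient unchanged.\<close>
    case False
    then have "t < 0" using elim by simp
    have "of_real (inverse (0 - t)) \<odot>\<^bsub>F\<^esub> (?\<phi> 0 \<ominus>\<^bsub>F\<^esub> ?\<phi> t) \<in> V"
     by (rule cod.mean_value_convex[OF \<open>t < 0\<close> V(1)]) (use V(4) cl der elim in auto)
    moreover have "inverse (0 - t) \<odot>\<^bsub>F\<^esub> (?\<phi> 0 \<ominus>\<^bsub>F\<^esub> ?\<phi> t) = inverse t \<odot>\<^bsub>F\<^esub> (?\<phi> t \<ominus>\<^bsub>F\<^esub> ?\<phi> 0)"
    proof -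
     have "?\<phi> 0 \<ominus>\<^bsub>F\<^esub> ?\<phi> t = (- 1) \<odot>\<^bsub>F\<^esub> (?\<phi> t \<ominus>\<^bsub>F\<^esub> ?\<phi> 0)" using cl[of t] cl[of 0] elim d(1)
      by (simp add: cod.diff_eq cod.smult_add_right cod.smult_smult cod.ag.a_comm)
     then show ?thesis using cl[of t] cl[of 0] elim d(1) by (simp add: cod.smult_smult)
    qed
    ultimately show ?thesis unfolding \<phi>0 using V(3) by auto
   qed
  qed
 qed
qed

end

context lcs2
begin

text \<open>The step in direction \<open>u \<oplus> u'\<close> is made through the intermediate
  point reached by \<open>u\<close>. The second half then has a moving base point, which
  \<open>smooth_on_increment\<close> permits.\<close>

lemma deriv_add_last:
 assumes f: "smooth_on E F U f" and x: "x \<in> U" and v: "!!i. i < k ==> v i \<in> carrier E"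
  and u: "u \<in> carrier E" "u' \<in> carrier E"
 shows "dir_deriv E F f (Suc k) x (v(k := u \<oplus> u')) =
  dir_deriv E F f (Suc k) x (v(k := u)) \<oplus>\<^bsub>F\<^esub> dir_deriv E F f (Suc k) x (v(k := u'))"
proof -
 note U = smooth_on_open[OF f]
 have xc: "x \<in> carrier E" using x smooth_on_subset[OF f] by auto
 let ?D = "%y. dir_deriv E F f k y v"
 have A: "limitin (vtop F) (%t. inverse t \<odot>\<^bsub>F\<^esub> (?D (x \<oplus> t \<odot> w) \<ominus>\<^bsub>F\<^esub> ?D x))
   (dir_deriv E F f (Suc k) x (v(k := w))) (at 0)" if "w \<in> carrier E" for w
  by (rule smooth_on_increment[OF f _ x]) (use v xc that in auto)
 have B: "limitin (vtop F) (%t. inverse t \<odot>\<^bsub>F\<^esub> (?D ((x \<oplus> t \<odot> u) \<oplus> t \<odot> u') \<ominus>\<^bsub>F\<^esub> ?D (x \<oplus> t \<odot> u)))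
   (dir_deriv E F f (Suc k) x (v(k := u'))) (at 0)"
  by (rule smooth_on_increment[OF f line_limit x]) (use v xc u in auto)
 have C: "limitin (vtop F) (%t. inverse t \<odot>\<^bsub>F\<^esub> (?D (x \<oplus> t \<odot> (u \<oplus> u')) \<ominus>\<^bsub>F\<^esub> ?D x))
   (dir_deriv E F f (Suc k) x (v(k := u)) \<oplus>\<^bsub>F\<^esub> dir_deriv E F f (Suc k) x (v(k := u'))) (at 0)"
 proof (rule cod.lim_eq[OF cod.lim_add[OF A[OF u(1)] B]])
  have "eventually (%t. x \<oplus> t \<odot> u \<in> U) (at 0)"
   "eventually (%t. x \<oplus> t \<odot> (u \<oplus> u') \<in> U) (at 0)" using line_eventually[OF U x] u by auto
  then show "\<forall>\<^sub>F t in at 0. inverse t \<odot>\<^bsub>F\<^esub> (?D (x \<oplus> t \<odot> u) \<ominus>\<^bsub>F\<^esub> ?D x) \<oplus>\<^bsub>F\<^esub>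
    inverse t \<odot>\<^bsub>F\<^esub> (?D ((x \<oplus> t \<odot> u) \<oplus> t \<odot> u') \<ominus>\<^bsub>F\<^esub> ?D (x \<oplus> t \<odot> u)) =
   inverse t \<odot>\<^bsub>F\<^esub> (?D (x \<oplus> t \<odot> (u \<oplus> u')) \<ominus>\<^bsub>F\<^esub> ?D x)"
  proof eventually_elim
   case (elim t)
   have e: "(x \<oplus> t \<odot> u) \<oplus> t \<odot> u' = x \<oplus> t \<odot> (u \<oplus> u')"
    using u xc by (simp add: dom.smult_add_right dom.ag.a_assoc)
   have c: "?D (x \<oplus> t \<odot> u) \<in> carrier F" "?D x \<in> carrier F"
    "?D (x \<oplus> t \<odot> (u \<oplus> u')) \<in> carrier F" using elim x v by (auto intro!: smooth_on_deriv_closed[OF f])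
   show ?case unfolding e using c by (subst cod.smult_add_right[symmetric])
      (simp_all add: cod.ag.a_comm[of "_ \<ominus>\<^bsub>F\<^esub> ?D x"] cod.diff_telescope)
  qed
 qed
 show ?thesis using cod.lim_unique[OF A C] u by simp
qed

text \<open>Substitute \<open>t * c\<close> for \<open>t\<close> in the difference quotient. For
  \<open>c = 0\<close> this degenerates; there additivity shows that the derivative in direction
  zero vanishes.\<close>

lemma deriv_smult_last:
 assumes f: "smooth_on E F U f" and x: "x \<in> U" and v: "!!i. i < k ==> v i \<in> carrier E"
  and u: "u \<in> carrier E"
 shows "dir_deriv E F f (Suc k) x (v(k := c \<odot> u)) = c \<odot>\<^bsub>F\<^esub> dir_deriv E F f (Suc k) x (v(k := u))"
proof (cases "c = 0")
 case True
 have c0: "dir_deriv E F f (Suc k) x (v(k := w)) \<in> carrier F" if "w \<in> carrier E" for w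
  by (rule smooth_on_deriv_closed[OF f x]) (use v that in auto)
 have "dir_deriv E F f (Suc k) x (v(k := \<zero>)) = \<zero>\<^bsub>F\<^esub>"
  using deriv_add_last[where k = k and v = v, OF f x v dom.ag.zero_closed dom.ag.zero_closed] c0[of "\<zero>"]
  by (simp del: dir_deriv.simps)
 then show ?thesis using True u c0 by (simp del: dir_deriv.simps)
next
 case False
 have xc: "x \<in> carrier E" using x smooth_on_subset[OF f] by auto
 let ?D = "%y. dir_deriv E F f k y v"
 have A: "limitin (vtop F) (%t. inverse t \<odot>\<^bsub>F\<^esub> (?D (x \<oplus> t \<odot> w) \<ominus>\<^bsub>F\<^esub> ?D x))
   (dir_deriv E F f (Suc k) x (v(k := w))) (at 0)" if "w \<in> carrier E" for w
  by (rule smooth_on_increment[OF f _ x]) (use v xc that in auto)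
 have flt: "filterlim (%t. t * c) (at 0) (at (0::real))" unfolding filterlim_at using False
  by (auto intro!: tendsto_eq_intros simp: eventually_at intro: exI[of _ 1])
 have comp: "limitin (vtop F) (%t. inverse (t * c) \<odot>\<^bsub>F\<^esub> (?D (x \<oplus> (t * c) \<odot> u) \<ominus>\<^bsub>F\<^esub> ?D x))
   (dir_deriv E F f (Suc k) x (v(k := u))) (at 0)" unfolding limitin_def
 proof (intro conjI allI impI)
  show "dir_deriv E F f (Suc k) x (v(k := u)) \<in> topspace (vtop F)" using limitin_topspace[OF A[OF u]] .
  fix W assume "openin (vtop F) W \<and> dir_deriv E F f (Suc k) x (v(k := u)) \<in> W"
  then have "eventually (%t. inverse t \<odot>\<^bsub>F\<^esub> (?D (x \<oplus> t \<odot> u) \<ominus>\<^bsub>F\<^esub> ?D x) \<in> W) (at 0)"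
   using limitinD[OF A[OF u]] by blast
  from eventually_compose_filterlim[OF this flt]
  show "\<forall>\<^sub>F t in at 0. inverse (t * c) \<odot>\<^bsub>F\<^esub> (?D (x \<oplus> (t * c) \<odot> u) \<ominus>\<^bsub>F\<^esub> ?D x) \<in> W" .
 qed
 have "limitin (vtop F) (%t. inverse t \<odot>\<^bsub>F\<^esub> (?D (x \<oplus> t \<odot> (c \<odot> u)) \<ominus>\<^bsub>F\<^esub> ?D x))
   (c \<odot>\<^bsub>F\<^esub> dir_deriv E F f (Suc k) x (v(k := u))) (at 0)"
 proof (rule cod.lim_eq[OF cod.lim_smult[OF tendsto_const comp]])
  have "eventually (%t. x \<oplus> t \<odot> (c \<odot> u) \<in> U) (at 0)" using line_eventually[OF smooth_on_open[OF f] x] u by auto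
  then show "\<forall>\<^sub>F t in at 0. c \<odot>\<^bsub>F\<^esub> (inverse (t * c) \<odot>\<^bsub>F\<^esub> (?D (x \<oplus> (t * c) \<odot> u) \<ominus>\<^bsub>F\<^esub> ?D x)) =
   inverse t \<odot>\<^bsub>F\<^esub> (?D (x \<oplus> t \<odot> (c \<odot> u)) \<ominus>\<^bsub>F\<^esub> ?D x)"
  proof eventually_elim
   case (elim t)
   have "?D (x \<oplus> t \<odot> (c \<odot> u)) \<in> carrier F" "?D x \<in> carrier F"
    using elim x v by (auto intro!: smooth_on_deriv_closed[OF f])
   moreover have "c * inverse (t * c) = inverse t" using False by (cases "t = 0") (auto simp: field_simps)
   ultimately show ?case using u by (simp add: dom.smult_smult cod.smult_smult del: inverse_mult_distrib)
  qed
 qed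
 then show ?thesis using cod.lim_unique[OF A] u by simp
qed

text \<open>For the newest direction this is the content of the two preceding lemmas. For an older
  direction the difference quotients are linear by induction, and linearity survives the
  limit.\<close>

lemma deriv_multilinear:
 assumes f: "smooth_on E F U f" and "x \<in> U" and "!!i. i < k ==> v i \<in> carrier E"
  and "i < k" and u: "u \<in> carrier E" "u' \<in> carrier E"
 shows "dir_deriv E F f k x (v(i := u \<oplus> u')) =
   dir_deriv E F f k x (v(i := u)) \<oplus>\<^bsub>F\<^esub> dir_deriv E F f k x (v(i := u'))"
  and "dir_deriv E F f k x (v(i := c \<odot> u)) = c \<odot>\<^bsub>F\<^esub> dir_deriv E F f k x (v(i := u))"
proof -
 have "dir_deriv E F f k x (v(i := u \<oplus> u')) =
   dir_deriv E F f k x (v(i := u)) \<oplus>\<^bsub>F\<^esub> dir_deriv E F f k x (v(i := u')) \<and>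
  dir_deriv E F f k x (v(i := c \<odot> u)) = c \<odot>\<^bsub>F\<^esub> dir_deriv E F f k x (v(i := u))" using assms(2-4)
 proof (induction k arbitrary: x)
  case (Suc k)
  show ?case
  proof (cases "i = k")
   case True
   show ?thesis unfolding True
    using deriv_add_last[OF f Suc.prems(1) _ u, of k v] deriv_smult_last[OF f Suc.prems(1) _ u(1), of k v c] Suc.prems(2)
    by (simp del: dir_deriv.simps fun_upd_apply)
  next
   case False
   then have i: "i < k" using Suc.prems by simp
   let ?q = "%w t. inverse t \<odot>\<^bsub>F\<^esub> (dir_deriv E F f k (x \<oplus> t \<odot> v k) (v(i := w))
     \<ominus>\<^bsub>F\<^esub> dir_deriv E F f k x (v(i := w)))"
   have lim: "limitin (vtop F) (?q w) (dir_deriv E F f (Suc k) x (v(i := w))) (at 0)"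
    if "w \<in> carrier E" for w
    using smooth_on_deriv_limit[OF f Suc.prems(1), of k "v(i := w)"] Suc.prems(2) that False by simp
   have cl: "dir_deriv E F f k y (v(i := w)) \<in> carrier F" if "y \<in> U" "w \<in> carrier E" for y w
    by (rule smooth_on_deriv_closed[OF f that(1)]) (use Suc.prems that in auto)
   have ev: "eventually (%t. x \<oplus> t \<odot> v k \<in> U) (at 0)"
    using line_eventually[OF smooth_on_open[OF f] Suc.prems(1)] Suc.prems by auto
   have vk: "!!j. j < k ==> v j \<in> carrier E" using Suc.prems by auto
   have l1: "limitin (vtop F) (?q (u \<oplus> u')) (dir_deriv E F f (Suc k) x (v(i := u)) \<oplus>\<^bsub>F\<^esub>
     dir_deriv E F f (Suc k) x (v(i := u'))) (at 0)"
   proof (rule cod.lim_eq[OF cod.lim_add[OF lim[OF u(1)] lim[OF u(2)]]])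
    show "\<forall>\<^sub>F t in at 0. ?q u t \<oplus>\<^bsub>F\<^esub> ?q u' t = ?q (u \<oplus> u') t" using ev
    proof eventually_elim
     case (elim t)
     show ?case using Suc.IH[OF elim vk i] Suc.IH[OF Suc.prems(1) vk i] cl u elim Suc.prems(1)
      by (simp add: cod.diff_add_add cod.smult_add_right del: fun_upd_apply)
    qed
   qed
   have l2: "limitin (vtop F) (?q (c \<odot> u)) (c \<odot>\<^bsub>F\<^esub> dir_deriv E F f (Suc k) x (v(i := u))) (at 0)"
   proof (rule cod.lim_eq[OF cod.lim_smult[OF tendsto_const lim[OF u(1)]]])
    show "\<forall>\<^sub>F t in at 0. c \<odot>\<^bsub>F\<^esub> ?q u t = ?q (c \<odot> u) t" using ev
    proof eventually_elim
     case (elim t)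
     show ?case using Suc.IH[OF elim vk i] Suc.IH[OF Suc.prems(1) vk i] cl u elim Suc.prems(1)
      by (simp add: cod.smult_diff_right[symmetric] cod.smult_smult mult.commute del: fun_upd_apply)
    qed
   qed
   show ?thesis
    by (rule conjI; rule cod.lim_unique[OF lim]) (use u l1 l2 in \<open>simp_all del: dir_deriv.simps fun_upd_apply\<close>)
  qed
 qed simp
 then show "dir_deriv E F f k x (v(i := u \<oplus> u')) =
   dir_deriv E F f k x (v(i := u)) \<oplus>\<^bsub>F\<^esub> dir_deriv E F f k x (v(i := u'))"
  and "dir_deriv E F f k x (v(i := c \<odot> u)) = c \<odot>\<^bsub>F\<^esub> dir_deriv E F f k x (v(i := u))" by auto
qed

lemma deriv_diff_slot:
 assumes f: "smooth_on E F U f" and x: "x \<in> U" and v: "!!i. i < k ==> v i \<in> carrier E"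
  and i: "i < k" and u: "u \<in> carrier E" "u' \<in> carrier E"
 shows "dir_deriv E F f k x (v(i := u)) \<ominus>\<^bsub>F\<^esub> dir_deriv E F f k x (v(i := u')) =
  dir_deriv E F f k x (v(i := u \<ominus> u'))"
proof -
 have cl: "dir_deriv E F f k x (v(i := w)) \<in> carrier F" if "w \<in> carrier E" for w
  by (rule smooth_on_deriv_closed[OF f x]) (use v that in auto)
 show ?thesis
  using deriv_multilinear(1)[where v = v and k = k and i = i and u = "u \<ominus> u'" and u' = u', OF f x v i] u cl
  by (intro cod.diff_eqI) auto
qed

end

section \<open>The chain rule\<close>

text \<open>Sums over lists, because the chain rule produces its summands as nested lists;
  flattening and repeated entries then cause no trouble with index sets.\<close>

definition lsum :: "('k, 'f, 'r) module_scheme => 'f list => 'f"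
 where "lsum F xs = foldr (%a b. a \<oplus>\<^bsub>F\<^esub> b) xs \<zero>\<^bsub>F\<^esub>"

lemma lsum_simps [simp]:
 "lsum F [] = \<zero>\<^bsub>F\<^esub>" "lsum F (x # xs) = x \<oplus>\<^bsub>F\<^esub> lsum F xs" by (simp_all add: lsum_def)

context vec
begin

lemma lsum_closed [simp]: "set xs \<subseteq> carrier E ==> lsum E xs \<in> carrier E" by (induction xs) auto

lemma lsum_append:
 "set xs \<subseteq> carrier E ==> set ys \<subseteq> carrier E ==> lsum E (xs @ ys) = lsum E xs \<oplus> lsum E ys"
 by (induction xs) (auto simp: ag.a_assoc)

lemma lsum_concat:
 "(!!xs. xs \<in> set xss ==> set xs \<subseteq> carrier E) ==> lsum E (concat xss) = lsum E (map (lsum E) xss)"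
 by (induction xss) (auto simp: lsum_append UN_subset_iff)

lemma lsum_diff_quotient:
 "(!!x. x \<in> set xs ==> a x \<in> carrier E \<and> b x \<in> carrier E) ==>
  c \<odot> (lsum E (map a xs) \<ominus> lsum E (map b xs)) = lsum E (map (%x. c \<odot> (a x \<ominus> b x)) xs)"
proof (induction xs)
 case (Cons x xs)
 have "set (map a xs) \<subseteq> carrier E" "set (map b xs) \<subseteq> carrier E" using Cons.prems by auto
 then show ?case using Cons by (simp add: diff_add_add smult_add_right)
qed simp

end

context lcs
begin

lemma lim_lsum:
 "(!!x. x \<in> set xs ==> limitin (vtop E) (q x) (l x) G) ==>
  limitin (vtop E) (%t. lsum E (map (%x. q x t) xs)) (lsum E (map l xs)) G"
 by (induction xs) (auto intro!: lim_add)

lemma continuous_map_lsum: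
 "(!!x. x \<in> set xs ==> continuous_map Z (vtop E) (q x)) ==>
  continuous_map Z (vtop E) (%z. lsum E (map (%x. q x z) xs))"
 by (induction xs) (auto intro!: continuous_map_vadd)

end

context lcs2
begin

text \<open>The chain and product rule for a jet whose point and directions run along curves. Moving
  the point contributes one derivative more, in the direction of its velocity. The directions are
  then exchanged one at a time, and each exchange is an exact difference by multilinearity.\<close>

lemma deriv_along_curves:
 assumes f: "smooth_on E F U f" and y0: "y0 \<in> U"
  and yc: "eventually (%t. y t \<in> carrier E) (at 0)"
  and y: "limitin (vtop E) (%t. inverse t \<odot> (y t \<ominus> y0)) y' (at (0::real))"
  and wc: "!!i. i < k ==> eventually (%t. w t i \<in> carrier E) (at 0)"
  and w0: "!!i. i < k ==> w0 i \<in> carrier E"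
  and w: "!!i. i < k ==> limitin (vtop E) (%t. inverse t \<odot> (w t i \<ominus> w0 i)) (w' i) (at 0)"
 shows "limitin (vtop F) (%t. inverse t \<odot>\<^bsub>F\<^esub> (dir_deriv E F f k (y t) (w t) \<ominus>\<^bsub>F\<^esub> dir_deriv E F f k y0 w0))
  (dir_deriv E F f (Suc k) y0 (w0(k := y')) \<oplus>\<^bsub>F\<^esub>
   lsum F (map (%i. dir_deriv E F f k y0 (w0(i := w' i))) [0..<k])) (at 0)"
proof -
 let ?D = "dir_deriv E F f k"
 note U = smooth_on_open[OF f]
 have y0c: "y0 \<in> carrier E" using y0 smooth_on_subset[OF f] by auto
 have w'c: "w' i \<in> carrier E" if "i < k" for i using w[OF that] dom.lim_closed by blast
 have id: "((%t. t) \<longlongrightarrow> (0::real)) (at 0)" by (rule tendsto_ident_at)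
 have ne: "eventually (%t. t \<noteq> (0::real)) (at 0)" by (simp add: eventually_at_filter)
 have recover: "z0 \<oplus> t \<odot> (inverse t \<odot> (z \<ominus> z0)) = z"
  if "t \<noteq> 0" "z \<in> carrier E" "z0 \<in> carrier E" for z z0 and t :: real
  using that by (simp add: dom.smult_smult dom.ag.a_comm[of z0])
 \<comment> \<open>A curve with convergent difference quotient tends to its starting value, as it is
   that value plus \<open>t\<close> times the quotient.\<close>
 have base: "limitin (vtop E) z z0 (at 0)"
  if "eventually (%t. z t \<in> carrier E) (at 0)" "z0 \<in> carrier E"
   "limitin (vtop E) (%t. inverse t \<odot> (z t \<ominus> z0)) z' (at (0::real))" for z z0 z'
 proof -
  have "limitin (vtop E) (%t. z0 \<oplus> t \<odot> (inverse t \<odot> (z t \<ominus> z0))) (z0 \<oplus> 0 \<odot> z') (at 0)"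
   by (intro dom.lim_add dom.lim_smult id that dom.lim_const)
  moreover have "z0 \<oplus> 0 \<odot> z' = z0" using that dom.lim_closed[OF that(3)] by simp
  ultimately have l: "limitin (vtop E) (%t. z0 \<oplus> t \<odot> (inverse t \<odot> (z t \<ominus> z0))) z0 (at 0)" by simp
  have "\<forall>\<^sub>F t in at 0. z0 \<oplus> t \<odot> (inverse t \<odot> (z t \<ominus> z0)) = z t"
   using that(1) ne by eventually_elim (use recover that(2) in blast)
  with l show ?thesis by (rule dom.lim_eq)
 qed
 have wl: "limitin (vtop E) (%t. w t i) (w0 i) (at 0)" if "i < k" for i
  using base[OF wc[OF that] w0[OF that] w[OF that]] .
 have yl: "limitin (vtop E) y y0 (at 0)" using base[OF yc y0c y] .
 have wall: "eventually (%t. \<forall>i\<in>{..<k}. w t i \<in> carrier E) (at 0)"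
  by (intro eventually_ball_finite ballI) (auto intro: wc)
 have yU: "eventually (%t. y t \<in> U) (at 0)" using limitinD[OF yl U y0] .
 have first: "limitin (vtop F) (%t. inverse t \<odot>\<^bsub>F\<^esub> (?D (y t) (w t) \<ominus>\<^bsub>F\<^esub> ?D y0 (w t)))
   (dir_deriv E F f (Suc k) y0 (w0(k := y'))) (at 0)"
 proof (rule cod.lim_eq[OF smooth_on_increment[OF f dom.lim_const[OF y0c] y0 wl y]])
  show "\<forall>\<^sub>F t in at 0. inverse t \<odot>\<^bsub>F\<^esub> (?D (y0 \<oplus> t \<odot> (inverse t \<odot> (y t \<ominus> y0))) (w t) \<ominus>\<^bsub>F\<^esub> ?D y0 (w t)) =
     inverse t \<odot>\<^bsub>F\<^esub> (?D (y t) (w t) \<ominus>\<^bsub>F\<^esub> ?D y0 (w t))" using yc ne by eventually_elim (simp add: recover y0c)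
 qed
 \<comment> \<open>Hybrid directions: the first \<open>j\<close> already move, the others are still
   at their starting values.\<close>
 define W where "W j t = (%i. if i < j then w t i else w0 i)" for j t
 have second: "limitin (vtop F) (%t. inverse t \<odot>\<^bsub>F\<^esub> (?D y0 (W j t) \<ominus>\<^bsub>F\<^esub> ?D y0 w0))
   (lsum F (map (%i. ?D y0 (w0(i := w' i))) [0..<j])) (at 0)" if "j \<le> k" for j using that
 proof (induction j)
  case 0
  have "W 0 t = w0" for t by (simp add: W_def)
  then show ?case using smooth_on_deriv_closed[OF f y0 w0] by simp
 next
  case (Suc j)
  then have j: "j < k" by simp
  have cl: "?D y0 (w0(i := w' i)) \<in> carrier F" if "i < k" for i
   by (rule smooth_on_deriv_closed[OF f y0]) (use w0 w'c that in auto)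
  have l: "limitin (vtop F) (%t. ?D y0 ((W j t)(j := inverse t \<odot> (w t j \<ominus> w0 j)))) (?D y0 (w0(j := w' j))) (at 0)"
   apply (rule smooth_on_jet_limit[OF f dom.lim_const[OF y0c] y0])
   subgoal for i by (cases "i = j"; cases "i < j") (use w wl w0 in \<open>auto simp: W_def\<close>)
   done
  have "limitin (vtop F) (%t. inverse t \<odot>\<^bsub>F\<^esub> (?D y0 (W (Suc j) t) \<ominus>\<^bsub>F\<^esub> ?D y0 w0))
   (lsum F (map (%i. ?D y0 (w0(i := w' i))) [0..<j]) \<oplus>\<^bsub>F\<^esub> ?D y0 (w0(j := w' j))) (at 0)"
  proof (rule cod.lim_eq[OF cod.lim_add[OF Suc.IH l]])
   show "\<forall>\<^sub>F t in at 0. inverse t \<odot>\<^bsub>F\<^esub> (?D y0 (W j t) \<ominus>\<^bsub>F\<^esub> ?D y0 w0) \<oplus>\<^bsub>F\<^esub>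
     ?D y0 ((W j t)(j := inverse t \<odot> (w t j \<ominus> w0 j))) =
     inverse t \<odot>\<^bsub>F\<^esub> (?D y0 (W (Suc j) t) \<ominus>\<^bsub>F\<^esub> ?D y0 w0)" using wall
   proof eventually_elim
    case (elim t)
    have e1: "W (Suc j) t = (W j t)(j := w t j)" and e2: "W j t = (W j t)(j := w0 j)"
     by (auto simp: W_def fun_eq_iff less_Suc_eq)
    have Wc: "!!j i. i < k ==> W j t i \<in> carrier E" using elim w0 by (auto simp: W_def)
    have Dc: "!!j. ?D y0 (W j t) \<in> carrier F" "?D y0 w0 \<in> carrier F"
     by (rule smooth_on_deriv_closed[OF f y0]; use Wc w0 in auto)+
    have "?D y0 ((W j t)(j := inverse t \<odot> (w t j \<ominus> w0 j))) =
      inverse t \<odot>\<^bsub>F\<^esub> ?D y0 ((W j t)(j := w t j \<ominus> w0 j))"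
     by (rule deriv_multilinear(2)[OF f y0 Wc j]) (use elim w0 j in auto)
    also have "\<dots> = inverse t \<odot>\<^bsub>F\<^esub> (?D y0 ((W j t)(j := w t j)) \<ominus>\<^bsub>F\<^esub> ?D y0 ((W j t)(j := w0 j)))"
     by (subst deriv_diff_slot[OF f y0 Wc j]) (use elim w0 j in auto)
    also have "\<dots> = inverse t \<odot>\<^bsub>F\<^esub> (?D y0 (W (Suc j) t) \<ominus>\<^bsub>F\<^esub> ?D y0 (W j t))" using e1 e2 by simp
    finally show ?case using Dc by (subst cod.ag.a_comm)
       (simp_all add: cod.smult_add_right[symmetric] cod.diff_telescope)
   qed
  qed (use j in simp)
  moreover have "lsum F (map (%i. ?D y0 (w0(i := w' i))) [0..<Suc j]) =
    lsum F (map (%i. ?D y0 (w0(i := w' i))) [0..<j]) \<oplus>\<^bsub>F\<^esub> ?D y0 (w0(j := w' j))"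
   using cl j by (simp, subst cod.lsum_append) auto
  ultimately show ?case by (simp only:)
 qed
 have "limitin (vtop F) (%t. inverse t \<odot>\<^bsub>F\<^esub> (?D y0 (w t) \<ominus>\<^bsub>F\<^esub> ?D y0 w0))
   (lsum F (map (%i. ?D y0 (w0(i := w' i))) [0..<k])) (at 0)"
 proof -
  have "?D y0 (W k t) = ?D y0 (w t)" for t by (rule dir_deriv_cong_dirs) (simp add: W_def)
  then show ?thesis using second[of k] by simp
 qed
 from cod.lim_add[OF first this] show ?thesis
 proof (rule cod.lim_eq)
  show "\<forall>\<^sub>F t in at 0. inverse t \<odot>\<^bsub>F\<^esub> (?D (y t) (w t) \<ominus>\<^bsub>F\<^esub> ?D y0 (w t)) \<oplus>\<^bsub>F\<^esub>
    inverse t \<odot>\<^bsub>F\<^esub> (?D y0 (w t) \<ominus>\<^bsub>F\<^esub> ?D y0 w0) =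
    inverse t \<odot>\<^bsub>F\<^esub> (?D (y t) (w t) \<ominus>\<^bsub>F\<^esub> ?D y0 w0)" using wall yU
  proof eventually_elim
   case (elim t)
   then have "?D (y t) (w t) \<in> carrier F" "?D y0 (w t) \<in> carrier F" "?D y0 w0 \<in> carrier F"
    using y0 w0 by (auto intro!: smooth_on_deriv_closed[OF f])
   then show ?case by (simp add: cod.smult_add_right[symmetric] cod.diff_telescope)
  qed
 qed
qed

end

text \<open>Differentiating a summand in a further direction \<open>k\<close> either differentiates
  the outer map once more, which opens the block \<open>[k]\<close>, or differentiates one inner
  factor again, which appends \<open>k\<close> to its block.\<close>

primrec chain_terms :: "nat => nat list list list" where
 "chain_terms 0 = [[]]"
| "chain_terms (Suc k) = concat (map (%ls. (ls @ [[k]]) # map (%i. ls[i := ls ! i @ [k]]) [0..<length ls])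
  (chain_terms k))"

lemma chain_terms_bound:
 "ls \<in> set (chain_terms k) ==> l \<in> set ls ==> j \<in> set l ==> j < k"
proof (induction k arbitrary: ls l)
 case (Suc k)
 obtain ms where ms: "ms \<in> set (chain_terms k)"
  "ls \<in> set ((ms @ [[k]]) # map (%i. ms[i := ms ! i @ [k]]) [0..<length ms])"
  using Suc.prems(1) unfolding chain_terms.simps set_concat set_map by blast
 then have ms2: "ls = ms @ [[k]] \<or> (\<exists>i<length ms. ls = ms[i := ms ! i @ [k]])" by auto
 have IH: "m \<in> set ms ==> j \<in> set m ==> j < k" for m using Suc.IH[OF ms(1)] by blast
 from ms2 show ?case
 proof
  assume "ls = ms @ [[k]]"
  then show ?thesis using Suc.prems IH by (auto intro: less_SucI)
 next
  assume "\<exists>i<length ms. ls = ms[i := ms ! i @ [k]]"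
  then obtain i where i: "i < length ms" "ls = ms[i := ms ! i @ [k]]" by blast
  then have "l = ms ! i @ [k] \<or> l \<in> set ms"
   using Suc.prems(2) set_update_subset_insert[of ms i "ms ! i @ [k]"] by auto
  then show ?thesis using Suc.prems(3) IH[of "ms ! i"] IH[of l] i(1) by (auto intro: less_SucI)
 qed
qed simp

text \<open>The summands of the Faa di Bruno formula: the \<open>k\<close>-th derivative of \<open>h \<circ> f\<close> is the sum, over the
 set partitions of \<open>{..<k}\<close> (listed as lists of blocks by \<open>chain_terms k\<close>), of the derivative of
 \<open>h\<close> in the directions given by the derivatives of \<open>f\<close> along the blocks.\<close>

definition chain_term ::
  "(real, 'e) tvs => (real, 'f) tvs => (real, 'g) tvs => ('e => 'f) => ('f => 'g) =>
   'e => (nat => 'e) => nat list list => 'g"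
 where "chain_term E F G f h x v ls = dir_deriv F G h (length ls) (f x)
  (%i. dir_deriv E F f (length (ls ! i)) x (%j. v (ls ! i ! j)))"

definition chain_deriv ::
  "(real, 'e) tvs => (real, 'f) tvs => (real, 'g) tvs => ('e => 'f) => ('f => 'g) =>
   nat => 'e => (nat => 'e) => 'g"
 where "chain_deriv E F G f h k x v = lsum G (map (chain_term E F G f h x v) (chain_terms k))"

text \<open>The parameter space carries only a topology. Joint continuity of all derivatives is what
  continuity of the map from parameters to functions amounts to for the smooth compact-open topology
  on locally compact domains.\<close>

definition smooth_family ::
  "'z topology => (real, 'e) tvs => (real, 'f) tvs => 'e set => ('z => 'e => 'f) => bool"
 where "smooth_family Z E F U f \<longleftrightarrow>
  openin (vtop E) U \<and> (\<forall>z\<in>topspace Z. smooth_on E F U (f z)) \<and>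
  (\<forall>k. continuous_map (prod_topology Z (jet_domain E U k)) (vtop F) (%(z, x, v). dir_deriv E F (f z) k x v))"

context lcs2
begin

lemma smooth_familyD: "smooth_family Z E F U f ==> z \<in> topspace Z ==> smooth_on E F U (f z)"
 by (simp add: smooth_family_def)

lemma continuous_map_family_deriv:
 assumes f: "smooth_family Z E F U f"
  and a: "continuous_map Y Z a" and b: "continuous_map Y (vtop E) b"
  and bU: "!!y. y \<in> topspace Y ==> b y \<in> U"
  and c: "!!i. i < k ==> continuous_map Y (vtop E) (%y. c y i)"
 shows "continuous_map Y (vtop F) (%y. dir_deriv E F (f (a y)) k (b y) (c y))"
proof -
 have "continuous_map Y (product_topology (%_. vtop E) {..<k}) (%y. restrict (c y) {..<k})"
  using c by (auto simp: continuous_map_componentwise)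
 then have "continuous_map Y (prod_topology Z (jet_domain E U k)) (%y. (a y, b y, restrict (c y) {..<k}))"
  using a b bU unfolding jet_domain_def
  by (intro continuous_map_pairedI) (auto simp: continuous_map_in_subtopology)
 moreover have "continuous_map (prod_topology Z (jet_domain E U k)) (vtop F)
   (%(z, x, v). dir_deriv E F (f z) k x v)" using f by (simp add: smooth_family_def)
 ultimately have "continuous_map Y (vtop F)
   ((%(z, x, v). dir_deriv E F (f z) k x v) \<circ> (%y. (a y, b y, restrict (c y) {..<k})))"
  by (rule continuous_map_compose)
 then show ?thesis by (simp add: o_def dir_deriv_restrict)
qed

lemma continuous_map_jet_point: "continuous_map (jet_domain E U k) (vtop E) fst"
 unfolding jet_domain_def by (rule continuous_map_into_fulltopology[OF continuous_map_fst])

lemma continuous_map_jet_dir: "i < k ==> continuous_map (jet_domain E U k) (vtop E) (%p. snd p i)"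
 unfolding jet_domain_def
 using continuous_map_compose[OF continuous_map_snd continuous_map_product_projection[of i "{..<k}" "%_. vtop E"]]
 by (simp add: o_def)

lemma smooth_family_const_param:
 assumes "smooth_on E F U f"
 shows "smooth_family Z E F U (%_. f)"
proof -
 have "continuous_map (prod_topology Z (jet_domain E U k)) (vtop F)
   ((%(x, v). dir_deriv E F f k x v) \<circ> snd)" for k
  using assms by (intro continuous_map_compose[OF continuous_map_snd]) (simp add: smooth_on_def)
 then show ?thesis using assms by (simp add: smooth_family_def smooth_on_def o_def case_prod_unfold)
qed

end

locale lcs3 = EF: lcs2 E F + FG: lcs2 F G
 for E :: "(real, 'e) tvs" (structure) and F :: "(real, 'f) tvs" and G :: "(real, 'g) tvs"
begin

sublocale EG: lcs2 E G by (intro lcs2.intro EF.dom.lcs_axioms FG.cod.lcs_axioms)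

lemma chain_term_inner_closed:
 assumes "smooth_on E F U f" "x \<in> U" "!!i. i < k ==> v i \<in> carrier E"
  and "ls \<in> set (chain_terms k)" "i < length ls"
 shows "dir_deriv E F f (length (ls ! i)) x (%j. v (ls ! i ! j)) \<in> carrier F"
 using assms chain_terms_bound[OF assms(4), of "ls ! i"] by (intro EF.smooth_on_deriv_closed[of U]) auto

lemma chain_term_closed:
 assumes "smooth_on E F U f" "smooth_on F G V h" "!!x. x \<in> U ==> f x \<in> V"
  and "x \<in> U" "!!i. i < k ==> v i \<in> carrier E" "ls \<in> set (chain_terms k)"
 shows "chain_term E F G f h x v ls \<in> carrier G" unfolding chain_term_def
 by (rule FG.smooth_on_deriv_closed[OF assms(2) assms(3)[OF assms(4)]])
   (rule chain_term_inner_closed[OF assms(1,4,5,6)])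

text \<open>The Faa di Bruno sum arises from the derivatives of \<open>f z\<close> and
  \<open>h z\<close> by substitution and addition, so joint continuity is inherited. This is what
  the explicit formula is for.\<close>

lemma continuous_map_chain_deriv:
 assumes f: "smooth_family Z E F U f" and h: "smooth_family Z F G V h"
  and fV: "!!z x. z \<in> topspace Z ==> x \<in> U ==> f z x \<in> V"
 shows "continuous_map (prod_topology Z (jet_domain E U k)) (vtop G)
  (%(z, x, v). chain_deriv E F G (f z) (h z) k x v)"
proof -
 let ?Y = "prod_topology Z (jet_domain E U k)"
 have a: "continuous_map ?Y Z fst" by (rule continuous_map_fst)
 have b: "continuous_map ?Y (vtop E) (%y. fst (snd y))"
  using continuous_map_compose[OF continuous_map_snd EF.continuous_map_jet_point] by (simp add: o_def)
 have c: "continuous_map ?Y (vtop E) (%y. snd (snd y) i)" if "i < k" for i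
  using continuous_map_compose[OF continuous_map_snd EF.continuous_map_jet_dir[OF that]] by (simp add: o_def)
 have bU: "fst (snd y) \<in> U" if "y \<in> topspace ?Y" for y
  using that by (cases y) (auto simp: EF.in_topspace_jet_domain)
 have inner: "continuous_map ?Y (vtop F)
   (%y. dir_deriv E F (f (fst y)) (length (ls ! i)) (fst (snd y)) (%j. snd (snd y) (ls ! i ! j)))"
  if "ls \<in> set (chain_terms k)" "i < length ls" for ls i
  using chain_terms_bound[OF that(1), of "ls ! i"] that(2)
  by (intro EF.continuous_map_family_deriv[OF f a b bU] c) auto
 have zero: "continuous_map ?Y (vtop F) (%y. f (fst y) (fst (snd y)))"
  using EF.continuous_map_family_deriv[OF f a b bU, of 0] by simp
 have "continuous_map ?Y (vtop G)
   (%y. lsum G (map (%ls. chain_term E F G (f (fst y)) (h (fst y)) (fst (snd y)) (snd (snd y)) ls) (chain_terms k)))"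
  unfolding chain_term_def
  by (intro FG.cod.continuous_map_lsum FG.continuous_map_family_deriv[OF h a zero] inner fV bU)
    auto
 then show ?thesis by (simp add: chain_deriv_def case_prod_unfold)
qed

text \<open>\<open>chain_deriv\<close> is the candidate in \<open>smooth_onI_jet\<close>.
  Differentiating one summand by \<open>deriv_along_curves\<close> gives exactly the summands that
  the step from \<open>chain_terms k\<close> to \<open>chain_terms (Suc k)\<close> makes out of
  it.\<close>

lemma smooth_on_compose:
 assumes f: "smooth_on E F U f" and h: "smooth_on F G V h" and fV: "!!x. x \<in> U ==> f x \<in> V"
 shows "smooth_on E G U (%x. h (f x))"
  and "!!k x v. x \<in> U ==> (!!i. i < k ==> v i \<in> carrier E) ==>
   dir_deriv E G (%x. h (f x)) k x v = chain_deriv E F G f h k x v"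
proof -
 note U = EF.smooth_on_open[OF f]
 have lim: "limitin (vtop G) (%t. inverse t \<odot>\<^bsub>G\<^esub> (chain_deriv E F G f h k (x \<oplus> (t \<odot> v k)) v \<ominus>\<^bsub>G\<^esub>
    chain_deriv E F G f h k x v)) (chain_deriv E F G f h (Suc k) x v) (at 0)"
  if x: "x \<in> U" and v: "!!i. i < Suc k ==> v i \<in> carrier E" for k x v
 proof -
  let ?T = "chain_term E F G f h"
  let ?next = "%ls. (ls @ [[k]]) # map (%i. ls[i := ls ! i @ [k]]) [0..<length ls]"
  have ev: "eventually (%t. x \<oplus> t \<odot> v k \<in> U) (at 0)" using EF.line_eventually[OF U x] v by auto
  have v': "!!i. i < k ==> v i \<in> carrier E" using v by simp
  have term_lim: "limitin (vtop G) (%t. inverse t \<odot>\<^bsub>G\<^esub> (?T (x \<oplus> (t \<odot> v k)) v ls \<ominus>\<^bsub>G\<^esub> ?T x v ls))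
    (lsum G (map (?T x v) (?next ls))) (at 0)" if ls: "ls \<in> set (chain_terms k)" for ls
  proof -
   let ?m = "length ls"
   let ?w0 = "%i. dir_deriv E F f (length (ls ! i)) x (%j. v (ls ! i ! j))"
   let ?y' = "dir_deriv E F f 1 x (%_. v k)"
   let ?w' = "%i. dir_deriv E F f (length (ls ! i @ [k])) x (%j. v ((ls ! i @ [k]) ! j))"
   have "limitin (vtop G) (%t. inverse t \<odot>\<^bsub>G\<^esub> (?T (x \<oplus> (t \<odot> v k)) v ls \<ominus>\<^bsub>G\<^esub> ?T x v ls))
    (dir_deriv F G h (Suc ?m) (f x) (?w0(?m := ?y')) \<oplus>\<^bsub>G\<^esub>
     lsum G (map (%i. dir_deriv F G h ?m (f x) (?w0(i := ?w' i))) [0..<?m])) (at 0)" unfolding chain_term_def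
   proof (rule FG.deriv_along_curves[OF h fV[OF x]])
    show "\<forall>\<^sub>F t in at 0. f (x \<oplus> t \<odot> v k) \<in> carrier F"
     using ev by eventually_elim (rule EF.smooth_on_closed[OF f])
    show "limitin (vtop F) (%t. inverse t \<odot>\<^bsub>F\<^esub> (f (x \<oplus> t \<odot> v k) \<ominus>\<^bsub>F\<^esub> f x)) ?y' (at 0)"
     using EF.smooth_on_deriv_limit[OF f x, of 0 "%_. v k"] v by (simp del: dir_deriv.simps(2))
   next
    fix i assume i: "i < ?m"
    have bound: "j < length (ls ! i) ==> ls ! i ! j < k" for j
     using chain_terms_bound[OF ls, of "ls ! i" "ls ! i ! j"] i by simp
    show "\<forall>\<^sub>F t in at 0. dir_deriv E F f (length (ls ! i)) (x \<oplus> t \<odot> v k) (%j. v (ls ! i ! j)) \<in> carrier F"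
     using ev by eventually_elim (rule chain_term_inner_closed[OF f _ v' ls i])
    show "?w0 i \<in> carrier F" by (rule chain_term_inner_closed[OF f x v' ls i])
    let ?v = "%j. v ((ls ! i @ [k]) ! j)"
    \<comment> \<open>Appending \<open>k\<close> to a block does not touch its earlier directions;
      \<open>v k\<close> becomes the last one, in which the new derivative is taken.\<close>
    have "dir_deriv E F f (length (ls ! i)) z ?v = dir_deriv E F f (length (ls ! i)) z (%j. v (ls ! i ! j))" for z
     by (rule dir_deriv_cong_dirs) (simp add: nth_append)
    note eq = this
    have "?v j \<in> carrier E" if "j < Suc (length (ls ! i))" for j
     using that bound v by (auto simp: nth_append less_Suc_eq)
    from EF.smooth_on_deriv_limit[where k = "length (ls ! i)" and v = ?v, OF f x this]
    show "limitin (vtop F) (%t. inverse t \<odot>\<^bsub>F\<^esub> (dir_deriv E F f (length (ls ! i)) (x \<oplus> t \<odot> v k) (%j. v (ls ! i ! j)) \<ominus>\<^bsub>F\<^esub> ?w0 i)) (?w' i) (at 0)"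
     by (simp only: eq nth_append_length length_append_singleton)
   qed
   moreover have "dir_deriv F G h (Suc ?m) (f x) (?w0(?m := ?y')) = ?T x v (ls @ [[k]])"
    unfolding chain_term_def length_append_singleton
   proof (rule dir_deriv_cong_dirs)
    fix i assume "i < Suc ?m"
    have "dir_deriv E F f 1 x (%_. v k) = dir_deriv E F f 1 x (%j. v ([k] ! j))"
     by (rule dir_deriv_cong_dirs) simp
    then show "(?w0(?m := ?y')) i = dir_deriv E F f (length ((ls @ [[k]]) ! i)) x (%j. v ((ls @ [[k]]) ! i ! j))"
     using \<open>i < Suc ?m\<close> by (simp add: nth_append del: dir_deriv.simps)
   qed
   moreover have "dir_deriv F G h ?m (f x) (?w0(i := ?w' i)) = ?T x v (ls[i := ls ! i @ [k]])" if "i < ?m" for i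
    unfolding chain_term_def length_list_update
    by (rule dir_deriv_cong_dirs) (use that in \<open>simp add: nth_list_update del: dir_deriv.simps\<close>)
   then have "map (%i. dir_deriv F G h ?m (f x) (?w0(i := ?w' i))) [0..<?m] = map (?T x v) (map (%i. ls[i := ls ! i @ [k]]) [0..<?m])"
    by (simp del: dir_deriv.simps fun_upd_apply)
   ultimately show ?thesis by (simp only: list.map lsum_simps)
  qed
  have "limitin (vtop G) (%t. lsum G (map (%ls. inverse t \<odot>\<^bsub>G\<^esub> (?T (x \<oplus> (t \<odot> v k)) v ls \<ominus>\<^bsub>G\<^esub> ?T x v ls)) (chain_terms k)))
    (lsum G (map (%ls. lsum G (map (?T x v) (?next ls))) (chain_terms k))) (at 0)"
   by (rule FG.cod.lim_lsum) (rule term_lim)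
  moreover have "lsum G (map (%ls. lsum G (map (?T x v) (?next ls))) (chain_terms k)) = chain_deriv E F G f h (Suc k) x v"
  proof -
   have sub: "set (map (?T x v) (?next ls)) \<subseteq> carrier G" if "ls \<in> set (chain_terms k)" for ls
   proof -
    have "?T x v l \<in> carrier G" if "l \<in> set (?next ls)" for l
    proof (rule chain_term_closed[OF f h fV x v])
     show "l \<in> set (chain_terms (Suc k))" using \<open>ls \<in> set (chain_terms k)\<close> that
      unfolding chain_terms.simps set_concat set_map by blast
    qed
    then show ?thesis unfolding set_map by blast
   qed
   have "lsum G (concat (map (%ls. map (?T x v) (?next ls)) (chain_terms k))) =
     lsum G (map (lsum G) (map (%ls. map (?T x v) (?next ls)) (chain_terms k)))"
   proof (rule FG.cod.lsum_concat)
    fix xs assume "xs \<in> set (map (%ls. map (?T x v) (?next ls)) (chain_terms k))"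
    then obtain ls where "ls \<in> set (chain_terms k)" "xs = map (?T x v) (?next ls)" unfolding set_map by blast
    then show "set xs \<subseteq> carrier G" using sub by (simp only:)
   qed
   then show ?thesis unfolding chain_deriv_def chain_terms.simps map_concat list.map_comp o_def by (simp only:)
  qed
  ultimately have "limitin (vtop G) (%t. lsum G (map (%ls. inverse t \<odot>\<^bsub>G\<^esub> (?T (x \<oplus> (t \<odot> v k)) v ls \<ominus>\<^bsub>G\<^esub> ?T x v ls)) (chain_terms k)))
    (chain_deriv E F G f h (Suc k) x v) (at 0)" by (simp only:)
  then show ?thesis
  proof (rule FG.cod.lim_eq)
   show "\<forall>\<^sub>F t in at 0. lsum G (map (%ls. inverse t \<odot>\<^bsub>G\<^esub> (?T (x \<oplus> (t \<odot> v k)) v ls \<ominus>\<^bsub>G\<^esub> ?T x v ls)) (chain_terms k)) =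
     inverse t \<odot>\<^bsub>G\<^esub> (chain_deriv E F G f h k (x \<oplus> (t \<odot> v k)) v \<ominus>\<^bsub>G\<^esub> chain_deriv E F G f h k x v)"
    using ev unfolding chain_deriv_def
   proof eventually_elim
    case (elim t)
    show ?case by (rule FG.cod.lsum_diff_quotient[symmetric])
       (intro conjI chain_term_closed[OF f h fV _ v'] elim x)
   qed
  qed
 qed
 have cont: "continuous_map (jet_domain E U k) (vtop G) (%(x, v). chain_deriv E F G f h k x v)" for k
 proof -
  \<comment> \<open>A one-point parameter space makes the statement without parameters an instance
    of the one with parameters.\<close>
  let ?Z = "discrete_topology {()}"
  have c1: "continuous_map (prod_topology ?Z (jet_domain E U k)) (vtop G)
    (%(z, x, v). chain_deriv E F G f h k x v)"
   by (rule continuous_map_chain_deriv[OF EF.smooth_family_const_param[OF f] FG.smooth_family_const_param[OF h]])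
     (use fV in auto)
  have c2: "continuous_map (jet_domain E U k) (prod_topology ?Z (jet_domain E U k)) (%p. ((), p))"
   by (intro continuous_map_pairedI) auto
  from continuous_map_compose[OF c2 c1] show ?thesis by (simp add: o_def)
 qed
 have zero: "chain_deriv E F G f h 0 x v = h (f x)" if "x \<in> U" for x v
  using FG.smooth_on_closed[OF h fV[OF that]] by (simp add: chain_deriv_def chain_term_def)
 show "smooth_on E G U (%x. h (f x))"
  by (rule EG.smooth_onI_jet(1)[where g = "chain_deriv E F G f h", OF U zero lim cont])
 show "!!k x v. x \<in> U ==> (!!i. i < k ==> v i \<in> carrier E) ==>
   dir_deriv E G (%x. h (f x)) k x v = chain_deriv E F G f h k x v"
  by (rule EG.smooth_onI_jet(2)[where g = "chain_deriv E F G f h", OF U zero lim cont])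
qed

text \<open>Both maps may vary with the parameter. Later one of them is always constant: the outer
  one for products and changes of fibre coordinates, the inner one for translations of the
  base.\<close>

lemma smooth_family_compose:
 assumes f: "smooth_family Z E F U f" and h: "smooth_family Z F G V h"
  and fV: "!!z x. z \<in> topspace Z ==> x \<in> U ==> f z x \<in> V"
 shows "smooth_family Z E G U (%z x. h z (f z x))" unfolding smooth_family_def
proof (intro conjI ballI allI)
 show "openin (vtop E) U" using f by (simp add: smooth_family_def)
 fix z assume z: "z \<in> topspace Z"
 show "smooth_on E G U (%x. h z (f z x))"
  by (rule smooth_on_compose(1)[OF EF.smooth_familyD[OF f z] FG.smooth_familyD[OF h z] fV[OF z]])
next
 fix k
 show "continuous_map (prod_topology Z (jet_domain E U k)) (vtop G)
   (%(z, x, v). dir_deriv E G (%x. h z (f z x)) k x v)"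
 proof (rule continuous_map_eq[OF continuous_map_chain_deriv[OF f h fV]])
  fix y assume "y \<in> topspace (prod_topology Z (jet_domain E U k))"
  then obtain z x v where y: "y = (z, x, v)" "z \<in> topspace Z" "x \<in> U" "v \<in> {..<k} \<rightarrow>\<^sub>E carrier E"
   by (cases y) (auto simp: EF.in_topspace_jet_domain)
  have "dir_deriv E G (%x. h z (f z x)) k x v = chain_deriv E F G (f z) (h z) k x v"
   by (rule smooth_on_compose(2)[OF EF.smooth_familyD[OF f y(2)] FG.smooth_familyD[OF h y(2)] fV[OF y(2)] y(3)])
     (use y in auto)
  then show "(%(z, x, v). chain_deriv E F G (f z) (h z) k x v) y =
    (%(z, x, v). dir_deriv E G (%x. h z (f z x)) k x v) y" using y by simp
 qed
qed

end

section \<open>Local character of smoothness, linear and bilinear maps\<close>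

lemma continuous_map_local:
 assumes "!!x. x \<in> topspace X ==> \<exists>N. openin X N \<and> x \<in> N \<and> continuous_map (subtopology X N) Y f"
 shows "continuous_map X Y f" unfolding continuous_map_def
proof (intro conjI allI impI)
 show "f \<in> topspace X \<rightarrow> topspace Y"
 proof
  fix x assume x: "x \<in> topspace X"
  then obtain N where "openin X N" "x \<in> N" "continuous_map (subtopology X N) Y f" using assms by blast
  then show "f x \<in> topspace Y" using x by (auto simp: continuous_map_def Pi_iff)
 qed
 fix W assume W: "openin Y W"
 show "openin X {x \<in> topspace X. f x \<in> W}"
 proof (subst openin_subopen, intro ballI)
  fix x assume x: "x \<in> {x \<in> topspace X. f x \<in> W}"
  then obtain N where N: "openin X N" "x \<in> N" "continuous_map (subtopology X N) Y f" using assms by blast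
  have "openin (subtopology X N) {y \<in> topspace (subtopology X N). f y \<in> W}"
   using openin_continuous_map_preimage[OF N(3) W] .
  then have "openin X {y \<in> topspace (subtopology X N). f y \<in> W}" using N(1) openin_trans_full by blast
  then show "\<exists>T. openin X T \<and> x \<in> T \<and> T \<subseteq> {x \<in> topspace X. f x \<in> W}"
   using x N(2) by (intro exI[of _ "{y \<in> topspace (subtopology X N). f y \<in> W}"]) auto
 qed
qed

lemma jet_domain_subset:
 assumes "V \<subseteq> U"
 shows "jet_domain E V k = subtopology (jet_domain E U k) (V \<times> UNIV)"
 using assms by (simp add: jet_domain_def subtopology_Times subtopology_subtopology Int_absorb1)

context lcs2
begin

lemma limitin_cong_at0:
 assumes "eventually (%t. f t = g t) (at 0)"
 shows "limitin (vtop F) f l (at (0::real)) \<longleftrightarrow> limitin (vtop F) g l (at 0)"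
 using cod.lim_eq[of f l "at 0" g] cod.lim_eq[of g l "at 0" f] assms by (auto simp: eq_commute)

text \<open>At a point of an open set the difference quotients see only nearby points. Local
  representatives contain \<open>inv_into\<close>, which takes arbitrary values off the chart, so
  derivatives must be known to depend on germs alone.\<close>

lemma dir_deriv_cong:
 assumes U: "openin (vtop E) U" and eq: "!!x. x \<in> U ==> f x = g x"
  and "x \<in> U" "!!i. i < k ==> v i \<in> carrier E"
 shows "dir_deriv E F f k x v = dir_deriv E F g k x v" using assms(3,4)
proof (induction k arbitrary: x)
 case (Suc k)
 have "eventually (%t. x \<oplus> t \<odot> v k \<in> U) (at 0)" using line_eventually[OF U] Suc.prems by simp
 then have "\<forall>\<^sub>F t in at 0. inverse t \<odot>\<^bsub>F\<^esub> (dir_deriv E F f k (x \<oplus> t \<odot> v k) v \<ominus>\<^bsub>F\<^esub> dir_deriv E F f k x v) =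
  inverse t \<odot>\<^bsub>F\<^esub> (dir_deriv E F g k (x \<oplus> t \<odot> v k) v \<ominus>\<^bsub>F\<^esub> dir_deriv E F g k x v)"
  by eventually_elim (use Suc in simp)
 then show ?case unfolding dir_deriv.simps by (subst limitin_cong_at0) auto
qed (simp add: eq)

lemma smooth_family_cong:
 assumes f: "smooth_family Z E F U f" and eq: "!!z x. z \<in> topspace Z ==> x \<in> U ==> f z x = g z x"
 shows "smooth_family Z E F U g"
proof -
 have U: "openin (vtop E) U" using f by (simp add: smooth_family_def)
 have D: "dir_deriv E F (f z) k x v = dir_deriv E F (g z) k x v"
  if "z \<in> topspace Z" "x \<in> U" "!!i. i < k ==> v i \<in> carrier E" for z k x v
  by (rule dir_deriv_cong[OF U eq[OF that(1)] that(2,3)])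
 show ?thesis unfolding smooth_family_def
 proof (intro conjI ballI allI U)
  fix z assume z: "z \<in> topspace Z"
  note fz = smooth_familyD[OF f z]
  have "continuous_map (jet_domain E U k) (vtop F) (%(x, v). dir_deriv E F (f z) k x v)" for k
   using fz by (simp add: smooth_on_def)
  then show "smooth_on E F U (g z)"
   by (intro smooth_onI_jet(1)[where g = "dir_deriv E F (f z)"] U smooth_on_deriv_limit[OF fz])
     (simp_all add: eq z)
 next
  fix k
  have "continuous_map (prod_topology Z (jet_domain E U k)) (vtop F) (%(z, x, v). dir_deriv E F (f z) k x v)"
   using f by (simp add: smooth_family_def)
  then show "continuous_map (prod_topology Z (jet_domain E U k)) (vtop F)
    (%(z, x, v). dir_deriv E F (g z) k x v)"
  proof (rule continuous_map_eq)
   fix y assume "y \<in> topspace (prod_topology Z (jet_domain E U k))"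
   then obtain z x v where y: "y = (z, x, v)" "z \<in> topspace Z" "x \<in> U" "v \<in> {..<k} \<rightarrow>\<^sub>E carrier E"
    by (cases y) (auto simp: in_topspace_jet_domain)
   then have "dir_deriv E F (f z) k x v = dir_deriv E F (g z) k x v" by (intro D) auto
   then show "(%(z, x, v). dir_deriv E F (f z) k x v) y = (%(z, x, v). dir_deriv E F (g z) k x v) y"
    using y by simp
  qed
 qed
qed

lemma smooth_on_iff_family:
 "smooth_on E F U f \<longleftrightarrow> smooth_family (discrete_topology {()}) E F U (%_. f)"
 using smooth_family_const_param smooth_familyD by fastforce

lemma smooth_on_cong:
 "smooth_on E F U f ==> (!!x. x \<in> U ==> f x = g x) ==> smooth_on E F U g"
 unfolding smooth_on_iff_family by (rule smooth_family_cong)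

lemma smooth_family_open_subset:
 assumes f: "smooth_family Z E F U f" and V: "openin (vtop E) V" "V \<subseteq> U"
 shows "smooth_family Z E F V f" unfolding smooth_family_def
proof (intro conjI ballI allI V(1))
 fix z assume z: "z \<in> topspace Z"
 note fz = smooth_familyD[OF f z]
 have "continuous_map (jet_domain E V k) (vtop F) (%(x, v). dir_deriv E F (f z) k x v)" for k
  using fz unfolding jet_domain_subset[OF V(2)]
  by (intro continuous_map_from_subtopology) (simp add: smooth_on_def)
 then show "smooth_on E F V (f z)"
  using V(2) by (intro smooth_onI_jet(1)[where g = "dir_deriv E F (f z)"] V smooth_on_deriv_limit[OF fz])
   auto
next
 fix k
 have "continuous_map (prod_topology Z (jet_domain E U k)) (vtop F) (%(z, x, v). dir_deriv E F (f z) k x v)"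
  using f by (simp add: smooth_family_def)
 then show "continuous_map (prod_topology Z (jet_domain E V k)) (vtop F) (%(z, x, v). dir_deriv E F (f z) k x v)"
  unfolding jet_domain_subset[OF V(2)] prod_topology_subtopology by (rule continuous_map_from_subtopology)
qed

lemma smooth_on_open_subset:
 "smooth_on E F U f ==> openin (vtop E) V ==> V \<subseteq> U ==> smooth_on E F V f"
 unfolding smooth_on_iff_family by (rule smooth_family_open_subset)

lemma smooth_family_local:
 assumes loc: "!!x. x \<in> U ==> \<exists>V. x \<in> V \<and> V \<subseteq> U \<and> smooth_family Z E F V f"
 shows "smooth_family Z E F U f"
proof -
 have U: "openin (vtop E) U"
 proof (subst openin_subopen, intro ballI)
  fix x assume "x \<in> U"
  from loc[OF this] show "\<exists>T. openin (vtop E) T \<and> x \<in> T \<and> T \<subseteq> U" by (auto simp: smooth_family_def)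
 qed
 \<comment> \<open>Stated for any parameter space \<open>Y\<close>: the one-point space serves for a
   fixed parameter, \<open>Y = Z\<close> for joint continuity.\<close>
 have open_nbhd: "\<exists>N. openin (prod_topology Y (jet_domain E U k)) N \<and> y \<in> N \<and>
   continuous_map (subtopology (prod_topology Y (jet_domain E U k)) N) (vtop F) h"
  if yY: "y \<in> topspace (prod_topology Y (jet_domain E U k))"
   and h: "!!V. smooth_family Z E F V f ==> continuous_map (prod_topology Y (jet_domain E V k)) (vtop F) h"
  for Y :: "'y topology" and k y h
 proof -
  obtain z x v where y: "y = (z, x, v)" "z \<in> topspace Y" "x \<in> U" "(x, v) \<in> topspace (jet_domain E U k)"
   using yY by (cases y) (auto simp: in_topspace_jet_domain)
  obtain V where V: "x \<in> V" "V \<subseteq> U" "smooth_family Z E F V f" using loc[OF y(3)] by blast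
  have Vo: "openin (vtop E) V" using V by (simp add: smooth_family_def)
  have "openin (jet_domain E U k) (V \<times> topspace (product_topology (%_. vtop E) {..<k}))"
   unfolding jet_domain_def openin_prod_Times_iff
   using Vo V(2) openin_topspace[of "product_topology (%_. vtop E) {..<k}"]
   by (auto simp: openin_subtopology simp del: topspace_product_topology)
  then have o: "openin (prod_topology Y (jet_domain E U k))
    (topspace Y \<times> (V \<times> topspace (product_topology (%_. vtop E) {..<k})))" by (simp add: openin_prod_Times_iff)
  have "jet_domain E V k = subtopology (jet_domain E U k) (V \<times> topspace (product_topology (%_. vtop E) {..<k}))"
   using V(2) by (simp add: jet_domain_def subtopology_Times subtopology_subtopology Int_absorb1
     del: topspace_product_topology)
  then have "subtopology (prod_topology Y (jet_domain E U k))
    (topspace Y \<times> (V \<times> topspace (product_topology (%_. vtop E) {..<k}))) = prod_topology Y (jet_domain E V k)"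
   by (simp add: subtopology_Times)
  then show ?thesis using o h[OF V(3)] y V(1)
   by (intro exI[of _ "topspace Y \<times> (V \<times> topspace (product_topology (%_. vtop E) {..<k}))"])
     (auto simp: in_topspace_jet_domain PiE_iff)
 qed
 show ?thesis unfolding smooth_family_def
 proof (intro conjI ballI allI U)
  fix z assume z: "z \<in> topspace Z"
  have sm: "smooth_on E F V (f z)" if "smooth_family Z E F V f" for V using smooth_familyD[OF that z] .
  have c: "continuous_map (prod_topology (discrete_topology {()}) (jet_domain E U k)) (vtop F)
    (%(u, x, v). dir_deriv E F (f z) k x v)" for k
  proof (rule continuous_map_local, rule open_nbhd)
   fix V assume "smooth_family Z E F V f"
   from smooth_family_const_param[OF sm[OF this], of "discrete_topology {()}"]
   show "continuous_map (prod_topology (discrete_topology {()}) (jet_domain E V k)) (vtop F)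
     (%(u, x, v). dir_deriv E F (f z) k x v)" by (simp add: smooth_family_def)
  qed
  have "continuous_map (jet_domain E U k) (vtop F) (%(x, v). dir_deriv E F (f z) k x v)" for k
  proof -
   have "continuous_map (jet_domain E U k) (prod_topology (discrete_topology {()}) (jet_domain E U k)) (%p. ((), p))"
    by (intro continuous_map_pairedI) auto
   from continuous_map_compose[OF this c] show ?thesis by (simp add: o_def)
  qed
  then show "smooth_on E F U (f z)"
  proof (intro smooth_onI_jet(1)[where g = "dir_deriv E F (f z)"] U)
   fix k x and v :: "nat => 'e" assume x: "x \<in> U" and v: "!!i. i < Suc k ==> v i \<in> carrier E"
   obtain V where V: "x \<in> V" "smooth_family Z E F V f" using loc[OF x] by blast
   show "limitin (vtop F) (%t. inverse t \<odot>\<^bsub>F\<^esub> (dir_deriv E F (f z) k (x \<oplus> t \<odot> v k) v \<ominus>\<^bsub>F\<^esub>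
     dir_deriv E F (f z) k x v)) (dir_deriv E F (f z) (Suc k) x v) (at 0)"
    by (rule smooth_on_deriv_limit[OF sm[OF V(2)] V(1) v])
  qed auto
 next
  fix k
  show "continuous_map (prod_topology Z (jet_domain E U k)) (vtop F) (%(z, x, v). dir_deriv E F (f z) k x v)"
   by (rule continuous_map_local, rule open_nbhd) (auto simp: smooth_family_def)
 qed
qed

lemma smooth_on_local:
 "(!!x. x \<in> U ==> \<exists>V. x \<in> V \<and> V \<subseteq> U \<and> smooth_on E F V f) ==> smooth_on E F U f"
 unfolding smooth_on_iff_family by (rule smooth_family_local)

lemma smooth_on_continuous:
 assumes f: "smooth_on E F U f"
 shows "continuous_map (subtopology (vtop E) U) (vtop F) f"
 using continuous_map_family_deriv[OF smooth_family_const_param[OF f, of "discrete_topology {()}"],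
   of "subtopology (vtop E) U" "%_. ()" "%x. x" 0] by simp

lemma smooth_on_open_preimage:
 assumes f: "smooth_on E F U f" and W: "openin (vtop F) W"
 shows "openin (vtop E) {x \<in> U. f x \<in> W}"
proof -
 have "openin (subtopology (vtop E) U) {x \<in> topspace (subtopology (vtop E) U). f x \<in> W}"
  by (rule openin_continuous_map_preimage[OF smooth_on_continuous[OF f] W])
 moreover have "topspace (subtopology (vtop E) U) = U" using smooth_on_subset[OF f] by auto
 ultimately show ?thesis using smooth_on_open[OF f] openin_trans_full by fastforce
qed

lemma smooth_on_const:
 assumes "openin (vtop E) U" "c \<in> carrier F"
 shows "smooth_on E F U (%_. c)"
proof (rule smooth_onI_jet(1)[where g = "%k x v. if k = 0 then c else \<zero>\<^bsub>F\<^esub>"])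
 fix k
 show "continuous_map (jet_domain E U k) (vtop F) (%(x, v). if k = 0 then c else \<zero>\<^bsub>F\<^esub>)"
  using assms by (cases "k = 0") (auto simp: case_prod_unfold)
qed (use assms in auto)

end

lemma smooth_on_id:
 fixes E :: "(real, 'e) tvs"
 assumes "lcs E" "openin (vtop E) U"
 shows "smooth_on E E U (%x. x)"
proof -
 interpret E: lcs E by fact
 interpret E2: lcs2 E E by (intro lcs2.intro assms)
 let ?g = "%k x (v :: nat => 'e). case k of 0 => x | Suc 0 => v 0 | _ => \<zero>\<^bsub>E\<^esub>"
 show ?thesis
 proof (rule E2.smooth_onI_jet(1)[where g = ?g])
  fix k x and v :: "nat => 'e" assume x: "x \<in> U" and v: "!!i. i < Suc k ==> v i \<in> carrier E"
  have xc: "x \<in> carrier E" using assms(2) x openin_subset by fastforce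
  show "limitin (vtop E) (%t. inverse t \<odot>\<^bsub>E\<^esub> (?g k (x \<oplus>\<^bsub>E\<^esub> t \<odot>\<^bsub>E\<^esub> v k) v \<ominus>\<^bsub>E\<^esub> ?g k x v)) (?g (Suc k) x v) (at 0)"
  proof (cases k)
   case 0
   have "\<forall>\<^sub>F t in at (0::real). v 0 = inverse t \<odot>\<^bsub>E\<^esub> (x \<oplus>\<^bsub>E\<^esub> t \<odot>\<^bsub>E\<^esub> v 0 \<ominus>\<^bsub>E\<^esub> x)" unfolding eventually_at_filter
   proof (rule always_eventually, intro allI impI)
    fix t :: real assume "t \<noteq> 0"
    have "x \<oplus>\<^bsub>E\<^esub> t \<odot>\<^bsub>E\<^esub> v 0 \<ominus>\<^bsub>E\<^esub> x = t \<odot>\<^bsub>E\<^esub> v 0"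
     using v[of 0] xc by (intro E.diff_eqI) (simp_all add: E.ag.a_comm)
    then show "v 0 = inverse t \<odot>\<^bsub>E\<^esub> (x \<oplus>\<^bsub>E\<^esub> t \<odot>\<^bsub>E\<^esub> v 0 \<ominus>\<^bsub>E\<^esub> x)"
     using \<open>t \<noteq> 0\<close> v[of 0] by (simp add: E.smult_smult)
   qed
   from E.lim_eq[OF E.lim_const this] show ?thesis using 0 v[of 0] by simp
  next
   case (Suc m)
   then show ?thesis using v[of 0] by (cases m) auto
  qed
 next
  fix k
  show "continuous_map (jet_domain E U k) (vtop E) (%(x, v). ?g k x v)"
  proof (cases k)
   case 0
   then show ?thesis using E2.continuous_map_jet_point[of U 0] by (simp add: case_prod_unfold)
  next
   case (Suc m)
   then show ?thesis using E2.continuous_map_jet_dir[of 0 k U] by (cases m) (auto simp: case_prod_unfold)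
  qed
 qed (use assms in auto)
qed

section \<open>Linear maps, pairs and bilinear maps\<close>

definition cont_linear :: "(real, 'f) tvs => (real, 'g) tvs => ('f => 'g) => bool"
 where "cont_linear F G T \<longleftrightarrow> continuous_map (vtop F) (vtop G) T \<and>
  (\<forall>x\<in>carrier F. \<forall>y\<in>carrier F. T (x \<oplus>\<^bsub>F\<^esub> y) = T x \<oplus>\<^bsub>G\<^esub> T y) \<and> (\<forall>c. \<forall>x\<in>carrier F. T (c \<odot>\<^bsub>F\<^esub> x) = c \<odot>\<^bsub>G\<^esub> T x)"

context lcs3
begin

lemma cont_linear_closed: "cont_linear F G T ==> x \<in> carrier F ==> T x \<in> carrier G"
 by (auto simp: cont_linear_def continuous_map_def)

lemma cont_linear_diff:
 assumes "cont_linear F G T" "x \<in> carrier F" "y \<in> carrier F"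
 shows "T (x \<ominus>\<^bsub>F\<^esub> y) = T x \<ominus>\<^bsub>G\<^esub> T y" using assms cont_linear_closed[OF assms(1)]
 by (simp add: EF.cod.diff_eq FG.cod.diff_eq cont_linear_def)

text \<open>A continuous linear map commutes with difference quotients and their limits. The formula
  for the derivatives is recorded because the jets of curves and sections have to be additive and
  homogeneous.\<close>

lemma smooth_on_linear_compose:
 assumes f: "smooth_on E F U f" and T: "cont_linear F G T"
 shows "smooth_on E G U (%x. T (f x))"
  and "!!k x v. x \<in> U ==> (!!i. i < k ==> v i \<in> carrier E) ==>
   dir_deriv E G (%x. T (f x)) k x v = T (dir_deriv E F f k x v)"
proof -
 let ?g = "%k x v. T (dir_deriv E F f k x v)"
 note U = EF.smooth_on_open[OF f]
 have Tc: "continuous_map (vtop F) (vtop G) T" using T by (simp add: cont_linear_def)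
 have lim: "limitin (vtop G) (%t. inverse t \<odot>\<^bsub>G\<^esub> (?g k (x \<oplus> t \<odot> v k) v \<ominus>\<^bsub>G\<^esub> ?g k x v)) (?g (Suc k) x v) (at 0)"
  if x: "x \<in> U" and v: "!!i. i < Suc k ==> v i \<in> carrier E" for k x v
 proof (rule FG.cod.lim_eq[OF continuous_map_limit[OF Tc EF.smooth_on_deriv_limit[OF f x v]]])
  have "eventually (%t. x \<oplus> t \<odot> v k \<in> U) (at 0)" using EF.line_eventually[OF U x] v by simp
  then show "\<forall>\<^sub>F t in at 0. (T \<circ> (%t. inverse t \<odot>\<^bsub>F\<^esub> (dir_deriv E F f k (x \<oplus> t \<odot> v k) v \<ominus>\<^bsub>F\<^esub> dir_deriv E F f k x v))) t =
    inverse t \<odot>\<^bsub>G\<^esub> (?g k (x \<oplus> t \<odot> v k) v \<ominus>\<^bsub>G\<^esub> ?g k x v)"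
  proof eventually_elim
   case (elim t)
   have "dir_deriv E F f k (x \<oplus> t \<odot> v k) v \<in> carrier F" "dir_deriv E F f k x v \<in> carrier F"
    using v x elim by (auto intro!: EF.smooth_on_deriv_closed[OF f])
   then show ?case using T cont_linear_diff[OF T] by (simp add: cont_linear_def)
  qed
 qed
 have cont: "continuous_map (jet_domain E U k) (vtop G) (%(x, v). ?g k x v)" for k
 proof -
  have "continuous_map (jet_domain E U k) (vtop F) (%(x, v). dir_deriv E F f k x v)"
   using f by (simp add: smooth_on_def)
  from continuous_map_compose[OF this Tc] show ?thesis by (simp add: o_def case_prod_unfold)
 qed
 show "smooth_on E G U (%x. T (f x))" by (rule EG.smooth_onI_jet(1)[where g = ?g, OF U _ lim cont]) simp
 show "!!k x v. x \<in> U ==> (!!i. i < k ==> v i \<in> carrier E) ==>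
   dir_deriv E G (%x. T (f x)) k x v = T (dir_deriv E F f k x v)"
  by (rule EG.smooth_onI_jet(2)[where g = ?g, OF U _ lim cont]) simp
qed

end

lemma prod_space_simps [simp]:
 "carrier (prod_space E F) = carrier E \<times> carrier F" "zero (prod_space E F) = (\<zero>\<^bsub>E\<^esub>, \<zero>\<^bsub>F\<^esub>)"
 "(x, y) \<oplus>\<^bsub>prod_space E F\<^esub> (x', y') = (x \<oplus>\<^bsub>E\<^esub> x', y \<oplus>\<^bsub>F\<^esub> y')"
 "r \<odot>\<^bsub>prod_space E F\<^esub> (x, y) = (r \<odot>\<^bsub>E\<^esub> x, r \<odot>\<^bsub>F\<^esub> y)"
 "vtop (prod_space E F) = prod_topology (vtop E) (vtop F)" by (simp_all add: prod_space_def)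

lemma locally_convex_spaceI:
 assumes "Module.module (scalars :: 'k::real_normed_field ring) E" "topspace (vtop E) = carrier E"
  "Hausdorff_space (vtop E)"
  "continuous_map (prod_topology (vtop E) (vtop E)) (vtop E) (%(x, y). x \<oplus>\<^bsub>E\<^esub> y)"
  "continuous_map (prod_topology euclidean (vtop E)) (vtop E) (%(c, x). c \<odot>\<^bsub>E\<^esub> x)"
  "!!W. openin (vtop E) W ==> \<zero>\<^bsub>E\<^esub> \<in> W ==>
   \<exists>V. openin (vtop E) V \<and> \<zero>\<^bsub>E\<^esub> \<in> V \<and> V \<subseteq> W \<and> (\<forall>x\<in>V. \<forall>y\<in>V. \<forall>t\<in>{0..1::real}.
     (of_real t \<odot>\<^bsub>E\<^esub> x) \<oplus>\<^bsub>E\<^esub> (of_real (1 - t) \<odot>\<^bsub>E\<^esub> y) \<in> V)"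
 shows "lcs E" using assms unfolding lcs_def locally_convex_space_def by blast

lemma lcs_prod_space:
 assumes "lcs E" "lcs F"
 shows "lcs (prod_space E F)"
proof -
 interpret E: lcs E by fact
 interpret F: lcs F by fact
 let ?P = "prod_space E F"
 show ?thesis
 proof (rule locally_convex_spaceI)
  show "Module.module scalars ?P"
  proof (rule module_scalarsI)
   show "abelian_group ?P"
   proof (rule abelian_groupI)
    fix x assume "x \<in> carrier ?P"
    then show "\<exists>y\<in>carrier ?P. y \<oplus>\<^bsub>?P\<^esub> x = \<zero>\<^bsub>?P\<^esub>"
     by (intro bexI[of _ "(\<ominus>\<^bsub>E\<^esub> fst x, \<ominus>\<^bsub>F\<^esub> snd x)"]) (auto simp: E.ag.l_neg F.ag.l_neg)
   qed (auto simp: E.ag.a_ac F.ag.a_ac)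
  qed (auto simp: E.smult_add_left F.smult_add_left E.smult_add_right F.smult_add_right
    E.smult_smult F.smult_smult)
  show "Hausdorff_space (vtop ?P)" by (simp add: Hausdorff_space_prod_topology E.hausdorff F.hausdorff)
  have c: "continuous_map (prod_topology (vtop ?P) (vtop ?P)) (vtop E) (%p. fst (fst p))"
    "continuous_map (prod_topology (vtop ?P) (vtop ?P)) (vtop E) (%p. fst (snd p))"
    "continuous_map (prod_topology (vtop ?P) (vtop ?P)) (vtop F) (%p. snd (fst p))"
    "continuous_map (prod_topology (vtop ?P) (vtop ?P)) (vtop F) (%p. snd (snd p))"
   by (auto intro!: continuous_map_fst_of continuous_map_snd_of continuous_map_fst continuous_map_snd
     continuous_map_compose[of _ _ fst _ fst, unfolded o_def]
     continuous_map_compose[of _ _ fst _ snd, unfolded o_def]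
     continuous_map_compose[of _ _ snd _ fst, unfolded o_def]
     continuous_map_compose[of _ _ snd _ snd, unfolded o_def])
  show "continuous_map (prod_topology (vtop ?P) (vtop ?P)) (vtop ?P) (%(x, y). x \<oplus>\<^bsub>?P\<^esub> y)"
   using continuous_map_pairedI[OF E.continuous_map_vadd[OF c(1,2)] F.continuous_map_vadd[OF c(3,4)]]
   by (simp add: case_prod_unfold prod_space_def)
  have d: "continuous_map (prod_topology euclidean (vtop ?P)) (vtop E) (%p. fst (snd p))"
    "continuous_map (prod_topology euclidean (vtop ?P)) (vtop F) (%p. snd (snd p))"
   by (auto intro!: continuous_map_fst continuous_map_snd
     continuous_map_compose[of _ _ snd _ fst, unfolded o_def]
     continuous_map_compose[of _ _ snd _ snd, unfolded o_def])
  show "continuous_map (prod_topology euclidean (vtop ?P)) (vtop ?P) (%(c, x). c \<odot>\<^bsub>?P\<^esub> x)"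
   using continuous_map_pairedI[OF E.continuous_map_vsmult[OF continuous_map_fst d(1)]
     F.continuous_map_vsmult[OF continuous_map_fst d(2)]] by (simp add: case_prod_unfold prod_space_def)
  fix W assume W: "openin (vtop ?P) W" "\<zero>\<^bsub>?P\<^esub> \<in> W"
  from W(1)[unfolded prod_space_simps openin_prod_topology_alt, rule_format, of "\<zero>\<^bsub>E\<^esub>" "\<zero>\<^bsub>F\<^esub>"] W(2)
  obtain W1 W2 where W12: "openin (vtop E) W1" "openin (vtop F) W2" "\<zero>\<^bsub>E\<^esub> \<in> W1" "\<zero>\<^bsub>F\<^esub> \<in> W2"
    "W1 \<times> W2 \<subseteq> W" by auto
  obtain V1 where V1: "openin (vtop E) V1" "\<zero>\<^bsub>E\<^esub> \<in> V1" "V1 \<subseteq> W1"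
   "!!x y t. x \<in> V1 ==> y \<in> V1 ==> 0 \<le> t ==> t \<le> 1 ==> of_real t \<odot>\<^bsub>E\<^esub> x \<oplus>\<^bsub>E\<^esub> of_real (1 - t) \<odot>\<^bsub>E\<^esub> y \<in> V1"
   by (rule E.convex_nhd_zero[OF W12(1,3)], rule that; assumption)
  obtain V2 where V2: "openin (vtop F) V2" "\<zero>\<^bsub>F\<^esub> \<in> V2" "V2 \<subseteq> W2"
   "!!x y t. x \<in> V2 ==> y \<in> V2 ==> 0 \<le> t ==> t \<le> 1 ==> of_real t \<odot>\<^bsub>F\<^esub> x \<oplus>\<^bsub>F\<^esub> of_real (1 - t) \<odot>\<^bsub>F\<^esub> y \<in> V2"
   by (rule F.convex_nhd_zero[OF W12(2,4)], rule that; assumption)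
  have "!!x y t. x \<in> V1 \<times> V2 ==> y \<in> V1 \<times> V2 ==> t \<in> {0..1} ==>
    of_real t \<odot>\<^bsub>?P\<^esub> x \<oplus>\<^bsub>?P\<^esub> of_real (1 - t) \<odot>\<^bsub>?P\<^esub> y \<in> V1 \<times> V2"
   using V1(4) V2(4) by (simp add: mem_Times_iff prod_space_def case_prod_unfold)
  moreover have "openin (vtop ?P) (V1 \<times> V2)" using V1 V2 by (simp add: openin_prod_Times_iff)
  ultimately show "\<exists>V. openin (vtop ?P) V \<and> \<zero>\<^bsub>?P\<^esub> \<in> V \<and> V \<subseteq> W \<and>
    (\<forall>x\<in>V. \<forall>y\<in>V. \<forall>t\<in>{0..1::real}. (of_real t \<odot>\<^bsub>?P\<^esub> x) \<oplus>\<^bsub>?P\<^esub> (of_real (1 - t) \<odot>\<^bsub>?P\<^esub> y) \<in> V)"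
   using V1(2,3) V2(2,3) W12(5) by (intro exI[of _ "V1 \<times> V2"]) auto
 qed simp
qed

context
 fixes E :: "(real, 'e) tvs" and F :: "(real, 'f) tvs"
 assumes E: "lcs E" and F: "lcs F"
begin

interpretation E: lcs E by (rule E)
interpretation F: lcs F by (rule F)
interpretation P: lcs "prod_space E F" by (rule lcs_prod_space[OF E F])

lemma prod_space_diff:
 assumes "x \<in> carrier E" "y \<in> carrier F" "x' \<in> carrier E" "y' \<in> carrier F"
 shows "(x, y) \<ominus>\<^bsub>prod_space E F\<^esub> (x', y') = (x \<ominus>\<^bsub>E\<^esub> x', y \<ominus>\<^bsub>F\<^esub> y')"
 using assms by (simp add: P.diff_eq E.diff_eq F.diff_eq)

lemma cont_linear_fst: "cont_linear (prod_space E F) E fst"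
 and cont_linear_snd: "cont_linear (prod_space E F) F snd"
 by (auto simp: cont_linear_def continuous_map_fst continuous_map_snd)

end

lemma smooth_on_linear:
 assumes "lcs E" "lcs F" "cont_linear E F T" "openin (vtop E) U"
 shows "smooth_on E F U T"
proof -
 interpret lcs3 E E F by (intro lcs3.intro lcs2.intro assms)
 show ?thesis using smooth_on_linear_compose(1)[OF smooth_on_id[OF assms(1,4)] assms(3)] .
qed

context
 fixes E :: "(real, 'e) tvs" and F :: "(real, 'f) tvs" and G :: "(real, 'g) tvs"
 assumes E: "lcs E" and F: "lcs F" and G: "lcs G"
begin

interpretation FG: lcs2 F G by (intro lcs2.intro F G)
interpretation EF: lcs2 E F by (intro lcs2.intro E F)
interpretation EG: lcs2 E G by (intro lcs2.intro E G)
interpretation EP: lcs2 E "prod_space F G" by (intro lcs2.intro E lcs_prod_space F G)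

lemma smooth_on_pair:
 assumes f: "smooth_on E F U f" and g: "smooth_on E G U g"
 shows "smooth_on E (prod_space F G) U (%x. (f x, g x))"
  and "!!k x v. x \<in> U ==> (!!i. i < k ==> v i \<in> carrier E) ==>
   dir_deriv E (prod_space F G) (%x. (f x, g x)) k x v = (dir_deriv E F f k x v, dir_deriv E G g k x v)"
proof -
 let ?P = "prod_space F G"
 let ?h = "%k x v. (dir_deriv E F f k x v, dir_deriv E G g k x v)"
 note U = EF.smooth_on_open[OF f]
 have lim: "limitin (vtop ?P) (%t. inverse t \<odot>\<^bsub>?P\<^esub> (?h k (x \<oplus>\<^bsub>E\<^esub> t \<odot>\<^bsub>E\<^esub> v k) v \<ominus>\<^bsub>?P\<^esub> ?h k x v)) (?h (Suc k) x v) (at 0)"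
  if x: "x \<in> U" and v: "!!i. i < Suc k ==> v i \<in> carrier E" for k x v
 proof -
  let ?q = "%t. (inverse t \<odot>\<^bsub>F\<^esub> (dir_deriv E F f k (x \<oplus>\<^bsub>E\<^esub> t \<odot>\<^bsub>E\<^esub> v k) v \<ominus>\<^bsub>F\<^esub> dir_deriv E F f k x v),
    inverse t \<odot>\<^bsub>G\<^esub> (dir_deriv E G g k (x \<oplus>\<^bsub>E\<^esub> t \<odot>\<^bsub>E\<^esub> v k) v \<ominus>\<^bsub>G\<^esub> dir_deriv E G g k x v))"
  have "limitin (vtop ?P) ?q (?h (Suc k) x v) (at 0)"
   using EF.smooth_on_deriv_limit[where k = k and v = v, OF f x v]
    EG.smooth_on_deriv_limit[where k = k and v = v, OF g x v]
   by (simp add: limitin_pairwise o_def del: dir_deriv.simps)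
  then show ?thesis
  proof (rule EP.cod.lim_eq)
   have "eventually (%t. x \<oplus>\<^bsub>E\<^esub> t \<odot>\<^bsub>E\<^esub> v k \<in> U) (at 0)" using EF.line_eventually[OF U x] v by simp
   then show "\<forall>\<^sub>F t in at 0. ?q t = inverse t \<odot>\<^bsub>?P\<^esub> (?h k (x \<oplus>\<^bsub>E\<^esub> t \<odot>\<^bsub>E\<^esub> v k) v \<ominus>\<^bsub>?P\<^esub> ?h k x v)"
   proof eventually_elim
    case (elim t)
    have "dir_deriv E F f k (x \<oplus>\<^bsub>E\<^esub> t \<odot>\<^bsub>E\<^esub> v k) v \<in> carrier F" "dir_deriv E F f k x v \<in> carrier F"
     "dir_deriv E G g k (x \<oplus>\<^bsub>E\<^esub> t \<odot>\<^bsub>E\<^esub> v k) v \<in> carrier G" "dir_deriv E G g k x v \<in> carrier G"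
     using v x elim by (auto intro!: EF.smooth_on_deriv_closed[OF f] EG.smooth_on_deriv_closed[OF g])
    then show ?case by (simp add: prod_space_diff[OF F G])
   qed
  qed
 qed
 have cont: "continuous_map (jet_domain E U k) (vtop ?P) (%(x, v). ?h k x v)" for k
  using f g by (simp add: smooth_on_def continuous_map_paired case_prod_unfold)
 show "smooth_on E ?P U (%x. (f x, g x))" by (rule EP.smooth_onI_jet(1)[where g = ?h, OF U _ lim cont]) simp
 show "!!k x v. x \<in> U ==> (!!i. i < k ==> v i \<in> carrier E) ==>
   dir_deriv E ?P (%x. (f x, g x)) k x v = (dir_deriv E F f k x v, dir_deriv E G g k x v)"
  by (rule EP.smooth_onI_jet(2)[where g = ?h, OF U _ lim cont]) simp
qed

lemma smooth_family_pair:
 assumes f: "smooth_family Z E F U f" and g: "smooth_family Z E G U g"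
 shows "smooth_family Z E (prod_space F G) U (%z x. (f z x, g z x))" unfolding smooth_family_def
proof (intro conjI ballI allI)
 show "openin (vtop E) U" using f by (simp add: smooth_family_def)
 fix z assume z: "z \<in> topspace Z"
 show "smooth_on E (prod_space F G) U (%x. (f z x, g z x))"
  by (rule smooth_on_pair(1)[OF EF.smooth_familyD[OF f z] EG.smooth_familyD[OF g z]])
next
 fix k
 have "continuous_map (prod_topology Z (jet_domain E U k)) (vtop (prod_space F G))
   (%(z, x, v). (dir_deriv E F (f z) k x v, dir_deriv E G (g z) k x v))"
  using f g by (simp add: smooth_family_def continuous_map_paired case_prod_unfold)
 then show "continuous_map (prod_topology Z (jet_domain E U k)) (vtop (prod_space F G))
   (%(z, x, v). dir_deriv E (prod_space F G) (%x. (f z x, g z x)) k x v)"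
 proof (rule continuous_map_eq)
  fix y assume "y \<in> topspace (prod_topology Z (jet_domain E U k))"
  then obtain z x v where y: "y = (z, x, v)" "z \<in> topspace Z" "x \<in> U" "v \<in> {..<k} \<rightarrow>\<^sub>E carrier E"
   by (cases y) (auto simp: EF.in_topspace_jet_domain)
  have "dir_deriv E (prod_space F G) (%x. (f z x, g z x)) k x v = (dir_deriv E F (f z) k x v, dir_deriv E G (g z) k x v)"
   by (rule smooth_on_pair(2)[OF EF.smooth_familyD[OF f y(2)] EG.smooth_familyD[OF g y(2)] y(3)])
     (use y in auto)
  then show "(%(z, x, v). (dir_deriv E F (f z) k x v, dir_deriv E G (g z) k x v)) y =
    (%(z, x, v). dir_deriv E (prod_space F G) (%x. (f z x, g z x)) k x v) y" using y by simp
 qed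
qed

end

definition cont_bilinear ::
  "(real, 'e) tvs => (real, 'f) tvs => (real, 'g) tvs => ('e => 'f => 'g) => bool"
 where "cont_bilinear E F G b \<longleftrightarrow>
  continuous_map (prod_topology (vtop E) (vtop F)) (vtop G) (%(x, y). b x y) \<and>
  (\<forall>x\<in>carrier E. \<forall>x'\<in>carrier E. \<forall>y\<in>carrier F. b (x \<oplus>\<^bsub>E\<^esub> x') y = b x y \<oplus>\<^bsub>G\<^esub> b x' y) \<and>
  (\<forall>x\<in>carrier E. \<forall>y\<in>carrier F. \<forall>y'\<in>carrier F. b x (y \<oplus>\<^bsub>F\<^esub> y') = b x y \<oplus>\<^bsub>G\<^esub> b x y') \<and>
  (\<forall>c. \<forall>x\<in>carrier E. \<forall>y\<in>carrier F. b (c \<odot>\<^bsub>E\<^esub> x) y = c \<odot>\<^bsub>G\<^esub> b x y \<and> b x (c \<odot>\<^bsub>F\<^esub> y) = c \<odot>\<^bsub>G\<^esub> b x y)"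

text \<open>Along a line a bilinear map is a polynomial of degree two, so its jet can be written
  down: the Leibniz rule in order one, an expression independent of the point in order two, and zero
  afterwards.\<close>

lemma smooth_on_bilinear:
 assumes lE: "lcs E" and lF: "lcs F" and lG: "lcs G" and b: "cont_bilinear E F G b"
 shows "smooth_on (prod_space E F) G (carrier (prod_space E F)) (%(x, y). b x y)"
proof -
 interpret E: lcs E by (rule lE)
 interpret F: lcs F by (rule lF)
 interpret G: lcs G by (rule lG)
 let ?P = "prod_space E F"
 interpret PG: lcs2 ?P G by (intro lcs2.intro lcs_prod_space lE lF lG)
 have bl: "b (x \<oplus>\<^bsub>E\<^esub> x') y = b x y \<oplus>\<^bsub>G\<^esub> b x' y" if "x \<in> carrier E" "x' \<in> carrier E" "y \<in> carrier F" for x x' y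
  using b that by (simp add: cont_bilinear_def)
 have br: "b x (y \<oplus>\<^bsub>F\<^esub> y') = b x y \<oplus>\<^bsub>G\<^esub> b x y'" if "x \<in> carrier E" "y \<in> carrier F" "y' \<in> carrier F" for x y y'
  using b that by (simp add: cont_bilinear_def)
 have bs: "b (c \<odot>\<^bsub>E\<^esub> x) y = c \<odot>\<^bsub>G\<^esub> b x y" "b x (c \<odot>\<^bsub>F\<^esub> y) = c \<odot>\<^bsub>G\<^esub> b x y"
  if "x \<in> carrier E" "y \<in> carrier F" for x y c using b that by (simp_all add: cont_bilinear_def)
 have bcont: "continuous_map (prod_topology (vtop E) (vtop F)) (vtop G) (%(x, y). b x y)"
  using b by (simp add: cont_bilinear_def)
 have bc: "b x y \<in> carrier G" if "x \<in> carrier E" "y \<in> carrier F" for x y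
 proof -
  have "(%(x, y). b x y) (x, y) \<in> topspace (vtop G)"
   using continuous_map_image_subset_topspace[OF bcont] that by fastforce
  then show ?thesis by simp
 qed
 let ?g = "%k x v. case k of 0 => b (fst x) (snd x)
  | Suc 0 => b (fst x) (snd (v 0)) \<oplus>\<^bsub>G\<^esub> b (fst (v 0)) (snd x)
  | Suc (Suc 0) => b (fst (v (Suc 0))) (snd (v 0)) \<oplus>\<^bsub>G\<^esub> b (fst (v 0)) (snd (v (Suc 0)))
  | _ => \<zero>\<^bsub>G\<^esub>"
 show ?thesis
 proof (rule PG.smooth_onI_jet(1)[where g = ?g])
  show "openin (vtop ?P) (carrier ?P)" by (metis PG.dom.topspace_eq openin_topspace)
 next
  fix k x and v :: "nat => 'a \<times> 'b"
  assume x: "x \<in> carrier ?P" and v: "!!i. i < Suc k ==> v i \<in> carrier ?P"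
  obtain x1 x2 where x12: "x = (x1, x2)" "x1 \<in> carrier E" "x2 \<in> carrier F" using x by auto
  obtain p q where pq: "v k = (p, q)" "p \<in> carrier E" "q \<in> carrier F" using v[of k] by auto
  have eq: "x \<oplus>\<^bsub>?P\<^esub> t \<odot>\<^bsub>?P\<^esub> v k = (x1 \<oplus>\<^bsub>E\<^esub> t \<odot>\<^bsub>E\<^esub> p, x2 \<oplus>\<^bsub>F\<^esub> t \<odot>\<^bsub>F\<^esub> q)" for t by (simp add: x12 pq)
  have ne: "eventually (%t. t \<noteq> (0::real)) (at 0)" by (simp add: eventually_at_filter)
  \<comment> \<open>Here \<open>c\<close> is the value at \<open>t = 0\<close>, \<open>m\<close> the
    derivative there and \<open>n\<close> the quadratic coefficient, which is zero when the first
    derivative is differentiated.\<close>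
  have quot: "limitin (vtop G) (%t. inverse t \<odot>\<^bsub>G\<^esub> (h t \<ominus>\<^bsub>G\<^esub> c)) m (at 0)"
   if "m \<in> carrier G" "n \<in> carrier G" "c \<in> carrier G" and h: "!!t. h t = t \<odot>\<^bsub>G\<^esub> (m \<oplus>\<^bsub>G\<^esub> t \<odot>\<^bsub>G\<^esub> n) \<oplus>\<^bsub>G\<^esub> c" for h m n c
  proof -
   have "limitin (vtop G) (%t. m \<oplus>\<^bsub>G\<^esub> t \<odot>\<^bsub>G\<^esub> n) (m \<oplus>\<^bsub>G\<^esub> 0 \<odot>\<^bsub>G\<^esub> n) (at 0)"
    using that by (intro G.lim_add G.lim_smult G.lim_const tendsto_ident_at) auto
   then have "limitin (vtop G) (%t. m \<oplus>\<^bsub>G\<^esub> t \<odot>\<^bsub>G\<^esub> n) m (at 0)" using that by simp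
   then show ?thesis by (rule G.lim_eq) (rule eventually_mono[OF ne], use that in \<open>simp add: G.smult_smult\<close>)
  qed
  consider "k = 0" | "k = Suc 0" | "k = Suc (Suc 0)" | m where "k = Suc (Suc (Suc m))"
   by (metis not0_implies_Suc)
  then show "limitin (vtop G) (%t. inverse t \<odot>\<^bsub>G\<^esub> (?g k (x \<oplus>\<^bsub>?P\<^esub> t \<odot>\<^bsub>?P\<^esub> v k) v \<ominus>\<^bsub>G\<^esub> ?g k x v)) (?g (Suc k) x v) (at 0)"
  proof cases
   case 1
   have "limitin (vtop G) (%t. inverse t \<odot>\<^bsub>G\<^esub> (b (x1 \<oplus>\<^bsub>E\<^esub> t \<odot>\<^bsub>E\<^esub> p) (x2 \<oplus>\<^bsub>F\<^esub> t \<odot>\<^bsub>F\<^esub> q) \<ominus>\<^bsub>G\<^esub> b x1 x2))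
     (b x1 q \<oplus>\<^bsub>G\<^esub> b p x2) (at 0)" by (rule quot[where n = "b p q"])
      (use x12 pq in \<open>simp_all add: bl br bs bc G.smult_add_right G.smult_smult G.ag.a_ac\<close>)
   then show ?thesis unfolding eq using 1 pq x12 by simp
  next
   case 2
   obtain p0 q0 where pq0: "v 0 = (p0, q0)" "p0 \<in> carrier E" "q0 \<in> carrier F" using v[of 0] by auto
   have "limitin (vtop G) (%t. inverse t \<odot>\<^bsub>G\<^esub> ((b (x1 \<oplus>\<^bsub>E\<^esub> t \<odot>\<^bsub>E\<^esub> p) q0 \<oplus>\<^bsub>G\<^esub> b p0 (x2 \<oplus>\<^bsub>F\<^esub> t \<odot>\<^bsub>F\<^esub> q))
     \<ominus>\<^bsub>G\<^esub> (b x1 q0 \<oplus>\<^bsub>G\<^esub> b p0 x2))) (b p q0 \<oplus>\<^bsub>G\<^esub> b p0 q) (at 0)" by (rule quot[where n = "\<zero>\<^bsub>G\<^esub>"])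
      (use x12 pq pq0 in \<open>simp_all add: bl br bs bc G.smult_add_right G.ag.a_ac\<close>)
   then show ?thesis unfolding eq using 2 pq x12 pq0 by simp
  next
   case 3
   then show ?thesis using v[of 0] v[of 1] bc by (auto simp: mem_Times_iff)
  next
   case 4
   then show ?thesis by simp
  qed
 next
  fix k
  let ?J = "jet_domain ?P (carrier ?P) k"
  have x1: "continuous_map ?J (vtop E) (%p. fst (fst p))" and x2: "continuous_map ?J (vtop F) (%p. snd (fst p))"
   using continuous_map_compose[OF PG.continuous_map_jet_point, of "vtop E" fst]
    continuous_map_compose[OF PG.continuous_map_jet_point, of "vtop F" snd]
   by (simp_all add: o_def continuous_map_fst continuous_map_snd)
  have v1: "continuous_map ?J (vtop E) (%p. fst (snd p i))" and v2: "continuous_map ?J (vtop F) (%p. snd (snd p i))"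
   if "i < k" for i using continuous_map_compose[OF PG.continuous_map_jet_dir[OF that], of "vtop E" fst]
    continuous_map_compose[OF PG.continuous_map_jet_dir[OF that], of "vtop F" snd]
   by (simp_all add: o_def continuous_map_fst continuous_map_snd)
  have bb: "continuous_map ?J (vtop G) (%p. b (f p) (g p))"
   if "continuous_map ?J (vtop E) f" "continuous_map ?J (vtop F) g" for f g
   using continuous_map_compose[OF continuous_map_pairedI[OF that] bcont] by (simp add: o_def)
  consider "k = 0" | "k = Suc 0" | "k = Suc (Suc 0)" | m where "k = Suc (Suc (Suc m))"
   by (metis not0_implies_Suc)
  then show "continuous_map ?J (vtop G) (%(x, v). ?g k x v)"
  proof cases
   case 1
   then show ?thesis using bb[OF x1 x2] by (simp add: case_prod_unfold)
  next
   case 2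
   then show ?thesis using G.continuous_map_vadd[OF bb[OF x1 v2[of 0]] bb[OF v1[of 0] x2]]
    by (simp add: case_prod_unfold)
  next
   case 3
   then show ?thesis using G.continuous_map_vadd[OF bb[OF v1[of 1] v2[of 0]] bb[OF v1[of 0] v2[of 1]]]
    by (simp add: case_prod_unfold)
  next
   case 4
   then show ?thesis by (simp add: case_prod_unfold)
  qed
 qed (auto simp: case_prod_unfold)
qed

section \<open>The model spaces\<close>

lemma real_space_simps [simp]:
 "carrier (real_space A) = carrier A" "zero (real_space A) = zero A" "add (real_space A) = add A"
 "r \<odot>\<^bsub>real_space A\<^esub> x = complex_of_real r \<odot>\<^bsub>A\<^esub> x" "vtop (real_space A) = vtop A"
 by (simp_all add: real_space_def)

lemma lcs_real_space:
 fixes A :: "(complex, 'a, 'r) tvs_scheme"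
 assumes "lcs A"
 shows "lcs (real_space A)"
proof -
 interpret A: lcs A by fact
 show ?thesis
 proof (rule locally_convex_spaceI)
  show "Module.module scalars (real_space A)"
  proof (rule module_scalarsI)
   show "abelian_group (real_space A)"
   proof (rule abelian_groupI)
    show "\<exists>y\<in>carrier (real_space A). y \<oplus>\<^bsub>real_space A\<^esub> x = \<zero>\<^bsub>real_space A\<^esub>"
     if "x \<in> carrier (real_space A)" for x using that by (intro bexI[of _ "\<ominus>\<^bsub>A\<^esub> x"]) (auto simp: A.ag.l_neg)
   qed (auto simp: A.ag.a_ac)
  qed (auto simp: A.smult_add_left A.smult_add_right A.smult_smult)
  show "continuous_map (prod_topology euclidean (vtop (real_space A))) (vtop (real_space A))
    (%(c, x). c \<odot>\<^bsub>real_space A\<^esub> x)"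
   using A.continuous_map_vsmult[of "prod_topology euclidean (vtop A)" "%p. complex_of_real (fst p)" snd]
    continuous_map_compose[OF continuous_map_fst, of euclidean euclidean complex_of_real "vtop A"]
   by (simp add: case_prod_unfold o_def continuous_map_snd continuous_intros)
  show "\<exists>V. openin (vtop (real_space A)) V \<and> \<zero>\<^bsub>real_space A\<^esub> \<in> V \<and> V \<subseteq> W \<and> (\<forall>x\<in>V. \<forall>y\<in>V. \<forall>t\<in>{0..1::real}.
     (of_real t \<odot>\<^bsub>real_space A\<^esub> x) \<oplus>\<^bsub>real_space A\<^esub> (of_real (1 - t) \<odot>\<^bsub>real_space A\<^esub> y) \<in> V)"
   if "openin (vtop (real_space A)) W" "\<zero>\<^bsub>real_space A\<^esub> \<in> W" for W
   using A.lcs that unfolding locally_convex_space_def by simp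
 qed (use A.hausdorff A.continuous_add in auto)
qed

lemma real_line_simps [simp]:
 "carrier real_line = UNIV" "zero real_line = 0" "x \<oplus>\<^bsub>real_line\<^esub> y = x + y"
 "c \<odot>\<^bsub>real_line\<^esub> x = c * x" "vtop real_line = euclidean" by (simp_all add: real_line_def)

lemma lcs_real_line: "lcs real_line"
proof (rule locally_convex_spaceI)
 show "Module.module scalars real_line"
 proof (rule module_scalarsI)
  show "abelian_group real_line"
  proof (rule abelian_groupI)
   show "\<exists>y\<in>carrier real_line. y \<oplus>\<^bsub>real_line\<^esub> x = \<zero>\<^bsub>real_line\<^esub>" for x by (intro bexI[of _ "- x"]) auto
  qed auto
 qed (auto simp: algebra_simps)
 show "continuous_map (prod_topology (vtop real_line) (vtop real_line)) (vtop real_line) (%(x, y). x \<oplus>\<^bsub>real_line\<^esub> y)"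
  by (simp add: case_prod_unfold continuous_map_add continuous_map_fst continuous_map_snd
    flip: prod_topology_euclidean)
 show "continuous_map (prod_topology euclidean (vtop real_line)) (vtop real_line) (%(c, x). c \<odot>\<^bsub>real_line\<^esub> x)"
  by (simp add: case_prod_unfold continuous_map_real_mult continuous_map_fst continuous_map_snd
    flip: prod_topology_euclidean)
 fix W :: "real set" assume "openin (vtop real_line) W" "\<zero>\<^bsub>real_line\<^esub> \<in> W"
 then obtain e where e: "e > 0" "ball 0 e \<subseteq> W"
  using open_contains_ball by (metis open_openin real_line_simps(2,5))
 have "t * x + (1 - t) * y \<in> ball 0 e" if "x \<in> ball 0 e" "y \<in> ball 0 e" "t \<in> {0..1}" for x y t :: real
  using convexD[OF convex_ball that(1,2), of t "1 - t"] that(3) by simp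
 then show "\<exists>V. openin (vtop real_line) V \<and> \<zero>\<^bsub>real_line\<^esub> \<in> V \<and> V \<subseteq> W \<and> (\<forall>x\<in>V. \<forall>y\<in>V. \<forall>t\<in>{0..1::real}.
     (of_real t \<odot>\<^bsub>real_line\<^esub> x) \<oplus>\<^bsub>real_line\<^esub> (of_real (1 - t) \<odot>\<^bsub>real_line\<^esub> y) \<in> V)"
  using e by (intro exI[of _ "ball 0 e"]) auto
qed auto

lemma euclid_space_simps [simp]:
 "carrier (euclid_space n) = {x. \<forall>i\<ge>n. x i = 0}" "zero (euclid_space n) = (%_. 0)"
 "x \<oplus>\<^bsub>euclid_space n\<^esub> y = (%i. x i + y i)" "c \<odot>\<^bsub>euclid_space n\<^esub> x = (%i. c * x i)"
 "vtop (euclid_space n) = Euclidean_space n" by (simp_all add: euclid_space_def topspace_Euclidean_space)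

lemma continuous_map_Euclidean_coord: "continuous_map (Euclidean_space n) euclideanreal (%x. x i)"
 unfolding Euclidean_space_def
 by (intro continuous_map_from_subtopology continuous_map_product_coordinates) simp

text \<open>\<open>Euclidean_space n\<close> sits inside an infinite product. The coordinates from
  \<open>n\<close> on are zero for all of its points, so only the first \<open>n\<close> conditions
  of a basic product set remain.\<close>

lemma Euclidean_box_nbhd:
 assumes "openin (Euclidean_space n) W" "a \<in> W"
 shows "\<exists>r>0. \<forall>x\<in>topspace (Euclidean_space n). (\<forall>i<n. \<bar>x i - a i\<bar> \<le> r) \<longrightarrow> x \<in> W"
proof -
 obtain W' where W': "openin (powertop_real UNIV) W'" "W = W' \<inter> {x. \<forall>i\<ge>n. x i = 0}"
  using assms(1) unfolding Euclidean_space_def openin_subtopology by blast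
 then have "a \<in> W'" using assms(2) by simp
 obtain X where X: "a \<in> (\<Pi>\<^sub>E i\<in>UNIV. X i)" "!!i. openin euclideanreal (X i)"
   "finite {i. X i \<noteq> topspace euclideanreal}" "(\<Pi>\<^sub>E i\<in>UNIV. X i) \<subseteq> W'"
  using product_topology_open_contains_basis[OF W'(1) \<open>a \<in> W'\<close>] by blast
 have "\<exists>r>0. \<forall>x. \<bar>x - a i\<bar> \<le> r \<longrightarrow> x \<in> X i" for i
 proof -
  have "open (X i)" "a i \<in> X i" using X(1,2) by auto
  then obtain e where "e > 0" "cball (a i) e \<subseteq> X i" using open_contains_cball by blast
  then show ?thesis by (intro exI[of _ e]) (auto simp: dist_real_def subset_iff)
 qed
 then obtain r where r: "!!i. r i > 0" "!!i x. \<bar>x - a i\<bar> \<le> r i ==> x \<in> X i" by metis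
 \<comment> \<open>The extra entry 1 keeps the minimum meaningful for \<open>n = 0\<close>.\<close>
 let ?r = "Min (insert 1 (r ` {..<n}))"
 show ?thesis
 proof (intro exI[of _ ?r] conjI ballI impI)
  show "?r > 0" using r(1) by auto
  fix x assume x: "x \<in> topspace (Euclidean_space n)" "\<forall>i<n. \<bar>x i - a i\<bar> \<le> ?r"
  have "x i \<in> X i" for i
  proof (cases "i < n")
   case True
   have "?r \<le> r i" using True by (intro Min_le) auto
   then show ?thesis using x(2)[rule_format, OF True] r(2)[of "x i" i] by linarith
  next
   case False
   then have "x i = a i" using x(1) assms W'(2) by (auto simp: topspace_Euclidean_space)
   then show ?thesis using X(1) by auto
  qed
  then show "x \<in> W" using X(4) W'(2) x(1) by (auto simp: topspace_Euclidean_space)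
 qed
qed

lemma lcs_euclid_space: "lcs (euclid_space n)"
proof (rule locally_convex_spaceI)
 let ?E = "euclid_space n"
 show "Module.module scalars ?E"
 proof (rule module_scalarsI)
  show "abelian_group ?E"
  proof (rule abelian_groupI)
   show "\<exists>y\<in>carrier ?E. y \<oplus>\<^bsub>?E\<^esub> x = \<zero>\<^bsub>?E\<^esub>" if "x \<in> carrier ?E" for x
    using that by (intro bexI[of _ "%i. - x i"]) auto
  qed (auto simp: algebra_simps)
 qed (auto simp: algebra_simps)
 show "topspace (vtop ?E) = carrier ?E" by (simp add: topspace_Euclidean_space)
 show "Hausdorff_space (vtop ?E)" by (simp add: Hausdorff_Euclidean_space)
 show "continuous_map (prod_topology (vtop ?E) (vtop ?E)) (vtop ?E) (%(x, y). x \<oplus>\<^bsub>?E\<^esub> y)"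
  by (simp add: case_prod_unfold continuous_map_Euclidean_space_add continuous_map_fst continuous_map_snd)
 have "continuous_map (prod_topology euclideanreal (Euclidean_space n)) euclideanreal (%p. fst p * snd p i)" for i
  using continuous_map_compose[OF continuous_map_snd continuous_map_Euclidean_coord[of n i]]
  by (intro continuous_map_real_mult continuous_map_fst) (simp add: o_def)
 then show "continuous_map (prod_topology euclidean (vtop ?E)) (vtop ?E) (%(c, x). c \<odot>\<^bsub>?E\<^esub> x)"
  by (auto simp: case_prod_unfold Euclidean_space_def continuous_map_in_subtopology continuous_map_componentwise_UNIV)
 fix W assume W: "openin (vtop ?E) W" "\<zero>\<^bsub>?E\<^esub> \<in> W"
 then have W': "openin (Euclidean_space n) W" "(%_. 0) \<in> W" by simp_all
 obtain r where r: "r > 0"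
   "\<forall>x\<in>topspace (Euclidean_space n). (\<forall>i<n. \<bar>x i - 0\<bar> \<le> r) \<longrightarrow> x \<in> W" using Euclidean_box_nbhd[OF W'] by auto
 let ?V = "{x \<in> topspace (Euclidean_space n). \<forall>i\<in>{..<n}. x i \<in> ball 0 r}"
 have "openin (Euclidean_space n) {x \<in> topspace (Euclidean_space n). x i \<in> ball 0 r}" for i
  by (rule openin_continuous_map_preimage[OF continuous_map_Euclidean_coord]) auto
 then have "openin (Euclidean_space n) (topspace (Euclidean_space n) \<inter>
   \<Inter>((%i. {x \<in> topspace (Euclidean_space n). x i \<in> ball 0 r}) ` {..<n}))"
  by (cases "n = 0") (auto intro!: openin_Int_Inter)
 moreover have "topspace (Euclidean_space n) \<inter>
   \<Inter>((%i. {x \<in> topspace (Euclidean_space n). x i \<in> ball 0 r}) ` {..<n}) = ?V" by auto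
 ultimately have "openin (Euclidean_space n) ?V" by simp
 moreover have "(%i. t * x i + (1 - t) * y i) \<in> ?V" if "x \<in> ?V" "y \<in> ?V" "t \<in> {0..1}" for x y and t :: real
 proof -
  have "t * x i + (1 - t) * y i \<in> ball 0 r" if "i < n" for i
   using convexD[OF convex_ball[of "0::real" r], of "x i" "y i" t "1 - t"] that \<open>x \<in> ?V\<close> \<open>y \<in> ?V\<close> \<open>t \<in> {0..1}\<close>
   by simp
  then show ?thesis using that by (auto simp: topspace_Euclidean_space)
 qed
 moreover have "?V \<subseteq> W" using r(2) by (force simp: abs_less_iff)
 moreover have "(%_. 0) \<in> ?V" using r(1) by (simp add: topspace_Euclidean_space)
 ultimately show "\<exists>V. openin (vtop ?E) V \<and> \<zero>\<^bsub>?E\<^esub> \<in> V \<and> V \<subseteq> W \<and> (\<forall>x\<in>V. \<forall>y\<in>V. \<forall>t\<in>{0..1::real}.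
     (of_real t \<odot>\<^bsub>?E\<^esub> x) \<oplus>\<^bsub>?E\<^esub> (of_real (1 - t) \<odot>\<^bsub>?E\<^esub> y) \<in> V)" by (intro exI[of _ ?V]) simp
qed

lemma locally_compact_euclideanreal: "locally_compact_space euclideanreal" unfolding locally_compact_space_def
proof (intro ballI)
 fix x :: real
 show "\<exists>U K. openin euclidean U \<and> compactin euclidean K \<and> x \<in> U \<and> U \<subseteq> K"
  by (intro exI[of _ "ball x 1"] exI[of _ "cball x 1"]) auto
qed

lemma locally_compact_Euclidean_space: "locally_compact_space (Euclidean_space n)"
proof -
 have "locally_compact_space (product_topology (%i. euclideanreal) {..<n})"
  unfolding locally_compact_space_product_topology using locally_compact_euclideanreal by auto
 then show ?thesis
  using homeomorphic_locally_compact_space[OF homeomorphic_Euclidean_space_product_topology] by blast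
qed

lemma Hausdorff_jet_domain:
 fixes E' :: "(real, 'g) tvs"
 assumes "lcs E'"
 shows "Hausdorff_space (jet_domain E' U k)"
proof -
 interpret E': lcs E' by fact
 show ?thesis unfolding jet_domain_def
  by (simp add: Hausdorff_space_prod_topology Hausdorff_space_product_topology
    Hausdorff_space_subtopology E'.hausdorff)
qed

text \<open>Only finitely many directions occur, so local compactness passes from the model space to
  the jets. Finite dimension of the base enters the topological arguments at this point.\<close>

lemma locally_compact_jet_domain:
 assumes "lcs E" "locally_compact_space (vtop E)" "openin (vtop E) U"
 shows "locally_compact_space (jet_domain E U k)"
proof -
 interpret E: lcs E by fact
 have "locally_compact_space (subtopology (vtop E) U)"
  using locally_compact_space_open_subset assms E.hausdorff by blast
 moreover have "locally_compact_space (product_topology (%_. vtop E) {..<k})"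
  unfolding locally_compact_space_product_topology using assms by auto
 ultimately show ?thesis unfolding jet_domain_def locally_compact_space_prod_topology by blast
qed

section \<open>Spaces with a compact-open topology\<close>

text \<open>The abstract situation behind both \<open>smooth_curves\<close> and \<open>section_algebra\<close>: elements are determined
 by continuous maps \<open>J i s\<close> on locally compact spaces, and carry the
 initial topology with respect to the compact-open topologies.\<close>

locale mapping_space =
 fixes X :: "(complex, 'x) tvs" and F :: "(complex, 'a) tvs" and I :: "'i set"
  and T :: "'i => 'p topology" and J :: "'i => 'x => 'p => 'a"
 assumes module: "Module.module scalars X" and lcs_F: "lcs F"
  and hausdorff: "!!i. i \<in> I ==> Hausdorff_space (T i)"
  and loc_compact: "!!i. i \<in> I ==> locally_compact_space (T i)"
  and J_cont: "!!i s. i \<in> I ==> s \<in> carrier X ==> continuous_map (T i) (vtop F) (J i s)"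
  and J_add: "!!i s t p. i \<in> I ==> s \<in> carrier X ==> t \<in> carrier X ==> p \<in> topspace (T i) ==>
   J i (s \<oplus>\<^bsub>X\<^esub> t) p = J i s p \<oplus>\<^bsub>F\<^esub> J i t p"
  and J_smult: "!!i c s p. i \<in> I ==> s \<in> carrier X ==> p \<in> topspace (T i) ==>
   J i (c \<odot>\<^bsub>X\<^esub> s) p = c \<odot>\<^bsub>F\<^esub> J i s p"
  and separating: "!!s t. s \<in> carrier X ==> t \<in> carrier X ==>
   (!!i p. i \<in> I ==> p \<in> topspace (T i) ==> J i s p = J i t p) ==> s = t"
  and top_eq: "vtop X = topology_generated_by (insert (carrier X)
   {{s \<in> carrier X. \<forall>p\<in>K. J i s p \<in> W} | i K W. i \<in> I \<and> compactin (T i) K \<and> openin (vtop F) W})"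
begin

sublocale vec X by (rule vec.intro[OF module])
interpretation F: lcs F by (rule lcs_F)

lemma topspace_X: "topspace (vtop X) = carrier X" unfolding top_eq topology_generated_by_topspace by auto

lemma openin_basic:
 "i \<in> I ==> compactin (T i) K ==> openin (vtop F) W ==>
  openin (vtop X) {s \<in> carrier X. \<forall>p\<in>K. J i s p \<in> W}"
 unfolding top_eq by (rule topology_generated_by_Basis) blast

text \<open>Local compactness gives a compact neighbourhood \<open>K\<close> of the point on which
  the given element already takes values in \<open>W\<close>; the elements mapping \<open>K\<close>
  into \<open>W\<close> form a basic open set. Together with \<open>continuous_map_into\<close> this
  is the exponential law.\<close>

lemma continuous_map_evaluation:
 assumes i: "i \<in> I"
 shows "continuous_map (prod_topology (vtop X) (T i)) (vtop F) (%(s, p). J i s p)" unfolding continuous_map_def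
proof (intro conjI allI impI)
 show "(%(s, p). J i s p) \<in> topspace (prod_topology (vtop X) (T i)) \<rightarrow> topspace (vtop F)"
  using J_cont[OF i] by (auto simp: topspace_X continuous_map_def Pi_iff)
 fix W assume W: "openin (vtop F) W"
 show "openin (prod_topology (vtop X) (T i)) {x \<in> topspace (prod_topology (vtop X) (T i)). (case x of (s, p) => J i s p) \<in> W}"
  unfolding openin_prod_topology_alt
 proof (intro allI impI)
  fix s p assume "(s, p) \<in> {x \<in> topspace (prod_topology (vtop X) (T i)). (case x of (s, p) => J i s p) \<in> W}"
  then have s: "s \<in> carrier X" and p: "p \<in> topspace (T i)" and JW: "J i s p \<in> W" by (auto simp: topspace_X)
  have nb: "neighbourhood_base_of (compactin (T i)) (T i)"
   using locally_compact_space_neighbourhood_base hausdorff[OF i] loc_compact[OF i] by blast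
  have "openin (T i) {q \<in> topspace (T i). J i s q \<in> W}"
   by (rule openin_continuous_map_preimage[OF J_cont[OF i s] W])
  then have "\<exists>U K. openin (T i) U \<and> compactin (T i) K \<and> p \<in> U \<and> U \<subseteq> K \<and>
    K \<subseteq> {q \<in> topspace (T i). J i s q \<in> W}"
   using p JW by (intro nb[unfolded neighbourhood_base_of, rule_format]) simp
  then obtain U K where UK: "openin (T i) U" "compactin (T i) K" "p \<in> U" "U \<subseteq> K"
    "K \<subseteq> {q \<in> topspace (T i). J i s q \<in> W}" by (elim exE conjE)
  show "\<exists>U V. openin (vtop X) U \<and> openin (T i) V \<and> s \<in> U \<and> p \<in> V \<and>
    U \<times> V \<subseteq> {x \<in> topspace (prod_topology (vtop X) (T i)). (case x of (s, p) => J i s p) \<in> W}"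
  proof (intro exI conjI)
   show "openin (vtop X) {s \<in> carrier X. \<forall>p\<in>K. J i s p \<in> W}" by (rule openin_basic[OF i UK(2) W])
   show "openin (T i) U" by fact
   show "s \<in> {s \<in> carrier X. \<forall>p\<in>K. J i s p \<in> W}" using s UK(5) by auto
   show "p \<in> U" by fact
   show "{s \<in> carrier X. \<forall>p\<in>K. J i s p \<in> W} \<times> U \<subseteq>
     {x \<in> topspace (prod_topology (vtop X) (T i)). (case x of (s, p) => J i s p) \<in> W}"
    using UK(4,5) by (auto simp: topspace_X)
  qed
 qed
qed

text \<open>For compact \<open>K\<close> the tube lemma shrinks an open set around
  \<open>{z} \<times> K\<close> to a neighbourhood of \<open>z\<close>. Continuity of operations on
  \<open>X\<close> thereby becomes joint continuity of the maps \<open>J i\<close>.\<close>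

lemma continuous_map_into:
 assumes \<Phi>: "!!z. z \<in> topspace Z ==> \<Phi> z \<in> carrier X"
  and J: "!!i. i \<in> I ==> continuous_map (prod_topology Z (T i)) (vtop F) (%(z, p). J i (\<Phi> z) p)"
 shows "continuous_map Z (vtop X) \<Phi>" unfolding top_eq
proof (rule continuous_on_generated_topo)
 show "\<Phi> ` topspace Z \<subseteq> \<Union> (insert (carrier X)
   {{s \<in> carrier X. \<forall>p\<in>K. J i s p \<in> W} | i K W. i \<in> I \<and> compactin (T i) K \<and> openin (vtop F) W})" using \<Phi> by auto
 fix N assume "N \<in> insert (carrier X)
   {{s \<in> carrier X. \<forall>p\<in>K. J i s p \<in> W} | i K W. i \<in> I \<and> compactin (T i) K \<and> openin (vtop F) W}"
 then consider "N = carrier X"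
  | i K W where "N = {s \<in> carrier X. \<forall>p\<in>K. J i s p \<in> W}" "i \<in> I" "compactin (T i) K" "openin (vtop F) W"
  by blast
 then show "openin Z (\<Phi> -` N \<inter> topspace Z)"
 proof cases
  case 1
  then have "\<Phi> -` N \<inter> topspace Z = topspace Z" using \<Phi> by auto
  then show ?thesis by simp
 next
  case 2
  let ?O = "{x \<in> topspace (prod_topology Z (T i)). (case x of (z, p) => J i (\<Phi> z) p) \<in> W}"
  have O: "openin (prod_topology Z (T i)) ?O" by (rule openin_continuous_map_preimage[OF J[OF 2(2)] 2(4)])
  show ?thesis
  proof (subst openin_subopen, intro ballI)
   fix z assume z: "z \<in> \<Phi> -` N \<inter> topspace Z"
   then have "{z} \<times> K \<subseteq> ?O" using 2 compactin_subset_topspace[OF 2(3)] by auto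
   then have "\<exists>U V. openin Z U \<and> openin (T i) V \<and> z \<in> U \<and> K \<subseteq> V \<and> U \<times> V \<subseteq> ?O"
    using z by (intro tube_lemma_right[OF O 2(3)]) simp
   then obtain U V where UV: "openin Z U" "openin (T i) V" "z \<in> U" "K \<subseteq> V" "U \<times> V \<subseteq> ?O" by (elim exE conjE)
   have "U \<subseteq> \<Phi> -` N \<inter> topspace Z"
   proof
    fix y assume y: "y \<in> U"
    then have "y \<in> topspace Z" using UV(1) openin_subset by blast
    moreover have "J i (\<Phi> y) p \<in> W" if "p \<in> K" for p using UV(4) y that subsetD[OF UV(5), of "(y, p)"] by auto
    ultimately show "y \<in> \<Phi> -` N \<inter> topspace Z" using \<Phi> 2(1) by auto
   qed
   then show "\<exists>T. openin Z T \<and> z \<in> T \<and> T \<subseteq> \<Phi> -` N \<inter> topspace Z" using UV by blast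
  qed
 qed
qed

lemma J_zero: "i \<in> I ==> p \<in> topspace (T i) ==> J i \<zero>\<^bsub>X\<^esub> p = \<zero>\<^bsub>F\<^esub>"
 using J_smult[of i "\<zero>\<^bsub>X\<^esub>" p 0] J_cont[of i "\<zero>\<^bsub>X\<^esub>"] by (auto simp: continuous_map_def Pi_iff)

lemma continuous_map_eval_param:
 assumes i: "i \<in> I" and a: "continuous_map Z (vtop X) a"
 shows "continuous_map (prod_topology Z (T i)) (vtop F) (%(z, p). J i (a z) p)"
proof -
 have "continuous_map (prod_topology Z (T i)) (prod_topology (vtop X) (T i)) (%x. (a (fst x), snd x))"
  using continuous_map_compose[OF continuous_map_fst a]
  by (intro continuous_map_pairedI continuous_map_snd) (simp add: o_def)
 from continuous_map_compose[OF this continuous_map_evaluation[OF i]] show ?thesis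
  by (simp add: o_def case_prod_unfold)
qed

text \<open>Induction over the generation of an open set from the subbasis. Convexity is stable
  under intersection, and for a subbasic set it is inherited from a convex neighbourhood in
  \<open>F\<close>, as the maps \<open>J i\<close> are linear in the element.\<close>

lemma convex_basis:
 assumes "generate_topology_on (insert (carrier X)
   {{s \<in> carrier X. \<forall>p\<in>K. J i s p \<in> W} | i K W. i \<in> I \<and> compactin (T i) K \<and> openin (vtop F) W}) O'"
  and "\<zero>\<^bsub>X\<^esub> \<in> O'"
 shows "\<exists>V. openin (vtop X) V \<and> \<zero>\<^bsub>X\<^esub> \<in> V \<and> V \<subseteq> O' \<and> (\<forall>x\<in>V. \<forall>y\<in>V. \<forall>t\<in>{0..1::real}.
     (of_real t \<odot>\<^bsub>X\<^esub> x) \<oplus>\<^bsub>X\<^esub> (of_real (1 - t) \<odot>\<^bsub>X\<^esub> y) \<in> V)" using assms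
proof (induction rule: generate_topology_on.induct)
 case Empty
 then show ?case by simp
next
 case (Int a b)
 from Int.IH(1) Int.prems obtain V where V: "openin (vtop X) V" "\<zero>\<^bsub>X\<^esub> \<in> V" "V \<subseteq> a"
   "\<forall>x\<in>V. \<forall>y\<in>V. \<forall>t\<in>{0..1::real}. (of_real t \<odot>\<^bsub>X\<^esub> x) \<oplus>\<^bsub>X\<^esub> (of_real (1 - t) \<odot>\<^bsub>X\<^esub> y) \<in> V" by auto
 from Int.IH(2) Int.prems obtain V' where V': "openin (vtop X) V'" "\<zero>\<^bsub>X\<^esub> \<in> V'" "V' \<subseteq> b"
   "\<forall>x\<in>V'. \<forall>y\<in>V'. \<forall>t\<in>{0..1::real}. (of_real t \<odot>\<^bsub>X\<^esub> x) \<oplus>\<^bsub>X\<^esub> (of_real (1 - t) \<odot>\<^bsub>X\<^esub> y) \<in> V'" by auto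
 show ?case using V V' by (intro exI[of _ "V \<inter> V'"]) auto
next
 case (UN \<K>)
 then obtain k where k: "k \<in> \<K>" "\<zero>\<^bsub>X\<^esub> \<in> k" by blast
 from UN.IH[OF k] show ?case using k(1) by (meson Union_upper order_trans)
next
 case (Basis s)
 then consider "s = carrier X"
  | i K W where "s = {s \<in> carrier X. \<forall>p\<in>K. J i s p \<in> W}" "i \<in> I" "compactin (T i) K" "openin (vtop F) W"
  by blast
 then show ?case
 proof cases
  case 1
  then show ?thesis using openin_topspace[of "vtop X"] by (intro exI[of _ "carrier X"]) (auto simp: topspace_X)
 next
  case 2
  show ?thesis
  \<comment> \<open>For empty \<open>K\<close> the condition is void and \<open>W\<close> may fail
    to contain zero, so no convex neighbourhood can be chosen inside it.\<close>
  proof (cases "K = {}")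
   case True
   then show ?thesis
    using openin_topspace[of "vtop X"] 2(1) by (intro exI[of _ "carrier X"]) (auto simp: topspace_X)
  next
   case False
   then obtain p where "p \<in> K" by blast
   then have "\<zero>\<^bsub>F\<^esub> \<in> W" using Basis.prems 2(1) J_zero[OF 2(2)] compactin_subset_topspace[OF 2(3)] by force
   then obtain V where V: "openin (vtop F) V" "\<zero>\<^bsub>F\<^esub> \<in> V" "V \<subseteq> W"
     "\<forall>x\<in>V. \<forall>y\<in>V. \<forall>t\<in>{0..1::real}. (of_real t \<odot>\<^bsub>F\<^esub> x) \<oplus>\<^bsub>F\<^esub> (of_real (1 - t) \<odot>\<^bsub>F\<^esub> y) \<in> V"
    using F.lcs 2(4) unfolding locally_convex_space_def by meson
   let ?V = "{s \<in> carrier X. \<forall>p\<in>K. J i s p \<in> V}"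
   have top: "p \<in> topspace (T i)" if "p \<in> K" for p using that compactin_subset_topspace[OF 2(3)] by blast
   have "(of_real t \<odot>\<^bsub>X\<^esub> x) \<oplus>\<^bsub>X\<^esub> (of_real (1 - t) \<odot>\<^bsub>X\<^esub> y) \<in> ?V"
    if "x \<in> ?V" "y \<in> ?V" "t \<in> {0..1}" for x y and t :: real
    using that V(4) by (auto simp: J_add J_smult 2(2) top simp del: of_real_diff)
   then show ?thesis using openin_basic[OF 2(2,3) V(1)] V(2,3) J_zero[OF 2(2) top] 2(1)
    by (intro exI[of _ ?V]) auto
  qed
 qed
qed

lemma lcs_mapping_space: "lcs X"
proof (rule locally_convex_spaceI[OF module topspace_X])
 show "Hausdorff_space (vtop X)" unfolding Hausdorff_space_def
 proof (intro allI impI)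
  fix s t assume st: "s \<in> topspace (vtop X) \<and> t \<in> topspace (vtop X) \<and> s \<noteq> t"
  then obtain i p where ip: "i \<in> I" "p \<in> topspace (T i)" "J i s p \<noteq> J i t p"
   using separating by (metis topspace_X)
  have ev: "continuous_map (vtop X) (vtop F) (%s. J i s p)"
  proof -
   have "continuous_map (vtop X) (prod_topology (vtop X) (T i)) (%s. (s, p))"
    using ip(2) by (intro continuous_map_pairedI) auto
   from continuous_map_compose[OF this continuous_map_evaluation[OF ip(1)]] show ?thesis by (simp add: o_def)
  qed
  have "J i s p \<in> topspace (vtop F)" "J i t p \<in> topspace (vtop F)"
   using ev st by (auto simp: continuous_map_def Pi_iff)
  then obtain U V where UV: "openin (vtop F) U" "openin (vtop F) V" "J i s p \<in> U" "J i t p \<in> V" "disjnt U V"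
   using F.hausdorff ip(3) unfolding Hausdorff_space_def by meson
  show "\<exists>U V. openin (vtop X) U \<and> openin (vtop X) V \<and> s \<in> U \<and> t \<in> V \<and> disjnt U V"
   using openin_continuous_map_preimage[OF ev UV(1)] openin_continuous_map_preimage[OF ev UV(2)] UV(3-5) st
   by (intro exI[of _ "{s \<in> topspace (vtop X). J i s p \<in> U}"] exI[of _ "{s \<in> topspace (vtop X). J i s p \<in> V}"])
     (auto simp: disjnt_def)
 qed
next
 let ?Z = "prod_topology (vtop X) (vtop X)"
 show "continuous_map ?Z (vtop X) (%(x, y). x \<oplus>\<^bsub>X\<^esub> y)"
 proof (rule continuous_map_into)
  fix i assume i: "i \<in> I"
  have "continuous_map (prod_topology ?Z (T i)) (vtop F) (%y. J i (fst (fst y)) (snd y) \<oplus>\<^bsub>F\<^esub> J i (snd (fst y)) (snd y))"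
   using continuous_map_eval_param[OF i continuous_map_fst[of "vtop X" "vtop X"]]
    continuous_map_eval_param[OF i continuous_map_snd[of "vtop X" "vtop X"]]
   by (intro F.continuous_map_vadd) (simp_all add: case_prod_unfold)
  then show "continuous_map (prod_topology ?Z (T i)) (vtop F) (%(z, p). J i (case z of (x, y) => x \<oplus>\<^bsub>X\<^esub> y) p)"
   by (rule continuous_map_eq) (auto simp: topspace_X J_add i)
 qed (auto simp: topspace_X)
next
 let ?Z = "prod_topology (euclidean :: complex topology) (vtop X)"
 show "continuous_map ?Z (vtop X) (%(c, x). c \<odot>\<^bsub>X\<^esub> x)"
 proof (rule continuous_map_into)
  fix i assume i: "i \<in> I"
  have "continuous_map (prod_topology ?Z (T i)) (vtop F) (%y. fst (fst y) \<odot>\<^bsub>F\<^esub> J i (snd (fst y)) (snd y))"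
   using continuous_map_eval_param[OF i continuous_map_snd[of euclidean "vtop X"]]
    continuous_map_compose[OF continuous_map_fst continuous_map_fst, of euclidean "vtop X" "T i"]
   by (intro F.continuous_map_vsmult) (simp_all add: case_prod_unfold o_def)
  then show "continuous_map (prod_topology ?Z (T i)) (vtop F) (%(z, p). J i (case z of (c, x) => c \<odot>\<^bsub>X\<^esub> x) p)"
   by (rule continuous_map_eq) (auto simp: topspace_X J_smult i)
 qed (auto simp: topspace_X)
next
 fix W assume "openin (vtop X) W" "\<zero>\<^bsub>X\<^esub> \<in> W"
 then show "\<exists>V. openin (vtop X) V \<and> \<zero>\<^bsub>X\<^esub> \<in> V \<and> V \<subseteq> W \<and> (\<forall>x\<in>V. \<forall>y\<in>V. \<forall>t\<in>{0..1::real}.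
     (of_real t \<odot>\<^bsub>X\<^esub> x) \<oplus>\<^bsub>X\<^esub> (of_real (1 - t) \<odot>\<^bsub>X\<^esub> y) \<in> V)"
  using convex_basis by (metis (no_types, lifting) openin_topology_generated_by top_eq)
qed

end

section \<open>Locally convex algebras\<close>

locale calg =
 fixes A :: "(complex, 'a, 'r) module_scheme" (structure)
 assumes calg: "complex_algebra A"
begin

sublocale vec A using calg by (intro vec.intro) (simp add: complex_algebra_def)

sublocale rg: ring A using calg by (simp add: complex_algebra_def)

lemma smult_mult_left: "a \<in> carrier A ==> b \<in> carrier A ==> (c \<odot> a) \<otimes> b = c \<odot> (a \<otimes> b)"
 and smult_mult_right: "a \<in> carrier A ==> b \<in> carrier A ==> a \<otimes> (c \<odot> b) = c \<odot> (a \<otimes> b)"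
 using calg by (simp_all add: complex_algebra_def)

lemma smult_nat_pow:
 assumes a: "a \<in> carrier A"
 shows "(c \<odot> a) [^] (n::nat) = (c ^ n) \<odot> (a [^] n)"
proof (induction n)
 case (Suc n)
 have "a [^] n \<in> carrier A" using a by simp
 then show ?case using Suc a by (simp add: smult_mult_left smult_mult_right smult_smult mult.commute)
qed simp

end

locale lca =
 fixes A :: "(complex, 'a, 'r) tvs_scheme" (structure)
 assumes lca: "locally_convex_algebra A"
begin

sublocale lcs A using lca by (intro lcs.intro) (simp add: locally_convex_algebra_def)

sublocale calg A using lca by (intro calg.intro) (simp add: locally_convex_algebra_def)

lemma continuous_mult: "continuous_map (prod_topology (vtop A) (vtop A)) (vtop A) (%(a, b). a \<otimes> b)"
 using lca by (simp add: locally_convex_algebra_def)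

lemma continuous_map_vmult:
 assumes "continuous_map Z (vtop A) f" "continuous_map Z (vtop A) g"
 shows "continuous_map Z (vtop A) (%z. f z \<otimes> g z)"
 using continuous_map_compose[OF continuous_map_pairedI[OF assms] continuous_mult] by (simp add: o_def)

end

lemma complex_algebraI:
 fixes R (structure)
 assumes "!!x y. x \<in> carrier R ==> y \<in> carrier R ==> x \<oplus> y \<in> carrier R" "\<zero> \<in> carrier R"
  "!!x y z. x \<in> carrier R ==> y \<in> carrier R ==> z \<in> carrier R ==> (x \<oplus> y) \<oplus> z = x \<oplus> (y \<oplus> z)"
  "!!x y. x \<in> carrier R ==> y \<in> carrier R ==> x \<oplus> y = y \<oplus> x"
  "!!x. x \<in> carrier R ==> \<zero> \<oplus> x = x"
  "!!x. x \<in> carrier R ==> (- 1) \<odot> x \<oplus> x = \<zero>"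
  "!!x y. x \<in> carrier R ==> y \<in> carrier R ==> x \<otimes> y \<in> carrier R" "\<one> \<in> carrier R"
  "!!x y z. x \<in> carrier R ==> y \<in> carrier R ==> z \<in> carrier R ==> (x \<otimes> y) \<otimes> z = x \<otimes> (y \<otimes> z)"
  "!!x. x \<in> carrier R ==> \<one> \<otimes> x = x" "!!x. x \<in> carrier R ==> x \<otimes> \<one> = x"
  "!!x y z. x \<in> carrier R ==> y \<in> carrier R ==> z \<in> carrier R ==> (x \<oplus> y) \<otimes> z = x \<otimes> z \<oplus> y \<otimes> z"
  "!!x y z. x \<in> carrier R ==> y \<in> carrier R ==> z \<in> carrier R ==> z \<otimes> (x \<oplus> y) = z \<otimes> x \<oplus> z \<otimes> y"
  "!!c x. x \<in> carrier R ==> c \<odot> x \<in> carrier R"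
  "!!a b x. x \<in> carrier R ==> (a + b) \<odot> x = a \<odot> x \<oplus> b \<odot> x"
  "!!a x y. x \<in> carrier R ==> y \<in> carrier R ==> a \<odot> (x \<oplus> y) = a \<odot> x \<oplus> a \<odot> y"
  "!!a b x. x \<in> carrier R ==> (a * b) \<odot> x = a \<odot> (b \<odot> x)"
  "!!x. x \<in> carrier R ==> 1 \<odot> x = x"
  "!!c a b. a \<in> carrier R ==> b \<in> carrier R ==> (c \<odot> a) \<otimes> b = c \<odot> (a \<otimes> b)"
  "!!c a b. a \<in> carrier R ==> b \<in> carrier R ==> a \<otimes> (c \<odot> b) = c \<odot> (a \<otimes> b)"
 shows "complex_algebra R"
proof -
 have ag: "abelian_group R"
 proof (rule abelian_groupI)
  fix x assume "x \<in> carrier R"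
  then show "\<exists>y\<in>carrier R. y \<oplus> x = \<zero>" using assms(6,14) by blast
 qed (use assms(1-5) in auto)
 have "monoid R" by (rule monoidI) (use assms(7-11) in auto)
 then have "ring R" using ag assms(12,13) by (intro ringI) auto
 moreover have "Module.module scalars R" by (rule module_scalarsI[OF ag]) (use assms(14-18) in auto)
 ultimately show ?thesis using assms(19,20) by (simp add: complex_algebra_def)
qed

text \<open>Extensional functions are determined by their values on \<open>D\<close>, so each axiom
  reduces to the axiom in the fibres. A constant fibre over all reals gives the smooth curves,
  varying fibres give the sections.\<close>

lemma pointwise_complex_algebra:
 fixes R :: "(complex, 'x => 'b, 'r) module_scheme" and F :: "'x => (complex, 'b, 's) module_scheme"
 assumes F: "!!x. x \<in> D ==> complex_algebra (F x)"
  and car: "carrier R \<subseteq> (\<Pi>\<^sub>E x\<in>D. carrier (F x))"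
  and ops: "mult R = (%s t. \<lambda>x\<in>D. s x \<otimes>\<^bsub>F x\<^esub> t x)" "one R = (\<lambda>x\<in>D. \<one>\<^bsub>F x\<^esub>)"
   "zero R = (\<lambda>x\<in>D. \<zero>\<^bsub>F x\<^esub>)" "add R = (%s t. \<lambda>x\<in>D. s x \<oplus>\<^bsub>F x\<^esub> t x)"
   "smult R = (%c s. \<lambda>x\<in>D. c \<odot>\<^bsub>F x\<^esub> s x)"
  and closed: "!!s t. s \<in> carrier R ==> t \<in> carrier R ==> s \<oplus>\<^bsub>R\<^esub> t \<in> carrier R"
   "!!s t. s \<in> carrier R ==> t \<in> carrier R ==> s \<otimes>\<^bsub>R\<^esub> t \<in> carrier R"
   "!!c s. s \<in> carrier R ==> c \<odot>\<^bsub>R\<^esub> s \<in> carrier R"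
   "\<zero>\<^bsub>R\<^esub> \<in> carrier R" "\<one>\<^bsub>R\<^esub> \<in> carrier R"
 shows "complex_algebra R"
proof -
 have c: "s x \<in> carrier (F x)" if "s \<in> carrier R" "x \<in> D" for s x using car that by (auto simp: PiE_def Pi_def)
 have v: "vec (F x)" and a: "calg (F x)" if "x \<in> D" for x
  using F[OF that] by (auto simp: vec_def calg_def complex_algebra_def)
 have ext: "s = t" if "s \<in> carrier R" "t \<in> carrier R" "!!x. x \<in> D ==> s x = t x" for s t
  using that car by (intro extensionalityI[of s D t]) (auto simp: PiE_def)
 have r: "ring (F x)" if "x \<in> D" for x using F[OF that] by (simp add: complex_algebra_def)
 have g: "abelian_group (F x)" if "x \<in> D" for x using r[OF that] by (simp add: ring_def)
 have mon: "monoid (F x)" if "x \<in> D" for x using r[OF that] by (simp add: ring_def)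
 note am = abelian_groupE[OF g]
 have neg: "(- 1) \<odot>\<^bsub>F x\<^esub> y \<oplus>\<^bsub>F x\<^esub> y = \<zero>\<^bsub>F x\<^esub>" if "x \<in> D" "y \<in> carrier (F x)" for x y
  using that vec.neg_eq[OF v[OF that(1)] that(2)] abelian_group.l_neg[OF g[OF that(1)] that(2)] by simp
 have neg': "y \<oplus>\<^bsub>F x\<^esub> (- 1) \<odot>\<^bsub>F x\<^esub> y = \<zero>\<^bsub>F x\<^esub>" if "x \<in> D" "y \<in> carrier (F x)" for x y
  using that vec.neg_eq[OF v[OF that(1)] that(2)] abelian_group.r_neg[OF g[OF that(1)] that(2)] by simp
 show ?thesis by (rule complex_algebraI; (rule closed | rule ext); (intro closed)?; (assumption)?)
    (auto simp: ops c neg neg' vec.smult_closed[OF v] vec.smult_add_left[OF v] vec.smult_add_right[OF v]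
     vec.smult_smult[OF v] vec.smult_1[OF v] calg.smult_mult_left[OF a] calg.smult_mult_right[OF a]
     monoid.m_assoc[OF mon] monoid.l_one[OF mon] monoid.r_one[OF mon]
     ring.ring_simprules[OF r] intro: am(4))
qed

section \<open>Smooth maps with values in a locally convex algebra\<close>

context
 fixes E :: "(real, 'e) tvs" and F :: "(real, 'f) tvs"
 assumes lE: "lcs E" and lF: "lcs F"
begin

interpretation E: lcs E by (rule lE)
interpretation F: lcs F by (rule lF)

lemma cont_linear_add: "cont_linear (prod_space F F) F (%(x, y). x \<oplus>\<^bsub>F\<^esub> y)" using F.continuous_add
 by (auto simp: cont_linear_def F.smult_add_right F.ag.a_ac)

text \<open>Addition is a continuous linear map on \<open>prod_space F F\<close>, so the rules for
  pairs and for linear maps apply.\<close>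

lemma smooth_on_add:
 assumes f: "smooth_on E F U f" and g: "smooth_on E F U g"
 shows "smooth_on E F U (%x. f x \<oplus>\<^bsub>F\<^esub> g x)"
  and "!!k x v. x \<in> U ==> (!!i. i < k ==> v i \<in> carrier E) ==>
   dir_deriv E F (%x. f x \<oplus>\<^bsub>F\<^esub> g x) k x v = dir_deriv E F f k x v \<oplus>\<^bsub>F\<^esub> dir_deriv E F g k x v"
proof -
 interpret lcs3 E "prod_space F F" F by (intro lcs3.intro lcs2.intro lE lF lcs_prod_space)
 note p = smooth_on_pair[OF lE lF lF f g]
 show "smooth_on E F U (%x. f x \<oplus>\<^bsub>F\<^esub> g x)" using smooth_on_linear_compose(1)[OF p(1) cont_linear_add] by simp
 show "dir_deriv E F (%x. f x \<oplus>\<^bsub>F\<^esub> g x) k x v = dir_deriv E F f k x v \<oplus>\<^bsub>F\<^esub> dir_deriv E F g k x v"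
  if "x \<in> U" "!!i. i < k ==> v i \<in> carrier E" for k x v
  using smooth_on_linear_compose(2)[OF p(1) cont_linear_add that] p(2)[OF that] by simp
qed

end

lemma smooth_family_reparam:
 assumes "lcs E" "lcs F" and f: "smooth_family Z E F U f" and a: "continuous_map Y Z a"
 shows "smooth_family Y E F U (%y. f (a y))"
proof -
 interpret EF: lcs2 E F by (intro lcs2.intro assms)
 let ?W = "%k. prod_topology Y (jet_domain E U k)"
 have "continuous_map (?W k) (vtop F) (%y. dir_deriv E F (f (a (fst y))) k (fst (snd y)) (snd (snd y)))" for k
 proof (rule EF.continuous_map_family_deriv[OF f])
  show "continuous_map (?W k) Z (%y. a (fst y))"
   using continuous_map_compose[OF continuous_map_fst a] by (simp add: o_def)
  show "continuous_map (?W k) (vtop E) (%y. fst (snd y))"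
   using continuous_map_compose[OF continuous_map_snd EF.continuous_map_jet_point] by (simp add: o_def)
  show "fst (snd y) \<in> U" if "y \<in> topspace (?W k)" for y
   using that by (cases y) (auto simp: EF.in_topspace_jet_domain)
  show "continuous_map (?W k) (vtop E) (%y. snd (snd y) i)" if "i < k" for i
   using continuous_map_compose[OF continuous_map_snd EF.continuous_map_jet_dir[OF that]] by (simp add: o_def)
 qed
 moreover have "a y \<in> topspace Z" if "y \<in> topspace Y" for y using a that by (auto simp: continuous_map_def)
 ultimately show ?thesis using f by (simp add: smooth_family_def case_prod_unfold)
qed

context
 fixes E :: "(real, 'e) tvs" and A :: "(complex, 'a) tvs"
 assumes lE: "lcs E" and lA: "lca A"
begin

interpretation A: lca A by (rule lA)
interpretation E: lcs E by (rule lE)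

lemma lcs_RA: "lcs (real_space A)" by (rule lcs_real_space[OF A.lcs_axioms])

lemma smooth_on_complex_linear:
 assumes f: "smooth_on E (real_space A) U f" and T: "continuous_map (vtop A) (vtop A) T"
  and add: "!!x y. x \<in> carrier A ==> y \<in> carrier A ==> T (x \<oplus>\<^bsub>A\<^esub> y) = T x \<oplus>\<^bsub>A\<^esub> T y"
  and smult: "!!c x. x \<in> carrier A ==> T (c \<odot>\<^bsub>A\<^esub> x) = c \<odot>\<^bsub>A\<^esub> T x"
 shows "smooth_on E (real_space A) U (%x. T (f x))"
  and "!!k x v. x \<in> U ==> (!!i. i < k ==> v i \<in> carrier E) ==>
   dir_deriv E (real_space A) (%x. T (f x)) k x v = T (dir_deriv E (real_space A) f k x v)"
proof -
 interpret lcs3 E "real_space A" "real_space A" by (intro lcs3.intro lcs2.intro lE lcs_RA)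
 have "cont_linear (real_space A) (real_space A) T" using T add smult by (simp add: cont_linear_def)
 from smooth_on_linear_compose[OF f this]
 show "smooth_on E (real_space A) U (%x. T (f x))"
  and "!!k x v. x \<in> U ==> (!!i. i < k ==> v i \<in> carrier E) ==>
   dir_deriv E (real_space A) (%x. T (f x)) k x v = T (dir_deriv E (real_space A) f k x v)" by blast+
qed

lemma smooth_on_csmult:
 assumes f: "smooth_on E (real_space A) U f"
 shows "smooth_on E (real_space A) U (%x. c \<odot>\<^bsub>A\<^esub> f x)"
  and "!!k x v. x \<in> U ==> (!!i. i < k ==> v i \<in> carrier E) ==>
   dir_deriv E (real_space A) (%x. c \<odot>\<^bsub>A\<^esub> f x) k x v = c \<odot>\<^bsub>A\<^esub> dir_deriv E (real_space A) f k x v"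
proof -
 have T: "continuous_map (vtop A) (vtop A) (%x. c \<odot>\<^bsub>A\<^esub> x)" by (rule A.continuous_map_vsmult) auto
 note * = smooth_on_complex_linear[OF f T]
 show "smooth_on E (real_space A) U (%x. c \<odot>\<^bsub>A\<^esub> f x)"
  by (rule *(1)) (simp_all add: A.smult_add_right A.smult_smult mult.commute)
 show "dir_deriv E (real_space A) (%x. c \<odot>\<^bsub>A\<^esub> f x) k x v = c \<odot>\<^bsub>A\<^esub> dir_deriv E (real_space A) f k x v"
  if "x \<in> U" "!!i. i < k ==> v i \<in> carrier E" for k x v
  by (rule *(2)) (simp_all add: A.smult_add_right A.smult_smult mult.commute that)
qed

lemma cont_bilinear_mult: "cont_bilinear (real_space A) (real_space A) (real_space A) (mult A)"
 using A.continuous_mult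
 by (simp add: cont_bilinear_def A.rg.l_distr A.rg.r_distr A.smult_mult_left A.smult_mult_right)

text \<open>Pairing followed by the bilinear product. Continuity of multiplication in the algebras
  of curves and of sections is derived from this.\<close>

lemma smooth_family_mult:
 assumes f: "smooth_family Z E (real_space A) U f" and g: "smooth_family Z E (real_space A) U g"
 shows "smooth_family Z E (real_space A) U (%z x. f z x \<otimes>\<^bsub>A\<^esub> g z x)"
proof -
 let ?RA = "real_space A"
 interpret EA: lcs2 E ?RA by (intro lcs2.intro lE lcs_RA)
 interpret lcs3 E "prod_space ?RA ?RA" ?RA by (intro lcs3.intro lcs2.intro lE lcs_RA lcs_prod_space)
 note m = smooth_on_bilinear[OF lcs_RA lcs_RA lcs_RA cont_bilinear_mult]
 have "smooth_family Z E ?RA U (%z x. (%(x, y). x \<otimes>\<^bsub>A\<^esub> y) (f z x, g z x))"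
 proof (rule smooth_family_compose[OF smooth_family_pair[OF lE lcs_RA lcs_RA f g] FG.smooth_family_const_param[OF m]])
  fix z x assume zx: "z \<in> topspace Z" "x \<in> U"
  show "(f z x, g z x) \<in> carrier (prod_space ?RA ?RA)"
   using EA.smooth_on_closed[OF EA.smooth_familyD[OF f zx(1)] zx(2)]
    EA.smooth_on_closed[OF EA.smooth_familyD[OF g zx(1)] zx(2)] by simp
 qed
 then show ?thesis by simp
qed

lemma smooth_on_mult:
 "smooth_on E (real_space A) U f ==> smooth_on E (real_space A) U g ==>
  smooth_on E (real_space A) U (%x. f x \<otimes>\<^bsub>A\<^esub> g x)"
proof -
 interpret EA: lcs2 E "real_space A" by (intro lcs2.intro lE lcs_RA)
 show "smooth_on E (real_space A) U f ==> smooth_on E (real_space A) U g ==>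
  smooth_on E (real_space A) U (%x. f x \<otimes>\<^bsub>A\<^esub> g x)"
  unfolding EA.smooth_on_iff_family by (rule smooth_family_mult)
qed

end

section \<open>The algebra of smooth curves\<close>

lemma smooth_curves_simps [simp]:
 "carrier (smooth_curves A) = {f. smooth_on real_line (real_space A) UNIV f}"
 "f \<otimes>\<^bsub>smooth_curves A\<^esub> g = (%t. f t \<otimes>\<^bsub>A\<^esub> g t)" "\<one>\<^bsub>smooth_curves A\<^esub> = (%_. \<one>\<^bsub>A\<^esub>)"
 "\<zero>\<^bsub>smooth_curves A\<^esub> = (%_. \<zero>\<^bsub>A\<^esub>)" "f \<oplus>\<^bsub>smooth_curves A\<^esub> g = (%t. f t \<oplus>\<^bsub>A\<^esub> g t)"
 "c \<odot>\<^bsub>smooth_curves A\<^esub> f = (%t. c \<odot>\<^bsub>A\<^esub> f t)" by (simp_all add: smooth_curves_def)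

context lca
begin

lemma lcs_real: "lcs (real_space A)" by (rule lcs_real_space[OF lcs_axioms])

end

context
 fixes A :: "(complex, 'a) tvs"
 assumes lA: "lca A"
begin

interpretation A: lca A by (rule lA)
interpretation RA: lcs2 real_line "real_space A" by (intro lcs2.intro lcs_real_line A.lcs_real)

abbreviation (input) "jet_curve k f p \<equiv> dir_deriv real_line (real_space A) f k (fst p) (snd p)"

lemma smooth_curve_closed: "f \<in> carrier (smooth_curves A) ==> f t \<in> carrier A"
 using RA.smooth_on_closed[of UNIV f t] by simp

lemma complex_algebra_smooth_curves: "complex_algebra (smooth_curves A)"
proof (rule pointwise_complex_algebra[where D = UNIV and F = "%_. A"])
 show "carrier (smooth_curves A) \<subseteq> UNIV \<rightarrow>\<^sub>E carrier A" using smooth_curve_closed by auto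
 fix s t and c assume s: "s \<in> carrier (smooth_curves A)"
 show "c \<odot>\<^bsub>smooth_curves A\<^esub> s \<in> carrier (smooth_curves A)"
  using s smooth_on_csmult(1)[OF lcs_real_line lA] by simp
 assume t: "t \<in> carrier (smooth_curves A)"
 show "s \<oplus>\<^bsub>smooth_curves A\<^esub> t \<in> carrier (smooth_curves A)"
  using s t smooth_on_add(1)[OF lcs_real_line A.lcs_real] by simp
 show "s \<otimes>\<^bsub>smooth_curves A\<^esub> t \<in> carrier (smooth_curves A)" using s t smooth_on_mult[OF lcs_real_line lA] by simp
next
 show "\<zero>\<^bsub>smooth_curves A\<^esub> \<in> carrier (smooth_curves A)" "\<one>\<^bsub>smooth_curves A\<^esub> \<in> carrier (smooth_curves A)"
  by (auto intro!: RA.smooth_on_const)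
qed (auto simp: smooth_curves_def A.calg restrict_def)

lemma mapping_space_smooth_curves:
 "mapping_space (smooth_curves A) A UNIV (jet_domain real_line UNIV) jet_curve"
proof (rule mapping_space.intro)
 show "Module.module scalars (smooth_curves A)"
  using complex_algebra_smooth_curves by (simp add: complex_algebra_def)
 show "lcs A" by (rule A.lcs_axioms)
 fix k :: nat
 show "Hausdorff_space (jet_domain real_line UNIV k)" by (rule Hausdorff_jet_domain[OF lcs_real_line])
 show "locally_compact_space (jet_domain real_line UNIV k)"
  by (rule locally_compact_jet_domain[OF lcs_real_line]) (auto simp: locally_compact_euclideanreal)
 fix s assume s: "s \<in> carrier (smooth_curves A)"
 show "continuous_map (jet_domain real_line UNIV k) (vtop A) (jet_curve k s)"
  using s by (auto simp: smooth_on_def case_prod_unfold)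
 fix p c assume p: "p \<in> topspace (jet_domain real_line UNIV k)"
 show "jet_curve k (c \<odot>\<^bsub>smooth_curves A\<^esub> s) p = c \<odot>\<^bsub>A\<^esub> jet_curve k s p"
  using s smooth_on_csmult(2)[OF lcs_real_line lA] by simp
 fix t assume t: "t \<in> carrier (smooth_curves A)"
 show "jet_curve k (s \<oplus>\<^bsub>smooth_curves A\<^esub> t) p = jet_curve k s p \<oplus>\<^bsub>A\<^esub> jet_curve k t p"
  using s t smooth_on_add(2)[OF lcs_real_line A.lcs_real] by simp
next
 fix s t :: "real => 'a"
 assume eq: "!!i p. i \<in> UNIV ==> p \<in> topspace (jet_domain real_line UNIV i) ==> jet_curve i s p = jet_curve i t p"
 \<comment> \<open>Jets of order zero are the values. There are no directions, and
   \<open>%_. undefined\<close> is the extensional function on the empty index set.\<close>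
 have "s x = t x" for x using eq[of 0 "(x, %_. undefined)"] by (simp add: RA.in_topspace_jet_domain)
 then show "s = t" by blast
next
 let ?S = "{{f \<in> N. smooth_on real_line (real_space A) UNIV f} |N. N \<in> smooth_co_subbasis real_line (real_space A) UNIV}"
 let ?T = "{{s \<in> carrier (smooth_curves A). \<forall>p\<in>K. jet_curve i s p \<in> W} |i K W.
   i \<in> UNIV \<and> compactin (jet_domain real_line UNIV i) K \<and> openin (vtop A) W}"
 have TS: "?T \<subseteq> ?S"
 proof
  fix N assume "N \<in> ?T"
  then obtain i K W where N: "N = {s \<in> carrier (smooth_curves A). \<forall>p\<in>K. jet_curve i s p \<in> W}"
    "compactin (jet_domain real_line UNIV i) K" "openin (vtop A) W" by blast
  have "N = {f \<in> {f. \<forall>(x, v)\<in>K. dir_deriv real_line (real_space A) f i x v \<in> W}.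
    smooth_on real_line (real_space A) UNIV f}" using N(1) by auto
  moreover have "{f. \<forall>(x, v)\<in>K. dir_deriv real_line (real_space A) f i x v \<in> W} \<in> smooth_co_subbasis real_line (real_space A) UNIV"
   unfolding smooth_co_subbasis_def using N(2,3) by auto
  ultimately show "N \<in> ?S" by blast
 qed
 have ST: "?S \<subseteq> ?T"
 proof
  fix N assume "N \<in> ?S"
  then obtain k K W where N: "N = {f \<in> {f. \<forall>(x, v)\<in>K. dir_deriv real_line (real_space A) f k x v \<in> W}.
    smooth_on real_line (real_space A) UNIV f}"
    "compactin (jet_domain real_line UNIV k) K" "openin (vtop A) W" unfolding smooth_co_subbasis_def by auto
  have "N = {s \<in> carrier (smooth_curves A). \<forall>p\<in>K. jet_curve k s p \<in> W}" using N(1) by auto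
  with N(2,3) show "N \<in> ?T" by blast
 qed
 \<comment> \<open>The empty compact set imposes no condition, so the carrier is itself subbasic and
   inserting it changes nothing.\<close>
 have cT: "carrier (smooth_curves A) \<in> ?T"
  by (rule CollectI, intro exI[of _ "0::nat"] exI[of _ "{}"] exI[of _ "{}"]) auto
 have "insert (carrier (smooth_curves A)) ?T = ?S"
  using equalityI[OF TS ST] insert_absorb[OF cT] by (simp only:)
 then show "vtop (smooth_curves A) = topology_generated_by (insert (carrier (smooth_curves A)) ?T)"
  by (simp add: smooth_curves_def)
qed

interpretation ms: mapping_space "smooth_curves A" A UNIV "jet_domain real_line UNIV" jet_curve
 by (rule mapping_space_smooth_curves)

text \<open>The tautological family, parametrized by the curves themselves. Reparametrization turns
  any continuous map into the space of curves into a smooth family.\<close>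

lemma smooth_family_curves: "smooth_family (vtop (smooth_curves A)) real_line (real_space A) UNIV (%f. f)"
 using ms.continuous_map_evaluation by (auto simp: smooth_family_def case_prod_unfold ms.topspace_X)

lemma lca_smooth_curves: "lca (smooth_curves A)"
proof -
 let ?R = "smooth_curves A"
 let ?Z = "prod_topology (vtop ?R) (vtop ?R)"
 have "continuous_map ?Z (vtop ?R) (%(f, g). f \<otimes>\<^bsub>?R\<^esub> g)"
 proof (rule ms.continuous_map_into)
  fix z assume z: "z \<in> topspace ?Z"
  interpret calg ?R by (rule calg.intro[OF complex_algebra_smooth_curves])
  show "(case z of (f, g) => f \<otimes>\<^bsub>?R\<^esub> g) \<in> carrier ?R"
   using z rg.m_closed by (cases z) (simp only: topspace_prod_topology ms.topspace_X mem_Times_iff case_prod_conv fst_conv snd_conv)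
 next
  fix k :: nat
  have "smooth_family ?Z real_line (real_space A) UNIV (%z x. fst z x \<otimes>\<^bsub>A\<^esub> snd z x)"
   by (intro smooth_family_mult[OF lcs_real_line lA]
     smooth_family_reparam[OF lcs_real_line A.lcs_real smooth_family_curves] continuous_map_fst continuous_map_snd)
  then show "continuous_map (prod_topology ?Z (jet_domain real_line UNIV k)) (vtop A)
    (%(z, p). jet_curve k (case z of (f, g) => f \<otimes>\<^bsub>?R\<^esub> g) p)" by (simp add: smooth_family_def case_prod_unfold)
 qed
 then show ?thesis using ms.lcs_mapping_space complex_algebra_smooth_curves
  by (simp add: lca_def locally_convex_algebra_def lcs_def)
qed

text \<open>Composition with \<open>T\<close> applies \<open>T\<close> to every derivative, so joint
  continuity of the jets is preserved. In the localization \<open>T\<close> is one of the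
  automorphisms \<open>\<alpha> g\<close>.\<close>

lemma smooth_curves_push:
 assumes T: "continuous_map (vtop A) (vtop A) T"
  and add: "!!x y. x \<in> carrier A ==> y \<in> carrier A ==> T (x \<oplus>\<^bsub>A\<^esub> y) = T x \<oplus>\<^bsub>A\<^esub> T y"
  and smult: "!!c x. x \<in> carrier A ==> T (c \<odot>\<^bsub>A\<^esub> x) = c \<odot>\<^bsub>A\<^esub> T x"
 shows "continuous_map (vtop (smooth_curves A)) (vtop (smooth_curves A)) (%f. T \<circ> f)"
proof (rule ms.continuous_map_into)
 let ?R = "smooth_curves A"
 note * = smooth_on_complex_linear[OF lcs_real_line lA _ T add smult]
 show "T \<circ> f \<in> carrier ?R" if "f \<in> topspace (vtop ?R)" for f
  using that *(1)[of UNIV f] by (simp add: ms.topspace_X o_def)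
 fix k :: nat
 have "continuous_map (prod_topology (vtop ?R) (jet_domain real_line UNIV k)) (vtop A)
   (T \<circ> (%(f, p). jet_curve k f p))" by (intro continuous_map_compose[OF _ T] ms.continuous_map_evaluation) simp
 then show "continuous_map (prod_topology (vtop ?R) (jet_domain real_line UNIV k)) (vtop A)
   (%(f, p). jet_curve k (T \<circ> f) p)"
 proof (rule continuous_map_eq)
  fix y assume "y \<in> topspace (prod_topology (vtop ?R) (jet_domain real_line UNIV k))"
  then have "smooth_on real_line (real_space A) UNIV (fst y)" by (cases y) (simp add: ms.topspace_X)
  then show "(T \<circ> (%(f, p). jet_curve k f p)) y = (%(f, p). jet_curve k (T \<circ> f) p) y"
   using *(2)[of UNIV "fst y"] by (simp add: case_prod_unfold o_def)
 qed
qed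

lemma linear_curve:
 assumes "w \<in> carrier A"
 shows "(%t. complex_of_real t \<odot>\<^bsub>A\<^esub> w) \<in> carrier (smooth_curves A)"
proof -
 have "continuous_map euclideanreal (vtop A) (%t. complex_of_real t \<odot>\<^bsub>A\<^esub> w)"
  by (rule A.continuous_map_vsmult) (use assms in \<open>auto intro!: continuous_intros\<close>)
 then have "cont_linear real_line (real_space A) (%t. complex_of_real t \<odot>\<^bsub>A\<^esub> w)"
  using assms by (simp add: cont_linear_def A.smult_add_left A.smult_smult)
 then show ?thesis using smooth_on_linear[OF lcs_real_line A.lcs_real] by simp
qed

end

section \<open>Quotients by closed ideals\<close>

text \<open>A product of quotient maps need not be a quotient map, but a product of open surjections
  is open. This yields joint continuity of the operations of a quotient algebra.\<close>

lemma continuous_map_from_open_quotients: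
 assumes q1: "open_map X1 Y1 q1" "continuous_map X1 Y1 q1" "q1 ` topspace X1 = topspace Y1"
  and q2: "open_map X2 Y2 q2" "continuous_map X2 Y2 q2" "q2 ` topspace X2 = topspace Y2"
  and f: "continuous_map (prod_topology X1 X2) W (%(x, y). f (q1 x, q2 y))"
 shows "continuous_map (prod_topology Y1 Y2) W f" unfolding continuous_map_def
proof (intro conjI allI impI)
 have fW: "f (q1 x, q2 y) \<in> topspace W" if "x \<in> topspace X1" "y \<in> topspace X2" for x y
  using f that by (auto simp: continuous_map_def Pi_iff)
 then show "f \<in> topspace (prod_topology Y1 Y2) \<rightarrow> topspace W" by (auto simp: q1(3)[symmetric] q2(3)[symmetric])
 fix U assume U: "openin W U"
 let ?O = "{p \<in> topspace (prod_topology X1 X2). (case p of (x, y) => f (q1 x, q2 y)) \<in> U}"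
 have O: "openin (prod_topology X1 X2) ?O" by (rule openin_continuous_map_preimage[OF f U])
 show "openin (prod_topology Y1 Y2) {x \<in> topspace (prod_topology Y1 Y2). f x \<in> U}"
  unfolding openin_prod_topology_alt
 proof (intro allI impI)
  fix a b assume "(a, b) \<in> {x \<in> topspace (prod_topology Y1 Y2). f x \<in> U}"
  then have ab: "a \<in> topspace Y1" "b \<in> topspace Y2" "f (a, b) \<in> U" by auto
  then obtain x y where xy: "x \<in> topspace X1" "a = q1 x" "y \<in> topspace X2" "b = q2 y" using q1(3) q2(3) by blast
  then have "(x, y) \<in> ?O" using ab by simp
  from O[unfolded openin_prod_topology_alt, rule_format, OF this]
  obtain U1 U2 where U12: "openin X1 U1" "openin X2 U2" "x \<in> U1" "y \<in> U2" "U1 \<times> U2 \<subseteq> ?O" by (elim exE conjE)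
  have "q1 ` U1 \<times> q2 ` U2 \<subseteq> {x \<in> topspace (prod_topology Y1 Y2). f x \<in> U}"
  proof
   fix p assume "p \<in> q1 ` U1 \<times> q2 ` U2"
   then obtain u v where uv: "p = (q1 u, q2 v)" "u \<in> U1" "v \<in> U2" by auto
   then have "(u, v) \<in> ?O" using U12(5) by blast
   then show "p \<in> {x \<in> topspace (prod_topology Y1 Y2). f x \<in> U}" using uv q1(3) q2(3) by auto
  qed
  moreover have "openin Y1 (q1 ` U1)" "openin Y2 (q2 ` U2)"
   using q1(1) q2(1) U12 by (simp_all add: open_map_def)
  ultimately show "\<exists>U' V. openin Y1 U' \<and> openin Y2 V \<and> a \<in> U' \<and> b \<in> V \<and>
    U' \<times> V \<subseteq> {x \<in> topspace (prod_topology Y1 Y2). f x \<in> U}"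
   using xy U12(3,4) by (intro exI[of _ "q1 ` U1"] exI[of _ "q2 ` U2"]) simp
 qed
qed

text \<open>The axioms are equations and descend along a surjection compatible with the operations.
  Applied to quotients by ideals and to the fibres of the pull-back.\<close>

lemma surj_complex_algebra:
 fixes R :: "(complex, 'x, 'r) module_scheme" and Q :: "(complex, 'y, 's) module_scheme"
 assumes R: "complex_algebra R" and surj: "carrier Q = h ` carrier R"
  and hom: "!!x y. x \<in> carrier R ==> y \<in> carrier R ==> h x \<oplus>\<^bsub>Q\<^esub> h y = h (x \<oplus>\<^bsub>R\<^esub> y)"
   "!!x y. x \<in> carrier R ==> y \<in> carrier R ==> h x \<otimes>\<^bsub>Q\<^esub> h y = h (x \<otimes>\<^bsub>R\<^esub> y)"
   "!!c x. x \<in> carrier R ==> c \<odot>\<^bsub>Q\<^esub> h x = h (c \<odot>\<^bsub>R\<^esub> x)"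
   "\<zero>\<^bsub>Q\<^esub> = h \<zero>\<^bsub>R\<^esub>" "\<one>\<^bsub>Q\<^esub> = h \<one>\<^bsub>R\<^esub>"
 shows "complex_algebra Q"
proof -
 interpret calg R by (rule calg.intro[OF R])
 have neg: "(- 1) \<odot>\<^bsub>R\<^esub> x \<oplus>\<^bsub>R\<^esub> x = \<zero>\<^bsub>R\<^esub>" if "x \<in> carrier R" for x using neg_eq[OF that] ag.l_neg[OF that] by simp
 show ?thesis
 proof (rule complex_algebraI)
  fix x y assume "x \<in> carrier Q" "y \<in> carrier Q"
  then obtain a b where "a \<in> carrier R" "b \<in> carrier R" "x = h a" "y = h b" unfolding surj by blast
  then show "x \<oplus>\<^bsub>Q\<^esub> y = y \<oplus>\<^bsub>Q\<^esub> x" by (simp add: hom ag.a_comm)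
 qed (unfold surj, auto simp: hom neg smult_add_left smult_add_right smult_smult smult_mult_left
   smult_mult_right rg.m_assoc rg.l_distr rg.r_distr ag.a_assoc)
qed

text \<open>Closedness of the ideal is what makes the quotient Hausdorff.\<close>

locale lca_ideal = lca R for R :: "(complex, 'x) tvs" (structure) +
 fixes I
 assumes ideal: "ideal I R" and closed: "closedin (vtop R) I"
begin

abbreviation "Q \<equiv> quotient_algebra R I"
abbreviation q where "q x \<equiv> I +> x"

interpretation I: ideal I R by (rule ideal)

lemma I_sub: "x \<in> I ==> x \<in> carrier R" using I.a_subset by blast

lemma coset_eq: "q x = (%i. i \<oplus> x) ` I" by (auto simp: a_r_coset_def')

text \<open>A ring ideal of a unital algebra is a linear subspace, because a scalar acts as
  multiplication by its multiple of the unit.\<close>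

lemma I_smult:
 assumes "x \<in> I"
 shows "c \<odot> x \<in> I"
proof -
 have "(c \<odot> \<one>) \<otimes> x \<in> I" using assms by (intro I.I_l_closed) auto
 then show ?thesis using I_sub[OF assms] by (simp add: smult_mult_left)
qed

lemma q_eq_iff:
 assumes "x \<in> carrier R" "y \<in> carrier R"
 shows "q x = q y \<longleftrightarrow> x \<ominus> y \<in> I"
proof
 assume "q x = q y"
 moreover have "x \<in> q x" unfolding coset_eq using assms I.zero_closed by (intro image_eqI[of _ _ \<zero>]) auto
 ultimately obtain i where "i \<in> I" "x = i \<oplus> y" unfolding coset_eq by auto
 then show "x \<ominus> y \<in> I" using assms I_sub by simp
next
 assume i: "x \<ominus> y \<in> I"
 have "\<ominus> (x \<ominus> y) = y \<ominus> x" using assms by (simp add: neg_eq diff_eq smult_add_right smult_smult ag.a_comm)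
 then have x: "x = (x \<ominus> y) \<oplus> y" and y: "y = (\<ominus> (x \<ominus> y)) \<oplus> x" using assms by simp_all
 have e: "h \<oplus> x = (h \<oplus> (x \<ominus> y)) \<oplus> y" "h \<oplus> y = (h \<oplus> (\<ominus> (x \<ominus> y))) \<oplus> x" if "h \<in> I" for h
  using assms I_sub[OF that] by (simp_all only: ag.a_assoc diff_closed ag.a_inv_closed x[symmetric] y[symmetric])
 have m: "h \<oplus> (x \<ominus> y) \<in> I" "h \<oplus> (\<ominus> (x \<ominus> y)) \<in> I" if "h \<in> I" for h
  using that i by (auto intro: I.a_closed I.a_inv_closed)
 show "q x = q y" unfolding coset_eq
 proof (intro equalityI subsetI; elim imageE; hypsubst)
  fix h assume h: "h \<in> I"
  show "h \<oplus> x \<in> (%i. i \<oplus> y) ` I"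
   by (rule image_eqI[of _ _ "h \<oplus> (x \<ominus> y)"]) (simp_all only: e(1)[OF h] m(1)[OF h])
  show "h \<oplus> y \<in> (%i. i \<oplus> x) ` I"
   by (rule image_eqI[of _ _ "h \<oplus> (\<ominus> (x \<ominus> y))"]) (simp_all only: e(2)[OF h] m(2)[OF h])
 qed
qed

lemma carrier_Q: "carrier Q = q ` carrier R" by (auto simp: quotient_algebra_def FactRing_def A_RCOSETS_def')

lemma Q_add: "x \<in> carrier R ==> y \<in> carrier R ==> q x \<oplus>\<^bsub>Q\<^esub> q y = q (x \<oplus> y)"
 using ring_hom_add[OF I.rcos_ring_hom] by (simp add: quotient_algebra_def)

lemma Q_mult: "x \<in> carrier R ==> y \<in> carrier R ==> q x \<otimes>\<^bsub>Q\<^esub> q y = q (x \<otimes> y)"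
 using ring_hom_mult[OF I.rcos_ring_hom] by (simp add: quotient_algebra_def)

lemma Q_one: "\<one>\<^bsub>Q\<^esub> = q \<one>" using ring_hom_one[OF I.rcos_ring_hom] by (simp add: quotient_algebra_def)

text \<open>The quotient defines scalar multiplication as a union over representatives. All of them
  give the same coset, as the ideal is a linear subspace.\<close>

lemma Q_smult:
 assumes x: "x \<in> carrier R"
 shows "c \<odot>\<^bsub>Q\<^esub> q x = q (c \<odot> x)"
proof -
 have "q (c \<odot> y) = q (c \<odot> x)" if yq: "y \<in> q x" for y
 proof -
  obtain i where i: "i \<in> I" "y = i \<oplus> x" using yq unfolding coset_eq by auto
  then have "c \<odot> y \<ominus> c \<odot> x = c \<odot> i" using x I_sub by (simp add: smult_add_right)
  then show ?thesis using i x I_sub I_smult by (simp add: q_eq_iff)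
 qed
 moreover have "x \<in> q x" unfolding coset_eq using x I.zero_closed by (intro image_eqI[of _ _ \<zero>]) auto
 ultimately have "(\<Union>y\<in>q x. q (c \<odot> y)) = q (c \<odot> x)" by blast
 then show ?thesis by (simp add: quotient_algebra_def)
qed

lemma Q_zero: "\<zero>\<^bsub>Q\<^esub> = q \<zero>"
proof -
 have "q \<zero> = I" unfolding coset_eq using I_sub by (auto simp: image_iff)
 then show ?thesis by (simp add: quotient_algebra_def FactRing_def)
qed

lemma complex_algebra_Q: "complex_algebra Q"
 by (rule surj_complex_algebra[OF calg carrier_Q Q_add Q_mult Q_smult Q_zero Q_one])

lemma openin_Q: "openin (vtop Q) V \<longleftrightarrow> V \<subseteq> carrier Q \<and> openin (vtop R) {x \<in> carrier R. q x \<in> V}"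
proof -
 have "openin (vtop Q) = (%V. V \<subseteq> carrier (R Quot I) \<and> openin (vtop R) {x \<in> topspace (vtop R). q x \<in> V})"
  unfolding quotient_algebra_def by (simp add: topology_inverse'[OF istopology_quotient] del: topspace_eq)
 then show ?thesis by (simp add: quotient_algebra_def)
qed

lemma topspace_Q: "topspace (vtop Q) = carrier Q"
proof -
 have "openin (vtop Q) (carrier Q)"
 proof -
  have "{x \<in> carrier R. q x \<in> carrier Q} = topspace (vtop R)" by (auto simp: carrier_Q)
  then show ?thesis unfolding openin_Q by (metis openin_topspace order_refl)
 qed
 then show ?thesis using openin_subset openin_topspace openin_Q by blast
qed

lemma q_continuous: "continuous_map (vtop R) (vtop Q) q"
 unfolding continuous_map_def by (auto simp: topspace_Q carrier_Q openin_Q)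

text \<open>The saturation of an open set is the union of its translates by elements of the
  ideal.\<close>

lemma q_open: "open_map (vtop R) (vtop Q) q" unfolding open_map_def
proof (intro allI impI)
 fix U assume U: "openin (vtop R) U"
 have sub: "U \<subseteq> carrier R" using openin_subset[OF U] by simp
 have "{x \<in> carrier R. q x \<in> q ` U} = (\<Union>i\<in>I. {x \<in> topspace (vtop R). x \<oplus> i \<in> U})"
 proof (intro equalityI subsetI)
  fix x assume "x \<in> {x \<in> carrier R. q x \<in> q ` U}"
  then obtain u where u: "x \<in> carrier R" "u \<in> U" "q u = q x" by auto
  then have "u \<ominus> x \<in> I" using sub q_eq_iff by blast
  moreover have "x \<oplus> (u \<ominus> x) = u" using u sub by (subst ag.a_comm) auto
  ultimately show "x \<in> (\<Union>i\<in>I. {x \<in> topspace (vtop R). x \<oplus> i \<in> U})" using u by (intro UN_I[of "u \<ominus> x"]) auto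
 next
  fix x assume "x \<in> (\<Union>i\<in>I. {x \<in> topspace (vtop R). x \<oplus> i \<in> U})"
  then obtain i where i: "i \<in> I" "x \<in> carrier R" "x \<oplus> i \<in> U" by auto
  then have "(x \<oplus> i) \<ominus> x = i" using I_sub by (intro diff_eqI) (simp_all add: ag.a_comm)
  then have "q (x \<oplus> i) = q x" using i I_sub by (simp add: q_eq_iff)
  then show "x \<in> {x \<in> carrier R. q x \<in> q ` U}" using i by (auto intro: image_eqI[of _ _ "x \<oplus> i"])
 qed
 moreover have "openin (vtop R) {x \<in> topspace (vtop R). x \<oplus> i \<in> U}" if "i \<in> I" for i
 proof (rule openin_continuous_map_preimage[OF _ U])
  show "continuous_map (vtop R) (vtop R) (%x. x \<oplus> i)"
   by (intro continuous_map_vadd) (use I_sub[OF that] in auto)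
 qed
 ultimately have "openin (vtop R) {x \<in> carrier R. q x \<in> q ` U}" by (auto intro: openin_Union)
 then show "openin (vtop Q) (q ` U)" using sub by (auto simp: openin_Q carrier_Q)
qed

lemma q_surj: "q ` topspace (vtop R) = topspace (vtop Q)" by (simp add: topspace_Q carrier_Q)

lemmas q_quot = q_open q_continuous q_surj

lemma lca_Q: "lca Q"
proof -
 have "lcs Q"
 proof (rule locally_convex_spaceI)
  show "Module.module scalars Q" using complex_algebra_Q by (simp add: complex_algebra_def)
  show "topspace (vtop Q) = carrier Q" by (rule topspace_Q)
  show "Hausdorff_space (vtop Q)" unfolding Hausdorff_space_def
  proof (intro allI impI)
   fix X Y assume "X \<in> topspace (vtop Q) \<and> Y \<in> topspace (vtop Q) \<and> X \<noteq> Y"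
   then obtain x y where xy: "x \<in> carrier R" "y \<in> carrier R" "X = q x" "Y = q y" "q x \<noteq> q y"
    unfolding topspace_Q carrier_Q by blast
   \<comment> \<open>Pairs whose difference avoids the closed ideal form an open set. An open
     rectangle inside it has factors with disjoint images in the quotient.\<close>
   let ?O = "{p \<in> topspace (prod_topology (vtop R) (vtop R)). (case p of (u, v) => u \<ominus> v) \<in> topspace (vtop R) - I}"
   have "continuous_map (prod_topology (vtop R) (vtop R)) (vtop R) (%p. fst p \<ominus> snd p)"
    by (intro continuous_map_vdiff continuous_map_fst continuous_map_snd)
   then have O: "openin (prod_topology (vtop R) (vtop R)) ?O"
    using closed by (intro openin_continuous_map_preimage) (auto simp: case_prod_unfold closedin_def)
   have "(x, y) \<in> ?O" using xy q_eq_iff by auto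
   from O[unfolded openin_prod_topology_alt, rule_format, OF this]
   obtain U V where UV: "openin (vtop R) U" "openin (vtop R) V" "x \<in> U" "y \<in> V" "U \<times> V \<subseteq> ?O" by (elim exE conjE)
   have "disjnt (q ` U) (q ` V)" unfolding disjnt_def
   proof (rule ccontr)
    assume "q ` U \<inter> q ` V \<noteq> {}"
    then obtain u v where uv: "u \<in> U" "v \<in> V" "q u = q v" by blast
    have "(u, v) \<in> ?O" using UV(5) uv by blast
    then have "u \<in> carrier R" "v \<in> carrier R" "u \<ominus> v \<notin> I" by auto
    then show False using uv(3) q_eq_iff by blast
   qed
   then show "\<exists>U V. openin (vtop Q) U \<and> openin (vtop Q) V \<and> X \<in> U \<and> Y \<in> V \<and> disjnt U V"
    using q_open UV xy by (intro exI[of _ "q ` U"] exI[of _ "q ` V"]) (auto simp: open_map_def)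
  qed
  show "continuous_map (prod_topology (vtop Q) (vtop Q)) (vtop Q) (%(x, y). x \<oplus>\<^bsub>Q\<^esub> y)"
  proof (rule continuous_map_from_open_quotients[OF q_quot q_quot])
   have "continuous_map (prod_topology (vtop R) (vtop R)) (vtop Q) (q \<circ> (%(x, y). x \<oplus> y))"
    by (rule continuous_map_compose[OF continuous_add q_continuous])
   then show "continuous_map (prod_topology (vtop R) (vtop R)) (vtop Q) (%(x, y). (case (q x, q y) of (x, y) => x \<oplus>\<^bsub>Q\<^esub> y))"
    by (rule continuous_map_eq) (auto simp: Q_add)
  qed
  have id: "open_map (euclidean :: complex topology) euclidean (%x. x)" "continuous_map (euclidean :: complex topology) euclidean (%x. x)"
    "(%x. x) ` topspace (euclidean :: complex topology) = topspace euclidean" by (auto simp: open_map_def)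
  show "continuous_map (prod_topology euclidean (vtop Q)) (vtop Q) (%(c, x). c \<odot>\<^bsub>Q\<^esub> x)"
  proof (rule continuous_map_from_open_quotients[OF id q_quot])
   have "continuous_map (prod_topology euclidean (vtop R)) (vtop Q) (q \<circ> (%(c, x). c \<odot> x))"
    by (rule continuous_map_compose[OF continuous_smult q_continuous])
   then show "continuous_map (prod_topology euclidean (vtop R)) (vtop Q) (%(c, y). (case (c, q y) of (c, x) => c \<odot>\<^bsub>Q\<^esub> x))"
    by (rule continuous_map_eq) (auto simp: Q_smult)
  qed
  fix W assume W: "openin (vtop Q) W" "\<zero>\<^bsub>Q\<^esub> \<in> W"
  then have "openin (vtop R) {x \<in> carrier R. q x \<in> W}" "\<zero> \<in> {x \<in> carrier R. q x \<in> W}"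
   by (auto simp: openin_Q Q_zero)
  then obtain V where V: "openin (vtop R) V" "\<zero> \<in> V" "V \<subseteq> {x \<in> carrier R. q x \<in> W}"
    "\<forall>x\<in>V. \<forall>y\<in>V. \<forall>t\<in>{0..1::real}. (of_real t \<odot> x) \<oplus> (of_real (1 - t) \<odot> y) \<in> V"
   using lcs unfolding locally_convex_space_def by meson
  have "(of_real t \<odot>\<^bsub>Q\<^esub> X) \<oplus>\<^bsub>Q\<^esub> (of_real (1 - t) \<odot>\<^bsub>Q\<^esub> Y) \<in> q ` V"
   if XY: "X \<in> q ` V" "Y \<in> q ` V" and t: "t \<in> {0..1}" for X Y and t :: real
  proof -
   obtain x y where xy: "X = q x" "Y = q y" "x \<in> V" "y \<in> V" using XY by blast
   then have c: "x \<in> carrier R" "y \<in> carrier R" using V(3) by auto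
   have "(of_real t \<odot>\<^bsub>Q\<^esub> X) \<oplus>\<^bsub>Q\<^esub> (of_real (1 - t) \<odot>\<^bsub>Q\<^esub> Y) = q ((of_real t \<odot> x) \<oplus> (of_real (1 - t) \<odot> y))"
    using xy c by (simp only: Q_smult Q_add smult_closed)
   then show ?thesis using V(4) xy t by blast
  qed
  then show "\<exists>V. openin (vtop Q) V \<and> \<zero>\<^bsub>Q\<^esub> \<in> V \<and> V \<subseteq> W \<and> (\<forall>x\<in>V. \<forall>y\<in>V. \<forall>t\<in>{0..1::real}.
     (of_real t \<odot>\<^bsub>Q\<^esub> x) \<oplus>\<^bsub>Q\<^esub> (of_real (1 - t) \<odot>\<^bsub>Q\<^esub> y) \<in> V)"
   using V q_open by (intro exI[of _ "q ` V"]) (auto simp: open_map_def Q_zero)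
 qed
 moreover have "continuous_map (prod_topology (vtop Q) (vtop Q)) (vtop Q) (%(x, y). x \<otimes>\<^bsub>Q\<^esub> y)"
 proof (rule continuous_map_from_open_quotients[OF q_quot q_quot])
  have "continuous_map (prod_topology (vtop R) (vtop R)) (vtop Q) (q \<circ> (%(x, y). x \<otimes> y))"
   by (rule continuous_map_compose[OF continuous_mult q_continuous])
  then show "continuous_map (prod_topology (vtop R) (vtop R)) (vtop Q) (%(x, y). (case (q x, q y) of (x, y) => x \<otimes>\<^bsub>Q\<^esub> y))"
   by (rule continuous_map_eq) (auto simp: Q_mult)
 qed
 ultimately show ?thesis using complex_algebra_Q by (simp add: lca_def locally_convex_algebra_def lcs_def)
qed

lemma q_nat_pow: "x \<in> carrier R ==> q x [^]\<^bsub>Q\<^esub> (n::nat) = q (x [^] n)" by (induction n) (auto simp: Q_one Q_mult)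

end

text \<open>Translations and multiplications by a fixed element are continuous, so each of them maps
  the closure into itself once it maps \<open>J\<close> into the closure.\<close>

lemma (in lca) ideal_closure:
 assumes J: "ideal J A"
 shows "ideal (vtop A closure_of J) A"
proof -
 interpret J: ideal J A by (rule J)
 let ?C = "vtop A closure_of J"
 have sub: "?C \<subseteq> carrier A" using closure_of_subset_topspace[of "vtop A" J] by simp
 have JC: "J \<subseteq> ?C" using J.a_subset by (intro closure_of_subset) simp
 have push: "f c \<in> ?C" if "continuous_map (vtop A) (vtop A) f" "!!j. j \<in> J ==> f j \<in> ?C" "c \<in> ?C" for f c
 proof -
  have "f ` ?C \<subseteq> vtop A closure_of (f ` J)" by (rule continuous_map_image_closure_subset[OF that(1)])
  also have "\<dots> \<subseteq> vtop A closure_of ?C" using that(2) by (intro closure_of_mono) auto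
  finally show ?thesis using that(3) by auto
 qed
 \<comment> \<open>The sum is extended one argument at a time: closure plus \<open>J\<close> here,
   closure plus closure in the next step.\<close>
 have addJ: "c \<oplus> j \<in> ?C" if "c \<in> ?C" "j \<in> J" for c j
 proof (rule push[of "%c. c \<oplus> j"])
  show "continuous_map (vtop A) (vtop A) (%c. c \<oplus> j)"
   by (intro continuous_map_vadd) (use J.a_subset that in auto)
  show "i \<oplus> j \<in> ?C" if "i \<in> J" for i using that \<open>j \<in> J\<close> JC by auto
 qed fact
 have add: "c \<oplus> d \<in> ?C" if "c \<in> ?C" "d \<in> ?C" for c d
 proof (rule push[of "%d. c \<oplus> d"])
  show "continuous_map (vtop A) (vtop A) (%d. c \<oplus> d)" by (intro continuous_map_vadd) (use sub that in auto)
 qed (use addJ that in auto)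
 have mult: "x \<otimes> c \<in> ?C" "c \<otimes> x \<in> ?C" if "c \<in> ?C" "x \<in> carrier A" for c x
 proof -
  have "continuous_map (vtop A) (vtop A) (%c. x \<otimes> c)" "continuous_map (vtop A) (vtop A) (%c. c \<otimes> x)"
   by (intro continuous_map_vmult; use that in auto)+
  moreover have "x \<otimes> j \<in> ?C" "j \<otimes> x \<in> ?C" if "j \<in> J" for j
   using JC that \<open>x \<in> carrier A\<close> J.I_l_closed J.I_r_closed by auto
  ultimately show "x \<otimes> c \<in> ?C" "c \<otimes> x \<in> ?C" using push[of "%c. x \<otimes> c" c] push[of "%c. c \<otimes> x" c] that by blast+
 qed
 show ?thesis
 proof (rule idealI)
  show "ring A" by (rule rg.ring_axioms)
  show "subgroup ?C (add_monoid A)"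
  proof (rule ag.add.subgroupI)
   show "?C \<noteq> {}" using JC J.zero_closed by blast
   show "\<ominus> c \<in> ?C" if "c \<in> ?C" for c
   proof -
    have "(\<ominus> \<one>) \<otimes> c \<in> ?C" using that by (intro mult) auto
    then show ?thesis using that sub by (auto simp: rg.l_minus)
   qed
  qed (use sub add in auto)
 qed (use mult in auto)
qed

section \<open>Smooth localization of a dynamical system\<close>

lemma continuous_map_discrete_prod:
 assumes "!!g. g \<in> S ==> continuous_map X Y (%x. f (g, x))"
 shows "continuous_map (prod_topology (discrete_topology S) X) Y f"
proof (rule continuous_map_local)
 fix p assume "p \<in> topspace (prod_topology (discrete_topology S) X)"
 then obtain g x where p: "p = (g, x)" "g \<in> S" "x \<in> topspace X" by auto
 let ?N = "{g} \<times> topspace X"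
 have o: "openin (prod_topology (discrete_topology S) X) ?N" using p by (simp add: openin_prod_Times_iff)
 have "continuous_map (subtopology (prod_topology (discrete_topology S) X) ?N) Y ((%x. f (g, x)) \<circ> snd)"
  by (intro continuous_map_compose[OF continuous_map_from_subtopology[OF continuous_map_snd]] assms p)
 then have "continuous_map (subtopology (prod_topology (discrete_topology S) X) ?N) Y f"
  by (rule continuous_map_eq) auto
 then show "\<exists>N. openin (prod_topology (discrete_topology S) X) N \<and> p \<in> N \<and>
   continuous_map (subtopology (prod_topology (discrete_topology S) X) N) Y f" using o p by blast
qed

locale localized_system =
 fixes A :: "(complex, 'a) tvs" and L :: "('l, 'r) monoid_scheme" and \<alpha> :: "'l => 'a => 'a" and z :: 'a
 assumes dyn: "dynamical_system A L \<alpha>" and z: "z \<in> carrier (fixed_center A L \<alpha>)"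
begin

lemma lca_A: "lca A" using dyn by (simp add: dynamical_system_def lca_def)

sublocale A: lca A by (rule lca_A)
sublocale L: group L using dyn by (simp add: dynamical_system_def)

abbreviation R where "R \<equiv> smooth_curves A"
abbreviation I where "I \<equiv> localization_ideal A z"
abbreviation \<beta> where "\<beta> \<equiv> localized_action A z \<alpha>"

sublocale R: lca R by (rule lca_smooth_curves[OF lca_A])

lemma z_closed: "z \<in> carrier A" and z_fixed: "g \<in> carrier L ==> \<alpha> g z = z"
 using z by (auto simp: fixed_center_def alg_center_def)

lemma \<alpha>_iso: "g \<in> carrier L ==> \<alpha> g \<in> alg_iso A A"
 using dyn by (simp add: dynamical_system_def automorphism_action_def)

lemma
 assumes g: "g \<in> carrier L"
 shows \<alpha>_closed: "a \<in> carrier A ==> \<alpha> g a \<in> carrier A"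
  and \<alpha>_add: "a \<in> carrier A ==> b \<in> carrier A ==> \<alpha> g (a \<oplus>\<^bsub>A\<^esub> b) = \<alpha> g a \<oplus>\<^bsub>A\<^esub> \<alpha> g b"
  and \<alpha>_mult: "a \<in> carrier A ==> b \<in> carrier A ==> \<alpha> g (a \<otimes>\<^bsub>A\<^esub> b) = \<alpha> g a \<otimes>\<^bsub>A\<^esub> \<alpha> g b"
  and \<alpha>_one: "\<alpha> g \<one>\<^bsub>A\<^esub> = \<one>\<^bsub>A\<^esub>"
  and \<alpha>_smult: "a \<in> carrier A ==> \<alpha> g (c \<odot>\<^bsub>A\<^esub> a) = c \<odot>\<^bsub>A\<^esub> \<alpha> g a"
 using \<alpha>_iso[OF g] by (auto simp: alg_iso_def ring_hom_def Pi_iff)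

lemma \<alpha>_unit: "a \<in> carrier A ==> \<alpha> \<one>\<^bsub>L\<^esub> a = a"
 and \<alpha>_comp: "g \<in> carrier L ==> h \<in> carrier L ==> a \<in> carrier A ==> \<alpha> (g \<otimes>\<^bsub>L\<^esub> h) a = \<alpha> g (\<alpha> h a)"
 using dyn by (auto simp: dynamical_system_def automorphism_action_def)

lemma \<alpha>_continuous:
 assumes "g \<in> carrier L"
 shows "continuous_map (vtop A) (vtop A) (\<alpha> g)"
proof -
 have "continuous_map (vtop A) (prod_topology (discrete_topology (carrier L)) (vtop A)) (%a. (g, a))"
  using assms by (intro continuous_map_pairedI) auto
 moreover have "continuous_map (prod_topology (discrete_topology (carrier L)) (vtop A)) (vtop A) (%(g, a). \<alpha> g a)"
  using dyn by (simp add: dynamical_system_def)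
 ultimately show ?thesis
  using continuous_map_compose[of "vtop A" _ "%a. (g, a)" "vtop A" "%(g, a). \<alpha> g a"] by (simp add: o_def)
qed

lemma curve_closed: "f \<in> carrier R ==> f t \<in> carrier A" using smooth_curve_closed[OF lca_A] .

lemma push_continuous: "g \<in> carrier L ==> continuous_map (vtop R) (vtop R) (%f. \<alpha> g \<circ> f)"
 by (intro smooth_curves_push[OF lca_A] \<alpha>_continuous \<alpha>_add \<alpha>_smult)

lemma push_closed: "g \<in> carrier L ==> f \<in> carrier R ==> \<alpha> g \<circ> f \<in> carrier R"
 using push_continuous[of g] R.topspace_eq by (auto simp: continuous_map_def Pi_iff)

lemma
 assumes g: "g \<in> carrier L"
 shows push_add: "f \<in> carrier R ==> h \<in> carrier R ==> \<alpha> g \<circ> (f \<oplus>\<^bsub>R\<^esub> h) = (\<alpha> g \<circ> f) \<oplus>\<^bsub>R\<^esub> (\<alpha> g \<circ> h)"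
  and push_mult: "f \<in> carrier R ==> h \<in> carrier R ==> \<alpha> g \<circ> (f \<otimes>\<^bsub>R\<^esub> h) = (\<alpha> g \<circ> f) \<otimes>\<^bsub>R\<^esub> (\<alpha> g \<circ> h)"
  and push_one: "\<alpha> g \<circ> \<one>\<^bsub>R\<^esub> = \<one>\<^bsub>R\<^esub>"
  and push_smult: "f \<in> carrier R ==> \<alpha> g \<circ> (c \<odot>\<^bsub>R\<^esub> f) = c \<odot>\<^bsub>R\<^esub> (\<alpha> g \<circ> f)"
 using curve_closed[of f] curve_closed[of h]
 by (auto simp: fun_eq_iff \<alpha>_add[OF g] \<alpha>_mult[OF g] \<alpha>_one[OF g] \<alpha>_smult[OF g] simp del: smooth_curves_simps(1))

definition "gen = (%t. \<one>\<^bsub>A\<^esub> \<ominus>\<^bsub>A\<^esub> (complex_of_real t \<odot>\<^bsub>A\<^esub> z))"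

lemma gen_eq: "gen = \<one>\<^bsub>R\<^esub> \<ominus>\<^bsub>R\<^esub> (%t. complex_of_real t \<odot>\<^bsub>A\<^esub> z)"
 using R.diff_eq[OF R.rg.one_closed linear_curve[OF lca_A z_closed]] z_closed by (simp add: gen_def A.diff_eq)

lemma gen_closed: "gen \<in> carrier R"
 unfolding gen_eq by (rule R.diff_closed[OF R.rg.one_closed linear_curve[OF lca_A z_closed]])

abbreviation J where "J \<equiv> Idl\<^bsub>R\<^esub> {gen}"

lemma ideal_J: "ideal J R" using gen_closed by (intro R.rg.genideal_ideal) simp

lemma I_def: "I = vtop R closure_of J" by (simp add: localization_ideal_def gen_def)

lemma gen_in_I: "gen \<in> I"
proof -
 have "gen \<in> J" using R.rg.genideal_self[of "{gen}"] gen_closed by auto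
 moreover have "J \<subseteq> topspace (vtop R)"
  using additive_subgroup.a_subset[OF ideal.axioms(1)[OF ideal_J]] R.topspace_eq by simp
 ultimately show ?thesis unfolding I_def using closure_of_subset by blast
qed

sublocale Q: lca_ideal R I unfolding I_def
 by (intro lca_ideal.intro lca_ideal_axioms.intro R.lca_axioms R.ideal_closure ideal_J closedin_closure_of)

text \<open>The automorphism fixes \<open>z\<close>, hence also the generator. The preimage of the
  generated ideal is therefore an ideal containing the generator, and continuity carries the
  invariance over to the closure.\<close>

lemma push_I:
 assumes g: "g \<in> carrier L" and f: "f \<in> I"
 shows "\<alpha> g \<circ> f \<in> I"
proof -
 have hom: "ring_hom_ring R R (%f. \<alpha> g \<circ> f)"
 proof (rule ring_hom_ringI2[OF R.rg.ring_axioms R.rg.ring_axioms])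
  show "(%f. \<alpha> g \<circ> f) \<in> ring_hom R R"
   by (rule ring_hom_memI) (use push_closed[OF g] push_mult[OF g] push_add[OF g] push_one[OF g] in blast)+
 qed
 have fix_gen: "\<alpha> g \<circ> gen = gen"
  using z_closed by (simp add: fun_eq_iff gen_def A.diff_eq \<alpha>_add[OF g] \<alpha>_smult[OF g] \<alpha>_one[OF g] z_fixed[OF g])
 have "J \<subseteq> {f \<in> carrier R. \<alpha> g \<circ> f \<in> J}"
 proof (rule R.rg.genideal_minimal)
  show "ideal {f \<in> carrier R. \<alpha> g \<circ> f \<in> J} R" by (rule ring_hom_ring.ideal_vimage[OF hom ideal_J])
  show "{gen} \<subseteq> {f \<in> carrier R. \<alpha> g \<circ> f \<in> J}" using gen_closed fix_gen R.rg.genideal_self[of "{gen}"] by auto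
 qed
 then have "(%f. \<alpha> g \<circ> f) ` J \<subseteq> J" by auto
 then have "vtop R closure_of ((%f. \<alpha> g \<circ> f) ` J) \<subseteq> I" unfolding I_def by (rule closure_of_mono)
 then show ?thesis
  using continuous_map_image_closure_subset[OF push_continuous[OF g], of J] f unfolding I_def by blast
qed

abbreviation q where "q f \<equiv> I +>\<^bsub>R\<^esub> f"

text \<open>The localized action is a union over representatives; it is a single coset because
  \<open>I\<close> is invariant under composition with \<open>\<alpha> g\<close>.\<close>

lemma \<beta>_q:
 assumes g: "g \<in> carrier L" and f: "f \<in> carrier R"
 shows "\<beta> g (q f) = q (\<alpha> g \<circ> f)"
proof -
 have "q (\<alpha> g \<circ> h) = q (\<alpha> g \<circ> f)" if hq: "h \<in> q f" for h
 proof -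
  obtain i where i: "i \<in> I" "h = i \<oplus>\<^bsub>R\<^esub> f" using hq unfolding Q.coset_eq by auto
  have ic: "i \<in> carrier R" by (rule Q.I_sub[OF i(1)])
  have e: "\<alpha> g \<circ> h = (\<alpha> g \<circ> i) \<oplus>\<^bsub>R\<^esub> (\<alpha> g \<circ> f)" unfolding i(2) by (rule push_add[OF g ic f])
  have "(\<alpha> g \<circ> h) \<ominus>\<^bsub>R\<^esub> (\<alpha> g \<circ> f) = \<alpha> g \<circ> i"
   unfolding e by (rule R.add_diff_cancel[OF push_closed[OF g ic] push_closed[OF g f]])
  moreover have "\<alpha> g \<circ> h \<in> carrier R"
   unfolding e by (rule R.ag.a_closed[OF push_closed[OF g ic] push_closed[OF g f]])
  ultimately show ?thesis using Q.q_eq_iff[OF _ push_closed[OF g f]] push_I[OF g i(1)] by simp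
 qed
 moreover have "f \<in> q f" using Q.q_eq_iff[OF f f] f unfolding Q.coset_eq by (intro image_eqI[of _ _ "\<zero>\<^bsub>R\<^esub>"])
    (simp_all only: R.ag.l_zero additive_subgroup.zero_closed[OF ideal.axioms(1)[OF Q.ideal]])
 ultimately have "(\<Union>h\<in>q f. q (\<alpha> g \<circ> h)) = q (\<alpha> g \<circ> f)" by blast
 then show ?thesis by (simp add: localized_action_def)
qed

lemma loc_eq: "localization A z = Q.Q" by (simp add: localization_def)

lemma push_unit: "f \<in> carrier R ==> \<alpha> \<one>\<^bsub>L\<^esub> \<circ> f = f" using curve_closed[of f] by (simp add: fun_eq_iff \<alpha>_unit)

lemma push_comp: "g \<in> carrier L ==> h \<in> carrier L ==> f \<in> carrier R ==>
  \<alpha> (g \<otimes>\<^bsub>L\<^esub> h) \<circ> f = \<alpha> g \<circ> (\<alpha> h \<circ> f)" using curve_closed[of f] by (simp add: fun_eq_iff \<alpha>_comp)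

lemma \<beta>_closed: "g \<in> carrier L ==> X \<in> carrier Q.Q ==> \<beta> g X \<in> carrier Q.Q"
 unfolding Q.carrier_Q using \<beta>_q push_closed by (auto simp del: smooth_curves_simps(1))

lemma \<beta>_comp: "g \<in> carrier L ==> h \<in> carrier L ==> X \<in> carrier Q.Q ==> \<beta> (g \<otimes>\<^bsub>L\<^esub> h) X = \<beta> g (\<beta> h X)"
 unfolding Q.carrier_Q using \<beta>_q push_closed push_comp by (auto simp del: smooth_curves_simps(1))

lemma \<beta>_unit: "X \<in> carrier Q.Q ==> \<beta> \<one>\<^bsub>L\<^esub> X = X"
 unfolding Q.carrier_Q using \<beta>_q push_unit by (auto simp del: smooth_curves_simps(1))

lemma dynamical_system_localization: "dynamical_system (localization A z) L \<beta>"
proof -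
 interpret QQ: lca Q.Q by (rule Q.lca_Q)
 have iso: "\<beta> g \<in> alg_iso Q.Q Q.Q" if g: "g \<in> carrier L" for g
 proof -
  have "\<beta> g \<in> ring_hom Q.Q Q.Q"
  proof (rule ring_hom_memI)
   fix X Y assume "X \<in> carrier Q.Q" "Y \<in> carrier Q.Q"
   then obtain f h where fh: "f \<in> carrier R" "h \<in> carrier R" "X = q f" "Y = q h" unfolding Q.carrier_Q by blast
   show "\<beta> g (X \<otimes>\<^bsub>Q.Q\<^esub> Y) = \<beta> g X \<otimes>\<^bsub>Q.Q\<^esub> \<beta> g Y"
    unfolding fh(3,4) Q.Q_mult[OF fh(1,2)] \<beta>_q[OF g fh(1)] \<beta>_q[OF g fh(2)]
     Q.Q_mult[OF push_closed[OF g fh(1)] push_closed[OF g fh(2)]]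
     \<beta>_q[OF g R.rg.m_closed[OF fh(1,2)]] push_mult[OF g fh(1,2)] ..
   show "\<beta> g (X \<oplus>\<^bsub>Q.Q\<^esub> Y) = \<beta> g X \<oplus>\<^bsub>Q.Q\<^esub> \<beta> g Y"
    unfolding fh(3,4) Q.Q_add[OF fh(1,2)] \<beta>_q[OF g fh(1)] \<beta>_q[OF g fh(2)]
     Q.Q_add[OF push_closed[OF g fh(1)] push_closed[OF g fh(2)]]
     \<beta>_q[OF g R.ag.a_closed[OF fh(1,2)]] push_add[OF g fh(1,2)] ..
  next
   show "\<beta> g \<one>\<^bsub>Q.Q\<^esub> = \<one>\<^bsub>Q.Q\<^esub>" unfolding Q.Q_one \<beta>_q[OF g R.rg.one_closed] push_one[OF g] ..
  qed (rule \<beta>_closed[OF g])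
  moreover have "bij_betw (\<beta> g) (carrier Q.Q) (carrier Q.Q)"
  proof (rule bij_betw_byWitness[where f' = "\<beta> (inv\<^bsub>L\<^esub> g)"])
   show "\<forall>X\<in>carrier Q.Q. \<beta> (inv\<^bsub>L\<^esub> g) (\<beta> g X) = X" "\<forall>X\<in>carrier Q.Q. \<beta> g (\<beta> (inv\<^bsub>L\<^esub> g) X) = X"
    using g \<beta>_unit by (simp_all add: \<beta>_comp[symmetric])
  qed (use g \<beta>_closed in auto)
  moreover have "\<beta> g (c \<odot>\<^bsub>Q.Q\<^esub> X) = c \<odot>\<^bsub>Q.Q\<^esub> \<beta> g X" if X: "X \<in> carrier Q.Q" for c X
  proof -
   obtain f where f: "f \<in> carrier R" "X = q f" using X unfolding Q.carrier_Q by blast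
   show ?thesis unfolding f(2) Q.Q_smult[OF f(1)] \<beta>_q[OF g f(1)] Q.Q_smult[OF push_closed[OF g f(1)]]
     \<beta>_q[OF g R.smult_closed[OF f(1)]] push_smult[OF g f(1)] ..
  qed
  ultimately show ?thesis by (simp add: alg_iso_def)
 qed
 \<comment> \<open>A map out of the quotient is continuous if its composite with the quotient map
   is. As the group is discrete, one element at a time suffices.\<close>
 have cont: "continuous_map (vtop Q.Q) (vtop Q.Q) (\<beta> g)" if g: "g \<in> carrier L" for g
 proof (rule continuous_compose_quotient_map)
  show "quotient_map (vtop R) (vtop Q.Q) q"
   by (rule continuous_open_imp_quotient_map[OF Q.q_continuous Q.q_open Q.q_surj])
  have "continuous_map (vtop R) (vtop Q.Q) (q \<circ> (%f. \<alpha> g \<circ> f))"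
   by (rule continuous_map_compose[OF push_continuous[OF g] Q.q_continuous])
  then show "continuous_map (vtop R) (vtop Q.Q) (\<beta> g \<circ> q)"
   by (rule continuous_map_eq) (simp only: o_apply R.topspace_eq \<beta>_q[OF g])
 qed
 show ?thesis unfolding loc_eq dynamical_system_def automorphism_action_def
  using QQ.lca L.group_axioms iso \<beta>_unit \<beta>_comp continuous_map_discrete_prod[of "carrier L" "vtop Q.Q" "vtop Q.Q" "%(g, a). \<beta> g a"] cont
  by simp
qed

lemma curve_nat_pow: "f [^]\<^bsub>R\<^esub> (n::nat) = (%t. f t [^]\<^bsub>A\<^esub> n)" by (induction n) simp_all

text \<open>In the localization the class of \<open>t \<mapsto> t z\<close> is \<open>1\<close>, so the class of \<open>t \<mapsto> t w\<close> is an
 \<open>n\<close>-th root of unity whenever \<open>w\<close> and \<open>z\<close> have the same \<open>n\<close>-th power.\<close>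

lemma isotypic_root:
 assumes w: "w \<in> isotypic A L \<alpha> \<omega>" and pow: "w [^]\<^bsub>A\<^esub> (n::nat) = z [^]\<^bsub>A\<^esub> n" and n: "n > 0"
 shows "\<exists>a\<in>isotypic (localization A z) L \<beta> \<omega>. a \<in> Units (localization A z) \<and>
  a [^]\<^bsub>localization A z\<^esub> n = \<one>\<^bsub>localization A z\<^esub>"
proof -
 interpret QQ: lca Q.Q by (rule Q.lca_Q)
 let ?c = "%w t. complex_of_real t \<odot>\<^bsub>A\<^esub> w"
 have wA: "w \<in> carrier A" and w\<omega>: "!!g. g \<in> carrier L ==> \<alpha> g w = \<omega> g \<odot>\<^bsub>A\<^esub> w" using w by (auto simp: isotypic_def)
 note wc = linear_curve[OF lca_A wA] and zc = linear_curve[OF lca_A z_closed]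
 let ?a = "q (?c w)"
 have aQ: "?a \<in> carrier Q.Q" unfolding Q.carrier_Q by (rule imageI[OF wc])
 \<comment> \<open>The two representatives differ by \<open>gen\<close>, which lies in the
   ideal.\<close>
 have "q \<one>\<^bsub>R\<^esub> = q (?c z)" using Q.q_eq_iff[OF R.rg.one_closed zc] gen_in_I unfolding gen_eq by simp
 then have one: "q (?c z) = \<one>\<^bsub>Q.Q\<^esub>" by (simp only: Q.Q_one)
 have "?c w [^]\<^bsub>R\<^esub> n = ?c z [^]\<^bsub>R\<^esub> n"
  unfolding curve_nat_pow using pow wA z_closed by (simp add: A.smult_nat_pow)
 then have an: "?a [^]\<^bsub>Q.Q\<^esub> n = \<one>\<^bsub>Q.Q\<^esub>" using Q.q_nat_pow[OF wc, of n] Q.q_nat_pow[OF zc, of n] one by simp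
 have "\<beta> g ?a = \<omega> g \<odot>\<^bsub>Q.Q\<^esub> ?a" if g: "g \<in> carrier L" for g
 proof -
  have "\<alpha> g \<circ> ?c w = \<omega> g \<odot>\<^bsub>R\<^esub> ?c w"
   using wA by (simp add: fun_eq_iff \<alpha>_smult[OF g] w\<omega>[OF g] A.smult_smult mult.commute)
  then show ?thesis by (simp only: \<beta>_q[OF g wc] Q.Q_smult[OF wc])
 qed
 then have "?a \<in> isotypic (localization A z) L \<beta> \<omega>" unfolding loc_eq using aQ by (simp add: isotypic_def)
 moreover have "?a \<in> Units Q.Q"
 proof -
  \<comment> \<open>Since \<open>n\<close> is positive, the power with exponent \<open>n - 1\<close>
    exists and is the inverse of the class.\<close>
  obtain m where m: "n = Suc m" using n gr0_implies_Suc by blast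
  have "?a [^]\<^bsub>Q.Q\<^esub> m \<otimes>\<^bsub>Q.Q\<^esub> ?a = \<one>\<^bsub>Q.Q\<^esub>" "?a \<otimes>\<^bsub>Q.Q\<^esub> ?a [^]\<^bsub>Q.Q\<^esub> m = \<one>\<^bsub>Q.Q\<^esub>"
   using an m QQ.rg.nat_pow_Suc2[OF aQ, of m] by simp_all
  then show ?thesis unfolding Units_def using aQ QQ.rg.nat_pow_closed[OF aQ] by blast
 qed
 ultimately show ?thesis using an unfolding loc_eq by blast
qed

end

section \<open>Smooth maps between manifolds\<close>

text \<open>What the calculus of smooth maps needs of a manifold; compatibility of the charts is expressed
 by smoothness of the identity.\<close>

definition charted :: "('m, 'e) mfd => bool"
 where "charted X \<longleftrightarrow> lcs (model X) \<and> (\<Union>(U, \<phi>)\<in>atlas X. U) = points X \<and>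
  (\<forall>(U, \<phi>)\<in>atlas X. openin (mtop X) U \<and> inj_on \<phi> U \<and>
   (\<forall>O'. openin (mtop X) O' \<and> O' \<subseteq> U \<longrightarrow> openin (vtop (model X)) (\<phi> ` O')))"

lemma
 assumes "charted X"
 shows charted_lcs: "lcs (model X)"
  and charted_cover: "x \<in> points X ==> \<exists>U \<phi>. (U, \<phi>) \<in> atlas X \<and> x \<in> U"
  and charted_open: "(U, \<phi>) \<in> atlas X ==> openin (mtop X) U"
  and charted_inj: "(U, \<phi>) \<in> atlas X ==> inj_on \<phi> U"
  and charted_image: "(U, \<phi>) \<in> atlas X ==> openin (mtop X) O' ==> O' \<subseteq> U ==> openin (vtop (model X)) (\<phi> ` O')"
 using assms unfolding charted_def by blast+

lemma charted_subset: "charted X ==> (U, \<phi>) \<in> atlas X ==> U \<subseteq> points X" by (meson charted_open openin_subset)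

lemma charted_inv: "charted X ==> (U, \<phi>) \<in> atlas X ==> x \<in> U ==> inv_into U \<phi> (\<phi> x) = x"
 by (rule inv_into_f_f[OF charted_inj])

lemma chart_closed:
 assumes "charted X" "(U, \<phi>) \<in> atlas X" "x \<in> U"
 shows "\<phi> x \<in> carrier (model X)"
proof -
 interpret lcs "model X" by (rule charted_lcs[OF assms(1)])
 have "openin (vtop (model X)) (\<phi> ` U)"
  by (rule charted_image[OF assms(1,2) charted_open[OF assms(1,2)] order_refl])
 then show ?thesis using openin_subset assms(3) by fastforce
qed

lemma smooth_manifold_charted:
 assumes X: "smooth_manifold X"
 shows "charted X" unfolding charted_def
proof (intro conjI)
 show "lcs (model X)" "(\<Union>(U, \<phi>)\<in>atlas X. U) = points X" using X by (simp_all add: smooth_manifold_def lcs_def)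
 show "\<forall>(U, \<phi>)\<in>atlas X. openin (mtop X) U \<and> inj_on \<phi> U \<and>
   (\<forall>O'. openin (mtop X) O' \<and> O' \<subseteq> U \<longrightarrow> openin (vtop (model X)) (\<phi> ` O'))"
 proof (clarify, intro conjI allI impI)
  fix U \<phi> assume U: "(U, \<phi>) \<in> atlas X"
  then have o: "openin (mtop X) U" "openin (vtop (model X)) (\<phi> ` U)"
   and h: "homeomorphic_map (subtopology (mtop X) U) (subtopology (vtop (model X)) (\<phi> ` U)) \<phi>"
   using X unfolding smooth_manifold_def by blast+
  show "openin (mtop X) U" by fact
  show "inj_on \<phi> U" using h openin_subset[OF o(1)] by (simp add: homeomorphic_eq_everything_map Int_absorb1)
  fix O' assume O': "openin (mtop X) O' \<and> O' \<subseteq> U"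
  then have "openin (subtopology (mtop X) U) O'" by (auto simp: openin_subtopology)
  then have "openin (subtopology (vtop (model X)) (\<phi> ` U)) (\<phi> ` O')"
   using h by (simp add: homeomorphic_eq_everything_map open_map_def)
  then show "openin (vtop (model X)) (\<phi> ` O')" using o(2) openin_trans_full by blast
 qed
qed

lemma smooth_map_chart:
 "smooth_map X Y f ==> (U, \<phi>) \<in> atlas X ==> (V, \<psi>) \<in> atlas Y ==>
  smooth_on (model X) (model Y) (\<phi> ` (U \<inter> f -` V)) (\<psi> \<circ> f \<circ> inv_into U \<phi>)" unfolding smooth_map_def by blast

lemma smooth_map_continuous: "smooth_map X Y f ==> continuous_map (mtop X) (mtop Y) f"
 by (simp add: smooth_map_def)

lemma smooth_map_image: "smooth_map X Y f ==> x \<in> points X ==> f x \<in> points Y"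
 using smooth_map_continuous by (fastforce simp: continuous_map_def)

lemma smooth_mapI:
 assumes "continuous_map (mtop X) (mtop Y) f"
  and "!!U \<phi> V \<psi>. (U, \<phi>) \<in> atlas X ==> (V, \<psi>) \<in> atlas Y ==>
   smooth_on (model X) (model Y) (\<phi> ` (U \<inter> f -` V)) (\<psi> \<circ> f \<circ> inv_into U \<phi>)"
 shows "smooth_map X Y f" using assms unfolding smooth_map_def by blast

text \<open>Near each point the composite passes through one chart of \<open>Y\<close>, where the
  chain rule applies. Smoothness is local, so no single chart of \<open>Y\<close> has to contain the
  whole image.\<close>

lemma smooth_map_compose:
 assumes X: "charted X" and Y: "charted Y" and Z: "charted Z"
  and f: "smooth_map X Y f" and g: "smooth_map Y Z g"
 shows "smooth_map X Z (%x. g (f x))"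
proof (rule smooth_mapI)
 show "continuous_map (mtop X) (mtop Z) (%x. g (f x))"
  using continuous_map_compose[OF smooth_map_continuous[OF f] smooth_map_continuous[OF g]] by (simp add: o_def)
 fix U \<phi> W \<chi>' assume U: "(U, \<phi>) \<in> atlas X" and W: "(W, \<chi>') \<in> atlas Z"
 interpret lcs3 "model X" "model Y" "model Z" by (intro lcs3.intro lcs2.intro charted_lcs X Y Z)
 let ?h = "%x. g (f x)"
 show "smooth_on (model X) (model Z) (\<phi> ` (U \<inter> ?h -` W)) (\<chi>' \<circ> ?h \<circ> inv_into U \<phi>)"
 proof (rule EG.smooth_on_local)
  fix x assume "x \<in> \<phi> ` (U \<inter> ?h -` W)"
  then obtain p where p: "p \<in> U" "g (f p) \<in> W" "x = \<phi> p" by auto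
  have "f p \<in> points Y" using smooth_map_image[OF f] p charted_subset[OF X U] by blast
  then obtain V \<psi> where V: "(V, \<psi>) \<in> atlas Y" "f p \<in> V" using charted_cover[OF Y] by blast
  let ?F = "\<psi> \<circ> f \<circ> inv_into U \<phi>" and ?H = "\<chi>' \<circ> g \<circ> inv_into V \<psi>"
  note F = smooth_map_chart[OF f U V(1)] and H = smooth_map_chart[OF g V(1) W]
  \<comment> \<open>The coordinates of the points that \<open>f\<close> sends into the chosen chart
    of \<open>Y\<close> and whose images \<open>g\<close> sends into \<open>W\<close>. Injectivity
    of \<open>\<psi>\<close> recovers the second condition from coordinates.\<close>
  let ?N = "{y \<in> \<phi> ` (U \<inter> f -` V). ?F y \<in> \<psi> ` (V \<inter> g -` W)}"
  have No: "openin (vtop (model X)) ?N" by (rule EF.smooth_on_open_preimage[OF F FG.smooth_on_open[OF H]])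
  have "smooth_on (model X) (model Z) ?N (%y. ?H (?F y))"
   by (rule smooth_on_compose(1)[OF EF.smooth_on_open_subset[OF F No] H]) auto
  then have s1: "smooth_on (model X) (model Z) ?N (\<chi>' \<circ> ?h \<circ> inv_into U \<phi>)"
  proof (rule EG.smooth_on_cong)
   fix y assume "y \<in> ?N"
   then obtain p' where "p' \<in> U" "f p' \<in> V" "y = \<phi> p'" by auto
   then show "?H (?F y) = (\<chi>' \<circ> ?h \<circ> inv_into U \<phi>) y" by (simp add: charted_inv[OF X U] charted_inv[OF Y V(1)])
  qed
  have s2: "x \<in> ?N" using p V by (auto simp: charted_inv[OF X U])
  have s3: "?N \<subseteq> \<phi> ` (U \<inter> ?h -` W)"
  proof
   fix y assume "y \<in> ?N"
   then obtain p' v where p': "p' \<in> U" "f p' \<in> V" "y = \<phi> p'" "v \<in> V" "g v \<in> W" "\<psi> (f p') = \<psi> v"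
    by (auto simp: charted_inv[OF X U])
   then have "f p' = v" using inj_onD[OF charted_inj[OF Y V(1)]] by blast
   then show "y \<in> \<phi> ` (U \<inter> ?h -` W)" using p' by auto
  qed
  show "\<exists>V. x \<in> V \<and> V \<subseteq> \<phi> ` (U \<inter> ?h -` W) \<and>
    smooth_on (model X) (model Z) V (\<chi>' \<circ> ?h \<circ> inv_into U \<phi>)" by (intro exI[of _ ?N] conjI s1 s2 s3)
 qed
qed

lemma smooth_map_cong:
 assumes X: "charted X" and Y: "charted Y" and f: "smooth_map X Y f"
  and eq: "!!x. x \<in> points X ==> f x = g x"
 shows "smooth_map X Y g"
proof (rule smooth_mapI)
 show "continuous_map (mtop X) (mtop Y) g" by (rule continuous_map_eq[OF smooth_map_continuous[OF f] eq])
 fix U \<phi> V \<psi> assume U: "(U, \<phi>) \<in> atlas X" and V: "(V, \<psi>) \<in> atlas Y"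
 interpret lcs2 "model X" "model Y" by (intro lcs2.intro charted_lcs X Y)
 have sub: "U \<subseteq> points X" by (rule charted_subset[OF X U])
 have "U \<inter> g -` V = U \<inter> f -` V" using sub eq by auto
 then have e: "\<phi> ` (U \<inter> g -` V) = \<phi> ` (U \<inter> f -` V)" by simp
 show "smooth_on (model X) (model Y) (\<phi> ` (U \<inter> g -` V)) (\<psi> \<circ> g \<circ> inv_into U \<phi>)" unfolding e
 proof (rule smooth_on_cong[OF smooth_map_chart[OF f U V]])
  fix x assume "x \<in> \<phi> ` (U \<inter> f -` V)"
  then obtain p where "p \<in> U" "x = \<phi> p" by auto
  then show "(\<psi> \<circ> f \<circ> inv_into U \<phi>) x = (\<psi> \<circ> g \<circ> inv_into U \<phi>) x"
   using sub eq by (auto simp: charted_inv[OF X U])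
 qed
qed

section \<open>Open submanifolds and gluing\<close>

lemma open_submfd_simps [simp]:
 "mtop (open_submfd X O') = subtopology (mtop X) O'" "model (open_submfd X O') = model X"
 by (simp_all add: open_submfd_def)

lemma atlas_open_submfd: "(W, \<phi>) \<in> atlas (open_submfd X O') \<longleftrightarrow> (\<exists>U. (U, \<phi>) \<in> atlas X \<and> W = U \<inter> O')"
 by (auto simp: open_submfd_def)

lemma charted_open_submfd:
 assumes X: "charted X" and O': "openin (mtop X) O'"
 shows "charted (open_submfd X O')" unfolding charted_def open_submfd_simps
proof (intro conjI charted_lcs[OF X])
 show "(\<Union>(U, \<phi>)\<in>atlas (open_submfd X O'). U) = topspace (subtopology (mtop X) O')"
 proof (intro equalityI subsetI)
  fix x assume "x \<in> (\<Union>(U, \<phi>)\<in>atlas (open_submfd X O'). U)"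
  then show "x \<in> topspace (subtopology (mtop X) O')"
   using charted_subset[OF X] by (fastforce simp: atlas_open_submfd)
 next
  fix x assume x: "x \<in> topspace (subtopology (mtop X) O')"
  then have "x \<in> points X" by simp
  from charted_cover[OF X this] obtain U \<phi> where U: "(U, \<phi>) \<in> atlas X" "x \<in> U" by (elim exE conjE)
  then have "(U \<inter> O', \<phi>) \<in> atlas (open_submfd X O')" by (auto simp: atlas_open_submfd)
  then show "x \<in> (\<Union>(U, \<phi>)\<in>atlas (open_submfd X O'). U)" using x U(2) by (intro UN_I[of "(U \<inter> O', \<phi>)"]) auto
 qed
 show "\<forall>(U, \<phi>)\<in>atlas (open_submfd X O'). openin (subtopology (mtop X) O') U \<and> inj_on \<phi> U \<and>
   (\<forall>W. openin (subtopology (mtop X) O') W \<and> W \<subseteq> U \<longrightarrow> openin (vtop (model X)) (\<phi> ` W))"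
 proof (clarify, intro conjI allI impI)
  fix W \<phi> assume "(W, \<phi>) \<in> atlas (open_submfd X O')"
  then obtain U where U: "(U, \<phi>) \<in> atlas X" "W = U \<inter> O'" by (auto simp: atlas_open_submfd)
  show "openin (subtopology (mtop X) O') W"
   unfolding U(2) by (rule openin_subtopology_Int[OF charted_open[OF X U(1)]])
  show "inj_on \<phi> W" using inj_on_subset[OF charted_inj[OF X U(1)]] U(2) by blast
  fix V assume "openin (subtopology (mtop X) O') V \<and> V \<subseteq> W"
  then have "openin (mtop X) V" "V \<subseteq> U" using O' U(2) openin_trans_full by blast+
  then show "openin (vtop (model X)) (\<phi> ` V)" using charted_image[OF X U(1)] by blast
 qed
qed

text \<open>The charts of an open submanifold have smaller domains, so \<open>inv_into\<close> is
  formed over a different set. By injectivity the two inverses agree on the image of the smaller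
  domain.\<close>

lemma smooth_map_restrict:
 assumes X: "charted X" and Y: "charted Y" and f: "smooth_map X Y f" and O': "openin (mtop X) O'"
 shows "smooth_map (open_submfd X O') Y f"
proof (rule smooth_mapI)
 show "continuous_map (mtop (open_submfd X O')) (mtop Y) f"
  using smooth_map_continuous[OF f] by (simp add: continuous_map_from_subtopology)
 fix W \<phi> V \<psi> assume "(W, \<phi>) \<in> atlas (open_submfd X O')" and V: "(V, \<psi>) \<in> atlas Y"
 then obtain U where U: "(U, \<phi>) \<in> atlas X" "W = U \<inter> O'" by (auto simp: atlas_open_submfd)
 interpret lcs2 "model X" "model Y" by (intro lcs2.intro charted_lcs X Y)
 note F = smooth_map_chart[OF f U(1) V]
 have "openin (mtop X) {x \<in> points X. f x \<in> V}"
  by (rule openin_continuous_map_preimage[OF smooth_map_continuous[OF f] charted_open[OF Y V]])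
 moreover have "W \<inter> f -` V = U \<inter> O' \<inter> {x \<in> points X. f x \<in> V}" using U(2) charted_subset[OF X U(1)] by auto
 ultimately have "openin (mtop X) (W \<inter> f -` V)" using charted_open[OF X U(1)] O' by (simp add: openin_Int)
 then have "openin (vtop (model X)) (\<phi> ` (W \<inter> f -` V))" using charted_image[OF X U(1)] U(2) by blast
 then have "smooth_on (model X) (model Y) (\<phi> ` (W \<inter> f -` V)) (\<psi> \<circ> f \<circ> inv_into U \<phi>)"
  by (rule smooth_on_open_subset[OF F]) (use U(2) in auto)
 then show "smooth_on (model (open_submfd X O')) (model Y) (\<phi> ` (W \<inter> f -` V)) (\<psi> \<circ> f \<circ> inv_into W \<phi>)"
  unfolding open_submfd_simps
 proof (rule smooth_on_cong)
  fix x assume "x \<in> \<phi> ` (W \<inter> f -` V)"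
  then obtain p where p: "p \<in> W" "x = \<phi> p" by auto
  have "inj_on \<phi> W" using inj_on_subset[OF charted_inj[OF X U(1)]] U(2) by blast
  then show "(\<psi> \<circ> f \<circ> inv_into U \<phi>) x = (\<psi> \<circ> f \<circ> inv_into W \<phi>) x"
   using p U(2) by (simp add: charted_inv[OF X U(1)])
 qed
qed

lemma smooth_map_into_open:
 assumes X: "charted X" and f: "smooth_map X Y f" and im: "!!x. x \<in> points X ==> f x \<in> O'"
 shows "smooth_map X (open_submfd Y O') f"
proof (rule smooth_mapI)
 show "continuous_map (mtop X) (mtop (open_submfd Y O')) f"
  using smooth_map_continuous[OF f] im by (auto simp: continuous_map_in_subtopology)
 fix U \<phi> W \<psi> assume U: "(U, \<phi>) \<in> atlas X" and "(W, \<psi>) \<in> atlas (open_submfd Y O')"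
 then obtain V where V: "(V, \<psi>) \<in> atlas Y" "W = V \<inter> O'" by (auto simp: atlas_open_submfd)
 have "U \<inter> f -` W = U \<inter> f -` V" using V(2) im charted_subset[OF X U] by auto
 then show "smooth_on (model X) (model (open_submfd Y O')) (\<phi> ` (U \<inter> f -` W)) (\<psi> \<circ> f \<circ> inv_into U \<phi>)"
  using smooth_map_chart[OF f U V(1)] by simp
qed

lemma smooth_map_from_open:
 assumes X: "charted X" and f: "smooth_map X (open_submfd Y O') f"
 shows "smooth_map X Y f"
proof (rule smooth_mapI)
 have c: "continuous_map (mtop X) (subtopology (mtop Y) O') f" using smooth_map_continuous[OF f] by simp
 then show "continuous_map (mtop X) (mtop Y) f" by (rule continuous_map_into_fulltopology)
 fix U \<phi> V \<psi> assume U: "(U, \<phi>) \<in> atlas X" and V: "(V, \<psi>) \<in> atlas Y"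
 have "(V \<inter> O', \<psi>) \<in> atlas (open_submfd Y O')" using V by (auto simp: atlas_open_submfd)
 note * = smooth_map_chart[OF f U this]
 have "U \<inter> f -` (V \<inter> O') = U \<inter> f -` V"
  using c charted_subset[OF X U] by (auto simp: continuous_map_in_subtopology)
 then show "smooth_on (model X) (model Y) (\<phi> ` (U \<inter> f -` V)) (\<psi> \<circ> f \<circ> inv_into U \<phi>)" using * by simp
qed

text \<open>Smoothness is local on the source. The extension of bump functions by zero and the
  construction of sections over trivializing sets rest on this.\<close>

lemma smooth_map_glue:
 assumes X: "charted X" and Y: "charted Y"
  and loc: "!!x. x \<in> points X ==> \<exists>O'. openin (mtop X) O' \<and> x \<in> O' \<and> smooth_map (open_submfd X O') Y f"
 shows "smooth_map X Y f"
proof (rule smooth_mapI)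
 show "continuous_map (mtop X) (mtop Y) f"
 proof (rule continuous_map_local)
  fix x assume "x \<in> points X"
  then obtain O' where "openin (mtop X) O'" "x \<in> O'" "smooth_map (open_submfd X O') Y f" using loc by blast
  then show "\<exists>N. openin (mtop X) N \<and> x \<in> N \<and> continuous_map (subtopology (mtop X) N) (mtop Y) f"
   using smooth_map_continuous[of "open_submfd X O'" Y f] by auto
 qed
 fix U \<phi> V \<psi> assume U: "(U, \<phi>) \<in> atlas X" and V: "(V, \<psi>) \<in> atlas Y"
 interpret lcs2 "model X" "model Y" by (intro lcs2.intro charted_lcs X Y)
 show "smooth_on (model X) (model Y) (\<phi> ` (U \<inter> f -` V)) (\<psi> \<circ> f \<circ> inv_into U \<phi>)"
 proof (rule smooth_on_local)
  fix x assume "x \<in> \<phi> ` (U \<inter> f -` V)"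
  then obtain p where p: "p \<in> U" "f p \<in> V" "x = \<phi> p" by auto
  then have "p \<in> points X" using charted_subset[OF X U] by blast
  then obtain O' where O': "openin (mtop X) O'" "p \<in> O'" "smooth_map (open_submfd X O') Y f" using loc by blast
  have UO: "(U \<inter> O', \<phi>) \<in> atlas (open_submfd X O')" using U by (auto simp: atlas_open_submfd)
  let ?N = "\<phi> ` (U \<inter> O' \<inter> f -` V)"
  have "smooth_on (model X) (model Y) ?N (\<psi> \<circ> f \<circ> inv_into (U \<inter> O') \<phi>)"
   using smooth_map_chart[OF O'(3) UO V] by simp
  then have s1: "smooth_on (model X) (model Y) ?N (\<psi> \<circ> f \<circ> inv_into U \<phi>)"
  proof (rule smooth_on_cong)
   fix y assume "y \<in> ?N"
   then obtain p' where p': "p' \<in> U \<inter> O'" "y = \<phi> p'" by auto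
   have "inj_on \<phi> (U \<inter> O')" using inj_on_subset[OF charted_inj[OF X U]] by blast
   then show "(\<psi> \<circ> f \<circ> inv_into (U \<inter> O') \<phi>) y = (\<psi> \<circ> f \<circ> inv_into U \<phi>) y"
    using p' by (simp add: charted_inv[OF X U])
  qed
  have s2: "x \<in> ?N" "?N \<subseteq> \<phi> ` (U \<inter> f -` V)" using p O' by auto
  show "\<exists>N. x \<in> N \<and> N \<subseteq> \<phi> ` (U \<inter> f -` V) \<and> smooth_on (model X) (model Y) N (\<psi> \<circ> f \<circ> inv_into U \<phi>)"
   by (intro exI[of _ ?N] conjI s1 s2)
 qed
qed

lemma smooth_map_id:
 assumes "smooth_manifold X"
 shows "smooth_map X X (%x. x)"
proof (rule smooth_mapI)
 fix U \<phi> V \<psi> assume "(U, \<phi>) \<in> atlas X" "(V, \<psi>) \<in> atlas X"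
 then have "smooth_on (model X) (model X) (\<phi> ` (U \<inter> V)) (\<psi> \<circ> inv_into U \<phi>)"
  using assms unfolding smooth_manifold_def by blast
 then show "smooth_on (model X) (model X) (\<phi> ` (U \<inter> (%x. x) -` V)) (\<psi> \<circ> (%x. x) \<circ> inv_into U \<phi>)"
  by (simp add: o_def)
qed simp

lemma smooth_map_const:
 assumes X: "charted X" and Y: "charted Y" and c: "c \<in> points Y"
 shows "smooth_map X Y (%_. c)"
proof (rule smooth_mapI)
 fix U \<phi> V \<psi> assume U: "(U, \<phi>) \<in> atlas X" and V: "(V, \<psi>) \<in> atlas Y"
 interpret lcs2 "model X" "model Y" by (intro lcs2.intro charted_lcs X Y)
 show "smooth_on (model X) (model Y) (\<phi> ` (U \<inter> (%_. c) -` V)) (\<psi> \<circ> (%_. c) \<circ> inv_into U \<phi>)"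
 proof (cases "c \<in> V")
  case True
  have "openin (vtop (model X)) (\<phi> ` U)" by (rule charted_image[OF X U charted_open[OF X U] order_refl])
  then show ?thesis using smooth_on_const[OF _ chart_closed[OF Y V True]] True by (simp add: o_def)
 next
  case False
  then have "U \<inter> (%_. c) -` V = {}" by auto
  then show ?thesis by (intro smooth_on_local) auto
 qed
qed (use c in simp)

section \<open>Products of manifolds\<close>

lemma prod_mfd_simps [simp]:
 "mtop (prod_mfd X Y) = prod_topology (mtop X) (mtop Y)" "model (prod_mfd X Y) = prod_space (model X) (model Y)"
 by (simp_all add: prod_mfd_def)

lemma atlas_prod_mfd:
 "(W, \<chi>') \<in> atlas (prod_mfd X Y) \<longleftrightarrow> (\<exists>U \<phi> V \<psi>. W = U \<times> V \<and> \<chi>' = map_prod \<phi> \<psi> \<and> (U, \<phi>) \<in> atlas X \<and> (V, \<psi>) \<in> atlas Y)"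
 by (auto simp: prod_mfd_def)

lemma charted_prod_mfd:
 assumes X: "charted X" and Y: "charted Y"
 shows "charted (prod_mfd X Y)" unfolding charted_def prod_mfd_simps
proof (intro conjI lcs_prod_space charted_lcs X Y)
 show "(\<Union>(W, \<chi>')\<in>atlas (prod_mfd X Y). W) = topspace (prod_topology (mtop X) (mtop Y))"
 proof (intro equalityI subsetI)
  fix p assume "p \<in> (\<Union>(W, \<chi>')\<in>atlas (prod_mfd X Y). W)"
  then show "p \<in> topspace (prod_topology (mtop X) (mtop Y))"
   using charted_subset[OF X] charted_subset[OF Y] by (fastforce simp: atlas_prod_mfd)
 next
  fix p assume "p \<in> topspace (prod_topology (mtop X) (mtop Y))"
  then obtain x y where p: "p = (x, y)" "x \<in> points X" "y \<in> points Y" by auto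
  obtain U \<phi> where U: "(U, \<phi>) \<in> atlas X" "x \<in> U" using charted_cover[OF X p(2)] by blast
  obtain V \<psi> where V: "(V, \<psi>) \<in> atlas Y" "y \<in> V" using charted_cover[OF Y p(3)] by blast
  have "(U \<times> V, map_prod \<phi> \<psi>) \<in> atlas (prod_mfd X Y)" using U V by (auto simp: atlas_prod_mfd)
  then show "p \<in> (\<Union>(W, \<chi>')\<in>atlas (prod_mfd X Y). W)"
   using p U V by (intro UN_I[of "(U \<times> V, map_prod \<phi> \<psi>)"]) auto
 qed
 show "\<forall>(W, \<chi>')\<in>atlas (prod_mfd X Y). openin (prod_topology (mtop X) (mtop Y)) W \<and> inj_on \<chi>' W \<and>
   (\<forall>O'. openin (prod_topology (mtop X) (mtop Y)) O' \<and> O' \<subseteq> W \<longrightarrow>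
    openin (vtop (prod_space (model X) (model Y))) (\<chi>' ` O'))"
 proof (clarify, intro conjI allI impI)
  fix W and \<chi>' :: "'a \<times> 'c => 'b \<times> 'd" assume "(W, \<chi>') \<in> atlas (prod_mfd X Y)"
  then obtain U \<phi> V \<psi> where W: "W = U \<times> V" "\<chi>' = map_prod \<phi> \<psi>" and U: "(U, \<phi>) \<in> atlas X" and V: "(V, \<psi>) \<in> atlas Y"
   by (auto simp: atlas_prod_mfd)
  show "openin (prod_topology (mtop X) (mtop Y)) W"
   using charted_open[OF X U] charted_open[OF Y V] W by (simp add: openin_prod_Times_iff)
  show "inj_on \<chi>' W" using charted_inj[OF X U] charted_inj[OF Y V] W by (simp add: map_prod_inj_on)
  fix O' assume O': "openin (prod_topology (mtop X) (mtop Y)) O' \<and> O' \<subseteq> W"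
  show "openin (vtop (prod_space (model X) (model Y))) (\<chi>' ` O')"
   unfolding prod_space_simps openin_prod_topology_alt
  proof (intro allI impI)
   fix a b assume "(a, b) \<in> \<chi>' ` O'"
   then obtain x y where xy: "(x, y) \<in> O'" "a = \<phi> x" "b = \<psi> y" using W(2) by auto
   from O'[THEN conjunct1, unfolded openin_prod_topology_alt, rule_format, OF xy(1)]
   obtain S T where ST: "openin (mtop X) S" "openin (mtop Y) T" "x \<in> S" "y \<in> T" "S \<times> T \<subseteq> O'" by (elim exE conjE)
   have sub: "S \<subseteq> U" "T \<subseteq> V" using ST O' W(1) by auto
   have "\<phi> ` S \<times> \<psi> ` T \<subseteq> \<chi>' ` O'" using ST(5) W(2) by (auto intro!: image_eqI[of _ "map_prod \<phi> \<psi>"])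
   then show "\<exists>U V. openin (vtop (model X)) U \<and> openin (vtop (model Y)) V \<and> a \<in> U \<and> b \<in> V \<and> U \<times> V \<subseteq> \<chi>' ` O'"
    using charted_image[OF X U ST(1) sub(1)] charted_image[OF Y V ST(2) sub(2)] xy ST
    by (intro exI[of _ "\<phi> ` S"] exI[of _ "\<psi> ` T"]) simp
  qed
 qed
qed

lemma smooth_map_pair:
 assumes X: "charted X" and Y: "charted Y" and Z: "charted Z"
  and f: "smooth_map X Y f" and g: "smooth_map X Z g"
 shows "smooth_map X (prod_mfd Y Z) (%x. (f x, g x))"
proof (rule smooth_mapI)
 show "continuous_map (mtop X) (mtop (prod_mfd Y Z)) (%x. (f x, g x))"
  using smooth_map_continuous[OF f] smooth_map_continuous[OF g] by (simp add: continuous_map_paired)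
 fix U \<phi> W \<chi>' assume U: "(U, \<phi>) \<in> atlas X" and "(W, \<chi>') \<in> atlas (prod_mfd Y Z)"
 then obtain V1 \<psi>1 V2 \<psi>2 where W: "W = V1 \<times> V2" "\<chi>' = map_prod \<psi>1 \<psi>2" and V1: "(V1, \<psi>1) \<in> atlas Y" and V2: "(V2, \<psi>2) \<in> atlas Z"
  by (auto simp: atlas_prod_mfd)
 interpret XY: lcs2 "model X" "model Y" by (intro lcs2.intro charted_lcs X Y)
 interpret XZ: lcs2 "model X" "model Z" by (intro lcs2.intro charted_lcs X Z)
 note F = smooth_map_chart[OF f U V1] and G = smooth_map_chart[OF g U V2]
 let ?S = "\<phi> ` (U \<inter> (%x. (f x, g x)) -` W)"
 have S: "?S = \<phi> ` (U \<inter> f -` V1) \<inter> \<phi> ` (U \<inter> g -` V2)"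
 proof -
  have "U \<inter> (%x. (f x, g x)) -` W = (U \<inter> f -` V1) \<inter> (U \<inter> g -` V2)" using W(1) by auto
  then show ?thesis using inj_on_image_Int[OF charted_inj[OF X U], of "U \<inter> f -` V1" "U \<inter> g -` V2"] by simp
 qed
 have So: "openin (vtop (model X)) ?S"
  unfolding S by (rule openin_Int[OF XY.smooth_on_open[OF F] XZ.smooth_on_open[OF G]])
 have "smooth_on (model X) (prod_space (model Y) (model Z)) ?S
   (%y. ((\<psi>1 \<circ> f \<circ> inv_into U \<phi>) y, (\<psi>2 \<circ> g \<circ> inv_into U \<phi>) y))"
  by (rule smooth_on_pair(1)[OF charted_lcs[OF X] charted_lcs[OF Y] charted_lcs[OF Z]
     XY.smooth_on_open_subset[OF F So] XZ.smooth_on_open_subset[OF G So]]) (simp_all only: S Int_lower1 Int_lower2)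
 moreover have "(%y. ((\<psi>1 \<circ> f \<circ> inv_into U \<phi>) y, (\<psi>2 \<circ> g \<circ> inv_into U \<phi>) y)) = \<chi>' \<circ> (%x. (f x, g x)) \<circ> inv_into U \<phi>"
  by (simp add: fun_eq_iff W(2))
 ultimately show "smooth_on (model X) (model (prod_mfd Y Z)) ?S (\<chi>' \<circ> (%x. (f x, g x)) \<circ> inv_into U \<phi>)" by simp
qed

text \<open>The target chart of a projection may differ from the factor of the product chart in the
  source. Smoothness of the identity of that factor supplies the change of charts.\<close>

lemma smooth_map_proj:
 assumes X: "charted X" and Y: "charted Y"
 shows smooth_map_fst: "smooth_map X X (%x. x) ==> smooth_map (prod_mfd X Y) X fst"
  and smooth_map_snd: "smooth_map Y Y (%y. y) ==> smooth_map (prod_mfd X Y) Y snd"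
proof -
 let ?P = "prod_space (model X) (model Y)"
 note lX = charted_lcs[OF X] and lY = charted_lcs[OF Y]
 interpret XX: lcs2 "model X" "model X" by (intro lcs2.intro charted_lcs X)
 interpret YY: lcs2 "model Y" "model Y" by (intro lcs2.intro charted_lcs Y)
 interpret P1: lcs3 ?P "model X" "model X" by (intro lcs3.intro lcs2.intro charted_lcs X Y lcs_prod_space)
 interpret P2: lcs3 ?P "model Y" "model Y" by (intro lcs3.intro lcs2.intro charted_lcs X Y lcs_prod_space)
 have inv: "inv_into (U \<times> V) (map_prod \<phi> \<psi>) (\<phi> x, \<psi> y) = (x, y)"
  if "(U, \<phi>) \<in> atlas X" "(V, \<psi>) \<in> atlas Y" "x \<in> U" "y \<in> V" for U \<phi> V \<psi> x y
  using inv_into_f_f[OF map_prod_inj_on[OF charted_inj[OF X that(1)] charted_inj[OF Y that(2)]], of "(x, y)"] that by simp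
 show "smooth_map (prod_mfd X Y) X fst" if id: "smooth_map X X (%x. x)"
 proof (rule smooth_mapI)
  fix W \<chi>' U' \<phi>' assume "(W, \<chi>') \<in> atlas (prod_mfd X Y)" and U': "(U', \<phi>') \<in> atlas X"
  then obtain U \<phi> V \<psi> where W: "W = U \<times> V" "\<chi>' = map_prod \<phi> \<psi>" and U: "(U, \<phi>) \<in> atlas X" and V: "(V, \<psi>) \<in> atlas Y"
   by (auto simp: atlas_prod_mfd)
  have tr: "smooth_on (model X) (model X) (\<phi> ` (U \<inter> U')) (\<phi>' \<circ> inv_into U \<phi>)"
   using smooth_map_chart[OF id U U'] by (simp add: o_def)
  have S: "\<chi>' ` (W \<inter> fst -` U') = \<phi> ` (U \<inter> U') \<times> \<psi> ` V" unfolding W by force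
  have "openin (vtop (model Y)) (\<psi> ` V)" by (rule charted_image[OF Y V charted_open[OF Y V] order_refl])
  then have So: "openin (vtop ?P) (\<phi> ` (U \<inter> U') \<times> \<psi> ` V)"
   using XX.smooth_on_open[OF tr] by (simp add: openin_prod_Times_iff)
  have "smooth_on ?P (model X) (\<phi> ` (U \<inter> U') \<times> \<psi> ` V) (%p. (\<phi>' \<circ> inv_into U \<phi>) (fst p))"
   by (rule P1.smooth_on_compose(1)[OF smooth_on_linear[OF lcs_prod_space[OF lX lY]
      lX cont_linear_fst[OF lX lY] So] tr]) auto
  then have "smooth_on ?P (model X) (\<phi> ` (U \<inter> U') \<times> \<psi> ` V) (\<phi>' \<circ> fst \<circ> inv_into W \<chi>')"
   by (rule P1.EF.smooth_on_cong) (auto simp: W inv[OF U V] charted_inv[OF X U])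
  then show "smooth_on (model (prod_mfd X Y)) (model X) (\<chi>' ` (W \<inter> fst -` U')) (\<phi>' \<circ> fst \<circ> inv_into W \<chi>')"
   unfolding S by simp
 qed (simp add: continuous_map_fst)
 show "smooth_map (prod_mfd X Y) Y snd" if id: "smooth_map Y Y (%x. x)"
 proof (rule smooth_mapI)
  fix W \<chi>' V' \<psi>' assume "(W, \<chi>') \<in> atlas (prod_mfd X Y)" and V': "(V', \<psi>') \<in> atlas Y"
  then obtain U \<phi> V \<psi> where W: "W = U \<times> V" "\<chi>' = map_prod \<phi> \<psi>" and U: "(U, \<phi>) \<in> atlas X" and V: "(V, \<psi>) \<in> atlas Y"
   by (auto simp: atlas_prod_mfd)
  have tr: "smooth_on (model Y) (model Y) (\<psi> ` (V \<inter> V')) (\<psi>' \<circ> inv_into V \<psi>)"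
   using smooth_map_chart[OF id V V'] by (simp add: o_def)
  have S: "\<chi>' ` (W \<inter> snd -` V') = \<phi> ` U \<times> \<psi> ` (V \<inter> V')" unfolding W by force
  have "openin (vtop (model X)) (\<phi> ` U)" by (rule charted_image[OF X U charted_open[OF X U] order_refl])
  then have So: "openin (vtop ?P) (\<phi> ` U \<times> \<psi> ` (V \<inter> V'))"
   using YY.smooth_on_open[OF tr] by (simp add: openin_prod_Times_iff)
  have "smooth_on ?P (model Y) (\<phi> ` U \<times> \<psi> ` (V \<inter> V')) (%p. (\<psi>' \<circ> inv_into V \<psi>) (snd p))"
   by (rule P2.smooth_on_compose(1)[OF smooth_on_linear[OF lcs_prod_space[OF lX lY]
      lY cont_linear_snd[OF lX lY] So] tr]) auto
  then have "smooth_on ?P (model Y) (\<phi> ` U \<times> \<psi> ` (V \<inter> V')) (\<psi>' \<circ> snd \<circ> inv_into W \<chi>')"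
   by (rule P2.EF.smooth_on_cong) (auto simp: W inv[OF U V] charted_inv[OF Y V])
  then show "smooth_on (model (prod_mfd X Y)) (model Y) (\<chi>' ` (W \<inter> snd -` V')) (\<psi>' \<circ> snd \<circ> inv_into W \<chi>')"
   unfolding S by simp
 qed (simp add: continuous_map_snd)
qed

text \<open>A locally convex space as a manifold with one global chart, so that smoothness into it
  involves no choice of a target chart. The fibre manifold \<open>alg_mfd\<close> is an
  instance.\<close>

definition vmfd :: "(real, 'e) tvs => ('e, 'e) mfd"
 where "vmfd E = \<lparr>mtop = vtop E, model = E, atlas = {(carrier E, %x. x)}\<rparr>"

lemma vmfd_simps [simp]:
 "mtop (vmfd E) = vtop E" "model (vmfd E) = E" "atlas (vmfd E) = {(carrier E, %x. x)}"
 by (simp_all add: vmfd_def)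

lemma alg_mfd_eq: "alg_mfd A = vmfd (real_space A)" by (simp add: alg_mfd_def vmfd_def)

lemma charted_vmfd: "lcs E ==> charted (vmfd E)"
proof -
 assume "lcs E"
 then interpret lcs E .
 show ?thesis using openin_topspace[of "vtop E"] lcs_axioms by (auto simp: charted_def)
qed

lemma smooth_map_vmfd_iff:
 assumes X: "charted X" and E: "lcs E"
 shows "smooth_map X (vmfd E) f \<longleftrightarrow> continuous_map (mtop X) (vtop E) f \<and>
  (\<forall>(U, \<phi>)\<in>atlas X. smooth_on (model X) E (\<phi> ` U) (f \<circ> inv_into U \<phi>))"
proof -
 interpret lcs E by (rule E)
 have "smooth_on (model X) E (\<phi> ` (U \<inter> f -` carrier E)) ((%x. x) \<circ> f \<circ> inv_into U \<phi>) \<longleftrightarrow>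
   smooth_on (model X) E (\<phi> ` U) (f \<circ> inv_into U \<phi>)"
  if U: "(U, \<phi>) \<in> atlas X" and f: "continuous_map (mtop X) (vtop E) f" for U \<phi>
 proof -
  have "U \<inter> f -` carrier E = U" using f charted_subset[OF X U] by (fastforce simp: continuous_map_def Pi_iff)
  then show ?thesis by (simp add: o_def)
 qed
 then show ?thesis by (auto simp: smooth_map_def)
qed

lemma smooth_map_vmfd_compose:
 assumes X: "charted X" and E: "lcs E" and F: "lcs F" and f: "smooth_map X (vmfd E) f"
  and T: "smooth_on E F W T" and im: "!!x. x \<in> points X ==> f x \<in> W"
 shows "smooth_map X (vmfd F) (%x. T (f x))" unfolding smooth_map_vmfd_iff[OF X F]
proof (intro conjI, safe)
 interpret lcs3 "model X" E F by (intro lcs3.intro lcs2.intro charted_lcs X E F)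
 have fc: "continuous_map (mtop X) (subtopology (vtop E) W) f"
  using f im by (auto simp: smooth_map_vmfd_iff[OF X E] continuous_map_in_subtopology)
 from continuous_map_compose[OF fc FG.smooth_on_continuous[OF T]]
 show "continuous_map (mtop X) (vtop F) (%x. T (f x))" by (simp add: o_def)
 fix U \<phi> assume U: "(U, \<phi>) \<in> atlas X"
 have fs: "smooth_on (model X) E (\<phi> ` U) (f \<circ> inv_into U \<phi>)"
  using f U by (auto simp: smooth_map_vmfd_iff[OF X E])
 show "smooth_on (model X) F (\<phi> ` U) ((%x. T (f x)) \<circ> inv_into U \<phi>)"
 proof -
  have "(f \<circ> inv_into U \<phi>) y \<in> W" if "y \<in> \<phi> ` U" for y
   using inv_into_into[OF that] im charted_subset[OF X U] by auto
  from smooth_on_compose(1)[OF fs T this] show ?thesis by (simp add: o_def)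
 qed
qed

lemma smooth_map_vmfd_pair:
 assumes X: "charted X" and E: "lcs E" and F: "lcs F"
  and f: "smooth_map X (vmfd E) f" and g: "smooth_map X (vmfd F) g"
 shows "smooth_map X (vmfd (prod_space E F)) (%x. (f x, g x))"
proof -
 have "smooth_on (model X) (prod_space E F) (\<phi> ` U) ((%x. (f x, g x)) \<circ> inv_into U \<phi>)" if U: "(U, \<phi>) \<in> atlas X" for U \<phi>
 proof -
  have "smooth_on (model X) E (\<phi> ` U) (f \<circ> inv_into U \<phi>)" "smooth_on (model X) F (\<phi> ` U) (g \<circ> inv_into U \<phi>)"
   using f g U by (auto simp: smooth_map_vmfd_iff[OF X E] smooth_map_vmfd_iff[OF X F])
  from smooth_on_pair(1)[OF charted_lcs[OF X] E F this] show ?thesis by (simp add: o_def)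
 qed
 then show ?thesis using f g by (auto simp: smooth_map_vmfd_iff[OF X E] smooth_map_vmfd_iff[OF X F]
    smooth_map_vmfd_iff[OF X lcs_prod_space[OF E F]] continuous_map_paired)
qed

section \<open>Discrete sets as zero-dimensional manifolds\<close>

lemma discrete_mfd_simps [simp]:
 "mtop (discrete_mfd S) = discrete_topology S" "model (discrete_mfd S) = euclid_space 0"
 by (simp_all add: discrete_mfd_def)

lemma atlas_discrete: "(U, \<phi>) \<in> atlas (discrete_mfd S) \<longleftrightarrow> (\<exists>g\<in>S. U = {g} \<and> \<phi> = (%_ _. 0))"
 by (auto simp: discrete_mfd_def)

lemma openin_euclid_0: "openin (vtop (euclid_space 0)) {%_. 0}"
proof -
 have "{%_. 0} = topspace (Euclidean_space 0)" by (auto simp: topspace_Euclidean_space)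
 then show ?thesis by simp
qed

lemma charted_discrete: "charted (discrete_mfd S)" unfolding charted_def
proof (intro conjI)
 show "lcs (model (discrete_mfd S))" by (simp add: lcs_euclid_space)
 show "\<forall>(U, \<phi>)\<in>atlas (discrete_mfd S). openin (mtop (discrete_mfd S)) U \<and> inj_on \<phi> U \<and>
   (\<forall>O'. openin (mtop (discrete_mfd S)) O' \<and> O' \<subseteq> U \<longrightarrow> openin (vtop (model (discrete_mfd S))) (\<phi> ` O'))"
 proof (clarify, intro conjI allI impI)
  fix U and \<phi> :: "'a => nat => real" assume "(U, \<phi>) \<in> atlas (discrete_mfd S)"
  then obtain g where g: "g \<in> S" "U = {g}" "\<phi> = (%_ _. 0)" by (auto simp: atlas_discrete)
  show "openin (mtop (discrete_mfd S)) U" "inj_on \<phi> U" using g by auto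
  fix O' assume "openin (mtop (discrete_mfd S)) O' \<and> O' \<subseteq> U"
  then have "O' = {} \<or> O' = {g}" using g(2) by auto
  then show "openin (vtop (model (discrete_mfd S))) (\<phi> ` O')" using openin_euclid_0 g(3) by auto
 qed
qed (auto simp: discrete_mfd_def)

lemma smooth_map_discrete_id: "smooth_map (discrete_mfd S) (discrete_mfd S) (%x. x)"
proof (rule smooth_mapI)
 fix U \<phi> V \<psi> assume U: "(U, \<phi>) \<in> atlas (discrete_mfd S)" and V: "(V, \<psi>) \<in> atlas (discrete_mfd S)"
 interpret lcs2 "euclid_space 0" "euclid_space 0" by (intro lcs2.intro lcs_euclid_space)
 obtain g h where gh: "U = {g}" "\<phi> = (%_ _. 0)" "V = {h}" "\<psi> = (%_ _. 0)"
  using U V by (auto simp: atlas_discrete)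
 have "\<phi> ` (U \<inter> (%x. x) -` V) = {%_. 0} \<or> \<phi> ` (U \<inter> (%x. x) -` V) = {}" using gh by (cases "g = h") auto
 then have "openin (vtop (euclid_space 0)) (\<phi> ` (U \<inter> (%x. x) -` V))" using openin_euclid_0 by auto
 then show "smooth_on (model (discrete_mfd S)) (model (discrete_mfd S)) (\<phi> ` (U \<inter> (%x. x) -` V)) (\<psi> \<circ> (%x. x) \<circ> inv_into U \<phi>)"
  using smooth_on_const[of "\<phi> ` (U \<inter> (%x. x) -` V)" "%_. 0"] gh(4) by (simp add: o_def)
qed simp

section \<open>Section algebras\<close>

text \<open>The properties of an algebra bundle on which the section algebra rests, with charted
  manifolds in place of smooth ones. In this form they can be verified for the pull-back.\<close>

locale alg_bundle_charted =
 fixes B :: "('b, 'f, 'm, 'a) alg_bundle"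
 assumes charted_E: "charted (total_space B)"
  and charted_M: "charted (base_space B)" and id_M: "smooth_map (base_space B) (base_space B) (%x. x)"
  and loc_compact_M: "locally_compact_space (vtop (model (base_space B)))"
  and lca_A: "lca (fibre B)"
  and proj_cont: "continuous_map (mtop (total_space B)) (mtop (base_space B)) (proj B)"
  and fibre_calg: "!!x. x \<in> points (base_space B) ==> complex_algebra (fibre_alg B x)"
  and fibre_carrier: "!!x. x \<in> points (base_space B) ==>
   carrier (fibre_alg B x) = {b \<in> points (total_space B). proj B b = x}"
  and triv_exists: "!!x. x \<in> points (base_space B) ==> \<exists>U \<phi>. x \<in> U \<and> local_trivialization B U \<phi>"
begin

abbreviation "E \<equiv> total_space B"
abbreviation "M \<equiv> base_space B"
abbreviation "A \<equiv> fibre B"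
abbreviation "RA \<equiv> real_space (fibre B)"
abbreviation "F \<equiv> fibre_alg B"
abbreviation over where "over U \<equiv> {b \<in> points E. proj B b \<in> U}"
abbreviation "X \<equiv> section_algebra B"

sublocale A: lca "fibre B" by (rule lca_A)

lemma lcs_RA: "lcs RA" by (rule A.lcs_real)

lemma charted_alg: "charted (alg_mfd A)" unfolding alg_mfd_eq by (rule charted_vmfd[OF lcs_RA])

lemma openin_over: "openin (mtop M) U ==> openin (mtop E) (over U)"
 by (rule openin_continuous_map_preimage[OF proj_cont])

context
 fixes U \<phi> assumes triv: "local_trivialization B U \<phi>"
begin

lemma triv_open: "openin (mtop M) U" using triv by (simp add: local_trivialization_def)

lemma triv_sub: "U \<subseteq> points M" using openin_subset[OF triv_open] .

lemma triv_points: "points (prod_mfd (open_submfd M U) (alg_mfd A)) = U \<times> carrier A"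
 using triv_sub by (auto simp: alg_mfd_def)

lemma triv_points_over: "points (open_submfd E (over U)) = over U" by auto

lemma triv_diffeo: "diffeomorphism (prod_mfd (open_submfd M U) (alg_mfd A)) (open_submfd E (over U)) \<phi>"
 using triv by (simp add: local_trivialization_def)

lemma triv_bij: "bij_betw \<phi> (U \<times> carrier A) (over U)"
 using triv_diffeo unfolding diffeomorphism_def triv_points triv_points_over by blast

lemma triv_smooth: "smooth_map (prod_mfd (open_submfd M U) (alg_mfd A)) (open_submfd E (over U)) \<phi>"
 using triv_diffeo unfolding diffeomorphism_def by blast

lemma triv_inv_smooth: "smooth_map (open_submfd E (over U)) (prod_mfd (open_submfd M U) (alg_mfd A)) (inv_into (U \<times> carrier A) \<phi>)"
 using triv_diffeo unfolding diffeomorphism_def triv_points by blast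

lemma triv_proj: "x \<in> U ==> a \<in> carrier A ==> proj B (\<phi> (x, a)) = x"
 using triv by (simp add: local_trivialization_def)

lemma triv_iso: "x \<in> U ==> (%a. \<phi> (x, a)) \<in> alg_iso A (F x)" using triv by (simp add: local_trivialization_def)

lemma triv_in: "x \<in> U ==> a \<in> carrier A ==> \<phi> (x, a) \<in> over U" using triv_bij by (auto simp: bij_betw_def)

lemma coord_triv:
 assumes "x \<in> U" "a \<in> carrier A"
 shows "fibre_coord B U \<phi> (\<phi> (x, a)) = a" using inv_into_f_f[of \<phi> "U \<times> carrier A" "(x, a)"] triv_bij assms
 by (simp add: fibre_coord_def bij_betw_def)

text \<open>Over \<open>U\<close> the inverse of the trivialization is the pair of projection and
  fibre coordinate. A point of a known fibre is thus determined by its coordinate.\<close>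

lemma triv_coord:
 assumes "b \<in> over U"
 shows "fibre_coord B U \<phi> b \<in> carrier A" "\<phi> (proj B b, fibre_coord B U \<phi> b) = b"
  "inv_into (U \<times> carrier A) \<phi> b = (proj B b, fibre_coord B U \<phi> b)"
proof -
 have "b \<in> \<phi> ` (U \<times> carrier A)" using assms triv_bij by (simp add: bij_betw_def)
 then obtain x a where xa: "x \<in> U" "a \<in> carrier A" "b = \<phi> (x, a)" by auto
 have inv: "inv_into (U \<times> carrier A) \<phi> b = (x, a)"
  using inv_into_f_f[of \<phi> "U \<times> carrier A" "(x, a)"] triv_bij xa by (simp add: bij_betw_def)
 show "fibre_coord B U \<phi> b \<in> carrier A" "\<phi> (proj B b, fibre_coord B U \<phi> b) = b"
  "inv_into (U \<times> carrier A) \<phi> b = (proj B b, fibre_coord B U \<phi> b)"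
  using xa inv triv_proj[OF xa(1,2)] by (simp_all add: fibre_coord_def)
qed

lemma fibre_over: "x \<in> U ==> b \<in> carrier (F x) ==> b \<in> over U \<and> proj B b = x" using triv_sub fibre_carrier by auto

lemma
 assumes x: "x \<in> U"
 shows coord_add: "b \<in> carrier (F x) ==> b' \<in> carrier (F x) ==>
   fibre_coord B U \<phi> (b \<oplus>\<^bsub>F x\<^esub> b') = fibre_coord B U \<phi> b \<oplus>\<^bsub>A\<^esub> fibre_coord B U \<phi> b'"
  and coord_mult: "b \<in> carrier (F x) ==> b' \<in> carrier (F x) ==>
   fibre_coord B U \<phi> (b \<otimes>\<^bsub>F x\<^esub> b') = fibre_coord B U \<phi> b \<otimes>\<^bsub>A\<^esub> fibre_coord B U \<phi> b'"
  and coord_smult: "b \<in> carrier (F x) ==> fibre_coord B U \<phi> (c \<odot>\<^bsub>F x\<^esub> b) = c \<odot>\<^bsub>A\<^esub> fibre_coord B U \<phi> b"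
  and coord_one: "fibre_coord B U \<phi> \<one>\<^bsub>F x\<^esub> = \<one>\<^bsub>A\<^esub>"
proof -
 let ?f = "fibre_coord B U \<phi>"
 have h: "(%a. \<phi> (x, a)) \<in> ring_hom A (F x)" "!!c a. a \<in> carrier A ==> \<phi> (x, c \<odot>\<^bsub>A\<^esub> a) = c \<odot>\<^bsub>F x\<^esub> \<phi> (x, a)"
  using triv_iso[OF x] by (auto simp: alg_iso_def)
 have bk: "?f b \<in> carrier A" "b = \<phi> (x, ?f b)" if "b \<in> carrier (F x)" for b
  using triv_coord[of b] fibre_over[OF x that] by auto
 show "?f (b \<oplus>\<^bsub>F x\<^esub> b') = ?f b \<oplus>\<^bsub>A\<^esub> ?f b'" if "b \<in> carrier (F x)" "b' \<in> carrier (F x)"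
 proof -
  have "b \<oplus>\<^bsub>F x\<^esub> b' = \<phi> (x, ?f b \<oplus>\<^bsub>A\<^esub> ?f b')"
   using ring_hom_add[OF h(1) bk(1)[OF that(1)] bk(1)[OF that(2)]] bk(2)[OF that(1)] bk(2)[OF that(2)] by simp
  then show ?thesis using coord_triv[OF x] bk(1)[OF that(1)] bk(1)[OF that(2)] by simp
 qed
 show "?f (b \<otimes>\<^bsub>F x\<^esub> b') = ?f b \<otimes>\<^bsub>A\<^esub> ?f b'" if "b \<in> carrier (F x)" "b' \<in> carrier (F x)"
 proof -
  have "b \<otimes>\<^bsub>F x\<^esub> b' = \<phi> (x, ?f b \<otimes>\<^bsub>A\<^esub> ?f b')"
   using ring_hom_mult[OF h(1) bk(1)[OF that(1)] bk(1)[OF that(2)]] bk(2)[OF that(1)] bk(2)[OF that(2)] by simp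
  then show ?thesis using coord_triv[OF x] bk(1)[OF that(1)] bk(1)[OF that(2)] by simp
 qed
 show "?f (c \<odot>\<^bsub>F x\<^esub> b) = c \<odot>\<^bsub>A\<^esub> ?f b" if "b \<in> carrier (F x)"
 proof -
  have "c \<odot>\<^bsub>F x\<^esub> b = \<phi> (x, c \<odot>\<^bsub>A\<^esub> ?f b)" using h(2)[OF bk(1)[OF that]] bk(2)[OF that] by simp
  then show ?thesis using coord_triv[OF x] bk(1)[OF that] by simp
 qed
 show "?f \<one>\<^bsub>F x\<^esub> = \<one>\<^bsub>A\<^esub>" using ring_hom_one[OF h(1)] coord_triv[OF x A.rg.one_closed] by simp
qed

lemma charted_MU: "charted (open_submfd M U)" by (rule charted_open_submfd[OF charted_M triv_open])

lemma charted_MUA: "charted (prod_mfd (open_submfd M U) (alg_mfd A))"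
 by (rule charted_prod_mfd[OF charted_MU charted_alg])

lemma charted_over: "charted (open_submfd E (over U))"
 by (rule charted_open_submfd[OF charted_E openin_over[OF triv_open]])

lemma id_alg: "smooth_map (alg_mfd A) (alg_mfd A) (%a. a)"
 unfolding alg_mfd_eq smooth_map_vmfd_iff[OF charted_vmfd[OF lcs_RA] lcs_RA]
proof (intro conjI ballI)
 fix p assume "p \<in> atlas (vmfd RA)"
 interpret R: lcs RA by (rule lcs_RA)
 interpret lcs2 RA RA by (intro lcs2.intro lcs_RA)
 have o: "openin (vtop RA) (carrier A)" using openin_topspace[of "vtop A"] by simp
 have "smooth_on RA RA (carrier A) ((%a. a) \<circ> inv_into (carrier A) (%a. a))"
  by (rule smooth_on_cong[OF smooth_on_id[OF lcs_RA o]]) (auto simp: inv_into_f_f[of "%a. a"])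
 then show "case p of (U, \<phi>) => smooth_on (model (vmfd RA)) RA (\<phi> ` U) ((%a. a) \<circ> inv_into U \<phi>)"
  using \<open>p \<in> atlas (vmfd RA)\<close> by simp
qed simp

lemma coord_smooth: "smooth_map (open_submfd E (over U)) (alg_mfd A) (fibre_coord B U \<phi>)"
proof -
 have "smooth_map (open_submfd E (over U)) (alg_mfd A) (%b. snd (inv_into (U \<times> carrier A) \<phi> b))"
  by (rule smooth_map_compose[OF charted_over charted_MUA charted_alg triv_inv_smooth
     smooth_map_snd[OF charted_MU charted_alg id_alg]])
 then show ?thesis by (simp add: fibre_coord_def[abs_def])
qed

text \<open>The counterpart of \<open>coord_smooth\<close>: base point and fibre coordinate together
  give a smooth map into the total space.\<close>

lemma smooth_map_via_triv:
 assumes Y: "charted Y" and f: "smooth_map Y M f" and fU: "!!y. y \<in> points Y ==> f y \<in> U"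
  and a: "smooth_map Y (alg_mfd A) a"
 shows "smooth_map Y E (%y. \<phi> (f y, a y))"
proof -
 have "smooth_map Y (prod_mfd (open_submfd M U) (alg_mfd A)) (%y. (f y, a y))"
  by (intro smooth_map_pair Y charted_MU charted_alg a smooth_map_into_open[OF Y f] fU)
 then have "smooth_map Y (open_submfd E (over U)) (%y. \<phi> (f y, a y))"
  by (rule smooth_map_compose[OF Y charted_MUA charted_over _ triv_smooth])
 then show ?thesis by (rule smooth_map_from_open[OF Y])
qed

end

section \<open>Smooth sections and their pointwise operations\<close>

lemma section_in: "s \<in> smooth_sections B ==> x \<in> points M ==> s x \<in> carrier (F x)"
 using smooth_map_image[of M E s] fibre_carrier by (auto simp: smooth_sections_def)

lemma section_over: "s \<in> smooth_sections B ==> local_trivialization B U \<phi> ==> x \<in> U ==> s x \<in> over U"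
 using fibre_over[of U \<phi> x "s x"] section_in triv_sub by blast

lemma section_rep_smooth:
 assumes s: "s \<in> smooth_sections B" and triv: "local_trivialization B U \<phi>"
 shows "smooth_map (open_submfd M U) (alg_mfd A) (%x. fibre_coord B U \<phi> (s x))"
proof -
 have "smooth_map (open_submfd M U) E s"
  using s by (intro smooth_map_restrict[OF charted_M charted_E _ triv_open[OF triv]]) (simp add: smooth_sections_def)
 then have "smooth_map (open_submfd M U) (open_submfd E (over U)) s"
  by (rule smooth_map_into_open[OF charted_MU[OF triv]]) (use section_over[OF s triv] in auto)
 then show ?thesis
  by (rule smooth_map_compose[OF charted_MU[OF triv] charted_over[OF triv] charted_alg _ coord_smooth[OF triv]])
qed

text \<open>Where the bundle is trivial a section is rebuilt from its base point and its coordinate,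
  so smoothness of the coordinate near each point suffices.\<close>

lemma sectionI:
 assumes ext: "s \<in> extensional (points M)" and fib: "!!x. x \<in> points M ==> s x \<in> carrier (F x)"
  and loc: "!!x. x \<in> points M ==> \<exists>O' U \<phi>. openin (mtop M) O' \<and> x \<in> O' \<and> O' \<subseteq> U \<and> local_trivialization B U \<phi> \<and>
   smooth_map (open_submfd M O') (alg_mfd A) (%x. fibre_coord B U \<phi> (s x))"
 shows "s \<in> smooth_sections B"
proof -
 have "smooth_map M E s"
 proof (rule smooth_map_glue[OF charted_M charted_E])
  fix x assume "x \<in> points M"
  from loc[OF this] obtain O' U \<phi> where O': "openin (mtop M) O'" "x \<in> O'" "O' \<subseteq> U" and triv: "local_trivialization B U \<phi>"
   and sm: "smooth_map (open_submfd M O') (alg_mfd A) (%x. fibre_coord B U \<phi> (s x))" by (elim exE conjE)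
  have c: "charted (open_submfd M O')" by (rule charted_open_submfd[OF charted_M O'(1)])
  have "smooth_map (open_submfd M O') E (%x. \<phi> (x, fibre_coord B U \<phi> (s x)))"
   by (rule smooth_map_via_triv[OF triv c smooth_map_restrict[OF charted_M charted_M id_M O'(1)] _ sm])
     (use O'(3) in auto)
  then have "smooth_map (open_submfd M O') E s"
  proof (rule smooth_map_cong[OF c charted_E])
   fix y assume "y \<in> points (open_submfd M O')"
   then have y: "y \<in> points M" "y \<in> U" using O'(3) by auto
   then have "s y \<in> over U \<and> proj B (s y) = y" using fibre_over[OF triv y(2) fib[OF y(1)]] by simp
   then show "\<phi> (y, fibre_coord B U \<phi> (s y)) = s y" using triv_coord(2)[OF triv, of "s y"] y(2) by simp
  qed
  then show "\<exists>O'. openin (mtop M) O' \<and> x \<in> O' \<and> smooth_map (open_submfd M O') E s"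
   using O' by (intro exI[of _ O'] conjI)
 qed
 then show ?thesis using ext fib fibre_carrier by (simp add: smooth_sections_def)
qed

lemma sectionI_triv:
 assumes ext: "s \<in> extensional (points M)" and fib: "!!x. x \<in> points M ==> s x \<in> carrier (F x)"
  and loc: "!!U \<phi>. local_trivialization B U \<phi> ==>
   smooth_map (open_submfd M U) (alg_mfd A) (%x. fibre_coord B U \<phi> (s x))"
 shows "s \<in> smooth_sections B"
proof (rule sectionI[OF ext fib])
 fix x assume "x \<in> points M"
 from triv_exists[OF this] obtain U \<phi> where U: "x \<in> U" "local_trivialization B U \<phi>" by (elim exE conjE)
 show "\<exists>O' U \<phi>. openin (mtop M) O' \<and> x \<in> O' \<and> O' \<subseteq> U \<and> local_trivialization B U \<phi> \<and>
   smooth_map (open_submfd M O') (alg_mfd A) (%x. fibre_coord B U \<phi> (s x))"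
  by (rule exI[of _ U], rule exI[of _ U], rule exI[of _ \<phi>]) (intro conjI order_refl U triv_open[OF U(2)] loc)
qed

lemma smooth_alg_add:
 assumes Y: "charted Y" and f: "smooth_map Y (alg_mfd A) f" and g: "smooth_map Y (alg_mfd A) g"
 shows "smooth_map Y (alg_mfd A) (%y. f y \<oplus>\<^bsub>A\<^esub> g y)"
proof -
 have o: "openin (vtop (prod_space RA RA)) (carrier (prod_space RA RA))"
  using openin_topspace[of "prod_topology (vtop A) (vtop A)"] by simp
 have "smooth_map Y (vmfd RA) (%y. (%(x, y). x \<oplus>\<^bsub>RA\<^esub> y) (f y, g y))"
  by (rule smooth_map_vmfd_compose[OF Y lcs_prod_space[OF lcs_RA lcs_RA] lcs_RA
     smooth_map_vmfd_pair[OF Y lcs_RA lcs_RA f[unfolded alg_mfd_eq] g[unfolded alg_mfd_eq]]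
     smooth_on_linear[OF lcs_prod_space[OF lcs_RA lcs_RA] lcs_RA cont_linear_add[OF lcs_RA lcs_RA] o]])
    (use smooth_map_image[OF f] smooth_map_image[OF g] in \<open>auto simp: alg_mfd_def\<close>)
 then show ?thesis unfolding alg_mfd_eq by simp
qed

lemma smooth_alg_mult:
 assumes Y: "charted Y" and f: "smooth_map Y (alg_mfd A) f" and g: "smooth_map Y (alg_mfd A) g"
 shows "smooth_map Y (alg_mfd A) (%y. f y \<otimes>\<^bsub>A\<^esub> g y)"
proof -
 have "smooth_map Y (vmfd RA) (%y. (%(x, y). x \<otimes>\<^bsub>A\<^esub> y) (f y, g y))"
  by (rule smooth_map_vmfd_compose[OF Y lcs_prod_space[OF lcs_RA lcs_RA] lcs_RA
     smooth_map_vmfd_pair[OF Y lcs_RA lcs_RA f[unfolded alg_mfd_eq] g[unfolded alg_mfd_eq]]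
     smooth_on_bilinear[OF lcs_RA lcs_RA lcs_RA cont_bilinear_mult[OF lcs_RA lca_A]]])
    (use smooth_map_image[OF f] smooth_map_image[OF g] in \<open>auto simp: alg_mfd_def\<close>)
 then show ?thesis unfolding alg_mfd_eq by simp
qed

lemma smooth_alg_smult:
 assumes Y: "charted Y" and f: "smooth_map Y (alg_mfd A) f"
 shows "smooth_map Y (alg_mfd A) (%y. c \<odot>\<^bsub>A\<^esub> f y)"
proof -
 have o: "openin (vtop RA) (carrier RA)" using openin_topspace[of "vtop A"] by simp
 have "continuous_map (vtop A) (vtop A) (%x. c \<odot>\<^bsub>A\<^esub> x)" by (rule A.continuous_map_vsmult) auto
 then have "cont_linear RA RA (%x. c \<odot>\<^bsub>A\<^esub> x)"
  by (simp add: cont_linear_def A.smult_add_right A.smult_smult mult.commute)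
 then show ?thesis
  using smooth_map_vmfd_compose[OF Y lcs_RA lcs_RA f[unfolded alg_mfd_eq] smooth_on_linear[OF lcs_RA lcs_RA _ o]]
   smooth_map_image[OF f] unfolding alg_mfd_eq by simp
qed

lemma section_algebra_simps:
 "carrier X = smooth_sections B" "mult X = (%s t. \<lambda>x\<in>points M. s x \<otimes>\<^bsub>F x\<^esub> t x)"
 "one X = (\<lambda>x\<in>points M. \<one>\<^bsub>F x\<^esub>)" "zero X = (\<lambda>x\<in>points M. \<zero>\<^bsub>F x\<^esub>)"
 "add X = (%s t. \<lambda>x\<in>points M. s x \<oplus>\<^bsub>F x\<^esub> t x)" "smult X = (%c s. \<lambda>x\<in>points M. c \<odot>\<^bsub>F x\<^esub> s x)"
 by (simp_all add: section_algebra_def)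

lemma calg_F: "x \<in> points M ==> calg (F x)" by (rule calg.intro[OF fibre_calg])

text \<open>The common part of the closure proofs: \<open>r\<close> is the pointwise formula,
  \<open>q\<close> its expression in the coordinates of a trivialization, where smoothness is
  visible.\<close>

lemma restrict_section:
 assumes "!!x. x \<in> points M ==> r x \<in> carrier (F x)"
  and "!!U \<phi>. local_trivialization B U \<phi> ==> smooth_map (open_submfd M U) (alg_mfd A) (q U \<phi>)"
  and "!!U \<phi> x. local_trivialization B U \<phi> ==> x \<in> U ==> x \<in> points M ==> q U \<phi> x = fibre_coord B U \<phi> (r x)"
 shows "(\<lambda>x\<in>points M. r x) \<in> smooth_sections B"
proof (rule sectionI_triv)
 fix U \<phi> assume triv: "local_trivialization B U \<phi>"
 show "smooth_map (open_submfd M U) (alg_mfd A) (%x. fibre_coord B U \<phi> ((\<lambda>x\<in>points M. r x) x))"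
  by (rule smooth_map_cong[OF charted_MU[OF triv] charted_alg assms(2)[OF triv]]) (use assms(3)[OF triv] in simp)
qed (use assms(1) in auto)

lemma add_section:
 assumes s: "s \<in> smooth_sections B" and t: "t \<in> smooth_sections B"
 shows "s \<oplus>\<^bsub>X\<^esub> t \<in> smooth_sections B" unfolding section_algebra_simps
proof (rule restrict_section)
 show "s x \<oplus>\<^bsub>F x\<^esub> t x \<in> carrier (F x)" if "x \<in> points M" for x
 proof -
  interpret calg "F x" by (rule calg_F[OF that])
  show ?thesis using section_in[OF s that] section_in[OF t that] by simp
 qed
qed (rule smooth_alg_add[OF charted_MU section_rep_smooth[OF s] section_rep_smooth[OF t]],
  simp_all add: coord_add section_in[OF s] section_in[OF t])

lemma mult_section:
 assumes s: "s \<in> smooth_sections B" and t: "t \<in> smooth_sections B"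
 shows "s \<otimes>\<^bsub>X\<^esub> t \<in> smooth_sections B" unfolding section_algebra_simps
proof (rule restrict_section)
 show "s x \<otimes>\<^bsub>F x\<^esub> t x \<in> carrier (F x)" if "x \<in> points M" for x
 proof -
  interpret calg "F x" by (rule calg_F[OF that])
  show ?thesis using section_in[OF s that] section_in[OF t that] by simp
 qed
qed (rule smooth_alg_mult[OF charted_MU section_rep_smooth[OF s] section_rep_smooth[OF t]],
  simp_all add: coord_mult section_in[OF s] section_in[OF t])

lemma smult_section:
 assumes s: "s \<in> smooth_sections B"
 shows "c \<odot>\<^bsub>X\<^esub> s \<in> smooth_sections B" unfolding section_algebra_simps
proof (rule restrict_section)
 show "c \<odot>\<^bsub>F x\<^esub> s x \<in> carrier (F x)" if "x \<in> points M" for x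
 proof -
  interpret calg "F x" by (rule calg_F[OF that])
  show ?thesis using section_in[OF s that] by simp
 qed
qed (rule smooth_alg_smult[OF charted_MU section_rep_smooth[OF s]], simp_all add: coord_smult section_in[OF s])

lemma one_section: "\<one>\<^bsub>X\<^esub> \<in> smooth_sections B" unfolding section_algebra_simps
proof (rule restrict_section)
 show "\<one>\<^bsub>F x\<^esub> \<in> carrier (F x)" if "x \<in> points M" for x
 proof -
  interpret calg "F x" by (rule calg_F[OF that])
  show ?thesis by simp
 qed
 show "smooth_map (open_submfd M U) (alg_mfd A) (%_. \<one>\<^bsub>A\<^esub>)" if "local_trivialization B U \<phi>" for U \<phi>
  by (intro smooth_map_const charted_MU[OF that] charted_alg) (simp add: alg_mfd_def)
qed (simp add: coord_one)

text \<open>Reduces smoothness of the zero section to that of the unit section.\<close>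

lemma zero_eq: "\<zero>\<^bsub>X\<^esub> = 0 \<odot>\<^bsub>X\<^esub> \<one>\<^bsub>X\<^esub>"
proof -
 have "\<zero>\<^bsub>F x\<^esub> = 0 \<odot>\<^bsub>F x\<^esub> \<one>\<^bsub>F x\<^esub>" if "x \<in> points M" for x
 proof -
  interpret calg "F x" by (rule calg_F[OF that])
  show ?thesis by simp
 qed
 then show ?thesis by (auto simp: section_algebra_simps restrict_def)
qed

lemma complex_algebra_X: "complex_algebra X"
proof (rule pointwise_complex_algebra[where D = "points M" and F = F])
 show "carrier X \<subseteq> (\<Pi>\<^sub>E x\<in>points M. carrier (F x))"
 proof
  fix s assume "s \<in> carrier X"
  then have s: "s \<in> smooth_sections B" by (simp add: section_algebra_simps)
  then show "s \<in> (\<Pi>\<^sub>E x\<in>points M. carrier (F x))"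
   using section_in[OF s] by (auto simp: PiE_def smooth_sections_def)
 qed
 show "\<zero>\<^bsub>X\<^esub> \<in> carrier X" unfolding zero_eq section_algebra_simps(1) by (intro smult_section one_section)
qed (use add_section mult_section smult_section one_section fibre_calg in \<open>simp_all only: section_algebra_simps\<close>)

end

section \<open>The topology of the section algebra\<close>

context alg_bundle_charted
begin

abbreviation local_rep where
 "local_rep U \<phi> V \<psi> s \<equiv> fibre_coord B U \<phi> \<circ> s \<circ> inv_into V \<psi>"

sublocale MR: lcs2 "model (base_space B)" "real_space (fibre B)"
 by (rule lcs2.intro[OF charted_lcs[OF charted_M] lcs_RA])

context
 fixes U \<phi> V \<psi>
 assumes triv: "local_trivialization B U \<phi>" and chart: "(V, \<psi>) \<in> atlas M"
begin

lemma chart_inv: "x \<in> \<psi> ` (U \<inter> V) ==> inv_into V \<psi> x \<in> U \<inter> V" using charted_inv[OF charted_M chart] by auto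

lemma chart_domain_open: "openin (vtop (model M)) (\<psi> ` (U \<inter> V))"
 by (intro charted_image[OF charted_M chart] openin_Int triv_open[OF triv] charted_open[OF charted_M chart]) auto

lemma smooth_on_chart:
 assumes f: "smooth_map (open_submfd M U) (alg_mfd A) f"
 shows "smooth_on (model M) RA (\<psi> ` (U \<inter> V)) (f \<circ> inv_into V \<psi>)"
proof -
 have "(V \<inter> U, \<psi>) \<in> atlas (open_submfd M U)" using chart atlas_open_submfd by blast
 then have "smooth_on (model M) RA (\<psi> ` (V \<inter> U)) (f \<circ> inv_into (V \<inter> U) \<psi>)"
  using f[unfolded alg_mfd_eq smooth_map_vmfd_iff[OF charted_MU[OF triv] lcs_RA]] by auto
 then show ?thesis unfolding Int_commute[of V U]
 proof (rule MR.smooth_on_cong)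
  fix x assume "x \<in> \<psi> ` (U \<inter> V)"
  then obtain y where y: "y \<in> U \<inter> V" "x = \<psi> y" by blast
  have "inv_into (U \<inter> V) \<psi> (\<psi> y) = y"
   by (rule inv_into_f_f[OF inj_on_subset[OF charted_inj[OF charted_M chart]] y(1)]) simp
  moreover have "inv_into V \<psi> (\<psi> y) = y" using y(1) by (intro charted_inv[OF charted_M chart]) simp
  ultimately show "(f \<circ> inv_into (U \<inter> V) \<psi>) x = (f \<circ> inv_into V \<psi>) x" by (simp only: o_apply y(2))
 qed
qed

lemma local_rep_smooth:
 assumes s: "s \<in> smooth_sections B"
 shows "smooth_on (model M) RA (\<psi> ` (U \<inter> V)) (local_rep U \<phi> V \<psi> s)"
 using smooth_on_chart[OF section_rep_smooth[OF s triv]] by (simp add: o_def)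

lemma local_rep_add:
 assumes "s \<in> smooth_sections B" "t \<in> smooth_sections B" "x \<in> \<psi> ` (U \<inter> V)"
 shows "local_rep U \<phi> V \<psi> (s \<oplus>\<^bsub>X\<^esub> t) x = local_rep U \<phi> V \<psi> s x \<oplus>\<^bsub>A\<^esub> local_rep U \<phi> V \<psi> t x"
 using coord_add[OF triv _ section_in section_in] chart_inv[OF assms(3)] assms triv_sub[OF triv]
 by (auto simp: section_algebra_simps)

lemma local_rep_mult:
 assumes "s \<in> smooth_sections B" "t \<in> smooth_sections B" "x \<in> \<psi> ` (U \<inter> V)"
 shows "local_rep U \<phi> V \<psi> (s \<otimes>\<^bsub>X\<^esub> t) x = local_rep U \<phi> V \<psi> s x \<otimes>\<^bsub>A\<^esub> local_rep U \<phi> V \<psi> t x"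
 using coord_mult[OF triv _ section_in section_in] chart_inv[OF assms(3)] assms triv_sub[OF triv]
 by (auto simp: section_algebra_simps)

lemma local_rep_smult:
 assumes "s \<in> smooth_sections B" "x \<in> \<psi> ` (U \<inter> V)"
 shows "local_rep U \<phi> V \<psi> (c \<odot>\<^bsub>X\<^esub> s) x = c \<odot>\<^bsub>A\<^esub> local_rep U \<phi> V \<psi> s x"
 using coord_smult[OF triv _ section_in] chart_inv[OF assms(2)] assms triv_sub[OF triv]
 by (auto simp: section_algebra_simps)

end

abbreviation (input) "sec_index \<equiv> {(U, \<phi>, V, \<psi>, k :: nat). local_trivialization B U \<phi> \<and> (V, \<psi>) \<in> atlas M}"
abbreviation (input) "sec_dom \<equiv> %(U :: 'm set, \<phi> :: 'm \<times> 'a => 'b, V :: 'm set, \<psi>, k). jet_domain (model M) (\<psi> ` (U \<inter> V)) k"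
abbreviation (input) "sec_jet \<equiv> %(U, \<phi>, V, \<psi>, k) s p. dir_deriv (model M) RA (local_rep U \<phi> V \<psi> s) k (fst p) (snd p)"

text \<open>An index consists of a trivialization, a chart and an order of differentiation. The
  subbasic sets of the section topology are exactly the conditions on the jets of the corresponding
  local representatives.\<close>

lemma mapping_space_sections: "mapping_space X A sec_index sec_dom sec_jet"
proof (rule mapping_space.intro)
 show "Module.module scalars X" using complex_algebra_X by (simp add: complex_algebra_def)
 show "lcs A" by (rule A.lcs_axioms)
next
 fix i assume "i \<in> sec_index"
 then obtain U \<phi> V \<psi> k where i: "i = (U, \<phi>, V, \<psi>, k)" "local_trivialization B U \<phi>" "(V, \<psi>) \<in> atlas M"
  by (cases i) auto
 let ?D = "\<psi> ` (U \<inter> V)"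
 note o = chart_domain_open[OF i(2,3)]
 show "Hausdorff_space (sec_dom i)"
  unfolding i(1) prod.case by (rule Hausdorff_jet_domain[OF MR.dom.lcs_axioms])
 show "locally_compact_space (sec_dom i)"
  unfolding i(1) prod.case by (rule locally_compact_jet_domain[OF MR.dom.lcs_axioms loc_compact_M o])
 fix s assume "s \<in> carrier X"
 then have s: "s \<in> smooth_sections B" by (simp add: section_algebra_simps)
 note rs = local_rep_smooth[OF i(2,3) s]
 show "continuous_map (sec_dom i) (vtop A) (sec_jet i s)"
  using rs unfolding i(1) prod.case by (simp add: smooth_on_def case_prod_unfold)
 fix p assume "p \<in> topspace (sec_dom i)"
 then have p: "fst p \<in> ?D" "!!j. j < k ==> snd p j \<in> carrier (model M)"
  unfolding i(1) prod.case using openin_subset[OF o] MR.in_topspace_jet_domain[of "fst p" "snd p"] by auto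
 {
  fix c
  have "dir_deriv (model M) RA (local_rep U \<phi> V \<psi> (c \<odot>\<^bsub>X\<^esub> s)) k (fst p) (snd p) =
    dir_deriv (model M) RA (%x. c \<odot>\<^bsub>A\<^esub> local_rep U \<phi> V \<psi> s x) k (fst p) (snd p)"
   by (rule MR.dir_deriv_cong[OF o local_rep_smult[OF i(2,3) s] p])
  also have "\<dots> = c \<odot>\<^bsub>A\<^esub> dir_deriv (model M) RA (local_rep U \<phi> V \<psi> s) k (fst p) (snd p)"
   by (rule smooth_on_csmult(2)[OF MR.dom.lcs_axioms lca_A rs p])
  finally show "sec_jet i (c \<odot>\<^bsub>X\<^esub> s) p = c \<odot>\<^bsub>A\<^esub> sec_jet i s p" unfolding i(1) prod.case .
 }
 fix t assume "t \<in> carrier X"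
 then have t: "t \<in> smooth_sections B" by (simp add: section_algebra_simps)
 have "dir_deriv (model M) RA (local_rep U \<phi> V \<psi> (s \<oplus>\<^bsub>X\<^esub> t)) k (fst p) (snd p) =
   dir_deriv (model M) RA (%x. local_rep U \<phi> V \<psi> s x \<oplus>\<^bsub>RA\<^esub> local_rep U \<phi> V \<psi> t x) k (fst p) (snd p)"
  by (rule MR.dir_deriv_cong[OF o _ p]) (simp only: local_rep_add[OF i(2,3) s t] real_space_simps)
 also have "\<dots> = dir_deriv (model M) RA (local_rep U \<phi> V \<psi> s) k (fst p) (snd p) \<oplus>\<^bsub>RA\<^esub>
   dir_deriv (model M) RA (local_rep U \<phi> V \<psi> t) k (fst p) (snd p)"
  by (rule smooth_on_add(2)[OF MR.dom.lcs_axioms lcs_RA rs local_rep_smooth[OF i(2,3) t] p])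
 finally show "sec_jet i (s \<oplus>\<^bsub>X\<^esub> t) p = sec_jet i s p \<oplus>\<^bsub>A\<^esub> sec_jet i t p"
  unfolding i(1) prod.case real_space_simps .
next
 fix s t assume "s \<in> carrier X" "t \<in> carrier X"
  and eq: "!!i p. i \<in> sec_index ==> p \<in> topspace (sec_dom i) ==> sec_jet i s p = sec_jet i t p"
 then have s: "s \<in> smooth_sections B" and t: "t \<in> smooth_sections B" by (simp_all add: section_algebra_simps)
 have "s x = t x" if x: "x \<in> points M" for x
 proof -
  from triv_exists[OF x] obtain U \<phi> where U: "x \<in> U" "local_trivialization B U \<phi>" by (elim exE conjE)
  from charted_cover[OF charted_M x] obtain V \<psi> where V: "(V, \<psi>) \<in> atlas M" "x \<in> V" by (elim exE conjE)
  \<comment> \<open>Order zero is enough to separate sections: it evaluates the representative at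
    \<open>\<psi> x\<close>, with the extensional function on the empty set as tuple of
    directions.\<close>
  have "(\<psi> x, %_. undefined) \<in> topspace (sec_dom (U, \<phi>, V, \<psi>, 0))"
   unfolding prod.case using U V chart_closed[OF charted_M V] MR.dom.topspace_eq by (auto simp: jet_domain_def)
  then have "sec_jet (U, \<phi>, V, \<psi>, 0) s (\<psi> x, %_. undefined) = sec_jet (U, \<phi>, V, \<psi>, 0) t (\<psi> x, %_. undefined)"
   using U V by (intro eq) auto
  then have "fibre_coord B U \<phi> (s x) = fibre_coord B U \<phi> (t x)" using charted_inv[OF charted_M V] by simp
  moreover have "proj B (s x) = x" "proj B (t x) = x" using s t x by (simp_all add: smooth_sections_def)
  ultimately show ?thesis
   using triv_coord(2)[OF U(2) section_over[OF s U(2,1)]] triv_coord(2)[OF U(2) section_over[OF t U(2,1)]] by simp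
 qed
 then show "s = t" using s t by (intro extensionalityI[of s "points M" t]) (auto simp: smooth_sections_def)
next
 let ?S = "{{s \<in> smooth_sections B. local_rep U \<phi> V \<psi> s \<in> N} | U \<phi> V \<psi> N.
    local_trivialization B U \<phi> \<and> (V, \<psi>) \<in> atlas M \<and> N \<in> smooth_co_subbasis (model M) RA (\<psi> ` (U \<inter> V))}"
 let ?T = "{{s \<in> carrier X. \<forall>p\<in>K. sec_jet i s p \<in> W} |i K W.
   i \<in> sec_index \<and> compactin (sec_dom i) K \<and> openin (vtop A) W}"
 have "?T \<subseteq> ?S"
 proof
  fix N assume "N \<in> ?T"
  then obtain i K W where N: "N = {s \<in> carrier X. \<forall>p\<in>K. sec_jet i s p \<in> W}"
    "i \<in> sec_index" "compactin (sec_dom i) K" "openin (vtop A) W" by (elim CollectE[of N] exE conjE)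
  obtain U \<phi> V \<psi> k where i: "i = (U, \<phi>, V, \<psi>, k)" "local_trivialization B U \<phi>" "(V, \<psi>) \<in> atlas M"
   using N(2) by (cases i) auto
  let ?N = "{f. \<forall>(x, v)\<in>K. dir_deriv (model M) RA f k x v \<in> W}"
  have "?N \<in> smooth_co_subbasis (model M) RA (\<psi> ` (U \<inter> V))"
   using N(3,4) unfolding i(1) prod.case smooth_co_subbasis_def by auto
  moreover have "N = {s \<in> smooth_sections B. local_rep U \<phi> V \<psi> s \<in> ?N}"
   unfolding N(1) i(1) prod.case by (auto simp: section_algebra_simps)
  ultimately show "N \<in> ?S"
   using i(2,3) by (intro CollectI exI[of _ U] exI[of _ \<phi>] exI[of _ V] exI[of _ \<psi>] exI[of _ ?N] conjI)
 qed
 moreover have "?S \<subseteq> ?T"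
 proof
  fix N assume "N \<in> ?S"
  then obtain U \<phi> V \<psi> N' where N: "N = {s \<in> smooth_sections B. local_rep U \<phi> V \<psi> s \<in> N'}"
    "local_trivialization B U \<phi>" "(V, \<psi>) \<in> atlas M" "N' \<in> smooth_co_subbasis (model M) RA (\<psi> ` (U \<inter> V))"
   by (elim CollectE exE conjE)
  from N(4) obtain k K W where K: "N' = {f. \<forall>(x, v)\<in>K. dir_deriv (model M) RA f k x v \<in> W}"
    "compactin (jet_domain (model M) (\<psi> ` (U \<inter> V)) k) K" "openin (vtop A) W"
   unfolding smooth_co_subbasis_def by auto
  have "N = {s \<in> carrier X. \<forall>p\<in>K. sec_jet (U, \<phi>, V, \<psi>, k) s p \<in> W}"
   unfolding N(1) K(1) prod.case by (auto simp: section_algebra_simps)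
  then show "N \<in> ?T"
   using K(2,3) N(2,3) by (intro CollectI exI[of _ "(U, \<phi>, V, \<psi>, k)"] exI[of _ K] exI[of _ W] conjI) auto
 qed
 ultimately have TS: "?T = ?S" by (rule equalityI)
 have v: "vtop X = topology_generated_by (insert (smooth_sections B) ?S)"
  unfolding section_algebra_def by (simp only: tvs.simps)
 show "vtop X = topology_generated_by (insert (carrier X) ?T)"
  by (subst TS) (simp only: v section_algebra_simps(1))
qed

interpretation ms: mapping_space X A sec_index sec_dom sec_jet by (rule mapping_space_sections)

lemma topspace_sections: "topspace (vtop X) = smooth_sections B"
 by (simp only: ms.topspace_X section_algebra_simps)

text \<open>The tautological family of local representatives, parametrized by the sections.
  Continuity statements about operations on sections start from it.\<close>

lemma smooth_family_sections:
 assumes triv: "local_trivialization B U \<phi>" and chart: "(V, \<psi>) \<in> atlas M"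
 shows "smooth_family (vtop X) (model M) RA (\<psi> ` (U \<inter> V)) (%s. local_rep U \<phi> V \<psi> s)" unfolding smooth_family_def
proof (intro conjI ballI allI)
 show "openin (vtop (model M)) (\<psi> ` (U \<inter> V))" by (rule chart_domain_open[OF triv chart])
 show "smooth_on (model M) RA (\<psi> ` (U \<inter> V)) (local_rep U \<phi> V \<psi> s)" if "s \<in> topspace (vtop X)" for s
  using that local_rep_smooth[OF triv chart] by (simp only: topspace_sections)
 fix k
 have "(U, \<phi>, V, \<psi>, k) \<in> sec_index" using triv chart by simp
 from ms.continuous_map_evaluation[OF this]
 show "continuous_map (prod_topology (vtop X) (jet_domain (model M) (\<psi> ` (U \<inter> V)) k)) (vtop RA)
   (%(s, x, v). dir_deriv (model M) RA (local_rep U \<phi> V \<psi> s) k x v)" by (simp add: case_prod_unfold)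
qed

text \<open>The converse half of the exponential law: continuity into the section algebra is tested
  on smooth families of local representatives.\<close>

lemma continuous_map_into_sections:
 assumes sec: "!!z. z \<in> topspace Z ==> \<Phi> z \<in> smooth_sections B"
  and fam: "!!U \<phi> V \<psi>. local_trivialization B U \<phi> ==> (V, \<psi>) \<in> atlas M ==>
   smooth_family Z (model M) RA (\<psi> ` (U \<inter> V)) (%z. local_rep U \<phi> V \<psi> (\<Phi> z))"
 shows "continuous_map Z (vtop X) \<Phi>"
proof (rule ms.continuous_map_into)
 show "\<Phi> z \<in> carrier X" if "z \<in> topspace Z" for z using sec[OF that] by (simp add: section_algebra_simps)
 fix i assume "i \<in> sec_index"
 then obtain U \<phi> V \<psi> k where i: "i = (U, \<phi>, V, \<psi>, k)" "local_trivialization B U \<phi>" "(V, \<psi>) \<in> atlas M"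
  by (cases i) auto
 from fam[OF i(2,3)] show "continuous_map (prod_topology Z (sec_dom i)) (vtop A) (%(z, p). sec_jet i (\<Phi> z) p)"
  unfolding i(1) prod.case by (simp add: smooth_family_def case_prod_unfold)
qed

text \<open>In coordinates the product of sections is the product of the fibre, applied to two
  copies of the tautological family.\<close>

lemma lca_X: "lca X"
proof -
 let ?Z = "prod_topology (vtop X) (vtop X)"
 have "continuous_map ?Z (vtop X) (%z. fst z \<otimes>\<^bsub>X\<^esub> snd z)"
 proof (rule continuous_map_into_sections)
  show "fst z \<otimes>\<^bsub>X\<^esub> snd z \<in> smooth_sections B" if "z \<in> topspace ?Z" for z
   using that by (intro mult_section) (auto simp: topspace_sections)
  fix U \<phi> V \<psi> assume triv: "local_trivialization B U \<phi>" and chart: "(V, \<psi>) \<in> atlas M"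
  have "smooth_family ?Z (model M) RA (\<psi> ` (U \<inter> V))
    (%z x. local_rep U \<phi> V \<psi> (fst z) x \<otimes>\<^bsub>A\<^esub> local_rep U \<phi> V \<psi> (snd z) x)"
   by (intro smooth_family_mult[OF MR.dom.lcs_axioms lca_A]
     smooth_family_reparam[OF MR.dom.lcs_axioms lcs_RA smooth_family_sections[OF triv chart]]
     continuous_map_fst continuous_map_snd)
  then show "smooth_family ?Z (model M) RA (\<psi> ` (U \<inter> V)) (%z. local_rep U \<phi> V \<psi> (fst z \<otimes>\<^bsub>X\<^esub> snd z))"
  proof (rule MR.smooth_family_cong)
   fix z x assume z: "z \<in> topspace ?Z" and x: "x \<in> \<psi> ` (U \<inter> V)"
   have "fst z \<in> smooth_sections B" "snd z \<in> smooth_sections B" using z by (auto simp: topspace_sections)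
   from local_rep_mult[OF triv chart this x]
   show "local_rep U \<phi> V \<psi> (fst z) x \<otimes>\<^bsub>A\<^esub> local_rep U \<phi> V \<psi> (snd z) x =
     local_rep U \<phi> V \<psi> (fst z \<otimes>\<^bsub>X\<^esub> snd z) x" by (rule sym)
  qed
 qed
 then show ?thesis using ms.lcs_mapping_space complex_algebra_X
  by (simp add: lca_def locally_convex_algebra_def lcs_def case_prod_unfold)
qed

end

lemma algebra_bundle_charted:
 assumes "algebra_bundle B"
 shows "alg_bundle_charted B"
proof (rule alg_bundle_charted.intro)
 have fd: "fin_dim_manifold (base_space B)" and sm: "smooth_manifold (total_space B)"
  using assms by (simp_all add: algebra_bundle_def)
 then have M: "smooth_manifold (base_space B)" and n: "\<exists>n. model (base_space B) = euclid_space n"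
  by (simp_all add: fin_dim_manifold_def)
 show "charted (total_space B)" "charted (base_space B)" by (rule smooth_manifold_charted, fact)+
 show "smooth_map (base_space B) (base_space B) (%x. x)" by (rule smooth_map_id, fact)
 show "locally_compact_space (vtop (model (base_space B)))"
  using n locally_compact_Euclidean_space by (auto simp: euclid_space_simps)
 show "lca (fibre B)" using assms by (simp add: algebra_bundle_def lca_def)
 show "continuous_map (mtop (total_space B)) (mtop (base_space B)) (proj B)"
  using assms by (simp add: algebra_bundle_def smooth_map_continuous)
qed (use assms in \<open>simp_all add: algebra_bundle_def\<close>)

section \<open>Pull-backs\<close>

text \<open>The pull-back along an arbitrary smooth map; the group and its action join
  later.\<close>

locale bundle_pullback = B: alg_bundle_charted B
 for B :: "('b, 'f, 'm, 'a) alg_bundle" +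
 fixes P :: "('p, nat => real) mfd" and \<pi> :: "'p => 'm"
 assumes charted_P: "charted P" and id_P: "smooth_map P P (%x. x)"
  and loc_compact_P: "locally_compact_space (vtop (model P))"
  and smooth_\<pi>: "smooth_map P (base_space B) \<pi>"
begin

abbreviation "PB \<equiv> pullback_bundle P \<pi> B"
abbreviation "T \<equiv> total_space (pullback_bundle P \<pi> B)"
abbreviation above where "above U \<equiv> {p \<in> points P. \<pi> p \<in> U}"
abbreviation pull_triv where "pull_triv \<phi> \<equiv> %(p, a). (p, \<phi> (\<pi> p, a))"

lemma PB_simps [simp]:
 "base_space PB = P" "fibre PB = B.A" "proj PB = fst" "model T = prod_space (model P) B.RA"
 "mtop T = subtopology (prod_topology (mtop P) (mtop B.E)) {(p, b). \<pi> p = proj B b}"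
 by (simp_all add: pullback_bundle_def)

lemma points_T: "(p, b) \<in> points T \<longleftrightarrow> p \<in> points P \<and> b \<in> points B.E \<and> \<pi> p = proj B b" by auto

lemma atlas_T: "(C, \<kappa>) \<in> atlas T \<longleftrightarrow> (\<exists>W \<psi> U \<phi>. (W, \<psi>) \<in> atlas P \<and> local_trivialization B U \<phi> \<and>
  C = {(p, b). p \<in> W \<and> \<pi> p \<in> U \<and> b \<in> points B.E \<and> \<pi> p = proj B b} \<and>
  \<kappa> = (%(p, b). (\<psi> p, fibre_coord B U \<phi> b)))" by (auto simp: pullback_bundle_def)

lemma fibre_alg_PB [simp]:
 "carrier (fibre_alg PB p) = {p} \<times> carrier (B.F (\<pi> p))"
 "x \<otimes>\<^bsub>fibre_alg PB p\<^esub> y = (p, snd x \<otimes>\<^bsub>B.F (\<pi> p)\<^esub> snd y)"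
 "x \<oplus>\<^bsub>fibre_alg PB p\<^esub> y = (p, snd x \<oplus>\<^bsub>B.F (\<pi> p)\<^esub> snd y)"
 "c \<odot>\<^bsub>fibre_alg PB p\<^esub> x = (p, c \<odot>\<^bsub>B.F (\<pi> p)\<^esub> snd x)"
 "\<one>\<^bsub>fibre_alg PB p\<^esub> = (p, \<one>\<^bsub>B.F (\<pi> p)\<^esub>)" "\<zero>\<^bsub>fibre_alg PB p\<^esub> = (p, \<zero>\<^bsub>B.F (\<pi> p)\<^esub>)"
 by (simp_all add: pullback_bundle_def Let_def)

lemma \<pi>_in: "p \<in> points P ==> \<pi> p \<in> points B.M" by (rule smooth_map_image[OF smooth_\<pi>])

lemma openin_above: "openin (mtop B.M) U ==> openin (mtop P) (above U)"
 by (rule openin_continuous_map_preimage[OF smooth_map_continuous[OF smooth_\<pi>]])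

lemma continuous_map_into_T:
 assumes "continuous_map Z (mtop P) (%z. fst (f z))" "continuous_map Z (mtop B.E) (%z. snd (f z))"
  and "!!z. z \<in> topspace Z ==> \<pi> (fst (f z)) = proj B (snd (f z))"
 shows "continuous_map Z (mtop T) f" unfolding PB_simps continuous_map_in_subtopology
 using continuous_map_pairedI[OF assms(1,2)] assms(3)
 by (intro conjI image_subsetI) (simp_all add: case_prod_unfold)

context
 fixes U \<phi> assumes triv: "local_trivialization B U \<phi>"
begin

lemma above_open: "openin (mtop P) (above U)" by (rule openin_above[OF B.triv_open[OF triv]])

lemma charted_above: "charted (open_submfd P (above U))" by (rule charted_open_submfd[OF charted_P above_open])

abbreviation (input) "dom_mfd \<equiv> prod_mfd (open_submfd P (above U)) (alg_mfd B.A)"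

lemma charted_dom: "charted dom_mfd" by (rule charted_prod_mfd[OF charted_above B.charted_alg])

lemma points_dom: "points dom_mfd = above U \<times> carrier B.A" by (auto simp: alg_mfd_def)

lemma smooth_dom_fst: "smooth_map dom_mfd P fst"
 by (rule smooth_map_from_open[OF charted_dom smooth_map_fst[OF charted_above B.charted_alg
    smooth_map_into_open[OF charted_above smooth_map_restrict[OF charted_P charted_P id_P above_open]]]]) auto

lemma smooth_dom_total: "smooth_map dom_mfd B.E (%x. \<phi> (\<pi> (fst x), snd x))"
proof (rule B.smooth_map_via_triv[OF triv charted_dom])
 show "smooth_map dom_mfd B.M (%x. \<pi> (fst x))"
  by (rule smooth_map_compose[OF charted_dom charted_P B.charted_M smooth_dom_fst smooth_\<pi>])
 show "\<pi> (fst y) \<in> U" if "y \<in> points dom_mfd" for y using that unfolding points_dom by auto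
 show "smooth_map dom_mfd (alg_mfd B.A) snd"
  by (rule smooth_map_snd[OF charted_above B.charted_alg B.id_alg[OF triv]])
qed

lemma pull_triv_in: "p \<in> above U ==> a \<in> carrier B.A ==> pull_triv \<phi> (p, a) \<in> points T"
 using B.triv_in[OF triv, of "\<pi> p" a] B.triv_proj[OF triv, of "\<pi> p" a] unfolding prod.case points_T by auto

lemma continuous_pull_triv: "continuous_map (mtop dom_mfd) (mtop T) (pull_triv \<phi>)"
proof (rule continuous_map_into_T)
 show "continuous_map (mtop dom_mfd) (mtop P) (%z. fst (pull_triv \<phi> z))"
  using smooth_map_continuous[OF smooth_dom_fst] by (simp only: case_prod_unfold fst_conv)
 show "continuous_map (mtop dom_mfd) (mtop B.E) (%z. snd (pull_triv \<phi> z))"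
  using smooth_map_continuous[OF smooth_dom_total] by (simp only: case_prod_unfold snd_conv)
 fix z assume "z \<in> points dom_mfd"
 then show "\<pi> (fst (pull_triv \<phi> z)) = proj B (snd (pull_triv \<phi> z))"
  unfolding points_dom using B.triv_proj[OF triv, of "\<pi> (fst z)" "snd z"] by (auto simp: case_prod_unfold)
qed

lemma over_T:
 assumes "t \<in> points T" "fst t \<in> above U"
 shows "snd t \<in> B.over U" "proj B (snd t) = \<pi> (fst t)"
  "pull_triv \<phi> (fst t, fibre_coord B U \<phi> (snd t)) = t" "fibre_coord B U \<phi> (snd t) \<in> carrier B.A"
proof -
 show s: "snd t \<in> B.over U" and "proj B (snd t) = \<pi> (fst t)" using assms points_T[of "fst t" "snd t"] by auto
 then show "pull_triv \<phi> (fst t, fibre_coord B U \<phi> (snd t)) = t" "fibre_coord B U \<phi> (snd t) \<in> carrier B.A"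
  using B.triv_coord(1,2)[OF triv s] by (simp_all add: prod_eq_iff)
qed

lemma continuous_pull_coord:
 "continuous_map (subtopology (mtop T) (above U \<times> UNIV)) (mtop dom_mfd) (%t. (fst t, fibre_coord B U \<phi> (snd t)))"
proof -
 let ?S = "subtopology (mtop T) (above U \<times> UNIV)"
 have top: "t \<in> points T" "fst t \<in> above U" if "t \<in> topspace ?S" for t using that by auto
 have f: "continuous_map (mtop T) (mtop P) fst" and s: "continuous_map (mtop T) (mtop B.E) snd"
  unfolding PB_simps by (intro continuous_map_from_subtopology continuous_map_fst continuous_map_snd)+
 have "continuous_map ?S (subtopology (mtop P) (above U)) fst"
  unfolding continuous_map_in_subtopology using continuous_map_from_subtopology[OF f] top by auto
 moreover have "continuous_map ?S (subtopology (mtop B.E) (B.over U)) snd"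
  unfolding continuous_map_in_subtopology using continuous_map_from_subtopology[OF s] over_T(1)[OF top] by blast
 then have "continuous_map ?S (mtop (alg_mfd B.A)) (fibre_coord B U \<phi> \<circ> snd)"
  using smooth_map_continuous[OF B.coord_smooth[OF triv]] by (intro continuous_map_compose) simp_all
 ultimately show ?thesis
  unfolding prod_mfd_simps open_submfd_simps by (intro continuous_map_pairedI) (simp_all add: o_def)
qed

end

lemma T_cover: "t \<in> points T ==> \<exists>U \<phi>. local_trivialization B U \<phi> \<and> fst t \<in> above U"
 using B.triv_exists[OF \<pi>_in[of "fst t"]] points_T[of "fst t" "snd t"] by auto

lemma openin_T_above:
 assumes "openin (mtop P) W" shows "openin (mtop T) {t \<in> points T. fst t \<in> W}"
proof -
 have "continuous_map (mtop T) (mtop P) fst"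
  unfolding PB_simps by (intro continuous_map_from_subtopology continuous_map_fst)
 from openin_continuous_map_preimage[OF this assms] show ?thesis .
qed

lemma chart_T_eq:
 assumes "W \<subseteq> points P"
 shows "{(p, b). p \<in> W \<and> \<pi> p \<in> U \<and> b \<in> points B.E \<and> \<pi> p = proj B b} = {t \<in> points T. fst t \<in> W \<inter> above U}"
 using assms by (auto simp: points_T simp del: PB_simps)

lemma chart_prod:
 assumes "(W, \<psi>) \<in> atlas P"
 shows "((W \<inter> O') \<times> carrier B.A, map_prod \<psi> (%a. a)) \<in> atlas (prod_mfd (open_submfd P O') (alg_mfd B.A))"
 unfolding atlas_prod_mfd by (intro exI conjI refl) (use assms in \<open>auto simp: alg_mfd_def atlas_open_submfd\<close>)

text \<open>A chart of the pull-back is a product chart of base and fibre read through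
  \<open>pull_triv\<close>. Injectivity of \<open>\<kappa>\<close> follows from
  \<open>over_T\<close>, and openness of images is transported from the product chart.\<close>

lemma charted_T: "charted T" unfolding charted_def
proof (intro conjI ballI, goal_cases)
 case 1
 show ?case unfolding PB_simps by (rule lcs_prod_space[OF charted_lcs[OF charted_P] B.lcs_RA])
next
 case 2
 show ?case
 proof (intro equalityI subsetI)
  fix t assume "t \<in> (\<Union>(C, \<kappa>)\<in>atlas T. C)"
  then obtain C \<kappa> where C: "(C, \<kappa>) \<in> atlas T" "t \<in> C" by auto
  then obtain W \<psi> U where "(W, \<psi>) \<in> atlas P" "C = {(p, b). p \<in> W \<and> \<pi> p \<in> U \<and> b \<in> points B.E \<and> \<pi> p = proj B b}"
   unfolding atlas_T by (elim exE conjE)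
  with C(2) charted_subset[OF charted_P] show "t \<in> points T" using chart_T_eq[of W U] by auto
 next
  fix t assume t: "t \<in> points T"
  obtain U \<phi> where U: "local_trivialization B U \<phi>" "fst t \<in> above U" using T_cover[OF t] by (elim exE conjE)
  then have "fst t \<in> points P" by simp
  from charted_cover[OF charted_P this] obtain W \<psi> where W: "(W, \<psi>) \<in> atlas P" "fst t \<in> W" by (elim exE conjE)
  let ?C = "{(p, b). p \<in> W \<and> \<pi> p \<in> U \<and> b \<in> points B.E \<and> \<pi> p = proj B b}"
  have "(?C, %(p, b). (\<psi> p, fibre_coord B U \<phi> b)) \<in> atlas T" unfolding atlas_T using W(1) U(1)
   by (intro exI[of _ W] exI[of _ \<psi>] exI[of _ U] exI[of _ \<phi>] conjI refl)
  moreover have "t \<in> ?C" unfolding chart_T_eq[OF charted_subset[OF charted_P W(1)]] using t U(2) W(2) by auto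
  ultimately show "t \<in> (\<Union>(C, \<kappa>)\<in>atlas T. C)"
   by (intro UN_I[of "(?C, %(p, b). (\<psi> p, fibre_coord B U \<phi> b))"]) (assumption, simp only: prod.case)
 qed
next
 case (3 x)
 obtain C \<kappa> where x: "x = (C, \<kappa>)" by (cases x)
 from 3 obtain W \<psi> U \<phi> where W: "(W, \<psi>) \<in> atlas P" and triv: "local_trivialization B U \<phi>"
  and C: "C = {(p, b). p \<in> W \<and> \<pi> p \<in> U \<and> b \<in> points B.E \<and> \<pi> p = proj B b}"
  and \<kappa>: "\<kappa> = (%(p, b). (\<psi> p, fibre_coord B U \<phi> b))" unfolding x atlas_T by (elim exE conjE)
 note C = C[unfolded chart_T_eq[OF charted_subset[OF charted_P W]]]
 have CU: "t \<in> points T" "fst t \<in> above U" "fst t \<in> W" if "t \<in> C" for t using that unfolding C by auto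
 have "inj_on \<kappa> C"
 proof (rule inj_onI)
  fix t t' assume t: "t \<in> C" "t' \<in> C" and eq: "\<kappa> t = \<kappa> t'"
  have "fst t = fst t'"
   using eq CU[OF t(1)] CU[OF t(2)] charted_inj[OF charted_P W] by (auto simp: \<kappa> case_prod_unfold dest: inj_onD)
  moreover have "fibre_coord B U \<phi> (snd t) = fibre_coord B U \<phi> (snd t')"
   using eq by (simp add: \<kappa> case_prod_unfold)
  ultimately show "t = t'" using over_T(3)[OF triv CU(1,2)[OF t(1)]] over_T(3)[OF triv CU(1,2)[OF t(2)]] by simp
 qed
 moreover have "openin (mtop T) C"
  unfolding C by (intro openin_T_above openin_Int above_open[OF triv] charted_open[OF charted_P W])
 moreover have "openin (vtop (model T)) (\<kappa> ` O')" if O': "openin (mtop T) O'" "O' \<subseteq> C" for O'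
 proof -
  let ?D = "prod_mfd (open_submfd P (above U)) (alg_mfd B.A)"
  let ?N = "{x \<in> points ?D. pull_triv \<phi> x \<in> O'}"
  have "openin (mtop ?D) ?N" by (rule openin_continuous_map_preimage[OF continuous_pull_triv[OF triv] O'(1)])
  moreover have "?N \<subseteq> (W \<inter> above U) \<times> carrier B.A"
  proof
   fix x assume x: "x \<in> ?N"
   then have "x \<in> above U \<times> carrier B.A" "pull_triv \<phi> x \<in> C" using O'(2) unfolding points_dom[OF triv] by auto
   then show "x \<in> (W \<inter> above U) \<times> carrier B.A" using CU(3)[of "pull_triv \<phi> x"] by (auto simp: case_prod_unfold)
  qed
  ultimately have "openin (vtop (model ?D)) (map_prod \<psi> (%a. a) ` ?N)"
   by (rule charted_image[OF charted_dom[OF triv] chart_prod[OF W]])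
  moreover have "\<kappa> ` O' = map_prod \<psi> (%a. a) ` ?N"
  proof (intro equalityI subsetI)
   fix y assume "y \<in> \<kappa> ` O'"
   then obtain t where t: "t \<in> O'" "y = \<kappa> t" by blast
   then have tC: "t \<in> C" using O'(2) by blast
   have "(fst t, fibre_coord B U \<phi> (snd t)) \<in> ?N"
    using over_T(3,4)[OF triv CU(1,2)[OF tC]] CU(2)[OF tC] t(1) unfolding points_dom[OF triv] by simp
   then show "y \<in> map_prod \<psi> (%a. a) ` ?N" unfolding t(2) \<kappa> by (rule rev_image_eqI) (simp add: case_prod_unfold)
  next
   fix y assume "y \<in> map_prod \<psi> (%a. a) ` ?N"
   then obtain p a where pa: "p \<in> above U" "a \<in> carrier B.A" "pull_triv \<phi> (p, a) \<in> O'" "y = (\<psi> p, a)"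
    unfolding points_dom[OF triv] by auto
   have "\<kappa> (pull_triv \<phi> (p, a)) = y" using B.coord_triv[OF triv, of "\<pi> p" a] pa by (simp add: \<kappa>)
   then show "y \<in> \<kappa> ` O'" using pa(3) by blast
  qed
  ultimately show ?thesis by (simp add: alg_mfd_eq del: PB_simps(5))
 qed
 ultimately show ?case unfolding x by blast
qed

text \<open>The universal property of the fibre product. A chart of \<open>T\<close> reads the first
  component in a chart of \<open>P\<close> and the second one through a fibre coordinate, and both
  are smooth.\<close>

lemma smooth_map_into_T:
 assumes Y: "charted Y" and f1: "smooth_map Y P (%y. fst (f y))" and f2: "smooth_map Y B.E (%y. snd (f y))"
  and eq: "!!y. y \<in> points Y ==> \<pi> (fst (f y)) = proj B (snd (f y))"
 shows "smooth_map Y T f"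
proof (rule smooth_mapI)
 show cont: "continuous_map (mtop Y) (mtop T) f" by (intro continuous_map_into_T smooth_map_continuous f1 f2 eq)
 fix V \<eta> C \<kappa> assume V: "(V, \<eta>) \<in> atlas Y" and "(C, \<kappa>) \<in> atlas T"
 then obtain W \<psi> U \<phi> where W: "(W, \<psi>) \<in> atlas P" and triv: "local_trivialization B U \<phi>"
  and C: "C = {(p, b). p \<in> W \<and> \<pi> p \<in> U \<and> b \<in> points B.E \<and> \<pi> p = proj B b}"
  and \<kappa>: "\<kappa> = (%(p, b). (\<psi> p, fibre_coord B U \<phi> b))" unfolding atlas_T by (elim exE conjE)
 note C = C[unfolded chart_T_eq[OF charted_subset[OF charted_P W]]]
 interpret YP: lcs2 "model Y" "model P" by (rule lcs2.intro[OF charted_lcs[OF Y] charted_lcs[OF charted_P]])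
 interpret YR: lcs2 "model Y" B.RA by (rule lcs2.intro[OF charted_lcs[OF Y] B.lcs_RA])
 interpret YT: lcs2 "model Y" "model T" by (rule lcs2.intro[OF charted_lcs[OF Y] charted_lcs[OF charted_T]])
 have oC: "openin (mtop T) C"
  unfolding C by (intro openin_T_above openin_Int above_open[OF triv] charted_open[OF charted_P W])
 define N where "N = {y \<in> points Y. f y \<in> C}"
 have oN: "openin (mtop Y) N" unfolding N_def by (rule openin_continuous_map_preimage[OF cont oC])
 have NV: "V \<inter> f -` C = V \<inter> N" using charted_subset[OF Y V] by (auto simp: N_def)
 have o: "openin (vtop (model Y)) (\<eta> ` (V \<inter> N))"
  by (intro charted_image[OF Y V] openin_Int oN charted_open[OF Y V]) simp
 have cN: "charted (open_submfd Y N)" by (rule charted_open_submfd[OF Y oN])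
 have fN: "f y \<in> points T" "fst (f y) \<in> above U" "fst (f y) \<in> W" if "y \<in> N" for y
  using that unfolding N_def C by auto
 have "V \<inter> N \<subseteq> V \<inter> (%y. fst (f y)) -` W" using fN(3) by auto
 then have s1: "smooth_on (model Y) (model P) (\<eta> ` (V \<inter> N)) (\<psi> \<circ> (%y. fst (f y)) \<circ> inv_into V \<eta>)"
  by (intro YP.smooth_on_open_subset[OF smooth_map_chart[OF f1 V W] o] image_mono)
 have "smooth_map (open_submfd Y N) (open_submfd B.E (B.over U)) (%y. snd (f y))"
  by (rule smooth_map_into_open[OF cN smooth_map_restrict[OF Y B.charted_E f2 oN]])
    (use over_T(1)[OF triv fN(1,2)] in auto)
 from smooth_map_compose[OF cN B.charted_over[OF triv] B.charted_alg this B.coord_smooth[OF triv]]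
 have "smooth_map (open_submfd Y N) (vmfd B.RA) (%y. fibre_coord B U \<phi> (snd (f y)))" unfolding alg_mfd_eq .
 moreover have "(V \<inter> N, \<eta>) \<in> atlas (open_submfd Y N)" using V atlas_open_submfd by blast
 ultimately have s2: "smooth_on (model Y) B.RA (\<eta> ` (V \<inter> N)) ((%y. fibre_coord B U \<phi> (snd (f y))) \<circ> inv_into (V \<inter> N) \<eta>)"
  unfolding smooth_map_vmfd_iff[OF cN B.lcs_RA] by auto
 show "smooth_on (model Y) (model T) (\<eta> ` (V \<inter> f -` C)) (\<kappa> \<circ> f \<circ> inv_into V \<eta>)" unfolding NV
 proof (rule YT.smooth_on_cong)
  show "smooth_on (model Y) (model T) (\<eta> ` (V \<inter> N)) (%x. ((\<psi> \<circ> (%y. fst (f y)) \<circ> inv_into V \<eta>) x,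
    ((%y. fibre_coord B U \<phi> (snd (f y))) \<circ> inv_into (V \<inter> N) \<eta>) x))"
   unfolding PB_simps by (rule smooth_on_pair(1)[OF charted_lcs[OF Y] charted_lcs[OF charted_P] B.lcs_RA s1 s2])
  fix x assume "x \<in> \<eta> ` (V \<inter> N)"
  then obtain y where y: "y \<in> V \<inter> N" "x = \<eta> y" by blast
  have "inv_into (V \<inter> N) \<eta> x = y"
   unfolding y(2) by (rule inv_into_f_f[OF inj_on_subset[OF charted_inj[OF Y V]] y(1)]) simp
  moreover have "inv_into V \<eta> x = y" unfolding y(2) using y(1) by (intro charted_inv[OF Y V]) simp
  ultimately show "((\<psi> \<circ> (%y. fst (f y)) \<circ> inv_into V \<eta>) x,
    ((%y. fibre_coord B U \<phi> (snd (f y))) \<circ> inv_into (V \<inter> N) \<eta>) x) = (\<kappa> \<circ> f \<circ> inv_into V \<eta>) x"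
   by (simp add: \<kappa> case_prod_unfold)
 qed
qed

text \<open>The images of the maps \<open>pull_triv\<close> cover the total space, and in the charts
  of source and target such a map is the identity. Hence smoothness may be tested after composition
  with them.\<close>

lemma smooth_map_from_T:
 assumes Y: "charted Y"
  and h: "!!U \<phi>. local_trivialization B U \<phi> ==>
   smooth_map (prod_mfd (open_submfd P (above U)) (alg_mfd B.A)) Y (%x. h (pull_triv \<phi> x))"
 shows "smooth_map T Y h"
proof (rule smooth_mapI)
 show "continuous_map (mtop T) (mtop Y) h"
 proof (rule continuous_map_local)
  fix t assume t: "t \<in> points T"
  obtain U \<phi> where U: "local_trivialization B U \<phi>" "fst t \<in> above U" using T_cover[OF t] by (elim exE conjE)
  let ?N = "{t \<in> points T. fst t \<in> above U}"
  have eq: "subtopology (mtop T) (above U \<times> UNIV) = subtopology (mtop T) ?N"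
   by (subst subtopology_restrict[symmetric], rule arg_cong[where f = "subtopology (mtop T)"]) auto
  have "continuous_map (subtopology (mtop T) ?N) (mtop Y) (%t. h (pull_triv \<phi> (fst t, fibre_coord B U \<phi> (snd t))))"
   using continuous_map_compose[OF continuous_pull_coord[OF U(1)] smooth_map_continuous[OF h[OF U(1)]]]
   unfolding eq by (simp add: o_def)
  then have "continuous_map (subtopology (mtop T) ?N) (mtop Y) h"
   by (rule continuous_map_eq) (simp only: topspace_subtopology Int_iff mem_Collect_eq over_T(3)[OF U(1)])
  then show "\<exists>N. openin (mtop T) N \<and> t \<in> N \<and> continuous_map (subtopology (mtop T) N) (mtop Y) h"
   using openin_T_above[OF above_open[OF U(1)]] t U(2) by (intro exI[of _ ?N] conjI) auto
 qed
 fix C \<kappa> V \<eta> assume "(C, \<kappa>) \<in> atlas T" and V: "(V, \<eta>) \<in> atlas Y"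
 then obtain W \<psi> U \<phi> where W: "(W, \<psi>) \<in> atlas P" and triv: "local_trivialization B U \<phi>"
  and C: "C = {(p, b). p \<in> W \<and> \<pi> p \<in> U \<and> b \<in> points B.E \<and> \<pi> p = proj B b}"
  and \<kappa>: "\<kappa> = (%(p, b). (\<psi> p, fibre_coord B U \<phi> b))" unfolding atlas_T by (elim exE conjE)
 have Cat: "(C, \<kappa>) \<in> atlas T" unfolding atlas_T C \<kappa> using W triv
  by (intro exI[of _ W] exI[of _ \<psi>] exI[of _ U] exI[of _ \<phi>] conjI refl)
 note C = C[unfolded chart_T_eq[OF charted_subset[OF charted_P W]]]
 have CU: "t \<in> points T" "fst t \<in> above U" "fst t \<in> W" if "t \<in> C" for t using that unfolding C by auto
 interpret TY: lcs2 "model T" "model Y" by (rule lcs2.intro[OF charted_lcs[OF charted_T] charted_lcs[OF Y]])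
 let ?h = "%x. h (pull_triv \<phi> x)" and ?W = "(W \<inter> above U) \<times> carrier B.A" and ?\<mu> = "map_prod \<psi> (%a. a)"
 have ch: "(?W, ?\<mu>) \<in> atlas (prod_mfd (open_submfd P (above U)) (alg_mfd B.A))" by (rule chart_prod[OF W])
 from smooth_map_chart[OF h[OF triv] this V]
 have s: "smooth_on (model T) (model Y) (?\<mu> ` (?W \<inter> ?h -` V)) (\<eta> \<circ> ?h \<circ> inv_into ?W ?\<mu>)"
  by (simp add: alg_mfd_def)
 have pt: "pull_triv \<phi> (p, a) \<in> C \<and> \<kappa> (pull_triv \<phi> (p, a)) = (\<psi> p, a)" if "p \<in> W \<inter> above U" "a \<in> carrier B.A" for p a
  using that pull_triv_in[OF triv, of p a] B.coord_triv[OF triv, of "\<pi> p" a] unfolding C \<kappa> by auto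
 have im: "\<kappa> ` (C \<inter> h -` V) = ?\<mu> ` (?W \<inter> ?h -` V)"
 proof (intro equalityI subsetI)
  fix y assume "y \<in> \<kappa> ` (C \<inter> h -` V)"
  then obtain t where t: "t \<in> C" "h t \<in> V" "y = \<kappa> t" by blast
  note ov = over_T(3,4)[OF triv CU(1,2)[OF t(1)]]
  have "(fst t, fibre_coord B U \<phi> (snd t)) \<in> ?W \<inter> ?h -` V" using ov CU[OF t(1)] t(2) by simp
  then show "y \<in> ?\<mu> ` (?W \<inter> ?h -` V)" unfolding t(3) \<kappa> by (rule rev_image_eqI) (simp add: case_prod_unfold)
 next
  fix y assume "y \<in> ?\<mu> ` (?W \<inter> ?h -` V)"
  then obtain p a where pa: "p \<in> W \<inter> above U" "a \<in> carrier B.A" "h (pull_triv \<phi> (p, a)) \<in> V" "y = (\<psi> p, a)"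
   by auto
  then show "y \<in> \<kappa> ` (C \<inter> h -` V)" using pt[OF pa(1,2)] by (intro image_eqI[of _ _ "pull_triv \<phi> (p, a)"]) auto
 qed
 show "smooth_on (model T) (model Y) (\<kappa> ` (C \<inter> h -` V)) (\<eta> \<circ> h \<circ> inv_into C \<kappa>)" unfolding im
 proof (rule TY.smooth_on_cong[OF s])
  fix y assume "y \<in> ?\<mu> ` (?W \<inter> ?h -` V)"
  then obtain p a where pa: "p \<in> W \<inter> above U" "a \<in> carrier B.A" "y = (\<psi> p, a)" by auto
  have "inv_into C \<kappa> y = pull_triv \<phi> (p, a)"
   using charted_inv[OF charted_T Cat, of "pull_triv \<phi> (p, a)"] pt[OF pa(1,2)] pa(3) by simp
  moreover have "inv_into ?W ?\<mu> y = (p, a)"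
   using charted_inv[OF charted_dom[OF triv] ch, of "(p, a)"] pa by simp
  ultimately show "(\<eta> \<circ> ?h \<circ> inv_into ?W ?\<mu>) y = (\<eta> \<circ> h \<circ> inv_into C \<kappa>) y" by simp
 qed
qed

lemma smooth_T_fst: "smooth_map T P fst"
 by (rule smooth_map_from_T[OF charted_P]) (use smooth_dom_fst in \<open>simp add: case_prod_unfold\<close>)

lemma smooth_T_snd: "smooth_map T B.E snd"
 by (rule smooth_map_from_T[OF B.charted_E]) (use smooth_dom_total in \<open>simp add: case_prod_unfold\<close>)

lemma id_T: "smooth_map T T (%t. t)" by (rule smooth_map_into_T[OF charted_T smooth_T_fst smooth_T_snd]) auto

lemma complex_algebra_PB:
 assumes p: "p \<in> points P"
 shows "complex_algebra (fibre_alg PB p)"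
 by (rule surj_complex_algebra[OF B.fibre_calg[OF \<pi>_in[OF p]], where h = "%b. (p, b)"]) auto

lemma pull_triv_iso:
 assumes triv: "local_trivialization B U \<phi>" and p: "\<pi> p \<in> U"
 shows "(%a. pull_triv \<phi> (p, a)) \<in> alg_iso B.A (fibre_alg PB p)"
proof -
 have "(%a. \<phi> (\<pi> p, a)) \<in> alg_iso B.A (B.F (\<pi> p))" by (rule B.triv_iso[OF triv p])
 then show ?thesis by (auto simp: alg_iso_def ring_hom_def bij_betw_def inj_on_def image_iff Pi_iff)
qed

text \<open>The trivialization is smooth by the universal property of the fibre product. Its inverse
  pairs the first component with the old fibre coordinate of the second.\<close>

lemma pull_trivialization:
 assumes triv: "local_trivialization B U \<phi>"
 shows "local_trivialization PB (above U) (pull_triv \<phi>)" unfolding local_trivialization_def PB_simps(1-3)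
proof (intro conjI ballI)
 show "openin (mtop P) (above U)" by (rule above_open[OF triv])
 show "fst (pull_triv \<phi> (p, a)) = p" for p a by simp
 show "(%a. pull_triv \<phi> (p, a)) \<in> alg_iso B.A (fibre_alg PB p)" if "p \<in> above U" for p
  using that by (intro pull_triv_iso[OF triv]) simp
 let ?D = "prod_mfd (open_submfd P (above U)) (alg_mfd B.A)"
 let ?O = "{t \<in> points T. fst t \<in> above U}"
 have oO: "openin (mtop T) ?O" by (rule openin_T_above[OF above_open[OF triv]])
 have cO: "charted (open_submfd T ?O)" by (rule charted_open_submfd[OF charted_T oO])
 have pO: "points (open_submfd T ?O) = ?O"
  unfolding open_submfd_simps by (simp only: topspace_subtopology) blast
 have bij: "bij_betw (pull_triv \<phi>) (points ?D) ?O" unfolding points_dom[OF triv]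
 proof (rule bij_betwI[where g = "%t. (fst t, fibre_coord B U \<phi> (snd t))"])
  show "pull_triv \<phi> \<in> above U \<times> carrier B.A \<rightarrow> ?O" using pull_triv_in[OF triv] by (auto simp del: PB_simps)
  show "(%t. (fst t, fibre_coord B U \<phi> (snd t))) \<in> ?O \<rightarrow> above U \<times> carrier B.A"
   using over_T(4)[OF triv] by (auto simp del: PB_simps)
  show "(fst (pull_triv \<phi> x), fibre_coord B U \<phi> (snd (pull_triv \<phi> x))) = x" if "x \<in> above U \<times> carrier B.A" for x
   using that B.coord_triv[OF triv] by auto
  show "pull_triv \<phi> (fst t, fibre_coord B U \<phi> (snd t)) = t" if "t \<in> ?O" for t
   using that by (intro over_T(3)[OF triv]) simp_all
 qed
 have inv: "inv_into (points ?D) (pull_triv \<phi>) t = (fst t, fibre_coord B U \<phi> (snd t))" if "t \<in> ?O" for t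
 proof -
  have t: "t \<in> points T" "fst t \<in> above U" using that by auto
  have "inv_into (points ?D) (pull_triv \<phi>) (pull_triv \<phi> (fst t, fibre_coord B U \<phi> (snd t))) = (fst t, fibre_coord B U \<phi> (snd t))"
   using over_T(4)[OF triv t] t(2) by (intro inv_into_f_f bij_betw_imp_inj_on[OF bij]) (simp add: alg_mfd_def)
  then show ?thesis by (simp only: over_T(3)[OF triv t])
 qed
 show "diffeomorphism ?D (open_submfd T ?O) (pull_triv \<phi>)" unfolding diffeomorphism_def pO
 proof (intro conjI bij)
  have "smooth_map ?D T (pull_triv \<phi>)"
  proof (rule smooth_map_into_T[OF charted_dom[OF triv]])
   show "smooth_map ?D P (%x. fst (pull_triv \<phi> x))"
    using smooth_dom_fst[OF triv] by (simp add: case_prod_unfold)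
   show "smooth_map ?D B.E (%x. snd (pull_triv \<phi> x))"
    using smooth_dom_total[OF triv] by (simp add: case_prod_unfold)
   show "\<pi> (fst (pull_triv \<phi> y)) = proj B (snd (pull_triv \<phi> y))" if "y \<in> points ?D" for y
    using pull_triv_in[OF triv, of "fst y" "snd y"] that unfolding points_dom[OF triv] by (auto simp: case_prod_unfold)
  qed
  then show "smooth_map ?D (open_submfd T ?O) (pull_triv \<phi>)"
   by (rule smooth_map_into_open[OF charted_dom[OF triv]]) (rule bij_betwE[OF bij, rule_format])
  have "smooth_map (open_submfd T ?O) (open_submfd P (above U)) fst"
   by (rule smooth_map_into_open[OF cO smooth_map_restrict[OF charted_T charted_P smooth_T_fst oO]])
     (unfold pO, blast)
  moreover have "smooth_map (open_submfd T ?O) (open_submfd B.E (B.over U)) snd"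
   by (rule smooth_map_into_open[OF cO smooth_map_restrict[OF charted_T B.charted_E smooth_T_snd oO]])
     (simp only: pO, use over_T(1)[OF triv] in blast)
  from smooth_map_compose[OF cO B.charted_over[OF triv] B.charted_alg this B.coord_smooth[OF triv]]
  have "smooth_map (open_submfd T ?O) (alg_mfd B.A) (%t. fibre_coord B U \<phi> (snd t))" .
  ultimately have "smooth_map (open_submfd T ?O) ?D (%t. (fst t, fibre_coord B U \<phi> (snd t)))"
   by (intro smooth_map_pair cO charted_above[OF triv] B.charted_alg)
  then show "smooth_map (open_submfd T ?O) ?D (inv_into (points ?D) (pull_triv \<phi>))"
   by (rule smooth_map_cong[OF cO charted_dom[OF triv]]) (simp only: pO inv)
 qed
qed

sublocale PB: alg_bundle_charted "pullback_bundle P \<pi> B"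
proof (rule alg_bundle_charted.intro)
 show "charted T" by (rule charted_T)
 show "charted (base_space PB)" "smooth_map (base_space PB) (base_space PB) (%x. x)"
  "locally_compact_space (vtop (model (base_space PB)))" "lca (fibre PB)"
  unfolding PB_simps by (rule charted_P id_P loc_compact_P B.lca_A)+
 show "continuous_map (mtop T) (mtop (base_space PB)) (proj PB)"
  unfolding PB_simps(1,3) by (rule smooth_map_continuous[OF smooth_T_fst])
 fix p assume "p \<in> points (base_space PB)"
 then have p: "p \<in> points P" by simp
 show "complex_algebra (fibre_alg PB p)" by (rule complex_algebra_PB[OF p])
 show "carrier (fibre_alg PB p) = {b \<in> points T. proj PB b = p}"
 proof (rule Set.set_eqI)
  fix t :: "'p \<times> 'b"
  show "t \<in> carrier (fibre_alg PB p) \<longleftrightarrow> t \<in> {b \<in> points T. proj PB b = p}"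
   using p points_T[of "fst t" "snd t"] unfolding fibre_alg_PB B.fibre_carrier[OF \<pi>_in[OF p]] PB_simps(3)
   by (cases t) (simp del: PB_simps, metis)
 qed
 from B.triv_exists[OF \<pi>_in[OF p]] obtain U \<phi> where "\<pi> p \<in> U" "local_trivialization B U \<phi>" by (elim exE conjE)
 then show "\<exists>U \<phi>. p \<in> U \<and> local_trivialization PB U \<phi>"
  using pull_trivialization p by (intro exI[of _ "above U"] exI[of _ "pull_triv \<phi>"]) auto
qed

end

section \<open>The group action on the pull-back bundle\<close>

locale equivariant_pullback = bundle_pullback B P \<pi> + L: group L
 for B :: "('b, 'f, 'm, 'a) alg_bundle" and P :: "('p, nat => real) mfd" and \<pi> :: "'p => 'm"
  and L :: "('l, 'r) monoid_scheme" +
 fixes \<sigma> :: "'p \<times> 'l => 'p"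
 assumes smooth_action: "smooth_right_action L P \<sigma>"
  and \<pi>_\<sigma>: "!!p g. p \<in> points P ==> g \<in> carrier L ==> \<pi> (\<sigma> (p, g)) = \<pi> p"
begin

lemma \<sigma>_in: "p \<in> points P ==> g \<in> carrier L ==> \<sigma> (p, g) \<in> points P"
 and \<sigma>_one: "p \<in> points P ==> \<sigma> (p, \<one>\<^bsub>L\<^esub>) = p"
 and \<sigma>_mult: "p \<in> points P ==> g \<in> carrier L ==> h \<in> carrier L ==> \<sigma> (\<sigma> (p, g), h) = \<sigma> (p, g \<otimes>\<^bsub>L\<^esub> h)"
 using smooth_action by (simp_all add: smooth_right_action_def right_action_def)

lemma \<sigma>_inv: "p \<in> points P ==> g \<in> carrier L ==> \<sigma> (\<sigma> (p, g), inv\<^bsub>L\<^esub> g) = p" by (simp add: \<sigma>_mult \<sigma>_one)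

lemma smooth_translation:
 assumes g: "g \<in> carrier L"
 shows "smooth_map P P (%p. \<sigma> (p, g))"
proof -
 have "smooth_map P (discrete_mfd (carrier L)) (%_. g)"
  by (rule smooth_map_const[OF charted_P charted_discrete]) (use g in simp)
 then have "smooth_map P (prod_mfd P (discrete_mfd (carrier L))) (%p. (p, g))"
  by (rule smooth_map_pair[OF charted_P charted_P charted_discrete id_P])
 then show ?thesis
  by (rule smooth_map_compose[OF charted_P charted_prod_mfd[OF charted_P charted_discrete] charted_P])
    (use smooth_action in \<open>simp add: smooth_right_action_def\<close>)
qed

lemma smooth_translation_T:
 assumes g: "g \<in> carrier L"
 shows "smooth_map T T (%t. (\<sigma> (fst t, g), snd t))"
proof (rule smooth_map_into_T[OF charted_T])
 show "smooth_map T P (%t. fst (\<sigma> (fst t, g), snd t))"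
  unfolding fst_conv by (rule smooth_map_compose[OF charted_T charted_P charted_P smooth_T_fst smooth_translation[OF g]])
 show "smooth_map T B.E (%t. snd (\<sigma> (fst t, g), snd t))" unfolding snd_conv by (rule smooth_T_snd)
 show "\<pi> (fst (\<sigma> (fst t, g), snd t)) = proj B (snd (\<sigma> (fst t, g), snd t))" if "t \<in> points T" for t
  using that \<pi>_\<sigma>[OF _ g] by auto
qed

text \<open>Only the base component moves. Since \<open>\<pi>\<close> is constant on orbits, the
  pair remains in the fibre product, and smoothness is checked componentwise.\<close>

lemma pullback_action_smooth: "smooth_right_action L T (pullback_action \<sigma>)"
 unfolding smooth_right_action_def right_action_def
proof (intro conjI ballI)
 fix t assume t: "t \<in> points T"
 obtain p b where pb: "t = (p, b)" by (cases t)
 then have tp: "p \<in> points P" "b \<in> points B.E" "\<pi> p = proj B b" using t points_T by simp_all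
 show "pullback_action \<sigma> (t, \<one>\<^bsub>L\<^esub>) = t" using tp by (simp add: pullback_action_def pb \<sigma>_one)
 fix g assume g: "g \<in> carrier L"
 show "pullback_action \<sigma> (t, g) \<in> points T" using tp g \<sigma>_in \<pi>_\<sigma> by (simp add: pullback_action_def pb points_T)
 fix h assume h: "h \<in> carrier L"
 show "pullback_action \<sigma> (pullback_action \<sigma> (t, g), h) = pullback_action \<sigma> (t, g \<otimes>\<^bsub>L\<^esub> h)"
  using tp g h by (simp add: pullback_action_def pb \<sigma>_mult)
next
 let ?D = "discrete_mfd (carrier L)"
 let ?Y = "prod_mfd T ?D"
 have cY: "charted ?Y" by (rule charted_prod_mfd[OF charted_T charted_discrete])
 have f: "smooth_map ?Y T fst" by (rule smooth_map_fst[OF charted_T charted_discrete id_T])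
 have g: "smooth_map ?Y ?D snd" by (rule smooth_map_snd[OF charted_T charted_discrete smooth_map_discrete_id])
 show "smooth_map ?Y T (pullback_action \<sigma>)"
 proof (rule smooth_map_into_T[OF cY])
  have "smooth_map ?Y (prod_mfd P ?D) (%y. (fst (fst y), snd y))"
   by (rule smooth_map_pair[OF cY charted_P charted_discrete
      smooth_map_compose[OF cY charted_T charted_P f smooth_T_fst] g])
  then have "smooth_map ?Y P (%y. \<sigma> (fst (fst y), snd y))"
   by (rule smooth_map_compose[OF cY charted_prod_mfd[OF charted_P charted_discrete] charted_P])
     (use smooth_action in \<open>simp add: smooth_right_action_def\<close>)
  then show "smooth_map ?Y P (%y. fst (pullback_action \<sigma> y))"
   by (simp add: pullback_action_def case_prod_unfold)
  have "smooth_map ?Y B.E (%y. snd (fst y))"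
   by (rule smooth_map_compose[OF cY charted_T B.charted_E f smooth_T_snd])
  then show "smooth_map ?Y B.E (%y. snd (pullback_action \<sigma> y))"
   by (simp add: pullback_action_def case_prod_unfold)
  fix y assume y: "y \<in> points ?Y"
  obtain p b g where pb: "y = ((p, b), g)" by (metis prod.exhaust)
  show "\<pi> (fst (pullback_action \<sigma> y)) = proj B (snd (pullback_action \<sigma> y))"
   using y \<pi>_\<sigma>[of p g] by (auto simp: pullback_action_def pb)
 qed
qed

section \<open>The group action on the sections\<close>

abbreviation "X \<equiv> section_algebra (pullback_bundle P \<pi> B)"
abbreviation "\<alpha> \<equiv> section_action P L \<sigma>"

lemma X_simps:
 "carrier X = smooth_sections PB" "s \<otimes>\<^bsub>X\<^esub> t = (\<lambda>p\<in>points P. (p, snd (s p) \<otimes>\<^bsub>B.F (\<pi> p)\<^esub> snd (t p)))"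
 "\<one>\<^bsub>X\<^esub> = (\<lambda>p\<in>points P. (p, \<one>\<^bsub>B.F (\<pi> p)\<^esub>))"
 "s \<oplus>\<^bsub>X\<^esub> t = (\<lambda>p\<in>points P. (p, snd (s p) \<oplus>\<^bsub>B.F (\<pi> p)\<^esub> snd (t p)))"
 "c \<odot>\<^bsub>X\<^esub> s = (\<lambda>p\<in>points P. (p, c \<odot>\<^bsub>B.F (\<pi> p)\<^esub> snd (s p)))" by (simp_all add: PB.section_algebra_simps)

lemma section_at:
 assumes "s \<in> smooth_sections PB" "p \<in> points P"
 shows "fst (s p) = p" "snd (s p) \<in> carrier (B.F (\<pi> p))" "s p = (p, snd (s p))"
 using PB.section_in[OF assms(1), of p] assms(2) by auto

lemma section_ext: "s \<in> smooth_sections PB ==> s \<in> extensional (points P)" by (simp add: smooth_sections_def)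

lemma section_eqI:
 assumes "s \<in> smooth_sections PB" "t \<in> smooth_sections PB" "!!p. p \<in> points P ==> snd (s p) = snd (t p)"
 shows "s = t"
proof (rule extensionalityI[OF section_ext[OF assms(1)] section_ext[OF assms(2)]])
 show "s p = t p" if "p \<in> points P" for p
  using section_at(3)[OF assms(1) that] section_at(3)[OF assms(2) that] assms(3)[OF that] by simp
qed

text \<open>The value of \<open>s\<close> at \<open>p.g\<close> lies over \<open>p.g\<close>, and
  the inverse of \<open>g\<close> brings the base point back to \<open>p\<close>. What remains is
  precomposition with a translation on the second component.\<close>

lemma \<alpha>_apply:
 assumes "s \<in> smooth_sections PB" "g \<in> carrier L" "p \<in> points P"
 shows "\<alpha> g s p = (p, snd (s (\<sigma> (p, g))))"
 using section_at(3)[OF assms(1) \<sigma>_in[OF assms(3,2)]] \<sigma>_inv[OF assms(3,2)] assms(3)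
 by (simp add: section_action_def pullback_action_def case_prod_unfold) (metis fst_conv)

lemma \<alpha>_section:
 assumes s: "s \<in> smooth_sections PB" and g: "g \<in> carrier L"
 shows "\<alpha> g s \<in> smooth_sections PB"
proof -
 have sm: "smooth_map P T s" using s by (simp add: smooth_sections_def)
 have "smooth_map P T (%p. (p, snd (s (\<sigma> (p, g)))))"
 proof (rule smooth_map_into_T[OF charted_P])
  show "smooth_map P P (%p. fst (p, snd (s (\<sigma> (p, g)))))" using id_P by simp
  have "smooth_map P T (%p. s (\<sigma> (p, g)))"
   by (rule smooth_map_compose[OF charted_P charted_P charted_T smooth_translation[OF g] sm])
  from smooth_map_compose[OF charted_P charted_T B.charted_E this smooth_T_snd]
  show "smooth_map P B.E (%p. snd (p, snd (s (\<sigma> (p, g)))))" by simp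
  fix p assume p: "p \<in> points P"
  have "snd (s (\<sigma> (p, g))) \<in> carrier (B.F (\<pi> p))" using section_at(2)[OF s \<sigma>_in[OF p g]] \<pi>_\<sigma>[OF p g] by simp
  then show "\<pi> (fst (p, snd (s (\<sigma> (p, g))))) = proj B (snd (p, snd (s (\<sigma> (p, g)))))"
   using B.fibre_carrier[OF \<pi>_in[OF p]] by simp
 qed
 then have "smooth_map P T (\<alpha> g s)"
  by (rule smooth_map_cong[OF charted_P charted_T]) (simp only: \<alpha>_apply[OF s g])
 moreover have "\<alpha> g s \<in> extensional (points P)" by (simp add: section_action_def)
 ultimately show ?thesis using \<alpha>_apply[OF s g] by (simp add: smooth_sections_def del: PB_simps(4,5))
qed

text \<open>Precomposition with right translations is a left action. It respects the algebra
  operations because \<open>p\<close> and \<open>p.g\<close> have the same image under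
  \<open>\<pi>\<close>, so both values lie in one fibre of the original bundle.\<close>

lemma automorphism_action_\<alpha>: "automorphism_action X L \<alpha>" unfolding automorphism_action_def alg_iso_def
proof (intro conjI ballI CollectI allI)
 interpret X: calg X by (rule calg.intro[OF PB.complex_algebra_X])
 have one: "\<alpha> \<one>\<^bsub>L\<^esub> s = s" if "s \<in> carrier X" for s
  using that by (intro section_eqI \<alpha>_section) (auto simp: X_simps(1) \<alpha>_apply \<sigma>_one)
 have mult: "\<alpha> (g \<otimes>\<^bsub>L\<^esub> h) s = \<alpha> g (\<alpha> h s)" if "g \<in> carrier L" "h \<in> carrier L" "s \<in> carrier X" for g h s
  using that by (intro section_eqI \<alpha>_section) (auto simp: X_simps(1) \<alpha>_apply \<alpha>_section \<sigma>_mult \<sigma>_in)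
 show "\<alpha> \<one>\<^bsub>L\<^esub> s = s" if "s \<in> carrier X" for s by (rule one[OF that])
 show "\<alpha> (g \<otimes>\<^bsub>L\<^esub> h) s = \<alpha> g (\<alpha> h s)" if "g \<in> carrier L" "h \<in> carrier L" "s \<in> carrier X" for g h s
  by (rule mult[OF that])
 fix g assume g: "g \<in> carrier L"
 have cl: "\<alpha> g s \<in> carrier X" if "s \<in> carrier X" for s using that \<alpha>_section[OF _ g] by (simp only: X_simps)
 show "bij_betw (\<alpha> g) (carrier X) (carrier X)"
 proof (rule bij_betwI[where g = "\<alpha> (inv\<^bsub>L\<^esub> g)"])
  show "\<alpha> g \<in> carrier X \<rightarrow> carrier X" "\<alpha> (inv\<^bsub>L\<^esub> g) \<in> carrier X \<rightarrow> carrier X"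
   using \<alpha>_section g by (auto simp: X_simps(1))
  show "\<alpha> (inv\<^bsub>L\<^esub> g) (\<alpha> g s) = s" if "s \<in> carrier X" for s
   using mult[of "inv\<^bsub>L\<^esub> g" g s] one[OF that] that g by simp
  show "\<alpha> g (\<alpha> (inv\<^bsub>L\<^esub> g) s) = s" if "s \<in> carrier X" for s
   using mult[of g "inv\<^bsub>L\<^esub> g" s] one[OF that] that g by simp
 qed
 have at: "\<alpha> g s = t" if "s \<in> carrier X" "t \<in> carrier X" "!!p. p \<in> points P ==> snd (s (\<sigma> (p, g))) = snd (t p)" for s t
  using that \<alpha>_section[OF _ g] \<alpha>_apply[OF _ g] by (intro section_eqI) (simp_all add: X_simps(1))
 have snd_\<alpha>: "snd (\<alpha> g s p) = snd (s (\<sigma> (p, g)))" if "s \<in> carrier X" "p \<in> points P" for s p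
  using that \<alpha>_apply[OF _ g] by (simp add: X_simps(1))
 show "\<alpha> g \<in> ring_hom X X"
 proof (rule ring_hom_memI[OF cl])
  fix s t assume s: "s \<in> carrier X" and t: "t \<in> carrier X"
  show "\<alpha> g (s \<otimes>\<^bsub>X\<^esub> t) = \<alpha> g s \<otimes>\<^bsub>X\<^esub> \<alpha> g t"
   by (rule at[OF X.rg.m_closed[OF s t] X.rg.m_closed[OF cl[OF s] cl[OF t]]])
     (simp add: X_simps(2) snd_\<alpha> s t \<sigma>_in g \<pi>_\<sigma>)
  show "\<alpha> g (s \<oplus>\<^bsub>X\<^esub> t) = \<alpha> g s \<oplus>\<^bsub>X\<^esub> \<alpha> g t"
   by (rule at[OF X.ag.a_closed[OF s t] X.ag.a_closed[OF cl[OF s] cl[OF t]]])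
     (simp add: X_simps(4) snd_\<alpha> s t \<sigma>_in g \<pi>_\<sigma>)
 next
  show "\<alpha> g \<one>\<^bsub>X\<^esub> = \<one>\<^bsub>X\<^esub>" by (rule at[OF X.rg.one_closed X.rg.one_closed]) (simp add: X_simps(3) \<sigma>_in g \<pi>_\<sigma>)
 qed
 show "\<alpha> g (c \<odot>\<^bsub>X\<^esub> s) = c \<odot>\<^bsub>X\<^esub> \<alpha> g s" if s: "s \<in> carrier X" for c s
  by (rule at[OF X.smult_closed[OF s] X.smult_closed[OF cl[OF s]]]) (simp add: X_simps(5) snd_\<alpha> s \<sigma>_in g \<pi>_\<sigma>)
qed

text \<open>By the exponential law the representatives of \<open>\<alpha> g s\<close> have to form a
  smooth family in \<open>s\<close>. Near \<open>p\<close> they come from a representative of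
  \<open>s\<close> near \<open>p.g\<close>: translate the base by \<open>\<tau>\<close>, evaluate,
  and pass to the other trivialization by a transition map that depends on the base point and on the
  fibre coordinate.\<close>

lemma continuous_\<alpha>:
 assumes g: "g \<in> carrier L"
 shows "continuous_map (vtop X) (vtop X) (\<alpha> g)"
proof (rule PB.continuous_map_into_sections)
 show "\<alpha> g s \<in> smooth_sections PB" if "s \<in> topspace (vtop X)" for s
  using \<alpha>_section[OF _ g] that by (simp only: PB.topspace_sections)
 fix U \<phi> V \<psi> assume triv: "local_trivialization PB U \<phi>" and chart': "(V, \<psi>) \<in> atlas (base_space PB)"
 have chart: "(V, \<psi>) \<in> atlas P" using chart' by simp
 let ?fc = "fibre_coord PB U \<phi>"
 interpret R: lcs2 "model P" B.RA by (rule lcs2.intro[OF charted_lcs[OF charted_P] B.lcs_RA])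
 interpret PP: lcs2 "model P" "model P"
  by (rule lcs2.intro[OF charted_lcs[OF charted_P] charted_lcs[OF charted_P]])
 interpret C1: lcs3 "model P" "model P" B.RA by (intro lcs3.intro PP.lcs2_axioms R.lcs2_axioms)
 have lprod: "lcs (prod_space (model P) B.RA)" by (rule lcs_prod_space[OF charted_lcs[OF charted_P] B.lcs_RA])
 interpret C2: lcs3 "model P" "prod_space (model P) B.RA" B.RA
  by (intro lcs3.intro lcs2.intro lprod charted_lcs[OF charted_P] B.lcs_RA)
 have gi: "inv\<^bsub>L\<^esub> g \<in> carrier L" using g by simp
 have "smooth_family (vtop X) (model P) B.RA (\<psi> ` (U \<inter> V)) (%s. PB.local_rep U \<phi> V \<psi> (\<alpha> g s))"
 proof (rule R.smooth_family_local)
  fix x assume "x \<in> \<psi> ` (U \<inter> V)"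
  then obtain p where p: "p \<in> U \<inter> V" "x = \<psi> p" by blast
  have pP: "p \<in> points P" using p(1) charted_subset[OF charted_P chart] by blast
  have qP: "\<sigma> (p, g) \<in> points P" by (rule \<sigma>_in[OF pP g])
  obtain U2 \<phi>2 where U2: "\<sigma> (p, g) \<in> U2" "local_trivialization PB U2 \<phi>2"
   using PB.triv_exists[of "\<sigma> (p, g)"] qP unfolding PB_simps(1) by (elim meta_impE exE conjE) blast+
  obtain V2 \<psi>2 where V2: "(V2, \<psi>2) \<in> atlas P" "\<sigma> (p, g) \<in> V2"
   using charted_cover[OF charted_P qP] by (elim exE conjE)
  have oU: "openin (mtop P) U" "openin (mtop P) U2"
   using PB.triv_open[OF triv] PB.triv_open[OF U2(2)] by simp_all
  \<comment> \<open>On \<open>N\<close> the point is in the given chart and trivialization, and its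
    translate in those chosen around \<open>p.g\<close>.\<close>
  define N where "N = U \<inter> V \<inter> {p \<in> points P. \<sigma> (p, g) \<in> U2 \<inter> V2}"
  have oN: "openin (mtop P) N" unfolding N_def by (intro openin_Int oU charted_open[OF charted_P chart]
     openin_continuous_map_preimage[OF smooth_map_continuous[OF smooth_translation[OF g]]] charted_open[OF charted_P V2(1)])
  have oD: "openin (vtop (model P)) (\<psi> ` N)" by (rule charted_image[OF charted_P chart oN]) (auto simp: N_def)
  define \<tau> where "\<tau> = \<psi>2 \<circ> (%p. \<sigma> (p, g)) \<circ> inv_into V \<psi>"
  have \<tau>_at: "\<tau> (\<psi> p) = \<psi>2 (\<sigma> (p, g))" if "p \<in> N" for p
   using that charted_inv[OF charted_P chart, of p] by (simp add: \<tau>_def N_def)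
  have \<tau>: "smooth_on (model P) (model P) (\<psi> ` N) \<tau>" unfolding \<tau>_def
   by (rule PP.smooth_on_open_subset[OF smooth_map_chart[OF smooth_translation[OF g] chart V2(1)] oD])
     (auto simp: N_def)
  \<comment> \<open>The points of the second trivialization whose translates by the inverse of
    \<open>g\<close> return to \<open>U\<close>; over them the transition \<open>?h\<close> is
    defined.\<close>
  define O2 where "O2 = U2 \<inter> {q \<in> points P. \<sigma> (q, inv\<^bsub>L\<^esub> g) \<in> U}"
  have oO2: "openin (mtop P) O2" unfolding O2_def by (intro openin_Int oU
     openin_continuous_map_preimage[OF smooth_map_continuous[OF smooth_translation[OF gi]]])
  let ?Y = "prod_mfd (open_submfd P O2) (alg_mfd B.A)"
  have cO2: "charted (open_submfd P O2)" by (rule charted_open_submfd[OF charted_P oO2])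
  have cY: "charted ?Y" by (rule charted_prod_mfd[OF cO2 B.charted_alg])
  have Y_pts: "y \<in> points ?Y ==> fst y \<in> O2 \<and> snd y \<in> carrier B.A" for y by (auto simp: alg_mfd_def)
  \<comment> \<open>The point with given coordinates in the second trivialization, translated back
    by the inverse of \<open>g\<close>. Its coordinate in the first trivialization is the transition
    map.\<close>
  define k where "k = (%y. (\<sigma> (fst (\<phi>2 (fst y, snd y)), inv\<^bsub>L\<^esub> g), snd (\<phi>2 (fst y, snd y))))"
  let ?h = "%y. ?fc (k y)"
  have h: "smooth_map ?Y (alg_mfd B.A) ?h"
  proof -
   have "smooth_map ?Y T (%y. \<phi>2 (fst y, snd y))"
   proof (rule PB.smooth_map_via_triv[OF U2(2) cY])
    show "smooth_map ?Y (base_space PB) fst" unfolding PB_simps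
     by (rule smooth_map_from_open[OF cY smooth_map_fst[OF cO2 B.charted_alg
        smooth_map_into_open[OF cO2 smooth_map_restrict[OF charted_P charted_P id_P oO2]]]]) auto
    show "fst y \<in> U2" if "y \<in> points ?Y" for y using Y_pts[OF that] by (simp add: O2_def)
    show "smooth_map ?Y (alg_mfd (fibre PB)) snd" unfolding PB_simps
     using PB.id_alg[OF triv] by (intro smooth_map_snd[OF cO2 B.charted_alg]) (simp del: PB_simps(4,5))
   qed
   from smooth_map_compose[OF cY charted_T charted_T this smooth_translation_T[OF gi]]
   have k: "smooth_map ?Y T k" unfolding k_def .
   then have "smooth_map ?Y (open_submfd T (PB.over U)) k"
   proof (rule smooth_map_into_open[OF cY])
    fix y assume y: "y \<in> points ?Y"
    have "fst (\<phi>2 (fst y, snd y)) = fst y"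
     using PB.triv_proj[OF U2(2), of "fst y" "snd y"] Y_pts[OF y] by (simp add: O2_def)
    then have "fst (k y) \<in> U" using Y_pts[OF y] by (simp add: O2_def k_def)
    moreover have "k y \<in> points T" by (rule smooth_map_image[OF k y])
    ultimately show "k y \<in> PB.over U" by (simp only: mem_Collect_eq PB_simps(3))
   qed
   from smooth_map_compose[OF cY PB.charted_over[OF triv] PB.charted_alg this PB.coord_smooth[OF triv]]
   show ?thesis unfolding PB_simps(2) .
  qed
  let ?W = "(V2 \<inter> O2) \<times> carrier B.A" and ?\<mu> = "map_prod \<psi>2 (%a. a)"
  have ch: "(?W, ?\<mu>) \<in> atlas ?Y" by (rule chart_prod[OF V2(1)])
  have h2: "smooth_on (prod_space (model P) B.RA) B.RA (?\<mu> ` ?W) (?h \<circ> inv_into ?W ?\<mu>)"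
   using bspec[OF conjunct2[OF h[unfolded alg_mfd_eq smooth_map_vmfd_iff[OF cY[unfolded alg_mfd_eq] B.lcs_RA]]] ch[unfolded alg_mfd_eq]]
   by (simp add: alg_mfd_eq)
  have sec: "s \<in> smooth_sections PB" if "s \<in> topspace (vtop X)" for s
   using that by (simp only: PB.topspace_sections)
  have q: "\<sigma> (p, g) \<in> U2 \<inter> V2" "\<sigma> (p, g) \<in> V2 \<inter> O2" "p \<in> points P" "\<sigma> (p, g) \<in> points P" if "p \<in> N" for p
   using that \<sigma>_inv[OF _ g] \<sigma>_in[OF _ g] by (auto simp: N_def O2_def)
  let ?rep = "PB.local_rep U2 \<phi>2 V2 \<psi>2"
  have fam0: "smooth_family (vtop X) (model P) B.RA (\<psi>2 ` (U2 \<inter> V2)) ?rep"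
   using PB.smooth_family_sections[OF U2(2), of V2 \<psi>2] V2(1) by simp
  have fam1: "smooth_family (vtop X) (model P) B.RA (\<psi> ` N) (%s x. ?rep s (\<tau> x))"
  proof (rule C1.smooth_family_compose[OF PP.smooth_family_const_param[OF \<tau>] fam0])
   show "\<tau> x \<in> \<psi>2 ` (U2 \<inter> V2)" if "x \<in> \<psi> ` N" for x using that \<tau>_at q(1) by auto
  qed
  have rep_at: "?rep s (\<tau> (\<psi> p)) = fibre_coord PB U2 \<phi>2 (s (\<sigma> (p, g)))" if "p \<in> N" for s p
   using \<tau>_at[OF that] charted_inv[OF charted_P V2(1), of "\<sigma> (p, g)"] q(1)[OF that] by simp
  have s_over: "s (\<sigma> (p, g)) \<in> PB.over U2" if "p \<in> N" "s \<in> smooth_sections PB" for p s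
   using PB.section_over[OF that(2) U2(2)] q(1)[OF that(1)] by blast
  have fam2: "smooth_family (vtop X) (model P) (prod_space (model P) B.RA) (\<psi> ` N) (%s x. (\<tau> x, ?rep s (\<tau> x)))"
   by (rule smooth_family_pair[OF charted_lcs[OF charted_P] charted_lcs[OF charted_P] B.lcs_RA
      PP.smooth_family_const_param[OF \<tau>] fam1])
  \<comment> \<open>The transition is a constant family; the base coordinate and the representative
    of \<open>s\<close> are fed into it, and only the latter depends on \<open>s\<close>.\<close>
  have fam3: "smooth_family (vtop X) (model P) B.RA (\<psi> ` N) (%s x. (?h \<circ> inv_into ?W ?\<mu>) (\<tau> x, ?rep s (\<tau> x)))"
  proof (rule C2.smooth_family_compose[OF fam2 C2.FG.smooth_family_const_param[OF h2]])
   fix s x assume s: "s \<in> topspace (vtop X)" and "x \<in> \<psi> ` N"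
   then obtain p where p: "p \<in> N" "x = \<psi> p" by blast
   have "fibre_coord PB U2 \<phi>2 (s (\<sigma> (p, g))) \<in> carrier B.A"
    using PB.triv_coord(1)[OF U2(2) s_over[OF p(1) sec[OF s]]] by simp
   then show "(\<tau> x, ?rep s (\<tau> x)) \<in> ?\<mu> ` ?W"
    unfolding p(2) rep_at[OF p(1)] unfolding \<tau>_at[OF p(1)] using q(2)[OF p(1)] by auto
  qed
  have "smooth_family (vtop X) (model P) B.RA (\<psi> ` N) (%s. PB.local_rep U \<phi> V \<psi> (\<alpha> g s))"
  proof (rule R.smooth_family_cong[OF fam3])
   fix s x assume "s \<in> topspace (vtop X)" and "x \<in> \<psi> ` N"
   then obtain p where p: "p \<in> N" "x = \<psi> p" and s: "s \<in> smooth_sections PB" using sec by blast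
   let ?q = "\<sigma> (p, g)"
   let ?a = "fibre_coord PB U2 \<phi>2 (s ?q)"
   have a: "?a \<in> carrier B.A" using PB.triv_coord(1)[OF U2(2) s_over[OF p(1) s]] by simp
   have \<phi>2: "\<phi>2 (?q, ?a) = s ?q"
    using PB.triv_coord(2)[OF U2(2) s_over[OF p(1) s]] section_at(1)[OF s q(4)[OF p(1)]] by simp
   have "inv_into ?W ?\<mu> (?\<mu> (?q, ?a)) = (?q, ?a)" using q(2)[OF p(1)] a by (intro charted_inv[OF cY ch]) simp
   then have "(?h \<circ> inv_into ?W ?\<mu>) (\<tau> x, ?rep s (\<tau> x)) = ?h (?q, ?a)"
    unfolding p(2) rep_at[OF p(1)] unfolding \<tau>_at[OF p(1)] by simp
   also have "\<dots> = ?fc (\<alpha> g s p)"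
    unfolding k_def using \<phi>2 section_at(1)[OF s q(4)[OF p(1)]] \<sigma>_inv[OF q(3)[OF p(1)] g] \<alpha>_apply[OF s g q(3)[OF p(1)]]
    by simp
   also have "\<dots> = PB.local_rep U \<phi> V \<psi> (\<alpha> g s) x"
    using charted_inv[OF charted_P chart, of p] p by (simp add: N_def)
   finally show "(?h \<circ> inv_into ?W ?\<mu>) (\<tau> x, ?rep s (\<tau> x)) = PB.local_rep U \<phi> V \<psi> (\<alpha> g s) x" .
  qed
  moreover have "x \<in> \<psi> ` N" using p pP U2(1) V2(2) by (auto simp: N_def)
  moreover have "\<psi> ` N \<subseteq> \<psi> ` (U \<inter> V)" by (auto simp: N_def)
  ultimately show "\<exists>D. x \<in> D \<and> D \<subseteq> \<psi> ` (U \<inter> V) \<and>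
    smooth_family (vtop X) (model P) B.RA D (%s. PB.local_rep U \<phi> V \<psi> (\<alpha> g s))"
   by (intro exI[of _ "\<psi> ` N"] conjI)
 qed
 then show "smooth_family (vtop X) (model (base_space PB)) (real_space (fibre PB)) (\<psi> ` (U \<inter> V))
   (%s. PB.local_rep U \<phi> V \<psi> (\<alpha> g s))" unfolding PB_simps(1,2) .
qed

lemma dynamical_system_\<alpha>: "dynamical_system X L \<alpha>" unfolding dynamical_system_def
proof (intro conjI automorphism_action_\<alpha> L.is_group)
 show "locally_convex_algebra X" using PB.lca_X by (simp add: lca_def)
 show "continuous_map (prod_topology (discrete_topology (carrier L)) (vtop X)) (vtop X) (%(g, a). \<alpha> g a)"
  by (rule continuous_map_discrete_prod) (use continuous_\<alpha> in simp)
qed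

end

section \<open>Generator systems of finite abelian groups\<close>

context comm_group
begin

lemma generate_eqI:
 assumes "X \<subseteq> carrier G" "Y \<subseteq> carrier G" "X \<subseteq> generate G Y" "Y \<subseteq> generate G X"
 shows "generate G X = generate G Y"
 by (rule equalityI[OF generate_subgroup_incl[OF assms(3) generate_is_subgroup[OF assms(2)]]
    generate_subgroup_incl[OF assms(4) generate_is_subgroup[OF assms(1)]]])

lemma generate_int_pow:
 assumes "X \<subseteq> carrier G" "x \<in> generate G X"
 shows "x [^] (k::int) \<in> generate G X"
 using subgroup_int_pow_closed[OF generate_is_subgroup[OF assms(1)] assms(2)] .

text \<open>Euclid's algorithm on the exponents. Reducing the larger exponent by a signed copy of
  the smaller one is compensated by a change of generators that keeps the generated subgroup, and
  the sum of absolute values drops. When at most one exponent is left it divides all the original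
  ones, and its generator is moved to position \<open>j\<close>.\<close>

lemma generating_family_euclid:
 fixes c :: "'i => int"
 assumes I: "finite I" "j \<in> I" and x: "x \<in> I \<rightarrow> carrier G"
 shows "\<exists>(d::int) y. y \<in> I \<rightarrow> carrier G \<and> generate G (y ` I) = generate G (x ` I) \<and>
  (\<forall>i\<in>I. d dvd c i) \<and> (\<Otimes>i\<in>I. x i [^] c i) = y j [^] d" using x
proof (induction "\<Sum>i\<in>I. nat \<bar>c i\<bar>" arbitrary: c x rule: less_induct)
 case less
 note x = less.prems
 have xc: "x i \<in> carrier G" if "i \<in> I" for i using x that by auto
 show ?case
 proof (cases "\<exists>a\<in>I. \<exists>b\<in>I. a \<noteq> b \<and> c a \<noteq> 0 \<and> c b \<noteq> 0")
  case True
  then obtain a b where ab: "a \<in> I" "b \<in> I" "a \<noteq> b" "c a \<noteq> 0" "c b \<noteq> 0" "\<bar>c b\<bar> \<le> \<bar>c a\<bar>" by (metis linear)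
  \<comment> \<open>With this sign the new exponent at \<open>a\<close> has absolute value
    \<open>\<bar>c a\<bar> - \<bar>c b\<bar>\<close>.\<close>
  define e where "e = sgn (c a) * sgn (c b)"
  define c' where "c' = c(a := c a - e * c b)"
  \<comment> \<open>Raising \<open>x' b\<close> to the power \<open>c b\<close> returns the power of
    \<open>x a\<close> that was taken away from the factor at \<open>a\<close>.\<close>
  define x' where "x' = x(b := x b \<otimes> x a [^] e)"
  have small: "\<bar>c a - e * c b\<bar> < \<bar>c a\<bar>" using ab by (auto simp: e_def sgn_if abs_if split: if_splits)
  have x': "x' \<in> I \<rightarrow> carrier G" using xc ab by (auto simp: x'_def)
  have "(\<Sum>i\<in>I. nat \<bar>c' i\<bar>) < (\<Sum>i\<in>I. nat \<bar>c i\<bar>)"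
  proof (rule sum_strict_mono_ex1[OF I(1)])
   show "\<forall>i\<in>I. nat \<bar>c' i\<bar> \<le> nat \<bar>c i\<bar>" using small by (auto simp: c'_def)
   show "\<exists>i\<in>I. nat \<bar>c' i\<bar> < nat \<bar>c i\<bar>" using small ab by (intro bexI[of _ a]) (auto simp: c'_def)
  qed
  from less.hyps[OF this x'] obtain d :: int and y where y: "y \<in> I \<rightarrow> carrier G"
    "generate G (y ` I) = generate G (x' ` I)" "\<forall>i\<in>I. d dvd c' i" "(\<Otimes>i\<in>I. x' i [^] c' i) = y j [^] d" by blast
  have dvd: "\<forall>i\<in>I. d dvd c i"
  proof
   fix i assume i: "i \<in> I"
   have db: "d dvd c b" using y(3) ab by (metis c'_def fun_upd_other)
   have "d dvd c a - e * c b" using y(3) ab by (metis c'_def fun_upd_same)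
   then have "d dvd (c a - e * c b) + e * c b" using db by (intro dvd_add dvd_mult)
   then have "d dvd c a" by simp
   then show "d dvd c i" using y(3) i by (cases "i = a") (auto simp: c'_def)
  qed
  have gen: "generate G (x' ` I) = generate G (x ` I)"
  proof (rule generate_eqI)
   show xI: "x ` I \<subseteq> carrier G" and xI': "x' ` I \<subseteq> carrier G" using x x' by auto
   have inx: "x i \<in> generate G (x ` I)" and inx': "x' i \<in> generate G (x' ` I)" if "i \<in> I" for i
    using that by (auto intro: generate.incl)
   show "x' ` I \<subseteq> generate G (x ` I)"
    using ab inx by (auto simp: x'_def intro!: generate.eng generate_int_pow[OF xI])
   have xa: "x a \<in> generate G (x' ` I)" using inx'[OF ab(1)] ab(3) by (simp add: x'_def)
   have "x b = x' b \<otimes> x' a [^] (- e)" using ab xc by (simp add: x'_def m_assoc int_pow_neg)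
   then have xb: "x b \<in> generate G (x' ` I)"
    using inx'[OF ab(1)] inx'[OF ab(2)] by (auto intro!: generate.eng generate_int_pow[OF xI'])
   show "x ` I \<subseteq> generate G (x' ` I)"
   proof
    fix u assume "u \<in> x ` I"
    then obtain i where "i \<in> I" "u = x i" by blast
    then show "u \<in> generate G (x' ` I)" using xb inx'[of i] by (cases "i = b") (auto simp: x'_def)
   qed
  qed
  have prod: "(\<Otimes>i\<in>I. x i [^] c i) = (\<Otimes>i\<in>I. x' i [^] c' i)"
  proof -
   let ?K = "I - {a, b}"
   have Ieq: "I = insert a (insert b ?K)" using ab by auto
   have K: "finite ?K" "a \<notin> insert b ?K" "b \<notin> ?K" using I ab by auto
   have cl: "(%i. x i [^] c i) \<in> ?K \<rightarrow> carrier G" "(%i. x' i [^] c' i) \<in> ?K \<rightarrow> carrier G" using xc x' by auto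
   have KE: "(\<Otimes>i\<in>?K. x i [^] c i) = (\<Otimes>i\<in>?K. x' i [^] c' i)"
    by (rule finprod_cong') (use cl in \<open>auto simp: x'_def c'_def\<close>)
   have split: "(\<Otimes>i\<in>I. f i) = f a \<otimes> (f b \<otimes> (\<Otimes>i\<in>?K. f i))" if "f \<in> I \<rightarrow> carrier G" for f
   proof -
    have "(\<Otimes>i\<in>I. f i) = (\<Otimes>i\<in>insert a (insert b ?K). f i)" using Ieq by simp
    also have "\<dots> = f a \<otimes> (f b \<otimes> (\<Otimes>i\<in>?K. f i))"
     using K that ab by (subst finprod_insert; (subst finprod_insert)?) (auto simp: Pi_iff)
    finally show ?thesis .
   qed
   have "x' a [^] c' a \<otimes> (x' b [^] c' b \<otimes> z) = x a [^] c a \<otimes> (x b [^] c b \<otimes> z)" if "z \<in> carrier G" for z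
   proof -
    have xab: "x a \<in> carrier G" "x b \<in> carrier G" using xc ab by auto
    have e1: "x' b [^] c' b = x a [^] (e * c b) \<otimes> x b [^] c b"
     using ab xab by (simp add: x'_def c'_def int_pow_distrib int_pow_pow m_comm)
    have e2: "x' a [^] c' a \<otimes> x a [^] (e * c b) = x a [^] c a"
     using ab xab by (simp add: x'_def c'_def int_pow_mult[symmetric])
    have "x' a [^] c' a \<otimes> (x' b [^] c' b \<otimes> z) = (x' a [^] c' a \<otimes> x a [^] (e * c b)) \<otimes> (x b [^] c b \<otimes> z)"
     unfolding e1 using xab x' ab that by (simp add: m_assoc Pi_iff)
    then show ?thesis unfolding e2 .
   qed
   then show ?thesis
    using split[of "%i. x i [^] c i"] split[of "%i. x' i [^] c' i"] KE cl xc x' by (auto simp: Pi_iff)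
  qed
  show ?thesis using y(1,2,4) dvd gen prod by (intro exI[of _ d] exI[of _ y] conjI) simp_all
 next
  case False
  show ?thesis
  proof (cases "\<exists>a\<in>I. c a \<noteq> 0")
   case True
   then obtain a where a: "a \<in> I" "c a \<noteq> 0" by blast
   then have z: "c i = 0" if "i \<in> I" "i \<noteq> a" for i using False that by blast
   have "(\<Otimes>i\<in>I. x i [^] c i) = (\<Otimes>i\<in>I. if i = a then x i [^] c i else \<one>)"
    by (rule finprod_cong') (use xc z in auto)
   also have "\<dots> = x a [^] c a" by (rule finprod_singleton_swap) (use I a xc in auto)
   finally have prod: "(\<Otimes>i\<in>I. x i [^] c i) = x a [^] c a" .
   \<comment> \<open>Swapping two members changes neither the range of the family nor the subgroup,
     and puts the surviving factor at position \<open>j\<close>.\<close>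
   let ?y = "x \<circ> Transposition.transpose a j"
   have tI: "Transposition.transpose a j ` I = I" using a(1) I(2) by (simp add: transpose_image_eq)
   then have "?y ` I = x ` I" by (simp only: image_comp[symmetric])
   moreover have "?y \<in> I \<rightarrow> carrier G"
   proof
    fix i assume "i \<in> I"
    then have "Transposition.transpose a j i \<in> I" using imageI[of i I "Transposition.transpose a j"] tI by simp
    then show "?y i \<in> carrier G" using xc by simp
   qed
   moreover have "\<forall>i\<in>I. c a dvd c i"
   proof
    fix i assume "i \<in> I"
    then show "c a dvd c i" using z[of i] by (cases "i = a") auto
   qed
   ultimately show ?thesis using prod by (intro exI[of _ "c a"] exI[of _ ?y] conjI) simp_all
  next
   case False
   then have "(\<Otimes>i\<in>I. x i [^] c i) = \<one>" by (intro finprod_one_eqI) auto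
   then show ?thesis using x by (intro exI[of _ "0::int"] exI[of _ x]) (use False in auto)
  qed
 qed
qed

text \<open>Among the generating lists of minimal length, one with lexicographically minimal element orders
 is independent: otherwise \<open>generating_family_euclid\<close> turns a nontrivial relation into a generator of
 smaller order.\<close>

lemma exists_independent_generators:
 assumes fin: "finite (carrier G)"
 obtains S where "S \<subseteq> carrier G" "generate G S = carrier G"
  "!!T. T \<subseteq> carrier G ==> generate G T = carrier G ==> card S \<le> card T"
  "!!e :: 'a => int. (\<Otimes>s\<in>S. s [^] e s) = \<one> ==> \<forall>s\<in>S. s [^] e s = \<one>"
proof -
 define P where "P k \<longleftrightarrow> (\<exists>T\<subseteq>carrier G. generate G T = carrier G \<and> card T = k)" for k
 have "generate G (carrier G) = carrier G"
  by (rule equalityI[OF generate_incl[OF order_refl] subsetI[OF generate.incl]])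
 then have "P (card (carrier G))" unfolding P_def by (intro exI[of _ "carrier G"]) simp
 then have Pk: "P (LEAST k. P k)" by (rule LeastI)
 define k where "k = (LEAST k. P k)"
 have kmin: "k \<le> card T" if "T \<subseteq> carrier G" "generate G T = carrier G" for T
  unfolding k_def by (rule Least_le) (use that in \<open>auto simp: P_def\<close>)
 define LL where "LL = {xs. length xs = k \<and> set xs \<subseteq> carrier G \<and> generate G (set xs) = carrier G}"
 obtain T where T: "T \<subseteq> carrier G" "generate G T = carrier G" "card T = k"
  using Pk unfolding P_def k_def by blast
 obtain ts where "set ts = T" "distinct ts" using finite_distinct_list[OF finite_subset[OF T(1) fin]] by blast
 then have "ts \<in> LL" using T by (auto simp: LL_def distinct_card)
 \<comment> \<open>\<open>lex\<close> relates only lists of equal length, which makes it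
   well-founded.\<close>
 moreover have "wf (inv_image (lex less_than) (map ord))" by (intro wf_inv_image wf_lex wf_less_than)
 ultimately have "\<exists>xs\<in>LL. \<forall>ys. (ys, xs) \<in> inv_image (lex less_than) (map ord) \<longrightarrow> ys \<notin> LL"
  unfolding wf_eq_minimal by blast
 then obtain xs where xs: "xs \<in> LL" and min: "!!ys. (map ord ys, map ord xs) \<in> lex less_than ==> ys \<notin> LL"
  unfolding in_inv_image by blast
 have len: "length xs = k" and xsc: "set xs \<subseteq> carrier G" and gen: "generate G (set xs) = carrier G"
  using xs by (auto simp: LL_def)
 have nth: "xs ! i \<in> carrier G" if "i < k" for i using that len xsc nth_mem by blast
 \<comment> \<open>A repetition would give a generating set with fewer than \<open>k\<close>
   elements.\<close>
 have "card (set xs) = length xs" using kmin[OF xsc gen] card_length[of xs] len by simp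
 then have dist: "distinct xs" by (simp add: card_distinct)
 have ind: "\<forall>i<k. xs ! i [^] c i = \<one>" if prod: "(\<Otimes>i\<in>{..<k}. xs ! i [^] c i) = \<one>" for c :: "nat => int"
 proof (rule ccontr)
  assume "\<not> (\<forall>i<k. xs ! i [^] c i = \<one>)"
  then obtain i0 where "i0 < k \<and> xs ! i0 [^] c i0 \<noteq> \<one>" by blast
  \<comment> \<open>The first nontrivial factor: the earlier entries are kept, so a smaller order at
    \<open>j\<close> decides the lexicographic comparison.\<close>
  then obtain j where j: "j < k" "xs ! j [^] c j \<noteq> \<one>" and below: "!!i. i < j ==> i < k ==> xs ! i [^] c i = \<one>"
   using exists_least_iff[of "%i. i < k \<and> xs ! i [^] c i \<noteq> \<one>"] by blast
  let ?n = "int (ord (xs ! j))"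
  have n: "?n > 0" using ord_ge_1[OF fin nth[OF j(1)]] by simp
  \<comment> \<open>Reduction modulo the order does not change the factor, and it makes the
    exponent, hence the absolute value of every divisor of it, smaller than the order.\<close>
  define m where "m = c j mod ?n"
  have mpow: "xs ! j [^] m = xs ! j [^] c j"
   unfolding m_def by (subst int_pow_eq[OF nth[OF j(1)]]) (simp add: mod_eq_dvd_iff[symmetric])
  have m: "0 < m" "m < ?n"
  proof -
   have "m \<noteq> 0" using mpow j by auto
   moreover have "0 \<le> m" "m < ?n" using n by (simp_all add: m_def)
   ultimately show "0 < m" "m < ?n" by auto
  qed
  define c' where "c' = c(j := m)"
  let ?I = "{j..<k}"
  have "(\<Otimes>i\<in>?I. xs ! i [^] c' i) = (\<Otimes>i\<in>{..<k}. xs ! i [^] c i)"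
   by (rule finprod_mono_neutral_cong_left) (use nth below mpow in \<open>auto simp: c'_def\<close>)
  then have prod': "(\<Otimes>i\<in>?I. xs ! i [^] c' i) = \<one>" using prod by simp
  obtain d y where y: "y \<in> ?I \<rightarrow> carrier G" "generate G (y ` ?I) = generate G ((%i. xs ! i) ` ?I)"
    "\<forall>i\<in>?I. d dvd c' i" "(\<Otimes>i\<in>?I. xs ! i [^] c' i) = y j [^] d"
   using generating_family_euclid[of ?I j "%i. xs ! i" c'] j nth by auto
  have yj: "y j \<in> carrier G" using y(1) j by auto
  \<comment> \<open>The relation becomes \<open>y j [^] d = \<one>\<close> with \<open>d\<close>
    dividing \<open>m\<close>. So the order of \<open>y j\<close> is at most \<open>m\<close>, below
    that of \<open>xs ! j\<close>.\<close>
  have "d dvd m" using bspec[OF y(3), of j] j by (simp add: c'_def)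
  then have d: "d \<noteq> 0" "\<bar>d\<bar> \<le> m" using m(1) zdvd_imp_le[of "\<bar>d\<bar>" m] by auto
  have "y j [^] d = \<one>" using y(4) prod' by (simp only:)
  then have "int (ord (y j)) dvd d" using int_pow_eq_id[OF yj, of d] by simp
  then have "int (ord (y j)) \<le> \<bar>d\<bar>" using zdvd_imp_le[of "int (ord (y j))" "\<bar>d\<bar>"] d(1) by simp
  then have less: "ord (y j) < ord (xs ! j)" using d(2) m(2) by linarith
  define ys where "ys = take j xs @ map y [j..<k]"
  have sys: "set ys = set (take j xs) \<union> y ` ?I" by (auto simp: ys_def)
  have ysc: "set ys \<subseteq> carrier G" using y(1) xsc set_take_subset[of j xs] unfolding sys by auto
  have "xs ! i \<in> generate G (set ys)" if i: "i < k" for i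
  proof (cases "i < j")
   case True
   then have "xs ! i \<in> set ys" unfolding sys using i len by (auto simp: in_set_conv_nth)
   then show ?thesis by (rule generate.incl)
  next
   case False
   then have "xs ! i \<in> generate G ((%i. xs ! i) ` ?I)" using i by (intro generate.incl) auto
   then show ?thesis using y(2) subsetD[OF mono_generate[of "y ` ?I" "set ys"]] sys by simp
  qed
  then have "set xs \<subseteq> generate G (set ys)" using len by (auto simp: in_set_conv_nth)
  then have "generate G (set xs) \<subseteq> generate G (set ys)"
   by (rule generate_subgroup_incl[OF _ generate_is_subgroup[OF ysc]])
  then have "generate G (set ys) = carrier G" using generate_incl[OF ysc] gen by (intro equalityI) simp_all
  then have "ys \<in> LL" using ysc len j by (auto simp: LL_def ys_def)
  moreover have "(map ord ys, map ord xs) \<in> lex less_than"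
  proof -
   have e1: "map ord xs = map ord (take j xs) @ ord (xs ! j) # map ord (drop (Suc j) xs)"
    using id_take_nth_drop[of j xs] j len by (metis list.simps(9) map_append)
   have e2: "map ord ys = map ord (take j xs) @ ord (y j) # map (ord \<circ> y) [Suc j..<k]"
    using j by (simp add: ys_def upt_conv_Cons)
   show ?thesis unfolding e1 e2 by (rule lex_append_leftI) (use less len in auto)
  qed
  ultimately show False using min by blast
 qed
 show ?thesis
 proof (rule that[of "set xs"])
  show "set xs \<subseteq> carrier G" "generate G (set xs) = carrier G" by fact+
  show "card (set xs) \<le> card T" if "T \<subseteq> carrier G" "generate G T = carrier G" for T
   using kmin[OF that] \<open>card (set xs) = length xs\<close> len by simp
  fix e :: "'a => int" assume e: "(\<Otimes>s\<in>set xs. s [^] e s) = \<one>"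
  have im: "set xs = (%i. xs ! i) ` {..<k}" using len by (auto simp: set_conv_nth)
  have inj: "inj_on (%i. xs ! i) {..<k}" using dist len by (auto simp: inj_on_def nth_eq_iff_index_eq)
  have "(\<Otimes>i\<in>{..<k}. xs ! i [^] e (xs ! i)) = \<one>"
  proof -
   have "(%s. s [^] e s) \<in> (%i. xs ! i) ` {..<k} \<rightarrow> carrier G"
    unfolding im[symmetric] using xsc by (intro Pi_I int_pow_closed) auto
   from finprod_reindex[OF this inj] e show ?thesis unfolding im by simp
  qed
  from ind[OF this] show "\<forall>s\<in>set xs. s [^] e s = \<one>" unfolding im by auto
 qed
qed

text \<open>By independence each power of a generator occurring in a product is determined by the
  product, which gives the direct decomposition. The character dual to \<open>s\<close> turns the
  exponent of \<open>s\<close> into a power of the primitive root of unity.\<close>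

lemma generator_system_exists:
 assumes fin: "finite (carrier G)"
 shows "\<exists>S. generator_system G S \<and> (\<forall>s\<in>S. dual_generator G S s \<in> dual_group G \<and> ord s > 0 \<and>
  (\<forall>g\<in>carrier G. dual_generator G S s g ^ ord s = 1))"
proof -
 obtain S where S: "S \<subseteq> carrier G" "generate G S = carrier G"
   "!!T. T \<subseteq> carrier G ==> generate G T = carrier G ==> card S \<le> card T"
  and ind: "!!e :: 'a => int. (\<Otimes>s\<in>S. s [^] e s) = \<one> ==> \<forall>s\<in>S. s [^] e s = \<one>"
  using exists_independent_generators[OF fin] by metis
 have finS: "finite S" using S(1) fin finite_subset by blast
 have Sc: "s \<in> carrier G" if "s \<in> S" for s using S(1) that by blast
 \<comment> \<open>The homomorphism from exponent vectors onto the group; independence describes its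
   kernel.\<close>
 define pr where "pr e = (\<Otimes>s\<in>S. s [^] (e s :: int))" for e
 have pr_closed: "pr e \<in> carrier G" for e unfolding pr_def using Sc by (intro finprod_closed) auto
 have pr_add: "pr (%t. e t + e' t) = pr e \<otimes> pr e'" for e e'
 proof -
  have "(\<Otimes>s\<in>S. s [^] (e s + e' s)) = (\<Otimes>s\<in>S. s [^] e s \<otimes> s [^] e' s)"
   using Sc by (intro finprod_cong') (auto simp: int_pow_mult)
  also have "\<dots> = (\<Otimes>s\<in>S. s [^] e s) \<otimes> (\<Otimes>s\<in>S. s [^] e' s)" using Sc by (intro finprod_multf) auto
  finally show ?thesis unfolding pr_def .
 qed
 have pr_unique: "s [^] e s = s [^] e' s" if "pr e = pr e'" "s \<in> S" for e e' s
 proof -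
  have "pr (%t. e t - e' t) \<otimes> pr e' = \<one> \<otimes> pr e'" using pr_add[of "%t. e t - e' t" e'] that(1) pr_closed by simp
  then have "pr (%t. e t - e' t) = \<one>" using pr_closed by (simp only: right_cancel one_closed)
  then have "s [^] (e s - e' s) = \<one>" using ind[of "%t. e t - e' t"] that(2) unfolding pr_def by blast
  then have "s [^] (e s - e' s) \<otimes> s [^] e' s = s [^] e' s" using Sc[OF that(2)] by simp
  then show ?thesis using Sc[OF that(2)] by (simp add: int_pow_mult[symmetric])
 qed
 have pr_delta: "pr (%t. if t = s then 1 else 0) = s" if "s \<in> S" for s
 proof -
  have "pr (%t. if t = s then 1 else 0) = (\<Otimes>t\<in>S. if t = s then t else \<one>)"
   unfolding pr_def using Sc by (intro finprod_cong') auto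
  also have "\<dots> = s" by (rule finprod_singleton_swap) (use that finS Sc in auto)
  finally show ?thesis .
 qed
 have pr_zero: "pr (%_. 0) = \<one>" unfolding pr_def by (rule finprod_one_eqI) simp
 have pr_surj: "\<exists>e. g = pr e" if "g \<in> generate G S" for g using that
 proof (induction rule: generate.induct)
  case one
  then show ?case using pr_zero by metis
 next
  case (incl h)
  then show ?case using pr_delta by metis
 next
  case (inv h)
  let ?\<delta> = "%t. if t = h then 1 else 0 :: int"
  have "h \<otimes> pr (%t. - ?\<delta> t) = \<one>" using pr_add[of ?\<delta> "%t. - ?\<delta> t"] pr_delta[OF inv] pr_zero by simp
  then have "inv h = pr (%t. - ?\<delta> t)" using Sc[OF inv] pr_closed by (metis inv_equality inv_inv m_comm)
  then show ?case by (intro exI[of _ "%t. - ?\<delta> t"])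
 next
  case (eng a b)
  then show ?case using pr_add by metis
 qed
 have gs: "generator_system G S" unfolding generator_system_def
 proof (intro conjI allI impI)
  show "bij_betw (%h. finprod G h S) (\<Pi>\<^sub>E s\<in>S. generate G {s}) (carrier G)" unfolding bij_betw_def
  proof (intro conjI)
   have pow: "\<exists>e. \<forall>s\<in>S. h s = s [^] (e s :: int)" if h: "h \<in> (\<Pi>\<^sub>E s\<in>S. generate G {s})" for h
   proof -
    have "\<forall>s\<in>S. \<exists>k. h s = s [^] (k :: int)"
    proof
     fix s assume s: "s \<in> S"
     then have "h s \<in> generate G {s}" using h by (auto simp: PiE_def Pi_def)
     then show "\<exists>k. h s = s [^] (k :: int)" unfolding generate_pow[OF Sc[OF s]] by blast
    qed
    then show ?thesis by (rule bchoice)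
   qed
   have fp: "finprod G h S = pr e" if "\<forall>s\<in>S. h s = s [^] (e s :: int)" for h e
    unfolding pr_def using that Sc by (intro finprod_cong') auto
   show "inj_on (%h. finprod G h S) (\<Pi>\<^sub>E s\<in>S. generate G {s})"
   proof (rule inj_onI)
    fix h h' assume h: "h \<in> (\<Pi>\<^sub>E s\<in>S. generate G {s})" and h': "h' \<in> (\<Pi>\<^sub>E s\<in>S. generate G {s})"
     and eq: "finprod G h S = finprod G h' S"
    obtain e e' where e: "\<forall>s\<in>S. h s = s [^] (e s :: int)" and e': "\<forall>s\<in>S. h' s = s [^] (e' s :: int)"
     using pow[OF h] pow[OF h'] by blast
    have "pr e = pr e'" using eq fp[OF e] fp[OF e'] by simp
    then have "h s = h' s" if "s \<in> S" for s using pr_unique[of e e' s] e e' that by simp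
    then show "h = h'" using h h' by (intro PiE_ext) auto
   qed
   show "(%h. finprod G h S) ` (\<Pi>\<^sub>E s\<in>S. generate G {s}) = carrier G"
   proof (intro equalityI subsetI)
    fix g assume "g \<in> (%h. finprod G h S) ` (\<Pi>\<^sub>E s\<in>S. generate G {s})"
    then obtain h where h: "h \<in> (\<Pi>\<^sub>E s\<in>S. generate G {s})" "g = finprod G h S" by blast
    obtain e where e: "\<forall>s\<in>S. h s = s [^] (e s :: int)" using pow[OF h(1)] by blast
    show "g \<in> carrier G" unfolding h(2) fp[OF e] by (rule pr_closed)
   next
    fix g assume "g \<in> carrier G"
    then obtain e where e: "g = pr e" using pr_surj S(2) by blast
    let ?h = "\<lambda>s\<in>S. s [^] e s"
    have "?h \<in> (\<Pi>\<^sub>E s\<in>S. generate G {s})"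
     by (intro restrict_PiE_iff[THEN iffD2] ballI) (auto simp: generate_pow[OF Sc])
    moreover have "finprod G ?h S = g" using fp[of ?h e] e by simp
    ultimately show "g \<in> (%h. finprod G h S) ` (\<Pi>\<^sub>E s\<in>S. generate G {s})"
     by (metis (no_types, lifting) image_eqI)
   qed
  qed
 qed (use S in auto)
 have dual: "dual_generator G S s \<in> dual_group G \<and> ord s > 0 \<and> (\<forall>g\<in>carrier G. dual_generator G S s g ^ ord s = 1)"
  if s: "s \<in> S" for s
 proof -
  let ?n = "ord s"
  have n: "?n > 0" using ord_ge_1[OF fin Sc[OF s]] by simp
  define ex where "ex k = exp (2 * of_real pi * \<i> * of_int k / of_nat ?n)" for k :: int
  have ex_add: "ex (k + l) = ex k * ex l" for k l
   unfolding ex_def by (simp add: exp_add[symmetric] add_divide_distrib distrib_left)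
  have ex_norm: "ex k \<in> sphere 0 1" for k unfolding ex_def by (simp add: norm_exp_eq_Re)
  have ex_mult: "ex (int ?n * l) = 1" for l
  proof -
   have "2 * of_real pi * \<i> * of_int (int ?n * l) / of_nat ?n = 2 * of_real pi * \<i> * (of_int l :: complex)"
    using n by simp
   then show ?thesis unfolding ex_def using exp_integer_2pi[of "of_int l"] by (simp add: mult_ac)
  qed
  have ex_pow: "ex k ^ ?n = 1" for k
  proof -
   have "ex k ^ m = ex (int m * k)" for m
   proof (induction m)
    case 0
    then show ?case by (simp add: ex_def)
   next
    case (Suc m)
    then show ?case by (simp add: ex_add[symmetric] distrib_right add.commute)
   qed
   then show ?thesis using ex_mult by simp
  qed
  have ex_eq: "ex k = ex l" if "s [^] k = s [^] l" for k l
  proof -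
   have "int ?n dvd l - k" using that int_pow_eq[OF Sc[OF s]] by simp
   then obtain m where "l = k + int ?n * m" by (metis diff_eq_eq dvdE add.commute)
   then show ?thesis by (simp add: ex_add ex_mult)
  qed
  \<comment> \<open>An exponent vector is not unique, but its choice is harmless: \<open>ex\<close>
    takes equal values on exponents that give the same power of \<open>s\<close>.\<close>
  define E where "E g = (SOME e. g = pr e)" for g
  have E: "g = pr (E g)" if "g \<in> carrier G" for g
   unfolding E_def by (rule someI_ex[OF pr_surj]) (simp only: S(2) that)
  define \<omega> where "\<omega> = (\<lambda>g\<in>carrier G. ex (E g s))"
  have \<omega>: "\<omega> (pr e) = ex (e s)" for e
   using pr_closed[of e] E[OF pr_closed[of e]] pr_unique[OF _ s, of e "E (pr e)"]
   by (auto simp: \<omega>_def intro!: ex_eq)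
  have \<omega>_dual: "\<omega> \<in> dual_group G"
  proof -
   have "\<omega> (g \<otimes> h) = \<omega> g * \<omega> h" if gh: "g \<in> carrier G" "h \<in> carrier G" for g h
   proof -
    have "g \<otimes> h = pr (%t. E g t + E h t)" using pr_add E gh by metis
    then show ?thesis using \<omega>[of "%t. E g t + E h t"] \<omega>[of "E g"] \<omega>[of "E h"] E gh by (metis ex_add)
   qed
   then show ?thesis using ex_norm by (auto simp: dual_group_def hom_def circle_group_def \<omega>_def)
  qed
  have \<omega>_s: "\<omega> s = exp (2 * of_real pi * \<i> / of_nat ?n)"
   using \<omega>[of "%t. if t = s then 1 else 0"] pr_delta[OF s] by (simp add: ex_def)
  have \<omega>_t: "\<omega> t = 1" if "t \<in> S - {s}" for t
   using \<omega>[of "%u. if u = t then 1 else 0"] pr_delta[of t] that by (auto simp: ex_def)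
  \<comment> \<open>Characters that agree on a generating set coincide, so \<open>\<omega>\<close>
    is the only solution of the description by \<open>THE\<close>.\<close>
  have "dual_generator G S s = \<omega>" unfolding dual_generator_def
  proof (rule the_equality)
   show "\<omega> \<in> dual_group G \<and> \<omega> s = exp (2 * of_real pi * \<i> / of_nat ?n) \<and> (\<forall>t\<in>S - {s}. \<omega> t = 1)"
    using \<omega>_dual \<omega>_s \<omega>_t by blast
   fix \<eta> assume \<eta>: "\<eta> \<in> dual_group G \<and> \<eta> s = exp (2 * of_real pi * \<i> / of_nat ?n) \<and> (\<forall>t\<in>S - {s}. \<eta> t = 1)"
   have agree: "\<eta> t = \<omega> t" if "t \<in> S" for t using \<eta> \<omega>_s \<omega>_t that by (cases "t = s") auto
   have hom: "\<zeta> (g \<otimes> h) = \<zeta> g * \<zeta> h" "\<zeta> g \<noteq> 0" if "\<zeta> \<in> dual_group G" "g \<in> carrier G" "h \<in> carrier G" for \<zeta> g h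
   proof -
    show "\<zeta> (g \<otimes> h) = \<zeta> g * \<zeta> h" using that by (auto simp: dual_group_def hom_def circle_group_def)
    have "\<zeta> g \<in> sphere 0 1" using that by (auto simp: dual_group_def hom_def circle_group_def)
    then show "\<zeta> g \<noteq> 0" by auto
   qed
   have dual_one: "\<zeta> \<one> = 1" if "\<zeta> \<in> dual_group G" for \<zeta> using hom[OF that one_closed one_closed] by simp
   have "\<eta> g = \<omega> g" if "g \<in> generate G S" for g using that
   proof (induction rule: generate.induct)
    case one
    then show ?case using dual_one[of \<eta>] dual_one[of \<omega>] \<eta> \<omega>_dual by simp
   next
    case (incl h)
    then show ?case by (rule agree)
   next
    case (inv h)
    have "\<zeta> h * \<zeta> (inv h) = 1" if "\<zeta> \<in> dual_group G" for \<zeta>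
     using hom(1)[OF that Sc[OF inv] inv_closed[OF Sc[OF inv]]] dual_one[OF that] Sc[OF inv] by simp
    then have "\<omega> h * \<eta> (inv h) = \<omega> h * \<omega> (inv h)" using \<eta> \<omega>_dual agree[OF inv] by metis
    then show ?case using hom(2)[OF \<omega>_dual Sc[OF inv] one_closed] by simp
   next
    case (eng a b)
    have "a \<in> carrier G" "b \<in> carrier G" using eng S(2) by auto
    then show ?case using hom(1)[of \<eta> a b] hom(1)[of \<omega> a b] \<eta> \<omega>_dual eng.IH by simp
   qed
   then show "\<eta> = \<omega>"
    using \<eta> \<omega>_dual S(2) by (intro extensionalityI[of \<eta> "carrier G" \<omega>]) (auto simp: dual_group_def)
  qed
  moreover have "\<omega> g ^ ?n = 1" if "g \<in> carrier G" for g using that ex_pow by (simp add: \<omega>_def)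
  ultimately show ?thesis using \<omega>_dual n by simp
 qed
 show ?thesis using gs dual by blast
qed

end

section \<open>Smooth real functions\<close>

abbreviation real_mfd :: "(real, real) mfd" where "real_mfd \<equiv> vmfd real_line"

lemma charted_real: "charted real_mfd" by (rule charted_vmfd[OF lcs_real_line])

text \<open>On the line the directional derivative of order \<open>k\<close> is the ordinary one
  times the product of the directions. The sequence \<open>H\<close> lists the ordinary
  derivatives.\<close>

lemma smooth_on_real_line:
 fixes H :: "nat => real => real"
 assumes U: "open U" and H: "!!k x. x \<in> U ==> (H k has_real_derivative H (Suc k) x) (at x)"
 shows "smooth_on real_line real_line U (H 0)"
proof -
 interpret lcs2 real_line real_line by (intro lcs2.intro lcs_real_line)
 have diff: "x \<ominus>\<^bsub>real_line\<^esub> y = x - y" for x y :: real using dom.diff_eq[of x y] by simp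
 show ?thesis
 proof (rule smooth_onI_jet(1)[where g = "%k x v. H k x * (\<Prod>i<k. v i)"])
  show "openin (vtop real_line) U" using U by simp
  fix k :: nat
  show "limitin (vtop real_line) (%t. inverse t \<odot>\<^bsub>real_line\<^esub> (H k (x \<oplus>\<^bsub>real_line\<^esub> (t \<odot>\<^bsub>real_line\<^esub> v k)) * (\<Prod>i<k. v i)
    \<ominus>\<^bsub>real_line\<^esub> H k x * (\<Prod>i<k. v i))) (H (Suc k) x * (\<Prod>i<Suc k. v i)) (at 0)"
   if x: "x \<in> U" for x and v :: "nat => real"
  proof -
   have "((%t. H k (x + t * v k)) has_real_derivative H (Suc k) x * v k) (at 0)"
    using H[OF x] by (intro DERIV_chain2[where g = "%t. x + t * v k"]) (auto intro!: derivative_eq_intros)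
   then have "((%t. (H k (x + t * v k) - H k x) / t) \<longlongrightarrow> H (Suc k) x * v k) (at 0)"
    by (simp add: has_field_derivative_iff)
   then have "((%t. (H k (x + t * v k) - H k x) / t * (\<Prod>i<k. v i)) \<longlongrightarrow> H (Suc k) x * v k * (\<Prod>i<k. v i)) (at 0)"
    by (rule tendsto_mult_right)
   then show ?thesis by (simp add: diff field_simps)
  qed
  have c1: "continuous_map (subtopology euclidean U) euclidean (H k)"
   using H by (auto intro!: continuous_at_imp_continuous_on DERIV_isCont)
  have c2: "continuous_map (jet_domain real_line U k) (subtopology euclidean U) fst"
   unfolding jet_domain_def by (simp add: continuous_map_fst)
  have "continuous_map (jet_domain real_line U k) euclidean (%p. H k (fst p))"
   using continuous_map_compose[OF c2 c1] by (simp add: o_def)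
  moreover have "continuous_map (jet_domain real_line U k) euclidean (%p. \<Prod>i<k. snd p i)"
   using continuous_map_jet_dir[of _ k U] by (intro continuous_map_prod) auto
  ultimately show "continuous_map (jet_domain real_line U k) (vtop real_line) (%(x, v). H k x * (\<Prod>i<k. v i))"
   by (simp add: case_prod_unfold continuous_map_real_mult)
 qed simp
qed

lemma smooth_on_inverse: "smooth_on real_line real_line {0<..} inverse"
proof -
 define H :: "nat => real => real" where "H k x = (- 1) ^ k * fact k * inverse x ^ Suc k" for k x
 have "smooth_on real_line real_line {0<..} (H 0)"
 proof (rule smooth_on_real_line)
  fix k and x :: real assume x: "x \<in> {0<..}"
  have "(H k has_real_derivative (- 1) ^ k * fact k * (of_nat (Suc k) * (inverse x ^ k * (- (inverse x * 1 * inverse x))))) (at x)"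
   unfolding H_def using x by (intro derivative_eq_intros refl) (auto simp: algebra_simps)
  then show "(H k has_real_derivative H (Suc k) x) (at x)" by (simp add: H_def algebra_simps)
 qed simp
 moreover have "H 0 = inverse" by (auto simp: H_def)
 ultimately show ?thesis by simp
qed

lemma tendsto_poly_exp_neg: "((%u. poly q u * exp (- u)) \<longlongrightarrow> (0::real)) at_top"
proof -
 have "((%u. \<Sum>i\<le>Polynomial.degree q. Polynomial.coeff q i * (u ^ i / exp u)) \<longlongrightarrow> (\<Sum>i\<le>Polynomial.degree q. Polynomial.coeff q i * 0)) at_top"
  by (intro tendsto_sum tendsto_mult tendsto_const tendsto_power_div_exp_0)
 then show ?thesis by (simp add: poly_altdef sum_distrib_right sum_divide_distrib exp_minus field_simps)
qed

text \<open>\<open>flat 1\<close> is the classical flat function. The polynomial in the inverse of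
  \<open>t\<close> makes the class closed under differentiation.\<close>

definition flat :: "real poly => real => real"
 where "flat p t = (if t > 0 then poly p (inverse t) * exp (- inverse t) else 0)"

text \<open>For positive \<open>t\<close> both the inner derivative of the polynomial and that of
  the exponential contribute the square of the inverse of \<open>t\<close>, which is the factor
  \<open>[:0, 0, 1:]\<close>. At zero the exponential decay beats every polynomial.\<close>

lemma flat_deriv: "(flat p has_real_derivative flat ([:0, 0, 1:] * (p - pderiv p)) t) (at t)"
proof (cases t "0 :: real" rule: linorder_cases)
 case less
 have "((%_. 0) has_real_derivative 0) (at t)" by simp
 then have "(flat p has_real_derivative 0) (at t)"
  by (rule has_field_derivative_transform_within_open[where S = "{..<0}"]) (use less in \<open>auto simp: flat_def\<close>)
 then show ?thesis using less by (simp add: flat_def)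
next
 case greater
 have "((%t. poly p (inverse t) * exp (- inverse t)) has_real_derivative
   poly (pderiv p) (inverse t) * - (inverse t * 1 * inverse t) * exp (- inverse t) +
   exp (- inverse t) * (inverse t * 1 * inverse t) * poly p (inverse t)) (at t)"
  using greater by (intro derivative_eq_intros poly_DERIV[THEN DERIV_chain2] refl) auto
 then have "(flat p has_real_derivative
   poly (pderiv p) (inverse t) * - (inverse t * 1 * inverse t) * exp (- inverse t) +
   exp (- inverse t) * (inverse t * 1 * inverse t) * poly p (inverse t)) (at t)"
  by (rule has_field_derivative_transform_within_open[where S = "{0<..}"]) (use greater in \<open>auto simp: flat_def\<close>)
 then show ?thesis using greater by (simp add: flat_def algebra_simps)
next
 case equal
 \<comment> \<open>Division by \<open>h\<close> multiplies the polynomial by the variable, hence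
   \<open>pCons 0 p\<close>.\<close>
 have "((%h. flat p h / h) \<longlongrightarrow> 0) (at_right 0)"
 proof (rule Lim_transform_eventually)
  show "((%h. poly (pCons 0 p) (inverse h) * exp (- inverse h)) \<longlongrightarrow> 0) (at_right 0)"
   by (rule filterlim_compose[OF tendsto_poly_exp_neg filterlim_inverse_at_top_right])
  show "\<forall>\<^sub>F h in at_right 0. poly (pCons 0 p) (inverse h) * exp (- inverse h) = flat p h / h"
   by (rule eventually_mono[OF eventually_at_right_less[of 0]]) (simp add: flat_def field_simps)
 qed
 moreover have "((%h. flat p h / h) \<longlongrightarrow> 0) (at_left 0)"
 proof (rule Lim_transform_eventually[OF tendsto_const])
  show "\<forall>\<^sub>F h in at_left 0. 0 = flat p h / h"
   by (rule eventually_mono[OF eventually_at_left_real[of "-1" 0]]) (simp_all add: flat_def)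
 qed
 ultimately have "((%h. flat p h / h) \<longlongrightarrow> 0) (at 0)" by (simp add: filterlim_at_split)
 then show ?thesis by (simp add: equal has_field_derivative_iff flat_def)
qed

lemma smooth_map_realI:
 assumes "smooth_on real_line real_line UNIV f"
 shows "smooth_map real_mfd real_mfd f"
proof -
 interpret lcs2 real_line real_line by (intro lcs2.intro lcs_real_line)
 have "smooth_on real_line real_line UNIV (f \<circ> inv_into UNIV (%x. x))"
  by (rule smooth_on_cong[OF assms]) (auto simp: inv_into_f_f[of "%x. x"])
 moreover have "continuous_map euclidean euclidean f" using smooth_on_continuous[OF assms] by simp
 ultimately show ?thesis unfolding smooth_map_vmfd_iff[OF charted_real lcs_real_line] by simp
qed

lemma smooth_flat: "smooth_map real_mfd real_mfd (flat p)"
proof (rule smooth_map_realI)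
 have "smooth_on real_line real_line UNIV ((%k. flat (((%q. [:0, 0, 1:] * (q - pderiv q)) ^^ k) p)) 0)"
  by (rule smooth_on_real_line) (simp_all add: flat_deriv del: mult_pCons_left)
 then show "smooth_on real_line real_line UNIV (flat p)" by simp
qed

context
 fixes X :: "('m, 'e) mfd"
 assumes X: "charted X"
begin

lemma smooth_real_const: "smooth_map X real_mfd (%_. c)" by (rule smooth_map_const[OF X charted_real]) simp

lemma smooth_real_add:
 assumes "smooth_map X real_mfd f" "smooth_map X real_mfd g"
 shows "smooth_map X real_mfd (%x. f x + g x)"
proof -
 have o: "openin (vtop (prod_space real_line real_line)) (carrier (prod_space real_line real_line))" by simp
 have "smooth_map X real_mfd (%x. (%(x, y). x \<oplus>\<^bsub>real_line\<^esub> y) (f x, g x))"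
  by (rule smooth_map_vmfd_compose[OF X lcs_prod_space[OF lcs_real_line lcs_real_line] lcs_real_line
     smooth_map_vmfd_pair[OF X lcs_real_line lcs_real_line assms]
     smooth_on_linear[OF lcs_prod_space[OF lcs_real_line lcs_real_line] lcs_real_line
      cont_linear_add[OF lcs_real_line lcs_real_line] o]]) simp
 then show ?thesis by simp
qed

lemma smooth_real_mult:
 assumes "smooth_map X real_mfd f" "smooth_map X real_mfd g"
 shows "smooth_map X real_mfd (%x. f x * g x)"
proof -
 have "continuous_map (prod_topology euclidean euclidean) euclidean (%(x, y). x * y :: real)"
  unfolding case_prod_unfold by (intro continuous_map_real_mult continuous_map_fst continuous_map_snd)
 then have "cont_bilinear real_line real_line real_line (*)" by (simp add: cont_bilinear_def algebra_simps)
 from smooth_on_bilinear[OF lcs_real_line lcs_real_line lcs_real_line this]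
 have "smooth_map X real_mfd (%x. (%(x, y). x * y) (f x, g x))"
  by (rule smooth_map_vmfd_compose[OF X lcs_prod_space[OF lcs_real_line lcs_real_line] lcs_real_line
     smooth_map_vmfd_pair[OF X lcs_real_line lcs_real_line assms]]) simp
 then show ?thesis by simp
qed

lemma smooth_real_diff:
 assumes "smooth_map X real_mfd f" "smooth_map X real_mfd g"
 shows "smooth_map X real_mfd (%x. f x - g x)"
 using smooth_real_add[OF assms(1) smooth_real_mult[OF smooth_real_const[of "- 1"] assms(2)]] by simp

lemma smooth_real_sum:
 "finite I ==> (!!i. i \<in> I ==> smooth_map X real_mfd (f i)) ==> smooth_map X real_mfd (%x. \<Sum>i\<in>I. f i x)"
 by (induction I rule: finite_induct) (auto intro!: smooth_real_const smooth_real_add)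

lemma smooth_real_prod:
 "finite I ==> (!!i. i \<in> I ==> smooth_map X real_mfd (f i)) ==> smooth_map X real_mfd (%x. \<Prod>i\<in>I. f i x)"
 by (induction I rule: finite_induct) (auto intro!: smooth_real_const smooth_real_mult)

lemma smooth_real_inverse:
 assumes "smooth_map X real_mfd f" "!!x. x \<in> points X ==> f x > 0"
 shows "smooth_map X real_mfd (%x. inverse (f x))"
 by (rule smooth_map_vmfd_compose[OF X lcs_real_line lcs_real_line assms(1) smooth_on_inverse]) (use assms(2) in simp)

end

section \<open>Smooth steps and bump functions on manifolds\<close>

definition smooth_step :: "real => real"
 where "smooth_step t = flat 1 t * inverse (flat 1 t + flat 1 (1 - t))"

lemma smooth_step_smooth: "smooth_map real_mfd real_mfd smooth_step"
proof -
 have "smooth_map real_mfd real_mfd (%t. t)" by (rule smooth_map_realI[OF smooth_on_id[OF lcs_real_line]]) simp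
 then have 1: "smooth_map real_mfd real_mfd (%t. flat 1 (1 - t))"
  by (intro smooth_map_compose[OF charted_real charted_real charted_real _ smooth_flat]
    smooth_real_diff smooth_real_const charted_real)
 \<comment> \<open>At least one of \<open>t\<close> and \<open>1 - t\<close> is positive.\<close>
 have "flat 1 t + flat 1 (1 - t) > 0" for t by (cases "t > 0") (auto simp: flat_def intro: add_pos_pos)
 then show ?thesis unfolding smooth_step_def[abs_def]
  by (intro smooth_real_mult smooth_real_inverse smooth_real_add charted_real smooth_flat 1)
qed

lemma smooth_step_0: "t \<le> 0 ==> smooth_step t = 0"
 and smooth_step_1: "t \<ge> 1 ==> smooth_step t = 1" by (simp_all add: smooth_step_def flat_def)

text \<open>Compatibility of charts makes a chart smooth as a map into the model space; its
  coordinates are the raw material of the bump functions.\<close>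

lemma smooth_chart:
 assumes X: "smooth_manifold X" and V: "(V, \<psi>) \<in> atlas X"
 shows "smooth_map (open_submfd X V) (vmfd (model X)) \<psi>"
proof -
 note cX = smooth_manifold_charted[OF X]
 note oV = charted_open[OF cX V]
 interpret lcs2 "model X" "model X" by (intro lcs2.intro charted_lcs[OF cX])
 have hom: "homeomorphic_map (subtopology (mtop X) V) (subtopology (vtop (model X)) (\<psi> ` V)) \<psi>"
  using X V unfolding smooth_manifold_def by fast
 show ?thesis unfolding smooth_map_vmfd_iff[OF charted_open_submfd[OF cX oV] charted_lcs[OF cX]]
 proof (intro conjI ballI)
  show "continuous_map (mtop (open_submfd X V)) (vtop (model X)) \<psi>"
   using homeomorphic_imp_continuous_map[OF hom] by (simp add: continuous_map_in_subtopology)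
  fix c assume "c \<in> atlas (open_submfd X V)"
  then obtain U \<phi> where c: "c = (U \<inter> V, \<phi>)" and U: "(U, \<phi>) \<in> atlas X"
   by (cases c) (auto simp: atlas_open_submfd)
  have "smooth_on (model X) (model X) (\<phi> ` (U \<inter> V)) (\<psi> \<circ> inv_into U \<phi>)"
   using X U V unfolding smooth_manifold_def by fast
  then have "smooth_on (model X) (model X) (\<phi> ` (U \<inter> V)) (\<psi> \<circ> inv_into (U \<inter> V) \<phi>)"
  proof (rule smooth_on_cong)
   fix x assume "x \<in> \<phi> ` (U \<inter> V)"
   then obtain y where y: "y \<in> U \<inter> V" "x = \<phi> y" by blast
   have "inv_into (U \<inter> V) \<phi> (\<phi> y) = y"
    by (rule inv_into_f_f[OF inj_on_subset[OF charted_inj[OF cX U]] y(1)]) simp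
   moreover have "inv_into U \<phi> (\<phi> y) = y" using y(1) by (intro charted_inv[OF cX U]) simp
   ultimately show "(\<psi> \<circ> inv_into U \<phi>) x = (\<psi> \<circ> inv_into (U \<inter> V) \<phi>) x" by (simp only: o_apply y(2))
  qed
  then show "case c of (U, \<phi>) => smooth_on (model (open_submfd X V)) (model X) (\<phi> ` U) (\<psi> \<circ> inv_into U \<phi>)"
   by (simp add: c)
 qed
qed

text \<open>A smooth step of the squared distance in a chart, extended by zero. The extension is
  smooth because \<open>K\<close> is compact, hence closed in the Hausdorff manifold, so that the
  chart domain and the complement of \<open>K\<close> are an open cover.\<close>

lemma bump_function_exists:
 assumes M: "fin_dim_manifold M" and W: "openin (mtop M) W" and x: "x \<in> W"
 shows "\<exists>b K N. smooth_map M real_mfd b \<and> closedin (mtop M) K \<and> K \<subseteq> W \<and> (\<forall>y\<in>points M - K. b y = 0) \<and>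
  openin (mtop M) N \<and> x \<in> N \<and> (\<forall>y\<in>N. b y = 1)"
proof -
 have sm: "smooth_manifold M" using M by (simp add: fin_dim_manifold_def)
 obtain n where n: "model M = euclid_space n" using M by (auto simp: fin_dim_manifold_def)
 note cM = smooth_manifold_charted[OF sm]
 have haus: "Hausdorff_space (mtop M)" using sm by (simp add: smooth_manifold_def)
 have xM: "x \<in> points M" using openin_subset[OF W] x by blast
 obtain V \<psi> where V: "(V, \<psi>) \<in> atlas M" "x \<in> V" using charted_cover[OF cM xM] by (elim exE conjE)
 note oV = charted_open[OF cM V(1)]
 let ?E = "Euclidean_space n"
 have tE: "vtop (model M) = ?E" by (simp add: n euclid_space_simps)
 define a where "a = \<psi> x"
 define D where "D = \<psi> ` (V \<inter> W)"
 have oD: "openin ?E D" unfolding D_def tE[symmetric] by (intro charted_image[OF cM V(1)] openin_Int oV W) simp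
 have aD: "a \<in> D" using V(2) x by (auto simp: a_def D_def)
 then have aE: "a \<in> topspace ?E" using openin_subset[OF oD] by blast
 obtain O' C where C: "openin ?E O'" "compactin ?E C" "a \<in> O'" "O' \<subseteq> C"
  using locally_compact_Euclidean_space[of n] aE unfolding locally_compact_space_def by blast
 obtain r where r: "r > 0" "!!y. y \<in> topspace ?E ==> (\<forall>i<n. \<bar>y i - a i\<bar> \<le> r) ==> y \<in> D \<inter> O'"
  using Euclidean_box_nbhd[OF openin_Int[OF oD C(1)], of a] aD C(3) by blast
 define Q :: "(nat => real) => real" where "Q y = (\<Sum>i<n. (y i - a i) * (y i - a i))" for y
 have Q_cont: "continuous_map ?E euclideanreal Q" unfolding Q_def
  by (intro continuous_map_sum continuous_map_real_mult continuous_map_diff continuous_map_Euclidean_coord) auto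
 have Q_box: "y \<in> D \<inter> O'" if "y \<in> topspace ?E" "Q y \<le> r\<^sup>2" for y
 proof (rule r(2)[OF that(1)], intro allI impI)
  fix i assume "i < n"
  then have "(y i - a i) * (y i - a i) \<le> Q y" unfolding Q_def by (intro member_le_sum) auto
  then have "(y i - a i)\<^sup>2 \<le> r\<^sup>2" using that(2) by (simp add: power2_eq_square)
  then show "\<bar>y i - a i\<bar> \<le> r" using r(1) abs_le_square_iff[of "y i - a i" r] by simp
 qed
 \<comment> \<open>This sublevel set is closed and lies in the compact set \<open>C\<close>, hence
   it is compact; it also lies inside the coordinates of \<open>V \<inter> W\<close>.\<close>
 define C' where "C' = {y \<in> topspace ?E. Q y \<in> {..r\<^sup>2}}"
 have C'_closed: "closedin ?E C'" unfolding C'_def by (rule closedin_continuous_map_preimage[OF Q_cont]) simp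
 have C'_sub: "C' \<subseteq> D" "C' \<subseteq> C" using Q_box C(4) by (auto simp: C'_def)
 have C'_compact: "compactin ?E C'" by (rule closed_compactin[OF C(2) C'_sub(2) C'_closed])
 define K where "K = inv_into V \<psi> ` C'"
 have hom: "homeomorphic_map (subtopology (mtop M) V) (subtopology ?E (\<psi> ` V)) \<psi>"
  using sm V(1) unfolding smooth_manifold_def tE[symmetric] by fast
 have inv: "inv_into V \<psi> (\<psi> y) = y" if "y \<in> V" for y by (rule charted_inv[OF cM V(1) that])
 have K_iff: "y \<in> K \<longleftrightarrow> y \<in> V \<and> \<psi> y \<in> C'" for y
 proof
  assume "y \<in> K"
  then obtain c where c: "c \<in> C'" "y = inv_into V \<psi> c" by (auto simp: K_def)
  then obtain u where "u \<in> V" "c = \<psi> u" using C'_sub(1) by (auto simp: D_def)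
  then show "y \<in> V \<and> \<psi> y \<in> C'" using c inv by simp
 next
  assume "y \<in> V \<and> \<psi> y \<in> C'"
  then show "y \<in> K" unfolding K_def using inv by (intro image_eqI[of _ _ "\<psi> y"]) auto
 qed
 have VM: "V \<subseteq> points M" by (rule charted_subset[OF cM V(1)])
 have "continuous_map (subtopology ?E (\<psi> ` V)) (subtopology (mtop M) V) (inv_into V \<psi>)"
  unfolding continuous_map_def
 proof (intro conjI allI impI)
  show "inv_into V \<psi> \<in> topspace (subtopology ?E (\<psi> ` V)) \<rightarrow> topspace (subtopology (mtop M) V)"
   using inv VM by auto
  fix G assume G: "openin (subtopology (mtop M) V) G"
  then have G': "openin (mtop M) G" "G \<subseteq> V" using openin_open_subtopology[OF oV] by blast+
  have "{y \<in> topspace (subtopology ?E (\<psi> ` V)). inv_into V \<psi> y \<in> G} = \<psi> ` G"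
   using inv G'(2) openin_subset[OF charted_image[OF cM V(1) G']] by (auto simp: tE)
  moreover have "openin (subtopology ?E (\<psi> ` V)) (\<psi> ` G)"
   using charted_image[OF cM V(1) G'] G'(2) by (auto simp: tE intro!: openin_subset_topspace_eq[THEN iffD2] simp: openin_subtopology intro: exI[of _ "\<psi> ` G"])
  ultimately show "openin (subtopology ?E (\<psi> ` V)) {y \<in> topspace (subtopology ?E (\<psi> ` V)). inv_into V \<psi> y \<in> G}"
   by simp
 qed
 moreover have "compactin (subtopology ?E (\<psi> ` V)) C'"
  using C'_compact C'_sub(1) by (auto simp: compactin_subtopology D_def)
 ultimately have "compactin (subtopology (mtop M) V) K" unfolding K_def by (rule image_compactin[rotated])
 then have "compactin (mtop M) K" by (simp add: compactin_subtopology)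
 then have K_closed: "closedin (mtop M) K" by (rule compactin_imp_closedin[OF haus])
 have K_sub: "K \<subseteq> W"
 proof
  fix y assume "y \<in> K"
  then have "y \<in> V" "\<psi> y \<in> D" using K_iff C'_sub(1) by auto
  then show "y \<in> W" unfolding D_def using charted_inj[OF cM V(1)] by (auto dest: inj_onD)
 qed
 \<comment> \<open>The argument of the step is at least 1 for
   \<open>Q (\<psi> y) \<le> r\<^sup>2 / 2\<close> and at most 0 for
   \<open>Q (\<psi> y) \<ge> r\<^sup>2\<close>.\<close>
 define b where "b y = (if y \<in> V then smooth_step (2 - 2 / r\<^sup>2 * Q (\<psi> y)) else 0)" for y
 have zero: "b y = 0" if "y \<in> points M - K" for y
 proof (cases "y \<in> V")
  case True
  have "\<psi> y \<in> topspace ?E"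
   unfolding tE[symmetric] lcs.topspace_eq[OF charted_lcs[OF cM]] by (rule chart_closed[OF cM V(1) True])
  then have "Q (\<psi> y) > r\<^sup>2" using that True K_iff[of y] by (auto simp: C'_def)
  then have "2 - 2 / r\<^sup>2 * Q (\<psi> y) \<le> 0" using r(1) by (simp add: field_simps)
  then show ?thesis using True by (simp add: b_def smooth_step_0)
 qed (simp add: b_def)
 have smV: "smooth_map (open_submfd M V) real_mfd b"
 proof -
  note cV = charted_open_submfd[OF cM oV]
  have lin: "cont_linear (model M) real_line (%y. y i)" for i
   using continuous_map_Euclidean_coord[of n i] by (simp add: cont_linear_def n euclid_space_simps)
  have oE: "openin (vtop (model M)) (carrier (model M))"
   using lcs.topspace_eq[OF charted_lcs[OF cM]] openin_topspace[of "vtop (model M)"] by simp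
  have coord: "smooth_map (open_submfd M V) real_mfd (%y. \<psi> y i)" for i
   by (rule smooth_map_vmfd_compose[OF cV charted_lcs[OF cM] lcs_real_line smooth_chart[OF sm V(1)]
      smooth_on_linear[OF charted_lcs[OF cM] lcs_real_line lin oE]]) (use chart_closed[OF cM V(1)] in simp)
  have "smooth_map (open_submfd M V) real_mfd (%y. 2 - 2 / r\<^sup>2 * Q (\<psi> y))" unfolding Q_def
   by (intro smooth_real_diff smooth_real_mult smooth_real_sum smooth_real_const cV coord) auto
  then have "smooth_map (open_submfd M V) real_mfd (%y. smooth_step (2 - 2 / r\<^sup>2 * Q (\<psi> y)))"
   by (rule smooth_map_compose[OF cV charted_real charted_real _ smooth_step_smooth])
  then show ?thesis by (rule smooth_map_cong[OF cV charted_real]) (simp add: b_def)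
 qed
 have smK: "smooth_map (open_submfd M (points M - K)) real_mfd b"
 proof -
  have cK: "charted (open_submfd M (points M - K))"
   using K_closed by (intro charted_open_submfd[OF cM]) (simp add: closedin_def)
  show ?thesis by (rule smooth_map_cong[OF cK charted_real smooth_real_const[OF cK, of 0]]) (use zero in auto)
 qed
 have "smooth_map M real_mfd b"
 proof (rule smooth_map_glue[OF cM charted_real])
  fix y assume y: "y \<in> points M"
  show "\<exists>O'. openin (mtop M) O' \<and> y \<in> O' \<and> smooth_map (open_submfd M O') real_mfd b"
  proof (cases "y \<in> V")
   case True
   then show ?thesis using oV smV by (intro exI[of _ V] conjI)
  next
   case False
   then have "y \<in> points M - K" using y K_iff by blast
   then show ?thesis using K_closed smK by (intro exI[of _ "points M - K"] conjI) (simp_all add: closedin_def)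
  qed
 qed
 moreover define N where "N = {y \<in> topspace (subtopology (mtop M) V). \<psi> y \<in> {y \<in> topspace ?E. Q y \<in> {..<r\<^sup>2 / 2}}}"
 have oQ: "openin ?E {y \<in> topspace ?E. Q y \<in> {..<r\<^sup>2 / 2}}"
  by (rule openin_continuous_map_preimage[OF Q_cont]) simp
 have "openin (subtopology (mtop M) V) N" unfolding N_def by (rule openin_continuous_map_preimage[OF _ oQ])
    (use homeomorphic_imp_continuous_map[OF hom] in \<open>simp add: continuous_map_in_subtopology\<close>)
 then have "openin (mtop M) N" using openin_open_subtopology[OF oV] by blast
 moreover have "x \<in> N" using V(2) xM aE r(1) by (auto simp: N_def a_def[symmetric] Q_def)
 moreover have "b y = 1" if "y \<in> N" for y
 proof -
  have "y \<in> V" "Q (\<psi> y) < r\<^sup>2 / 2" using that by (auto simp: N_def)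
  then show ?thesis using r(1) by (simp add: b_def) (rule smooth_step_1, simp add: field_simps)
 qed
 ultimately show ?thesis using zero K_closed K_sub by (intro exI[of _ b] exI[of _ K] exI[of _ N] conjI ballI)
qed

section \<open>Characters of function algebras\<close>

text \<open>Only finite sums and products can be evaluated under \<open>\<chi>'\<close>. If it
  killed all bumps, let \<open>c\<close> be its value on an unbounded function \<open>g\<close>:
  away from the zeros of the first few bumps a finite sum of their squares is positive, and on their
  common zeros \<open>g\<close> is too large to equal \<open>c\<close>. Both alternatives are
  combined in one positive function of the kernel.\<close>

lemma character_detects_bump:
 fixes b :: "nat => 'm => real" and \<chi>' :: "('m => real) => complex"
 assumes M: "charted M"
  and b: "!!i. smooth_map M real_mfd (b i)" and N: "!!i. openin (mtop M) (N i)"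
  and b1: "!!i x. x \<in> N i ==> b i x = 1" and cover: "!!x. x \<in> points M ==> \<exists>i. x \<in> N i"
  and add: "!!f g. smooth_map M real_mfd f ==> smooth_map M real_mfd g ==> \<chi>' (%x. f x + g x) = \<chi>' f + \<chi>' g"
  and mult: "!!f g. smooth_map M real_mfd f ==> smooth_map M real_mfd g ==> \<chi>' (%x. f x * g x) = \<chi>' f * \<chi>' g"
  and const: "!!c. \<chi>' (%_. c) = of_real c"
  and cong: "!!f g. (!!x. x \<in> points M ==> f x = g x) ==> \<chi>' f = \<chi>' g"
 shows "\<exists>i. \<chi>' (b i) \<noteq> 0"
proof (rule ccontr)
 assume "\<nexists>i. \<chi>' (b i) \<noteq> 0"
 then have b0: "\<chi>' (b i) = 0" for i by blast
 txt \<open>The function \<open>g\<close> is at least \<open>n\<close> wherever the first \<open>n\<close> bumps vanish, so the function \<open>G\<close> below is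
  positive, although \<open>\<chi>'\<close> kills it.\<close>
 define e where "e j x = (\<Prod>i<j. (1 - b i x) * (1 - b i x))" for j x
 define g where "g x = (\<Sum>j. e j x)" for x
 have e_nonneg: "e j x \<ge> 0" for j x unfolding e_def by (intro prod_nonneg) simp
 have e_zero: "e j x = 0" if "x \<in> N i" "j > i" for i j x
  unfolding e_def using that b1[OF that(1)] by (intro prod_zero) auto
 have g_fin: "g x = (\<Sum>j\<le>i. e j x)" if "x \<in> N i" for i x
  unfolding g_def using e_zero[OF that] by (intro suminf_finite) auto
 have smooth_e: "smooth_map M real_mfd (e j)" for j
  unfolding e_def by (intro smooth_real_prod smooth_real_mult smooth_real_diff smooth_real_const M b) simp
 have smooth_g: "smooth_map M real_mfd g"
 proof (rule smooth_map_glue[OF M charted_real])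
  fix x assume "x \<in> points M"
  from cover[OF this] obtain i where i: "x \<in> N i" by (elim exE)
  have "smooth_map M real_mfd (%x. \<Sum>j\<le>i. e j x)" by (intro smooth_real_sum M smooth_e) simp
  then have "smooth_map (open_submfd M (N i)) real_mfd (%x. \<Sum>j\<le>i. e j x)"
   by (rule smooth_map_restrict[OF M charted_real _ N])
  then have "smooth_map (open_submfd M (N i)) real_mfd g"
   by (rule smooth_map_cong[OF charted_open_submfd[OF M N] charted_real]) (use g_fin[of _ i] in simp)
  then show "\<exists>O'. openin (mtop M) O' \<and> x \<in> O' \<and> smooth_map (open_submfd M O') real_mfd g"
   using i N by (intro exI[of _ "N i"] conjI)
 qed
 define c where "c = \<chi>' g"
 obtain n :: nat where n: "cmod c < n" using reals_Archimedean2 by blast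
 have g_large: "g x \<ge> n" if x: "x \<in> points M" and 0: "!!i. i < n ==> b i x = 0" for x
 proof -
  from cover[OF x] obtain i where i: "x \<in> N i" by (elim exE)
  have "real n = (\<Sum>j<n. e j x)" using 0 by (simp add: e_def)
  also have "\<dots> \<le> g x" unfolding g_def
  proof (rule sum_le_suminf)
   show "summable (%j. e j x)" by (rule summable_finite[of "{..i}"]) (use e_zero[OF i] in auto)
  qed (use e_nonneg in auto)
  finally show ?thesis .
 qed
 \<comment> \<open>The first two terms are the squared distance of \<open>g\<close> from the complex
   number \<open>c\<close>. Under \<open>\<chi>'\<close> they cancel, because
   \<open>g - Re c\<close> goes to \<open>\<i> * Im c\<close>.\<close>
 define G where "G x = (g x - Re c) * (g x - Re c) + (Im c * Im c + (\<Sum>i<n. b i x * b i x))" for x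
 have smooth_sq: "smooth_map M real_mfd (%x. \<Sum>i<k. b i x * b i x)" for k
  by (intro smooth_real_sum smooth_real_mult M b) simp
 have smooth_d: "smooth_map M real_mfd (%x. g x - Re c)"
  by (intro smooth_real_diff smooth_real_const M smooth_g)
 have smooth_G: "smooth_map M real_mfd G"
  unfolding G_def by (intro smooth_real_add smooth_real_mult smooth_real_const M smooth_sq smooth_d)
 have "\<chi>' (%x. \<Sum>i<k. b i x * b i x) = 0" for k
  by (induction k) (use const[of 0] add[OF smooth_sq smooth_real_mult[OF M b b]] mult[OF b b] b0 in simp_all)
 moreover have "\<chi>' (%x. g x - Re c) = \<i> * Im c"
  using add[OF smooth_g smooth_real_const[OF M, of "- Re c"]] const[of "- Re c"]
  by (simp add: c_def[symmetric] complex_eq_iff)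
 ultimately have "\<chi>' G = 0" unfolding G_def[abs_def]
  by (subst add[OF smooth_real_mult[OF M smooth_d smooth_d] smooth_real_add[OF M smooth_real_const[OF M] smooth_sq]],
    subst mult[OF smooth_d smooth_d], subst add[OF smooth_real_const[OF M] smooth_sq], subst const)
    (simp add: complex_eq_iff)
 moreover have G_pos: "G x > 0" if x: "x \<in> points M" for x
 proof (cases "\<exists>i<n. b i x \<noteq> 0")
  case True
  then obtain i where "i < n" "b i x \<noteq> 0" by blast
  have "0 < b i x * b i x" using \<open>b i x \<noteq> 0\<close> not_real_square_gt_zero by blast
  moreover have "b i x * b i x \<le> (\<Sum>i<n. b i x * b i x)" using \<open>i < n\<close> by (intro member_le_sum) auto
  ultimately show ?thesis unfolding G_def by (smt (verit) zero_le_square)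
 next
  case False
  then have "g x > Re c" using g_large[OF x] n complex_Re_le_cmod[of c] by fastforce
  then have "(g x - Re c) * (g x - Re c) > 0" by simp
  moreover have "(\<Sum>i<n. b i x * b i x) \<ge> 0" by (intro sum_nonneg) simp
  ultimately show ?thesis unfolding G_def by (smt (verit) zero_le_square)
 qed
 moreover have "\<chi>' (%x. G x * inverse (G x)) = \<chi>' G * \<chi>' (%x. inverse (G x))"
  by (rule mult[OF smooth_G smooth_real_inverse[OF M smooth_G G_pos]])
 moreover have "\<chi>' (%x. G x * inverse (G x)) = \<chi>' (%_. 1)"
  using G_pos by (intro cong) (simp add: less_imp_neq[symmetric])
 ultimately show False using const[of 1] by simp
qed

section \<open>Sections of scalar multiples of the unit\<close>

text \<open>The local triviality clause of \<open>principal_bundle\<close> as a predicate, so that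
  trivializations can be handed around.\<close>

definition principal_triv ::
  "('p, nat => real) mfd => ('m, nat => real) mfd => ('l, 'r) monoid_scheme => ('p => 'm) =>
   ('p \<times> 'l => 'p) => 'm set => ('m \<times> 'l => 'p) => bool"
 where "principal_triv P M L \<pi> \<sigma> U \<phi> \<longleftrightarrow> openin (mtop M) U \<and>
  diffeomorphism (prod_mfd (open_submfd M U) (discrete_mfd (carrier L))) (open_submfd P {p \<in> points P. \<pi> p \<in> U}) \<phi> \<and>
  (\<forall>y\<in>U. \<forall>g\<in>carrier L. \<pi> (\<phi> (y, g)) = y) \<and>
  (\<forall>y\<in>U. \<forall>g\<in>carrier L. \<forall>h\<in>carrier L. \<phi> (y, g \<otimes>\<^bsub>L\<^esub> h) = \<sigma> (\<phi> (y, g), h))"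

lemma principal_triv_cases:
 assumes "principal_triv P M L \<pi> \<sigma> U \<phi>"
 shows "bij_betw \<phi> (U \<times> carrier L) {p \<in> points P. \<pi> p \<in> U}"
  and "p \<in> points P ==> \<pi> p \<in> U ==> \<exists>h. h \<in> carrier L \<and> p = \<phi> (\<pi> p, h)"
proof -
 have UM: "U \<subseteq> points M" using assms openin_subset by (auto simp: principal_triv_def)
 then show bij: "bij_betw \<phi> (U \<times> carrier L) {p \<in> points P. \<pi> p \<in> U}"
  using assms by (simp add: principal_triv_def diffeomorphism_def Int_absorb1 Int_absorb2 subset_eq)
 show "\<exists>h. h \<in> carrier L \<and> p = \<phi> (\<pi> p, h)" if "p \<in> points P" "\<pi> p \<in> U"
 proof -
  have "p \<in> \<phi> ` (U \<times> carrier L)" using bij that by (simp add: bij_betw_def)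
  then obtain y h where "y \<in> U" "h \<in> carrier L" "p = \<phi> (y, h)" by blast
  moreover from this have "\<pi> p = y" using assms by (simp add: principal_triv_def)
  ultimately show ?thesis by auto
 qed
qed

locale principal_pullback = equivariant_pullback B P \<pi> L \<sigma>
 for B :: "('b, 'f, 'm, 'a) alg_bundle" and P :: "('p, nat => real) mfd" and \<pi> :: "'p => 'm"
  and L :: "('l, 'r) monoid_scheme" and \<sigma> +
 assumes fin_dim_M: "fin_dim_manifold (base_space B)"
  and principal: "!!x. x \<in> points (base_space B) ==> \<exists>U \<phi>. x \<in> U \<and> principal_triv P (base_space B) L \<pi> \<sigma> U \<phi>"
begin

abbreviation ptriv where "ptriv \<equiv> principal_triv P B.M L \<pi> \<sigma>"

sublocale X: lca X by (rule PB.lca_X)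

text \<open>The multiple of the unit section by an arbitrary function \<open>u\<close>. The
  algebraic identities hold for every \<open>u\<close>; smoothness is a separate question.\<close>

definition scal :: "('p => complex) => 'p => 'p \<times> 'b"
 where "scal u = (\<lambda>p\<in>points P. (p, u p \<odot>\<^bsub>B.F (\<pi> p)\<^esub> \<one>\<^bsub>B.F (\<pi> p)\<^esub>))"

lemma calg_at: "p \<in> points P ==> calg (B.F (\<pi> p))" by (rule B.calg_F[OF \<pi>_in])

lemma scal_ext: "scal u \<in> extensional (points P)" by (simp add: scal_def)

lemma scal_cong: "(!!p. p \<in> points P ==> u p = v p) ==> scal u = scal v" by (simp add: scal_def cong: restrict_cong)

lemma scal_eqI:
 assumes "!!p. p \<in> points P ==> calg (B.F (\<pi> p)) ==> r p = u p \<odot>\<^bsub>B.F (\<pi> p)\<^esub> \<one>\<^bsub>B.F (\<pi> p)\<^esub>"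
 shows "(\<lambda>p\<in>points P. (p, r p)) = scal u" using assms calg_at by (auto simp: scal_def intro!: restrict_ext)

lemma scal_add: "scal u \<oplus>\<^bsub>X\<^esub> scal v = scal (%p. u p + v p)" unfolding X_simps
proof (rule scal_eqI)
 fix p assume p: "p \<in> points P" and "calg (B.F (\<pi> p))"
 then interpret calg "B.F (\<pi> p)" by simp
 show "snd (scal u p) \<oplus>\<^bsub>B.F (\<pi> p)\<^esub> snd (scal v p) = (u p + v p) \<odot>\<^bsub>B.F (\<pi> p)\<^esub> \<one>\<^bsub>B.F (\<pi> p)\<^esub>"
  using p by (simp add: scal_def smult_add_left)
qed

lemma scal_mult: "scal u \<otimes>\<^bsub>X\<^esub> scal v = scal (%p. u p * v p)" unfolding X_simps
proof (rule scal_eqI)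
 fix p assume p: "p \<in> points P" and "calg (B.F (\<pi> p))"
 then interpret calg "B.F (\<pi> p)" by simp
 show "snd (scal u p) \<otimes>\<^bsub>B.F (\<pi> p)\<^esub> snd (scal v p) = (u p * v p) \<odot>\<^bsub>B.F (\<pi> p)\<^esub> \<one>\<^bsub>B.F (\<pi> p)\<^esub>"
  using p by (simp add: scal_def smult_mult_left smult_smult)
qed

lemma scal_smult: "c \<odot>\<^bsub>X\<^esub> scal u = scal (%p. c * u p)" unfolding X_simps
proof (rule scal_eqI)
 fix p assume p: "p \<in> points P" and "calg (B.F (\<pi> p))"
 then interpret calg "B.F (\<pi> p)" by simp
 show "c \<odot>\<^bsub>B.F (\<pi> p)\<^esub> snd (scal u p) = (c * u p) \<odot>\<^bsub>B.F (\<pi> p)\<^esub> \<one>\<^bsub>B.F (\<pi> p)\<^esub>"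
  using p by (simp add: scal_def smult_smult)
qed

lemma scal_one: "\<one>\<^bsub>X\<^esub> = scal (%_. 1)" unfolding X_simps
proof (rule scal_eqI)
 fix p assume "calg (B.F (\<pi> p))"
 then interpret calg "B.F (\<pi> p)" .
 show "\<one>\<^bsub>B.F (\<pi> p)\<^esub> = 1 \<odot>\<^bsub>B.F (\<pi> p)\<^esub> \<one>\<^bsub>B.F (\<pi> p)\<^esub>" by simp
qed

lemma scal_pow: "scal u [^]\<^bsub>X\<^esub> (n::nat) = scal (%p. u p ^ n)"
 by (induction n) (simp_all add: scal_one scal_mult mult.commute)

lemma scal_central:
 assumes s: "s \<in> carrier X"
 shows "scal u \<otimes>\<^bsub>X\<^esub> s = s \<otimes>\<^bsub>X\<^esub> scal u" unfolding X_simps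
proof (rule extensionalityI[OF restrict_extensional restrict_extensional])
 fix p assume p: "p \<in> points P"
 interpret calg "B.F (\<pi> p)" by (rule calg_at[OF p])
 have "snd (s p) \<in> carrier (B.F (\<pi> p))" using s p by (intro section_at(2)) (simp_all only: X_simps)
 then show "(\<lambda>p\<in>points P. (p, snd (scal u p) \<otimes>\<^bsub>B.F (\<pi> p)\<^esub> snd (s p))) p =
   (\<lambda>p\<in>points P. (p, snd (s p) \<otimes>\<^bsub>B.F (\<pi> p)\<^esub> snd (scal u p))) p"
  using p by (simp add: scal_def smult_mult_left smult_mult_right)
qed

lemma scal_\<alpha>:
 assumes u: "scal u \<in> smooth_sections PB" and g: "g \<in> carrier L"
 shows "\<alpha> g (scal u) = scal (%p. u (\<sigma> (p, g)))"
proof (rule extensionalityI[OF section_ext[OF \<alpha>_section[OF u g]] scal_ext])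
 fix p assume p: "p \<in> points P"
 show "\<alpha> g (scal u) p = scal (%p. u (\<sigma> (p, g))) p"
  using \<alpha>_apply[OF u g p] p \<sigma>_in[OF p g] \<pi>_\<sigma>[OF p g] by (simp add: scal_def)
qed

text \<open>Comparison with different smooth sections near different points. This handles functions
  that are only locally a constant times a bump.\<close>

lemma scal_section_local:
 assumes loc: "!!p. p \<in> points P ==> \<exists>O' v. openin (mtop P) O' \<and> p \<in> O' \<and> scal v \<in> smooth_sections PB \<and> (\<forall>q\<in>O'. u q = v q)"
 shows "scal u \<in> smooth_sections PB"
proof -
 have "smooth_map P T (scal u)"
 proof (rule smooth_map_glue[OF charted_P charted_T])
  fix p assume "p \<in> points P"
  from loc[OF this] obtain O' v where O': "openin (mtop P) O'" "p \<in> O'" and v: "scal v \<in> smooth_sections PB"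
   and eq: "\<forall>q\<in>O'. u q = v q" by (elim exE conjE)
  have "smooth_map P T (scal v)" using v by (simp add: smooth_sections_def del: PB_simps(4,5))
  then have "smooth_map (open_submfd P O') T (scal v)"
   by (rule smooth_map_restrict[OF charted_P charted_T _ O'(1)])
  then have "smooth_map (open_submfd P O') T (scal u)"
   by (rule smooth_map_cong[OF charted_open_submfd[OF charted_P O'(1)] charted_T]) (use eq in \<open>simp add: scal_def\<close>)
  then show "\<exists>O'. openin (mtop P) O' \<and> p \<in> O' \<and> smooth_map (open_submfd P O') T (scal u)"
   using O' by (intro exI[of _ O'] conjI)
 qed
 then show ?thesis using scal_ext[of u] by (simp add: smooth_sections_def scal_def del: PB_simps(4,5))
qed

definition fun_section :: "('m => real) => 'p => 'p \<times> 'b"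
 where "fun_section f = scal (%p. complex_of_real (f (\<pi> p)))"

text \<open>A trivialization is unital on fibres, so the coordinate of the section is the linear
  curve through the unit, composed with \<open>f \<circ> \<pi>\<close>.\<close>

lemma fun_section_smooth:
 assumes f: "smooth_map B.M real_mfd f"
 shows "fun_section f \<in> smooth_sections PB"
proof (rule PB.sectionI_triv)
 show "fun_section f \<in> extensional (points (base_space PB))" using scal_ext by (simp add: fun_section_def)
 show at: "fun_section f p \<in> carrier (fibre_alg PB p)" if "p \<in> points (base_space PB)" for p
 proof -
  have p: "p \<in> points P" using that by simp
  interpret calg "B.F (\<pi> p)" by (rule calg_at[OF p])
  show ?thesis using p by (simp add: fun_section_def scal_def)
 qed
 fix U \<phi> assume triv: "local_trivialization PB U \<phi>"
 have oU: "openin (mtop P) U" using PB.triv_open[OF triv] by simp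
 have UP: "U \<subseteq> points P" using PB.triv_sub[OF triv] by simp
 have cU: "charted (open_submfd P U)" by (rule charted_open_submfd[OF charted_P oU])
 have "smooth_map (open_submfd P U) real_mfd (%p. f (\<pi> p))"
  by (rule smooth_map_restrict[OF charted_P charted_real smooth_map_compose[OF charted_P B.charted_M charted_real smooth_\<pi> f] oU])
 moreover have "smooth_on real_line B.RA UNIV (%t. complex_of_real t \<odot>\<^bsub>B.A\<^esub> \<one>\<^bsub>B.A\<^esub>)"
  using linear_curve[OF B.lca_A B.A.rg.one_closed] by simp
 ultimately have "smooth_map (open_submfd P U) (vmfd B.RA) (%p. complex_of_real (f (\<pi> p)) \<odot>\<^bsub>B.A\<^esub> \<one>\<^bsub>B.A\<^esub>)"
  by (rule smooth_map_vmfd_compose[OF cU lcs_real_line B.lcs_RA]) simp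
 then have "smooth_map (open_submfd P U) (alg_mfd B.A) (%p. fibre_coord PB U \<phi> (fun_section f p))"
  unfolding alg_mfd_eq
 proof (rule smooth_map_cong[OF cU charted_vmfd[OF B.lcs_RA]])
  fix p assume "p \<in> points (open_submfd P U)"
  then have p: "p \<in> U" "p \<in> points P" by auto
  have pb: "p \<in> points (base_space PB)" using p by simp
  interpret Q: calg "fibre_alg PB p" by (rule PB.calg_F[OF pb])
  have "fun_section f p = complex_of_real (f (\<pi> p)) \<odot>\<^bsub>fibre_alg PB p\<^esub> \<one>\<^bsub>fibre_alg PB p\<^esub>"
   using p(2) by (simp add: fun_section_def scal_def)
  then show "complex_of_real (f (\<pi> p)) \<odot>\<^bsub>B.A\<^esub> \<one>\<^bsub>B.A\<^esub> = fibre_coord PB U \<phi> (fun_section f p)"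
   using PB.coord_smult[OF triv p(1) Q.rg.one_closed] PB.coord_one[OF triv p(1)] by simp
 qed
 then show "smooth_map (open_submfd (base_space PB) U) (alg_mfd (fibre PB)) (%p. fibre_coord PB U \<phi> (fun_section f p))"
  unfolding PB_simps(1,2) .
qed

text \<open>Multiples of the unit are central, and \<open>f \<circ> \<pi>\<close> is constant on the
  orbits of the group.\<close>

lemma fun_section_fixed:
 assumes f: "smooth_map B.M real_mfd f"
 shows "fun_section f \<in> carrier (fixed_center X L \<alpha>)"
proof -
 note s = fun_section_smooth[OF f]
 have "\<alpha> g (fun_section f) = fun_section f" if g: "g \<in> carrier L" for g
  using scal_\<alpha>[OF s[unfolded fun_section_def] g] \<pi>_\<sigma>[OF _ g]
  unfolding fun_section_def by (auto intro: scal_cong)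
 moreover have "fun_section f \<in> alg_center X"
  using s scal_central unfolding alg_center_def fun_section_def by (auto simp: X_simps(1))
 ultimately show ?thesis by (simp add: fixed_center_def)
qed

text \<open>On the real smooth functions of the base, \<open>\<omega>\<close> restricts to a unital
  real algebra homomorphism, to which \<open>character_detects_bump\<close> applies.\<close>

lemma bump_not_killed:
 assumes \<omega>: "\<omega> \<in> characters (fixed_center X L \<alpha>)"
 shows "\<exists>b K U \<phi>. smooth_map B.M real_mfd b \<and> \<omega> (fun_section b) \<noteq> 0 \<and> closedin (mtop B.M) K \<and> K \<subseteq> U \<and>
  (\<forall>y\<in>points B.M - K. b y = 0) \<and> ptriv U \<phi>"
proof -
 let ?Z = "fixed_center X L \<alpha>"
 let ?bump = "%b K U. smooth_map B.M real_mfd b \<and> closedin (mtop B.M) K \<and> K \<subseteq> U \<and> (\<forall>y\<in>points B.M - K. b y = 0)"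
 let ?Q = "%x bn. openin (mtop B.M) (snd bn) \<and> x \<in> snd bn \<and> (\<forall>y\<in>snd bn. fst bn y = 1) \<and>
  smooth_map B.M real_mfd (fst bn) \<and> (\<exists>K U \<phi>. ?bump (fst bn) K U \<and> ptriv U \<phi>)"
 have "\<forall>x\<in>points B.M. \<exists>bn. ?Q x bn"
 proof
  fix x assume x: "x \<in> points B.M"
  from principal[OF x] obtain U \<phi> where U: "x \<in> U" "ptriv U \<phi>" by (elim exE conjE)
  then have oU: "openin (mtop B.M) U" by (simp add: principal_triv_def)
  from bump_function_exists[OF fin_dim_M oU U(1)] obtain b K N where b: "smooth_map B.M real_mfd b"
   "closedin (mtop B.M) K" "K \<subseteq> U" "\<forall>y\<in>points B.M - K. b y = 0" "openin (mtop B.M) N" "x \<in> N" "\<forall>y\<in>N. b y = 1"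
   by (elim exE conjE)
  show "\<exists>bn. ?Q x bn" by (rule exI[of _ "(b, N)"], unfold fst_conv snd_conv)
     (intro exI[of _ K] exI[of _ U] exI[of _ \<phi>] conjI b U)
 qed
 from bchoice[OF this] obtain bn where bn: "\<forall>x\<in>points B.M. ?Q x (bn x)" by (elim exE)
 define b N where "b x = fst (bn x)" and "N x = snd (bn x)" for x
 have bN: "openin (mtop B.M) (N x)" "x \<in> N x" "\<forall>y\<in>N x. b x y = 1" "smooth_map B.M real_mfd (b x)"
  and bK: "\<exists>K U \<phi>. ?bump (b x) K U \<and> ptriv U \<phi>" if "x \<in> points B.M" for x
 proof -
  note q = bspec[OF bn that, folded b_def N_def]
  show "openin (mtop B.M) (N x)" using q by (elim conjE)
  show "x \<in> N x" using q by (elim conjE)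
  show "\<forall>y\<in>N x. b x y = 1" using q by (elim conjE)
  show "smooth_map B.M real_mfd (b x)" using q by (elim conjE)
  show "\<exists>K U \<phi>. ?bump (b x) K U \<and> ptriv U \<phi>" using q by (elim conjE)
 qed
 \<comment> \<open>The bumps are needed as a sequence; second countability of the base provides a
   countable subcover.\<close>
 have lindelof: "Lindelof_space (mtop B.M)"
  using fin_dim_M by (intro second_countable_imp_Lindelof_space) (simp add: fin_dim_manifold_def)
 have un: "\<Union>(N ` points B.M) = points B.M"
 proof (intro equalityI subsetI)
  fix x assume "x \<in> \<Union>(N ` points B.M)"
  then obtain y where "y \<in> points B.M" "x \<in> N y" by (elim UN_E)
  then show "x \<in> points B.M" using openin_subset[OF bN(1)[of y]] by (rule_tac subsetD)
 next
  fix x assume "x \<in> points B.M"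
  then show "x \<in> \<Union>(N ` points B.M)" using bN(2)[of x] by (intro UN_I)
 qed
 have "\<exists>\<V>. countable \<V> \<and> \<V> \<subseteq> N ` points B.M \<and> \<Union>\<V> = points B.M"
  by (intro lindelof[unfolded Lindelof_space_def, THEN spec, THEN mp] conjI ballI un) (elim imageE, simp only: bN(1))
 then obtain \<V> where \<V>: "countable \<V>" "\<V> \<subseteq> N ` points B.M" "\<Union>\<V> = points B.M" by (elim exE conjE)
 obtain D where D: "countable D" "D \<subseteq> points B.M" "\<V> = N ` D"
  using countable_subset_image[of \<V> N "points B.M"] \<V>(1,2) by blast
 define \<chi>' where "\<chi>' f = \<omega> (fun_section f)" for f
 have \<omega>_add: "\<omega> (x \<oplus>\<^bsub>X\<^esub> y) = \<omega> x + \<omega> y" and \<omega>_mult: "\<omega> (x \<otimes>\<^bsub>X\<^esub> y) = \<omega> x * \<omega> y" if "x \<in> carrier ?Z" "y \<in> carrier ?Z" for x y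
  using \<omega> that unfolding characters_def by (simp_all add: fixed_center_def)
 have \<omega>_smult: "\<omega> (c \<odot>\<^bsub>X\<^esub> x) = c * \<omega> x" if "x \<in> carrier ?Z" for c x
  using \<omega> that unfolding characters_def by (simp add: fixed_center_def)
 have one: "fun_section (%_. 1) = \<one>\<^bsub>X\<^esub>" by (simp add: fun_section_def scal_one)
 have one_Z: "\<one>\<^bsub>X\<^esub> \<in> carrier ?Z"
  using fun_section_fixed[OF smooth_real_const[OF B.charted_M, of 1]] by (simp only: one)
 \<comment> \<open>A character is only assumed to be nonzero somewhere. Multiplying such an element
   by the unit fixes the value at the unit.\<close>
 have \<omega>_one: "\<omega> \<one>\<^bsub>X\<^esub> = 1"
 proof -
  obtain a where a: "a \<in> carrier ?Z" "\<omega> a \<noteq> 0" using \<omega> unfolding characters_def by blast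
  then have "a \<in> carrier X" by (simp add: fixed_center_def alg_center_def)
  then show ?thesis using \<omega>_mult[OF a(1) one_Z] a(2) by simp
 qed
 have add: "\<chi>' (%x. f x + g x) = \<chi>' f + \<chi>' g" and mult: "\<chi>' (%x. f x * g x) = \<chi>' f * \<chi>' g"
  if "smooth_map B.M real_mfd f" "smooth_map B.M real_mfd g" for f g
  using \<omega>_add[OF fun_section_fixed[OF that(1)] fun_section_fixed[OF that(2)]]
   \<omega>_mult[OF fun_section_fixed[OF that(1)] fun_section_fixed[OF that(2)]]
  by (simp_all add: \<chi>'_def fun_section_def scal_add scal_mult)
 have const: "\<chi>' (%_. c) = of_real c" for c
  using \<omega>_smult[OF one_Z, of "of_real c"] by (simp add: \<chi>'_def fun_section_def scal_one scal_smult \<omega>_one[unfolded scal_one])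
 have cong: "\<chi>' f = \<chi>' g" if "!!x. x \<in> points B.M ==> f x = g x" for f g
  unfolding \<chi>'_def fun_section_def using that \<pi>_in by (intro arg_cong[where f = \<omega>] scal_cong) simp
 \<comment> \<open>An enumeration by \<open>from_nat_into\<close> requires a nonempty set. Over an
   empty base the constants 0 and 1 would have the same image.\<close>
 have "D \<noteq> {}"
 proof
  assume "D = {}"
  then have "points B.M = {}" using \<V>(3) D(3) by simp
  then have "\<chi>' (%_. 0) = \<chi>' (%_. 1)" by (intro cong) simp
  then show False by (simp add: const)
 qed
 then have Dn: "from_nat_into D i \<in> D" for i by (rule from_nat_into)
 then have Dp: "from_nat_into D i \<in> points B.M" for i using D(2) by blast
 have "\<exists>i. \<chi>' (b (from_nat_into D i)) \<noteq> 0"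
 proof (rule character_detects_bump[OF B.charted_M bN(4)[OF Dp] bN(1)[OF Dp] bN(3)[OF Dp, rule_format] _ add mult const cong])
  fix x assume "x \<in> points B.M"
  then obtain d where d: "d \<in> D" "x \<in> N d" using \<V>(3) D(3) by blast
  then obtain i where "from_nat_into D i = d" using from_nat_into_surj[OF D(1)] by blast
  then show "\<exists>i. x \<in> N (from_nat_into D i)" using d by blast
 qed
 then obtain i where i: "\<chi>' (b (from_nat_into D i)) \<noteq> 0" by (elim exE)
 from bK[OF Dp[of i]] obtain K U \<phi> where "smooth_map B.M real_mfd (b (from_nat_into D i))"
  "closedin (mtop B.M) K" "K \<subseteq> U" "\<forall>y\<in>points B.M - K. b (from_nat_into D i) y = 0" "ptriv U \<phi>"
  by (elim exE conjE)
 with i[unfolded \<chi>'_def] show ?thesis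
  by (intro exI[of _ "b (from_nat_into D i)"] exI[of _ K] exI[of _ U] exI[of _ \<phi>] conjI)
qed

text \<open>The trivialization intertwines multiplication in the group with the action on
  \<open>P\<close>, which puts the product of \<open>b\<close> and \<open>\<eta>\<close> in the
  isotypic component. The values of \<open>\<eta>\<close> are roots of unity of order dividing
  \<open>n\<close>, so they disappear in the power.\<close>

lemma isotypic_section:
 assumes b: "smooth_map B.M real_mfd b" and K: "closedin (mtop B.M) K" "K \<subseteq> U" "\<forall>y\<in>points B.M - K. b y = 0"
  and triv: "ptriv U \<phi>"
  and \<eta>: "\<eta> \<in> dual_group L" "!!g. g \<in> carrier L ==> \<eta> g ^ n = 1" and n: "n > 0"
 shows "\<exists>w\<in>isotypic X L \<alpha> \<eta>. w [^]\<^bsub>X\<^esub> n = fun_section b [^]\<^bsub>X\<^esub> n"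
proof -
 let ?D = "prod_mfd (open_submfd B.M U) (discrete_mfd (carrier L))" and ?O = "open_submfd P (above U)"
 have U: "openin (mtop B.M) U" and diffeo: "diffeomorphism ?D ?O \<phi>"
  and \<phi>_\<pi>: "\<forall>y\<in>U. \<forall>g\<in>carrier L. \<pi> (\<phi> (y, g)) = y"
  and \<phi>_\<sigma>: "\<forall>y\<in>U. \<forall>g\<in>carrier L. \<forall>h\<in>carrier L. \<phi> (y, g \<otimes>\<^bsub>L\<^esub> h) = \<sigma> (\<phi> (y, g), h)"
  using triv by (simp_all add: principal_triv_def)
 have UM: "U \<subseteq> points B.M" using openin_subset[OF U] .
 have pD: "points ?D = U \<times> carrier L" using UM by auto
 note bij = principal_triv_cases(1)[OF triv]
 define \<iota> where "\<iota> = inv_into (U \<times> carrier L) \<phi>"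
 have \<iota>_cont: "continuous_map (subtopology (mtop P) (above U)) (mtop ?D) \<iota>"
 proof -
  have "smooth_map ?O ?D \<iota>" using diffeo unfolding diffeomorphism_def pD \<iota>_def by (elim conjE)
  from smooth_map_continuous[OF this] show ?thesis by (simp only: open_submfd_simps)
 qed
 have \<iota>_\<phi>: "\<iota> (\<phi> (y, h)) = (y, h)" if "y \<in> U" "h \<in> carrier L" for y h
  unfolding \<iota>_def using bij that by (intro inv_into_f_f) (auto simp: bij_betw_def)
 have above_cases: "\<exists>y h. y \<in> U \<and> h \<in> carrier L \<and> p = \<phi> (y, h)" if "p \<in> above U" for p
  using that principal_triv_cases(2)[OF triv, of p] by auto
 have hom: "\<eta> (g \<otimes>\<^bsub>L\<^esub> h) = \<eta> g * \<eta> h" if "g \<in> carrier L" "h \<in> carrier L" for g h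
  using \<eta>(1) that by (simp add: dual_group_def hom_def circle_group_def)
 \<comment> \<open>The character evaluated at the group coordinate. The value 0 elsewhere is only a
   default, as \<open>b\<close> vanishes off \<open>U\<close>.\<close>
 define u where "u p = (if \<pi> p \<in> U then \<eta> (snd (\<iota> p)) else 0)" for p
 have u_\<phi>: "u (\<phi> (y, h)) = \<eta> h" if "y \<in> U" "h \<in> carrier L" for y h using that \<phi>_\<pi> \<iota>_\<phi> by (simp add: u_def)
 have u_\<sigma>: "u (\<sigma> (p, g)) = \<eta> g * u p" if p: "p \<in> points P" and g: "g \<in> carrier L" for p g
 proof (cases "\<pi> p \<in> U")
  case True
  then obtain y h where yh: "y \<in> U" "h \<in> carrier L" "p = \<phi> (y, h)" using above_cases[of p] p by auto
  have "\<sigma> (p, g) = \<phi> (y, h \<otimes>\<^bsub>L\<^esub> g)" using yh g \<phi>_\<sigma> by simp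
  then show ?thesis using yh g u_\<phi> hom by (simp add: mult.commute)
 next
  case False
  then show ?thesis using \<pi>_\<sigma>[OF p g] by (simp add: u_def)
 qed
 let ?w = "%p. complex_of_real (b (\<pi> p)) * u p"
 have b_off: "b (\<pi> p) = 0" if "p \<in> points P" "\<pi> p \<notin> U" for p using that K(2,3) \<pi>_in by blast
 have sec_v: "scal (%p. c * complex_of_real (b (\<pi> p))) \<in> smooth_sections PB" for c
  using PB.smult_section[OF fun_section_smooth[OF b], of c] unfolding fun_section_def scal_smult .
 have sec: "scal ?w \<in> smooth_sections PB"
 proof (rule scal_section_local)
  fix p assume p: "p \<in> points P"
  show "\<exists>O' v. openin (mtop P) O' \<and> p \<in> O' \<and> scal v \<in> smooth_sections PB \<and> (\<forall>q\<in>O'. ?w q = v q)"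
  proof (cases "\<pi> p \<in> U")
   case True
   define h where "h = snd (\<iota> p)"
   have h: "h \<in> carrier L" using above_cases[of p] p True \<iota>_\<phi> by (auto simp: h_def)
   \<comment> \<open>The sheet of points over \<open>U\<close> with group coordinate
     \<open>h\<close>. It is open because the group is discrete, and \<open>u\<close> is constant on
     it.\<close>
   let ?N = "{q \<in> topspace (subtopology (mtop P) (above U)). \<iota> q \<in> U \<times> {h}}"
   have "openin (mtop ?D) (U \<times> {h})"
    using U UM h by (simp add: openin_prod_Times_iff openin_subtopology_self openin_open_subtopology)
   from openin_continuous_map_preimage[OF \<iota>_cont this]
   have "openin (mtop P) ?N" using openin_open_subtopology[OF openin_above[OF U]] by blast
   moreover have "p \<in> ?N" using above_cases[of p] p True \<iota>_\<phi> by (auto simp: h_def)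
   moreover have "\<forall>q\<in>?N. ?w q = \<eta> h * complex_of_real (b (\<pi> q))" by (auto simp: u_def)
   ultimately show ?thesis
    using sec_v by (intro exI[of _ ?N] exI[of _ "%q. \<eta> h * complex_of_real (b (\<pi> q))"] conjI)
  next
   \<comment> \<open>The complement of \<open>K\<close>, unlike that of \<open>U\<close>, is open.
     As \<open>b\<close> vanishes on it, the values of \<open>u\<close> there do not matter.\<close>
   case False
   have "openin (mtop P) (above (points B.M - K))" using K(1) by (intro openin_above) (simp add: closedin_def)
   moreover have "p \<in> above (points B.M - K)" using False p \<pi>_in K(2) by auto
   moreover have "\<forall>q\<in>above (points B.M - K). ?w q = 0 * complex_of_real (b (\<pi> q))" using K(3) by simp
   ultimately show ?thesis
    using sec_v by (intro exI[of _ "above (points B.M - K)"] exI[of _ "%q. 0 * complex_of_real (b (\<pi> q))"] conjI)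
  qed
 qed
 have "scal ?w \<in> isotypic X L \<alpha> \<eta>" unfolding isotypic_def
 proof (intro CollectI conjI ballI)
  show "scal ?w \<in> carrier X" using sec by (simp only: X_simps)
  fix g assume g: "g \<in> carrier L"
  show "\<alpha> g (scal ?w) = \<eta> g \<odot>\<^bsub>X\<^esub> scal ?w"
   unfolding scal_\<alpha>[OF sec g] scal_smult using u_\<sigma>[OF _ g] \<pi>_\<sigma>[OF _ g] by (intro scal_cong) simp
 qed
 moreover have "scal ?w [^]\<^bsub>X\<^esub> n = fun_section b [^]\<^bsub>X\<^esub> n" unfolding fun_section_def scal_pow
 proof (rule scal_cong)
  fix p assume p: "p \<in> points P"
  show "?w p ^ n = complex_of_real (b (\<pi> p)) ^ n"
  proof (cases "\<pi> p \<in> U")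
   case True
   then obtain y h where "y \<in> U" "h \<in> carrier L" "p = \<phi> (y, h)" using above_cases[of p] p by auto
   then have "u p ^ n = 1" using u_\<phi> \<eta>(2) by simp
   then show ?thesis by (simp add: power_mult_distrib)
  next
   case False
   then show ?thesis using b_off[OF p] n by simp
  qed
 qed
 ultimately show ?thesis by blast
qed

text \<open>The bump detected by the character is the element at which to localize. The generator
  system depends on the group alone and serves all characters; each of its members receives a root
  from \<open>isotypic_section\<close> and \<open>isotypic_root\<close>.\<close>

lemma nc_principal_bundle_sections:
 assumes comm: "comm_group L" and fin: "finite (carrier L)"
 shows "nc_principal_bundle X L \<alpha>" unfolding nc_principal_bundle_def
proof (intro conjI ballI dynamical_system_\<alpha>)
 fix \<omega> assume "\<omega> \<in> characters (fixed_center X L \<alpha>)"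
 from bump_not_killed[OF this] obtain b K U \<phi> where b: "smooth_map B.M real_mfd b" "\<omega> (fun_section b) \<noteq> 0"
  and U: "closedin (mtop B.M) K" "K \<subseteq> U" "\<forall>y\<in>points B.M - K. b y = 0" "ptriv U \<phi>" by (elim exE conjE)
 let ?z = "fun_section b"
 note z = fun_section_fixed[OF b(1)]
 interpret loc: localized_system X L \<alpha> ?z by (rule localized_system.intro[OF dynamical_system_\<alpha> z])
 from comm_group.generator_system_exists[OF comm fin] obtain S where S: "generator_system L S"
  and dual: "\<forall>s\<in>S. dual_generator L S s \<in> dual_group L \<and> L.ord s > 0 \<and>
   (\<forall>g\<in>carrier L. dual_generator L S s g ^ L.ord s = 1)" by (elim exE conjE)
 have "\<exists>a\<in>isotypic (localization X ?z) L (localized_action X ?z \<alpha>) (dual_generator L S s).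
   a \<in> Units (localization X ?z) \<and> a [^]\<^bsub>localization X ?z\<^esub> L.ord s = \<one>\<^bsub>localization X ?z\<^esub>" if "s \<in> S" for s
 proof -
  from dual that have d: "dual_generator L S s \<in> dual_group L" "L.ord s > 0"
   "!!g. g \<in> carrier L ==> dual_generator L S s g ^ L.ord s = 1" by auto
  have "\<exists>w\<in>isotypic X L \<alpha> (dual_generator L S s). w [^]\<^bsub>X\<^esub> L.ord s = ?z [^]\<^bsub>X\<^esub> L.ord s"
   by (rule isotypic_section[OF b(1) U d(1) _ d(2)]) (rule d(3))
  then obtain w where "w \<in> isotypic X L \<alpha> (dual_generator L S s)" "w [^]\<^bsub>X\<^esub> L.ord s = ?z [^]\<^bsub>X\<^esub> L.ord s"
   by (elim bexE)
  from loc.isotypic_root[OF this d(2)] show ?thesis .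
 qed
 then have "trivial_nc_principal_bundle (localization X ?z) L (localized_action X ?z \<alpha>)"
  unfolding trivial_nc_principal_bundle_def using loc.dynamical_system_localization S
  by (intro conjI exI[of _ S] ballI)
 then show "\<exists>z\<in>carrier (fixed_center X L \<alpha>). \<omega> z \<noteq> 0 \<and> trivial_nc_principal_bundle (localization X z) L (localized_action X z \<alpha>)"
  using z b(2) by (intro bexI[of _ ?z] conjI)
qed

end

lemma principal_bundle_pullback:
 assumes "algebra_bundle B" and PB: "principal_bundle P (base_space B) L \<pi> \<sigma>"
 shows "principal_pullback B P \<pi> L \<sigma>"
proof -
 have fd: "fin_dim_manifold P" "fin_dim_manifold (base_space B)" and L: "group L"
  and \<pi>: "smooth_map P (base_space B) \<pi>" and act: "smooth_right_action L P \<sigma>"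
  and triv: "!!x. x \<in> points (base_space B) ==> \<exists>U \<phi>. x \<in> U \<and> principal_triv P (base_space B) L \<pi> \<sigma> U \<phi>"
  using PB unfolding principal_bundle_def principal_triv_def by blast+
 have sm: "smooth_manifold P" and n: "\<exists>n. model P = euclid_space n"
  using fd(1) by (simp_all add: fin_dim_manifold_def)
 interpret L: group L by (rule L)
 \<comment> \<open>Invariance of \<open>\<pi>\<close> is read off from a trivialization:
   \<open>p\<close> has the form \<open>\<phi> (\<pi> p, h)\<close>, and acting by \<open>g\<close>
   changes only the second coordinate.\<close>
 have inv: "\<pi> (\<sigma> (p, g)) = \<pi> p" if p: "p \<in> points P" and g: "g \<in> carrier L" for p g
 proof -
  from triv[OF smooth_map_image[OF \<pi> p]] obtain U \<phi> where U: "\<pi> p \<in> U" "principal_triv P (base_space B) L \<pi> \<sigma> U \<phi>"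
   by (elim exE conjE)
  from principal_triv_cases(2)[OF U(2) p U(1)] obtain h where h: "h \<in> carrier L" "p = \<phi> (\<pi> p, h)" by (elim exE conjE)
  then have "\<sigma> (p, g) = \<phi> (\<pi> p, h \<otimes>\<^bsub>L\<^esub> g)" using U g unfolding principal_triv_def by metis
  moreover have "\<pi> (\<phi> (y, g)) = y" if "y \<in> U" "g \<in> carrier L" for y g
   using U(2) that by (simp add: principal_triv_def)
  ultimately show ?thesis using h(1) g U(1) by simp
 qed
 have "locally_compact_space (vtop (model P))"
  using n locally_compact_Euclidean_space by (auto simp: euclid_space_simps)
 then have "bundle_pullback B P \<pi>"
  by (intro bundle_pullback.intro bundle_pullback_axioms.intro algebra_bundle_charted[OF assms(1)]
    smooth_manifold_charted[OF sm] smooth_map_id[OF sm] \<pi>)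
 then have "equivariant_pullback B P \<pi> L \<sigma>"
  by (intro equivariant_pullback.intro equivariant_pullback_axioms.intro L act inv)
 then show ?thesis by (intro principal_pullback.intro principal_pullback_axioms.intro fd(2) triv)
qed

theorem theorem5p12:
  fixes L :: "('l, 'r) monoid_scheme"
    and B :: "('b, 'f, 'm, 'a) alg_bundle"
    and P :: "('p, nat \<Rightarrow> real) mfd"
    and \<pi> :: "'p \<Rightarrow> 'm"
    and \<sigma> :: "'p \<times> 'l \<Rightarrow> 'p"
  assumes "comm_group L" and "finite (carrier L)"
    and "algebra_bundle B"
    and "frechet_algebra (fibre B)" and "trivial_center (fibre B)"
    and "principal_bundle P (base_space B) L \<pi> \<sigma>"
  shows "smooth_right_action L (total_space (pullback_bundle P \<pi> B)) (pullback_action \<sigma>) \<and>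
    automorphism_action (section_algebra (pullback_bundle P \<pi> B)) L (section_action P L \<sigma>) \<and>
    nc_principal_bundle (section_algebra (pullback_bundle P \<pi> B)) L (section_action P L \<sigma>)"
proof -
  interpret principal_pullback B P \<pi> L \<sigma>
    by (rule principal_bundle_pullback[OF assms(3,6)])
  show ?thesis
    by (intro conjI pullback_action_smooth automorphism_action_\<alpha> nc_principal_bundle_sections assms(1,2))
qed

end
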